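(* Let $\Delta$ be a smooth fan in $N_{\mathbb R}$, $N\cong\mathbb Z^n$, with $d$ edges, let $X=X(\Delta)$ be the real toric variety, $X_+$ its non-negative part and $W=W(\Delta)$. 1. The developments $D(X_+,\varphi)$ and $D(X_+,\iota)$ of $X_+$ with respect to $\varphi$ and $\iota$ satisfy $D(X_+,\varphi)\simeq (T_2\times X_+/\!\sim)\simeq X$ and $D(X_+,\iota)\simeq (W\times X_+/\!\sim)=:\widetilde X$ (homeomorphisms). There are strata-preserving actions of $W$ on $D(X_+,\iota)$ and of $T_2$ on $D(X_+,\varphi)$ with strict fundamental domain $X_+$. 2. $X$ is connected if and only if the primitive vectors along the edges of $\Delta$ span $N\otimes_{\mathbb Z}\mathbb Z_2$. In particular, $X$ is connected whenever the primitive vectors contain a $\mathbb Z$-basis of $N$. 3. If $X$ is connected, then $\widetilde X=W\times X_+/\!\sim$ is the universal cover of $X$ and $\pi_1(X)\simeq\ker(\widehat\varphi)$, where $\widehat\varphi:W\to T_2$ is the canonical homomorphism induced by $\varphi$. 4. Suppose $X$ is connected. Let $h:W\to W_{ab}\simeq\mathbb Z_2^d$ be the abelianisation and let $\alpha=(h\circ\iota_\tau)_{\tau\in\Delta}:G(\Delta)\to\mathbb Z_2^d$ be the associated simple morphism, so that $\widehat\alpha=h$. Then $D(X_+,\alpha)\simeq\mathbb Z_2^d\times X_+/\!\sim$ is a covering space of $X$ with deck transformation group $\mathbb Z_2^{d-n}$, and $\pi_1(D(X_+,\alpha))\simeq[W,W]$.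
   Context: $M=\mathrm{Hom}(N,\mathbb Z)$, $N_{\mathbb R}=N\otimes\mathbb R$, $\mathbb Z_2=\mathbb Z/2\cong\{\pm1\}$. A smooth fan is a finite fan of strongly convex rational polyhedral cones, each generated by part of a $\mathbb Z$-basis of $N$ (not necessarily complete); $v_1,\dots,v_d$ are the primitive vectors along its edges $\rho_1,\dots,\rho_d$. For $\sigma\in\Delta$ let $S_\sigma=\sigma^\vee\cap M$, $U_\sigma=\mathrm{Hom}_{sg}(S_\sigma,\mathbb R)$, $(U_\sigma)_+=\mathrm{Hom}_{sg}(S_\sigma,\mathbb R_{\ge0})$ (homomorphisms to the multiplicative semigroup, sending $0$ to $1$). $X=\bigcup_\sigma U_\sigma$ is the real toric variety (classical topology) and $X_+=\bigcup_\sigma (U_\sigma)_+\subset X$. The distinguished point $x_\tau\in U_\tau$ is $x_\tau(u)=1$ for $u\in\tau^\perp$ and $0$ otherwise. $(O_\tau)_+$ is the orbit of $x_\tau$ under $\mathrm{Hom}(M,\mathbb R_{>0})$, and $V(\tau)_+$ is its closure in $X_+$; $X_+$ is the disjoint union of the $(O_\tau)_+$. $T_2=\mathrm{Hom}(M,\mathbb Z_2)\cong N\otimes\mathbb Z_2$ acts on $X$ by $(t\cdot x)(u)=t(u)x(u)$, and $G_\tau=\mathrm{Stab}_{T_2}(x_\tau)$, which is the subgroup of $N\otimes\mathbb Z_2$ with $\mathbb Z_2$-basis the classes of the $v_j\in\tau$. $W(\Delta)=\langle s_1,\dots,s_d\mid s_j^2,\ (s_is_j)^2\text{ whenever }\{v_i,v_j\}\text{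 spans a cone in }\Delta\rangle$. $G(\Delta)$ is the system of groups $(G_\tau)_{\tau\in\Delta}$ with the inclusions $G_\tau\hookrightarrow G_\sigma$ for $\tau<\sigma$ ($\tau$ a face of $\sigma$). A simple morphism $\phi:G(\Delta)\to G$ to a group $G$ is a family of homomorphisms $\phi_\tau:G_\tau\to G$ compatible with these inclusions; it is injective at the local groups if all $\phi_\tau$ are injective. $\varphi=(\varphi_\tau)$ is given by the inclusions $G_\tau\subset T_2$; $\iota=(\iota_\tau):G(\Delta)\to W$ is given by sending the class of $v_j$ to $s_j$. $W$ (with $\iota$) is the direct limit of $G(\Delta)$, so each simple morphism $\phi:G(\Delta)\to G$ induces a unique homomorphism $\widehat\phi:W\to G$ with $\widehat\phi\circ\iota_\tau=\phi_\tau$; in particular $\widehat\varphi(s_j)=v_j\bmod 2$. For $\phi:G(\Delta)\to G$ injective at the local groups ($G$ discrete), the development is the quotient space $D(X_+,\phi)=G\times X_+/\!\sim$ with $(g,x)\sim(g',x')$ iff $x=x'$ and $g^{-1}g'\in\phi_\tau(G_\tau)$, where $\tau$ is the unique cone with $x\in(O_\tau)_+$. $G$ acts by left multiplication; $X_+$ is identified with the image of $\{1\}\times X_+$. The strata of $D(X_+,\phi)$ are the translates $g\cdot V(\tau)_+$, $g\in G,\tau\in\Delta$. An action is strata-preserving if each group element acts by a homeomorphism carrying each stratum onto a stratum; a subset $Y$ is a strict fundamental domain if it is a union of strata, meets each orbit in exactly one point, and every stratum has exactly one translate contained in $Y$. *)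

theory Defs
  imports
    "HOL-Analysis.Analysis"
    "HOL-Algebra.Generated_Groups"
    "HOL-Algebra.Product_Groups"
    "HOL-Algebra.Group_Action"
begin

section \<open>Quotient spaces, coverings and fundamental groups of abstract topologies\<close>

definition quotient_space :: "'x topology \<Rightarrow> ('x \<times> 'x) set \<Rightarrow> 'x set topology" where
  "quotient_space X R = topology (\<lambda>\<U>. \<U> \<subseteq> topspace X // R \<and> openin X (\<Union>\<U>))"

lemma openin_quotient_space:
  assumes "equiv (topspace X) R"
  shows "openin (quotient_space X R) \<U> \<longleftrightarrow> \<U> \<subseteq> topspace X // R \<and> openin X (\<Union>\<U>)"
proof -
  have Int: "\<Union>(\<U> \<inter> \<V>) = \<Union>\<U> \<inter> \<Union>\<V>" if "\<U> \<subseteq> topspace X // R" "\<V> \<subseteq> topspace X // R" for \<U> \<V>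
    using quotient_disj[OF assms] that by blast
  have "istopology (\<lambda>\<U>. \<U> \<subseteq> topspace X // R \<and> openin X (\<Union>\<U>))"
    unfolding istopology_def
  proof (intro conjI allI impI)
    fix \<K> assume *: "\<forall>\<U>\<in>\<K>. \<U> \<subseteq> topspace X // R \<and> openin X (\<Union>\<U>)"
    then show "\<Union>\<K> \<subseteq> topspace X // R" by blast
    have "\<Union>(\<Union>\<K>) = (\<Union>\<U>\<in>\<K>. \<Union>\<U>)" by blast
    with * show "openin X (\<Union>(\<Union>\<K>))" by auto
  qed (auto simp: Int)
  then show ?thesis by (simp add: quotient_space_def)
qed

lemma quotient_map_quotient_space:
  assumes "equiv (topspace X) R"
  shows "quotient_map X (quotient_space X R) (\<lambda>x. R `` {x})"
proof -
  have un: "\<Union>(topspace X // R) = topspace X" by (rule Union_quotient[OF assms])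
  have top: "topspace (quotient_space X R) = topspace X // R"
    using openin_subset openin_quotient_space[OF assms] un
    by (metis openin_topspace subset_antisym order_refl)
  have "{x \<in> topspace X. R `` {x} \<in> \<U>} = \<Union>\<U>" if sub: "\<U> \<subseteq> topspace X // R" for \<U>
  proof (intro equalityI subsetI)
    fix x assume "x \<in> {x \<in> topspace X. R `` {x} \<in> \<U>}"
    then show "x \<in> \<Union>\<U>" using equiv_class_self[OF assms] by blast
  next
    fix x assume "x \<in> \<Union>\<U>"
    then obtain C where C: "C \<in> \<U>" "x \<in> C" by blast
    then obtain y where y: "y \<in> topspace X" "C = R `` {y}" using sub by (meson quotientE subsetD)
    then have "R `` {x} = C" using C(2) equiv_class_eq[OF assms] by blast
    then show "x \<in> {x \<in> topspace X. R `` {x} \<in> \<U>}"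
      using C y un sub by blast
  qed
  then show ?thesis
    by (auto simp: quotient_map_def top openin_quotient_space[OF assms] quotient_def)
qed

text \<open>The counterpart of \<^const>\<open>covering_space\<close> for abstract topologies.\<close>

definition covering_map :: "'x topology \<Rightarrow> 'y topology \<Rightarrow> ('x \<Rightarrow> 'y) \<Rightarrow> bool" where
  "covering_map E X p \<longleftrightarrow>
     continuous_map E X p \<and> p ` topspace E = topspace X \<and>
     (\<forall>x\<in>topspace X. \<exists>T. x \<in> T \<and> openin X T \<and>
        (\<exists>\<V>. \<Union>\<V> = {e \<in> topspace E. p e \<in> T} \<and> (\<forall>V\<in>\<V>. openin E V) \<and> pairwise disjnt \<V> \<and>
             (\<forall>V\<in>\<V>. homeomorphic_map (subtopology E V) (subtopology X T) p)))"

definition deck_group :: "'x topology \<Rightarrow> ('x \<Rightarrow> 'y) \<Rightarrow> ('x \<Rightarrow> 'x) monoid" where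
  "deck_group E p =
     \<lparr>carrier = {f \<in> extensional (topspace E). homeomorphic_map E E f \<and> (\<forall>e\<in>topspace E. p (f e) = p e)},
      monoid.mult = compose (topspace E),
      one = (\<lambda>e\<in>topspace E. e)\<rparr>"

definition loops :: "'x topology \<Rightarrow> 'x \<Rightarrow> (real \<Rightarrow> 'x) set" where
  "loops X x0 = {p. pathin X p \<and> p 0 = x0 \<and> p 1 = x0}"

definition loop_homotopy :: "'x topology \<Rightarrow> 'x \<Rightarrow> ((real \<Rightarrow> 'x) \<times> (real \<Rightarrow> 'x)) set" where
  "loop_homotopy X x0 =
     {(p, q). p \<in> loops X x0 \<and> q \<in> loops X x0 \<and>
              homotopic_with (\<lambda>r. r 0 = x0 \<and> r 1 = x0) (top_of_set {0..1}) X p q}"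

text \<open>The library's \<^term>\<open>(+++)\<close> needs a topological type class on the target.\<close>

definition path_concat :: "(real \<Rightarrow> 'x) \<Rightarrow> (real \<Rightarrow> 'x) \<Rightarrow> real \<Rightarrow> 'x" where
  "path_concat p q = (\<lambda>t. if t \<le> 1/2 then p (2 * t) else q (2 * t - 1))"

definition fundamental_group :: "'x topology \<Rightarrow> 'x \<Rightarrow> (real \<Rightarrow> 'x) set monoid" where
  "fundamental_group X x0 =
     \<lparr>carrier = loops X x0 // loop_homotopy X x0,
      monoid.mult = (\<lambda>A B. {r. \<exists>p\<in>A. \<exists>q\<in>B. (path_concat p q, r) \<in> loop_homotopy X x0}),
      one = loop_homotopy X x0 `` {\<lambda>_. x0}\<rparr>"

definition simply_connected_space :: "'x topology \<Rightarrow> bool" where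
  "simply_connected_space X \<longleftrightarrow>
     path_connected_space X \<and> (\<forall>x\<in>topspace X. trivial_group (fundamental_group X x))"

definition is_universal_cover :: "'x topology \<Rightarrow> 'y topology \<Rightarrow> bool" where
  "is_universal_cover E X \<longleftrightarrow> simply_connected_space E \<and> (\<exists>p. covering_map E X p)"


section \<open>Groups given by generators and relations\<close>

text \<open>A word is a list of letters: \<^term>\<open>(a, True)\<close> stands for the generator \<open>a\<close> and
  \<^term>\<open>(a, False)\<close> for its inverse.\<close>

type_synonym 'g word = "('g \<times> bool) list"

inductive word_eq :: "'g set \<Rightarrow> 'g word set \<Rightarrow> 'g word \<Rightarrow> 'g word \<Rightarrow> bool" for S R where
  refl: "w \<in> lists (S \<times> UNIV) \<Longrightarrow> word_eq S R w w"
| sym: "word_eq S R v w \<Longrightarrow> word_eq S R w v"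
| trans: "word_eq S R u v \<Longrightarrow> word_eq S R v w \<Longrightarrow> word_eq S R u w"
| cancel: "u \<in> lists (S \<times> UNIV) \<Longrightarrow> v \<in> lists (S \<times> UNIV) \<Longrightarrow> a \<in> S \<Longrightarrow>
           word_eq S R (u @ [(a, e), (a, \<not> e)] @ v) (u @ v)"
| relator: "u \<in> lists (S \<times> UNIV) \<Longrightarrow> v \<in> lists (S \<times> UNIV) \<Longrightarrow> r \<in> R \<Longrightarrow> r \<in> lists (S \<times> UNIV) \<Longrightarrow>
           word_eq S R (u @ r @ v) (u @ v)"

definition presented_group :: "'g set \<Rightarrow> 'g word set \<Rightarrow> 'g word set monoid" where
  "presented_group S R =
     \<lparr>carrier = lists (S \<times> UNIV) // {(v, w). word_eq S R v w},
      monoid.mult = (\<lambda>A B. {w. \<exists>a\<in>A. \<exists>b\<in>B. word_eq S R (a @ b) w}),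
      one = {w. word_eq S R [] w}\<rparr>"

definition presented_gen :: "'g set \<Rightarrow> 'g word set \<Rightarrow> 'g \<Rightarrow> 'g word set" where
  "presented_gen S R a = {w. word_eq S R [(a, True)] w}"


section \<open>Lattices and smooth fans\<close>

text \<open>
  \<open>N\<^sub>\<real>\<close> is the type \<^typ>\<open>'a\<close>: a lattice \<open>N\<close> of rank \<open>n\<close> is the set of integral combinations
  of a real basis of \<^typ>\<open>'a\<close> with \<open>n\<close> elements.  As \<^class>\<open>real_vector\<close> contains trivial
  types, \<open>n = 0\<close> is not excluded.
\<close>

definition Z_basis :: "'a::real_vector set \<Rightarrow> 'a set \<Rightarrow> bool" where
  "Z_basis N B \<longleftrightarrow> finite B \<and> independent B \<and> span B = UNIV \<and>
     N = range (\<lambda>c :: 'a \<Rightarrow> int. \<Sum>b\<in>B. of_int (c b) *\<^sub>R b)"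

definition lattice_of_rank :: "'a::real_vector set \<Rightarrow> nat \<Rightarrow> bool" where
  "lattice_of_rank N n \<longleftrightarrow> (\<exists>B. Z_basis N B \<and> card B = n)"

definition rational_polyhedral_cone :: "'a::real_vector set \<Rightarrow> 'a set \<Rightarrow> bool" where
  "rational_polyhedral_cone N \<sigma> \<longleftrightarrow> (\<exists>S. finite S \<and> S \<subseteq> N \<and> \<sigma> = convex_cone hull S)"

definition strongly_convex :: "'a::real_vector set \<Rightarrow> bool" where
  "strongly_convex \<sigma> \<longleftrightarrow> (\<forall>x. x \<in> \<sigma> \<and> - x \<in> \<sigma> \<longrightarrow> x = 0)"

text \<open>\<^const>\<open>face_of\<close> counts the empty set as a face; faces of cones are nonempty by convention.\<close>

definition fan :: "'a::real_vector set \<Rightarrow> 'a set set \<Rightarrow> bool" where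
  "fan N \<Delta> \<longleftrightarrow> finite \<Delta> \<and> \<Delta> \<noteq> {} \<and>
     (\<forall>\<sigma>\<in>\<Delta>. rational_polyhedral_cone N \<sigma> \<and> strongly_convex \<sigma>) \<and>
     (\<forall>\<sigma>\<in>\<Delta>. \<forall>\<tau>. \<tau> face_of \<sigma> \<and> \<tau> \<noteq> {} \<longrightarrow> \<tau> \<in> \<Delta>) \<and>
     (\<forall>\<sigma>\<in>\<Delta>. \<forall>\<tau>\<in>\<Delta>. (\<sigma> \<inter> \<tau>) face_of \<sigma> \<and> (\<sigma> \<inter> \<tau>) face_of \<tau>)"

definition smooth_fan :: "'a::real_vector set \<Rightarrow> 'a set set \<Rightarrow> bool" where
  "smooth_fan N \<Delta> \<longleftrightarrow> fan N \<Delta> \<and>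
     (\<forall>\<sigma>\<in>\<Delta>. \<exists>B S. Z_basis N B \<and> S \<subseteq> B \<and> \<sigma> = convex_cone hull S)"

text \<open>The primitive vectors \<open>v\<^sub>1, \<dots>, v\<^sub>d\<close>; the edges are indexed by them, so \<open>d\<close> is the cardinality.\<close>

definition primitive_vectors :: "'a::real_vector set \<Rightarrow> 'a set set \<Rightarrow> 'a set" where
  "primitive_vectors N \<Delta> =
     {v \<in> N. v \<noteq> 0 \<and> (\<forall>c. 0 < c \<and> c < 1 \<longrightarrow> c *\<^sub>R v \<notin> N) \<and> (\<exists>\<rho>\<in>\<Delta>. dim \<rho> = 1 \<and> v \<in> \<rho>)}"

text \<open>\<open>N \<otimes> \<int>/2 = N / 2N\<close>.\<close>

definition lattice_group :: "'a::real_vector set \<Rightarrow> 'a monoid" where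
  "lattice_group N = \<lparr>carrier = N, monoid.mult = (+), one = 0\<rparr>"

definition double_lattice :: "'a::real_vector set \<Rightarrow> 'a set" where
  "double_lattice N = {x + x | x. x \<in> N}"

definition lattice_mod2 :: "'a::real_vector set \<Rightarrow> 'a set monoid" where
  "lattice_mod2 N = lattice_group N Mod double_lattice N"

text \<open>A \<open>\<int>\<^sub>2\<close>-linear span is the same as a generated subgroup.\<close>

definition spans_mod2 :: "'a::real_vector set \<Rightarrow> 'a set \<Rightarrow> bool" where
  "spans_mod2 N V \<longleftrightarrow>
     generate (lattice_mod2 N) ((\<lambda>v. double_lattice N #>\<^bsub>lattice_group N\<^esub> v) ` V)
       = carrier (lattice_mod2 N)"


section \<open>The real toric variety\<close>

text \<open>\<open>M = Hom(N, \<int>)\<close>, each homomorphism being represented by its unique real-linear extension to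
  \<open>N\<^sub>\<real>\<close>, i.e. as an element of \<open>M\<^sub>\<real>\<close>.\<close>

definition dual_lattice :: "'a::real_vector set \<Rightarrow> ('a \<Rightarrow> real) set" where
  "dual_lattice N = {u. linear u \<and> (\<forall>x\<in>N. u x \<in> \<int>)}"

definition dual_semigroup :: "'a::real_vector set \<Rightarrow> 'a set \<Rightarrow> ('a \<Rightarrow> real) set" where
  "dual_semigroup N \<sigma> = {u \<in> dual_lattice N. \<forall>x\<in>\<sigma>. 0 \<le> u x}"

text \<open>\<open>Hom\<^sub>s\<^sub>g(S, A)\<close> for a multiplicative set \<open>A\<close> of real numbers.\<close>

definition sg_hom :: "('a \<Rightarrow> real) set \<Rightarrow> real set \<Rightarrow> (('a \<Rightarrow> real) \<Rightarrow> real) set" where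
  "sg_hom S A = {x \<in> S \<rightarrow>\<^sub>E A. x (\<lambda>_. 0) = 1 \<and>
     (\<forall>u\<in>S. \<forall>w\<in>S. x (\<lambda>a. u a + w a) = x u * x w)}"

text \<open>On \<open>U\<^sub>\<sigma>\<close> the classical topology is that of pointwise convergence on \<open>S\<^sub>\<sigma>\<close>.\<close>

definition affine_chart :: "'a::real_vector set \<Rightarrow> 'a set \<Rightarrow> (('a \<Rightarrow> real) \<Rightarrow> real) topology" where
  "affine_chart N \<sigma> =
     subtopology (product_topology (\<lambda>_. euclideanreal) (dual_semigroup N \<sigma>))
       (sg_hom (dual_semigroup N \<sigma>) UNIV)"

text \<open>\<open>U\<^sub>\<sigma>\<close> and \<open>U\<^sub>\<sigma>\<^sub>'\<close> are glued along \<open>U\<^sub>\<sigma>\<^sub>\<inter>\<^sub>\<sigma>\<^sub>'\<close>, which is embedded in both of them by restriction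
  of semigroup homomorphisms.\<close>

definition gluing :: "'a::real_vector set \<Rightarrow> 'a set set \<Rightarrow>
    (('a set \<times> (('a \<Rightarrow> real) \<Rightarrow> real)) \<times> ('a set \<times> (('a \<Rightarrow> real) \<Rightarrow> real))) set" where
  "gluing N \<Delta> = {((\<sigma>, x), (\<sigma>', x')). \<sigma> \<in> \<Delta> \<and> \<sigma>' \<in> \<Delta> \<and>
     (\<exists>y \<in> sg_hom (dual_semigroup N (\<sigma> \<inter> \<sigma>')) UNIV.
        x = restrict y (dual_semigroup N \<sigma>) \<and> x' = restrict y (dual_semigroup N \<sigma>'))}"

type_synonym 'a toric_point = "('a set \<times> (('a \<Rightarrow> real) \<Rightarrow> real)) set"

definition real_toric_variety :: "'a::real_vector set \<Rightarrow> 'a set set \<Rightarrow> 'a toric_point topology" where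
  "real_toric_variety N \<Delta> = quotient_space (sum_topology (affine_chart N) \<Delta>) (gluing N \<Delta>)"

definition chart_point :: "'a::real_vector set \<Rightarrow> 'a set set \<Rightarrow> 'a set \<Rightarrow> (('a \<Rightarrow> real) \<Rightarrow> real)
    \<Rightarrow> 'a toric_point" where
  "chart_point N \<Delta> \<sigma> x = gluing N \<Delta> `` {(\<sigma>, x)}"

definition nonneg_part :: "'a::real_vector set \<Rightarrow> 'a set set \<Rightarrow> 'a toric_point topology" where
  "nonneg_part N \<Delta> = subtopology (real_toric_variety N \<Delta>)
     {chart_point N \<Delta> \<sigma> x | \<sigma> x. \<sigma> \<in> \<Delta> \<and> x \<in> sg_hom (dual_semigroup N \<sigma>) {0..}}"

text \<open>\<open>Hom(M, A)\<close> for a multiplicative group \<open>A\<close> of real numbers; \<open>T\<^sub>2\<close> is the case \<open>A = {1, -1}\<close>.\<close>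

definition torus :: "'a::real_vector set \<Rightarrow> real set \<Rightarrow> (('a \<Rightarrow> real) \<Rightarrow> real) monoid" where
  "torus N A = \<lparr>carrier = sg_hom (dual_lattice N) A,
     monoid.mult = (\<lambda>s t. \<lambda>u\<in>dual_lattice N. s u * t u),
     one = (\<lambda>u\<in>dual_lattice N. 1)\<rparr>"

abbreviation T2 :: "'a::real_vector set \<Rightarrow> (('a \<Rightarrow> real) \<Rightarrow> real) monoid" where
  "T2 N \<equiv> torus N {1, -1}"

text \<open>The action \<open>(t \<cdot> x)(u) = t(u) x(u)\<close>, applied to all representatives of a point.\<close>

definition toric_act :: "'a::real_vector set \<Rightarrow> (('a \<Rightarrow> real) \<Rightarrow> real) \<Rightarrow> 'a toric_point \<Rightarrow> 'a toric_point" where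
  "toric_act N t p = (\<lambda>(\<sigma>, x). (\<sigma>, \<lambda>u\<in>dual_semigroup N \<sigma>. t u * x u)) ` p"

definition distinguished_point :: "'a::real_vector set \<Rightarrow> 'a set set \<Rightarrow> 'a set \<Rightarrow> 'a toric_point" where
  "distinguished_point N \<Delta> \<tau> =
     chart_point N \<Delta> \<tau> (\<lambda>u\<in>dual_semigroup N \<tau>. if \<forall>a\<in>\<tau>. u a = 0 then 1 else 0)"

definition nonneg_orbit :: "'a::real_vector set \<Rightarrow> 'a set set \<Rightarrow> 'a set \<Rightarrow> 'a toric_point set" where
  "nonneg_orbit N \<Delta> \<tau> = orbit (torus N {0<..}) (toric_act N) (distinguished_point N \<Delta> \<tau>)"

definition nonneg_stratum :: "'a::real_vector set \<Rightarrow> 'a set set \<Rightarrow> 'a set \<Rightarrow> 'a toric_point set" where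
  "nonneg_stratum N \<Delta> \<tau> = nonneg_part N \<Delta> closure_of nonneg_orbit N \<Delta> \<tau>"


section \<open>The local groups, simple morphisms and the group \<open>W(\<Delta>)\<close>\<close>

definition local_group :: "'a::real_vector set \<Rightarrow> 'a set set \<Rightarrow> 'a set \<Rightarrow> (('a \<Rightarrow> real) \<Rightarrow> real) monoid" where
  "local_group N \<Delta> \<tau> =
     (T2 N)\<lparr>carrier := stabilizer (T2 N) (toric_act N) (distinguished_point N \<Delta> \<tau>)\<rparr>"

text \<open>The image of \<open>v \<in> N\<close> under \<open>N \<rightarrow> N \<otimes> \<int>\<^sub>2 \<cong> T\<^sub>2\<close>.\<close>

definition T2_class :: "'a::real_vector set \<Rightarrow> 'a \<Rightarrow> ('a \<Rightarrow> real) \<Rightarrow> real" where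
  "T2_class N v = (\<lambda>u\<in>dual_lattice N. (-1) powi \<lfloor>u v\<rfloor>)"

definition simple_morphism :: "'a::real_vector set \<Rightarrow> 'a set set \<Rightarrow> ('g, 'b) monoid_scheme \<Rightarrow>
    ('a set \<Rightarrow> (('a \<Rightarrow> real) \<Rightarrow> real) \<Rightarrow> 'g) \<Rightarrow> bool" where
  "simple_morphism N \<Delta> G \<phi> \<longleftrightarrow>
     (\<forall>\<tau>\<in>\<Delta>. \<phi> \<tau> \<in> hom (local_group N \<Delta> \<tau>) G) \<and>
     (\<forall>\<sigma>\<in>\<Delta>. \<forall>\<tau>\<in>\<Delta>. \<tau> face_of \<sigma> \<longrightarrow> (\<forall>g\<in>carrier (local_group N \<Delta> \<tau>). \<phi> \<sigma> g = \<phi> \<tau> g))"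

definition injective_at_local_groups :: "'a::real_vector set \<Rightarrow> 'a set set \<Rightarrow>
    ('a set \<Rightarrow> (('a \<Rightarrow> real) \<Rightarrow> real) \<Rightarrow> 'g) \<Rightarrow> bool" where
  "injective_at_local_groups N \<Delta> \<phi> \<longleftrightarrow> (\<forall>\<tau>\<in>\<Delta>. inj_on (\<phi> \<tau>) (carrier (local_group N \<Delta> \<tau>)))"

definition W_relators :: "'a::real_vector set \<Rightarrow> 'a set set \<Rightarrow> 'a word set" where
  "W_relators N \<Delta> =
     {[(v, True), (v, True)] | v. v \<in> primitive_vectors N \<Delta>} \<union>
     {[(v, True), (w, True), (v, True), (w, True)] | v w.
        v \<in> primitive_vectors N \<Delta> \<and> w \<in> primitive_vectors N \<Delta> \<and> convex_cone hull {v, w} \<in> \<Delta>}"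

definition W_group :: "'a::real_vector set \<Rightarrow> 'a set set \<Rightarrow> 'a word set monoid" where
  "W_group N \<Delta> = presented_group (primitive_vectors N \<Delta>) (W_relators N \<Delta>)"

definition W_gen :: "'a::real_vector set \<Rightarrow> 'a set set \<Rightarrow> 'a \<Rightarrow> 'a word set" where
  "W_gen N \<Delta> = presented_gen (primitive_vectors N \<Delta>) (W_relators N \<Delta>)"

definition incl_morphism :: "'a set \<Rightarrow> (('a \<Rightarrow> real) \<Rightarrow> real) \<Rightarrow> (('a \<Rightarrow> real) \<Rightarrow> real)" where
  "incl_morphism \<tau> g = g"

text \<open>\<open>\<iota>\<^sub>\<tau>\<close> is determined by its values on the basis of \<open>G\<^sub>\<tau>\<close> formed by the classes of the \<open>v\<^sub>j \<in> \<tau>\<close>.\<close>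

definition iota :: "'a::real_vector set \<Rightarrow> 'a set set \<Rightarrow> 'a set \<Rightarrow> (('a \<Rightarrow> real) \<Rightarrow> real) \<Rightarrow> 'a word set" where
  "iota N \<Delta> \<tau> = (THE f. f \<in> hom (local_group N \<Delta> \<tau>) (W_group N \<Delta>) \<and>
     f \<in> extensional (carrier (local_group N \<Delta> \<tau>)) \<and>
     (\<forall>v \<in> primitive_vectors N \<Delta> \<inter> \<tau>. f (T2_class N v) = W_gen N \<Delta> v))"

text \<open>The homomorphism \<open>W \<rightarrow> G\<close> induced by a simple morphism through the universal property of the
  direct limit.\<close>

definition induced_hom :: "'a::real_vector set \<Rightarrow> 'a set set \<Rightarrow> ('g, 'b) monoid_scheme \<Rightarrow>
    ('a set \<Rightarrow> (('a \<Rightarrow> real) \<Rightarrow> real) \<Rightarrow> 'g) \<Rightarrow> 'a word set \<Rightarrow> 'g" where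
  "induced_hom N \<Delta> G \<phi> = (THE f. f \<in> hom (W_group N \<Delta>) G \<and>
     f \<in> extensional (carrier (W_group N \<Delta>)) \<and>
     (\<forall>\<tau>\<in>\<Delta>. \<forall>g\<in>carrier (local_group N \<Delta> \<tau>). f (iota N \<Delta> \<tau> g) = \<phi> \<tau> g))"


section \<open>Developments\<close>

definition dev_rel :: "'a::real_vector set \<Rightarrow> 'a set set \<Rightarrow> ('g, 'b) monoid_scheme \<Rightarrow>
    ('a set \<Rightarrow> (('a \<Rightarrow> real) \<Rightarrow> real) \<Rightarrow> 'g) \<Rightarrow> (('g \<times> 'a toric_point) \<times> ('g \<times> 'a toric_point)) set" where
  "dev_rel N \<Delta> G \<phi> = {((g, x), (g', x')). g \<in> carrier G \<and> g' \<in> carrier G \<and>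
     x \<in> topspace (nonneg_part N \<Delta>) \<and> x = x' \<and>
     (\<exists>\<tau>\<in>\<Delta>. x \<in> nonneg_orbit N \<Delta> \<tau> \<and>
        inv\<^bsub>G\<^esub> g \<otimes>\<^bsub>G\<^esub> g' \<in> \<phi> \<tau> ` carrier (local_group N \<Delta> \<tau>))}"

definition development :: "'a::real_vector set \<Rightarrow> 'a set set \<Rightarrow> ('g, 'b) monoid_scheme \<Rightarrow>
    ('a set \<Rightarrow> (('a \<Rightarrow> real) \<Rightarrow> real) \<Rightarrow> 'g) \<Rightarrow> ('g \<times> 'a toric_point) set topology" where
  "development N \<Delta> G \<phi> =
     quotient_space (prod_topology (discrete_topology (carrier G)) (nonneg_part N \<Delta>)) (dev_rel N \<Delta> G \<phi>)"

definition dev_act :: "'a::real_vector set \<Rightarrow> 'a set set \<Rightarrow> ('g, 'b) monoid_scheme \<Rightarrow>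
    ('a set \<Rightarrow> (('a \<Rightarrow> real) \<Rightarrow> real) \<Rightarrow> 'g) \<Rightarrow> 'g \<Rightarrow>
    ('g \<times> 'a toric_point) set \<Rightarrow> ('g \<times> 'a toric_point) set" where
  "dev_act N \<Delta> G \<phi> g = (\<lambda>c\<in>topspace (development N \<Delta> G \<phi>). (\<lambda>(h, x). (g \<otimes>\<^bsub>G\<^esub> h, x)) ` c)"

text \<open>\<open>x \<mapsto> [1, x]\<close> identifies \<open>X\<^sub>+\<close> with a subset of the development.\<close>

definition dev_emb :: "'a::real_vector set \<Rightarrow> 'a set set \<Rightarrow> ('g, 'b) monoid_scheme \<Rightarrow>
    ('a set \<Rightarrow> (('a \<Rightarrow> real) \<Rightarrow> real) \<Rightarrow> 'g) \<Rightarrow> 'a toric_point \<Rightarrow> ('g \<times> 'a toric_point) set" where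
  "dev_emb N \<Delta> G \<phi> x = dev_rel N \<Delta> G \<phi> `` {(\<one>\<^bsub>G\<^esub>, x)}"

definition dev_strata :: "'a::real_vector set \<Rightarrow> 'a set set \<Rightarrow> ('g, 'b) monoid_scheme \<Rightarrow>
    ('a set \<Rightarrow> (('a \<Rightarrow> real) \<Rightarrow> real) \<Rightarrow> 'g) \<Rightarrow> ('g \<times> 'a toric_point) set set set" where
  "dev_strata N \<Delta> G \<phi> =
     {dev_act N \<Delta> G \<phi> g ` dev_emb N \<Delta> G \<phi> ` nonneg_stratum N \<Delta> \<tau> | g \<tau>. g \<in> carrier G \<and> \<tau> \<in> \<Delta>}"

definition strata_preserving_action ::
    "('g, 'b) monoid_scheme \<Rightarrow> 'x topology \<Rightarrow> 'x set set \<Rightarrow> ('g \<Rightarrow> 'x \<Rightarrow> 'x) \<Rightarrow> bool" where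
  "strata_preserving_action G D \<S> \<psi> \<longleftrightarrow> group_action G (topspace D) \<psi> \<and>
     (\<forall>g\<in>carrier G. homeomorphic_map D D (\<psi> g) \<and> (\<forall>S\<in>\<S>. \<psi> g ` S \<in> \<S>))"

definition strict_fundamental_domain ::
    "('g, 'b) monoid_scheme \<Rightarrow> 'x topology \<Rightarrow> 'x set set \<Rightarrow> ('g \<Rightarrow> 'x \<Rightarrow> 'x) \<Rightarrow> 'x set \<Rightarrow> bool" where
  "strict_fundamental_domain G D \<S> \<psi> Y \<longleftrightarrow>
     (\<exists>\<F>\<subseteq>\<S>. Y = \<Union>\<F>) \<and>
     (\<forall>\<O> \<in> orbits G (topspace D) \<psi>. \<exists>!y. y \<in> \<O> \<and> y \<in> Y) \<and>
     (\<forall>S\<in>\<S>. \<exists>!S'. S' \<in> {\<psi> g ` S | g. g \<in> carrier G} \<and> S' \<subseteq> Y)"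


section \<open>Abelianisation and elementary abelian 2-groups\<close>

definition abelianisation :: "('g, 'b) monoid_scheme \<Rightarrow> 'g set monoid" where
  "abelianisation G = G Mod derived G (carrier G)"

definition abelianisation_map :: "('g, 'b) monoid_scheme \<Rightarrow> 'g \<Rightarrow> 'g set" where
  "abelianisation_map G g = derived G (carrier G) #>\<^bsub>G\<^esub> g"

definition Z2_power :: "nat \<Rightarrow> (nat \<Rightarrow> int) monoid" where
  "Z2_power k = product_group {..<k} (\<lambda>_. integer_mod_group 2)"

end

theory Submission
  imports Defs "HOL-Algebra.FiniteProduct"
begin

text \<open>
  All developments of \<open>X\<^sub>+\<close> are instances of one construction. A space \<open>Y\<close> is stratified by the faces of
  a simplicial complex and charted by corners \<open>[0, \<infinity>)\<^sup>S \<times> (0, \<infinity>)\<^bsup>B - S\<^esup>\<close>, and a group \<open>G\<close> contains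
  compatible copies of the groups \<open>\<int>\<^sub>2\<^sup>S\<close>. In the quotient of \<open>G \<times> Y\<close> the chambers around a corner fit
  together like the orthants of \<open>\<real>\<^sup>S\<close>, so a corner has a star-shaped neighbourhood, and a surjection
  \<open>G \<rightarrow> H\<close> that respects the \<open>\<int>\<^sub>2\<^sup>S\<close> induces a covering whose deck group is its kernel. Up to homotopy a
  path is the word of the walls it crosses: hence the development is connected iff the walls generate
  \<open>G\<close>, and as the squares and the commutation relations of \<open>W\<close> bound null-homotopic loops, the
  development of \<open>W\<close> is simply connected. The cases \<open>G = W\<close>, \<open>T\<^sub>2\<close>, \<open>W\<^sub>a\<^sub>b\<close> give the theorem, once
  \<open>(t, x) \<mapsto> t \<cdot> x\<close> has been shown to identify the development of \<open>T\<^sub>2\<close> with \<open>X\<close>.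
\<close>

section \<open>Path homotopy in abstract topologies\<close>

text \<open>The topology of the non-negative part enters the computation of fundamental groups only
  through its charts. The zero cone is a face of every cone, so all corner charts share the point
  \<open>x0\<close> that lies on no wall; every star in a development is a copy of a convex set and
  contains the centres of the chambers it meets. A path cut into pieces that lie in stars can
  therefore be pulled to the chamber centres piece by piece, and only the sequence of crossed walls
  is left. The two halves of the isomorphism between the kernel and the fundamental group have
  different sources. Cutting shows that every loop comes from a word, and the relations show that
  words for one element of \<open>W\<close> give homotopic loops. That different elements give
  different loops is monodromy: in the development of \<open>W\<close> a lifted word path ends in
  the chamber named by its word. For this the local groups must embed in \<open>W\<close>, which is
  visible only after projecting \<open>W\<close> to \<open>T2\<close>. Paths, lifts and coverings
  are treated for abstract topologies because the spaces are quotients whose points are sets of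
  pairs.\<close>

definition path_hom :: "'x topology \<Rightarrow> (real \<Rightarrow> 'x) \<Rightarrow> (real \<Rightarrow> 'x) \<Rightarrow> bool" where
  "path_hom X p q \<longleftrightarrow> homotopic_with (\<lambda>r. r 0 = p 0 \<and> r 1 = p 1) (top_of_set {0..1}) X p q"

definition path_reverse :: "(real \<Rightarrow> 'x) \<Rightarrow> real \<Rightarrow> 'x" where
  "path_reverse p = (\<lambda>t. p (1 - t))"

definition path_sub :: "(real \<Rightarrow> 'x) \<Rightarrow> real \<Rightarrow> real \<Rightarrow> real \<Rightarrow> 'x" where
  "path_sub p a b = (\<lambda>t. p (a + t * (b - a)))"

lemma path_concat_ends [simp]: "path_concat p q 0 = p 0" "path_concat p q 1 = q 1"
  by (auto simp: path_concat_def)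

lemma path_reverse_ends [simp]: "path_reverse p 0 = p 1" "path_reverse p 1 = p 0"
  by (auto simp: path_reverse_def)

lemma path_sub_ends [simp]: "path_sub p a b 0 = p a" "path_sub p a b 1 = p b"
  by (auto simp: path_sub_def)

lemma path_concat_compose: "f \<circ> path_concat p q = path_concat (f \<circ> p) (f \<circ> q)"
  by (auto simp: path_concat_def)

lemma pathin_reparametrize:
  assumes "pathin X p" "continuous_on {0..1} f" "f ` {0..1} \<subseteq> {0..1}"
  shows "pathin X (p \<circ> f)"
  unfolding pathin_def
proof (rule continuous_map_compose)
  show "continuous_map (top_of_set {0..1}) (top_of_set {0..1}) f"
    using assms(2,3) by (auto simp: continuous_map_in_subtopology)
  show "continuous_map (top_of_set {0..1}) X p" using assms(1) by (simp add: pathin_def)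
qed

lemma pathin_reverse: "pathin X p \<Longrightarrow> pathin X (path_reverse p)"
  using pathin_reparametrize[of X p "\<lambda>t. 1 - t"]
  by (force simp: path_reverse_def o_def intro: continuous_intros)

lemma affine_01:
  fixes a b t :: real
  assumes "0 \<le> a" "a \<le> 1" "0 \<le> b" "b \<le> 1" "0 \<le> t" "t \<le> 1"
  shows "0 \<le> a + t * (b - a)" "a + t * (b - a) \<le> 1"
proof -
  have e: "a + t * (b - a) = (1 - t) * a + t * b" by (simp add: algebra_simps)
  show "0 \<le> a + t * (b - a)" unfolding e using assms by simp
  show "a + t * (b - a) \<le> 1" unfolding e using assms convex_bound_le[of a 1 b "1 - t" t] by simp
qed

lemma pathin_sub: 
  assumes "pathin X p" "0 \<le> a" "a \<le> 1" "0 \<le> b" "b \<le> 1"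
  shows "pathin X (path_sub p a b)"
proof -
  have "path_sub p a b = p \<circ> (\<lambda>t. a + t * (b - a))" by (simp add: path_sub_def o_def)
  moreover have "pathin X (p \<circ> (\<lambda>t. a + t * (b - a)))"
    by (rule pathin_reparametrize) (use assms affine_01 in \<open>auto intro!: continuous_intros\<close>)
  ultimately show ?thesis by simp
qed

lemma pathin_concat:
  assumes p: "pathin X p" and q: "pathin X q" and pq: "p 1 = q 0"
  shows "pathin X (path_concat p q)"
proof -
  have "continuous_map (top_of_set {0..1}) X (\<lambda>t. if t \<le> 1/2 then (p \<circ> (\<lambda>t. 2 * t)) t else (q \<circ> (\<lambda>t. 2 * t - 1)) t)"
  proof (rule continuous_map_cases_le)
    show "continuous_map (subtopology (top_of_set {0..1}) {x \<in> topspace (top_of_set {0..1}). x \<le> 1 / 2}) X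
     (p \<circ> (\<lambda>t. 2 * t))"
      by (rule continuous_map_compose[OF _ p[unfolded pathin_def]])
        (auto simp: continuous_map_in_subtopology subtopology_subtopology intro!: continuous_intros)
    show "continuous_map (subtopology (top_of_set {0..1}) {x \<in> topspace (top_of_set {0..1}). 1 / 2 \<le> x}) X
     (q \<circ> (\<lambda>t. 2 * t - 1))"
      by (rule continuous_map_compose[OF _ q[unfolded pathin_def]])
        (auto simp: continuous_map_in_subtopology subtopology_subtopology intro!: continuous_intros)
    show "(p \<circ> (\<lambda>t. 2 * t)) x = (q \<circ> (\<lambda>t. 2 * t - 1)) x" if "x = 1/2" for x :: real
    proof -
      have "2 * x = 1" "2 * x - 1 = 0" using that by auto
      then show ?thesis using pq by (simp only: o_def)
    qed
  qed (auto intro!: continuous_intros)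
  then show ?thesis
    unfolding pathin_def path_concat_def o_def .
qed

lemma square_eq: "prod_topology (top_of_set {0..1::real}) (top_of_set {0..1::real}) = top_of_set ({0..1} \<times> {0..1})"
  by (simp add: prod_topology_subtopology_eu)

text \<open>Agreement with \<open>p\<close> and \<open>q\<close> is asked for on the unit interval
  only: off it the homotopy may take any values, since the endpoint condition looks at times 0 and 1
  alone.\<close>

lemma path_homI:
  fixes h :: "real \<times> real \<Rightarrow> 'x"
  assumes "continuous_map (top_of_set ({0..1} \<times> {0..1})) X h"
    and "\<And>x. x \<in> {0..1} \<Longrightarrow> h (0, x) = p x" "\<And>x. x \<in> {0..1} \<Longrightarrow> h (1, x) = q x"
    and "\<And>t. t \<in> {0..1} \<Longrightarrow> h (t, 0) = p 0" "\<And>t. t \<in> {0..1} \<Longrightarrow> h (t, 1) = p 1"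
  shows "path_hom X p q"
proof -
  have *: "homotopic_with (\<lambda>r. r 0 = p 0 \<and> r 1 = p 1) (top_of_set {0..1}) X p q \<longleftrightarrow>
    (\<exists>h. continuous_map (prod_topology (subtopology euclideanreal {0..1}) (top_of_set {0..1})) X h \<and>
              (\<forall>x \<in> topspace (top_of_set {0..1}). h(0,x) = p x) \<and>
              (\<forall>x \<in> topspace (top_of_set {0..1}). h(1,x) = q x) \<and>
              (\<forall>t \<in> {0..1}. (\<lambda>x. h (t, x)) 0 = p 0 \<and> (\<lambda>x. h (t, x)) 1 = p 1))"
    by (rule homotopic_with) auto
  show ?thesis
    unfolding path_hom_def *
    by (rule exI[of _ h]) (use assms in \<open>auto simp: square_eq\<close>)
qed

lemma path_homD:
  fixes X :: "'x topology"
  assumes "path_hom X p q"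
  obtains h :: "real \<times> real \<Rightarrow> 'x" where "continuous_map (top_of_set ({0..1} \<times> {0..1})) X h"
    "\<And>x. h (0, x) = p x" "\<And>x. h (1, x) = q x"
    "\<And>t. t \<in> {0..1} \<Longrightarrow> h (t, 0) = p 0" "\<And>t. t \<in> {0..1} \<Longrightarrow> h (t, 1) = p 1"
  using assms unfolding path_hom_def homotopic_with_def square_eq by blast

lemma path_hom_ends: "path_hom X p q \<Longrightarrow> q 0 = p 0 \<and> q 1 = p 1"
  unfolding path_hom_def by (drule homotopic_with_imp_property) simp

lemma path_hom_pathin: "path_hom X p q \<Longrightarrow> pathin X p" "path_hom X p q \<Longrightarrow> pathin X q"
  unfolding path_hom_def pathin_def using homotopic_with_imp_continuous_maps by blast+

lemma path_hom_refl: "pathin X p \<Longrightarrow> path_hom X p p"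
  by (simp add: path_hom_def pathin_def)

lemma path_hom_sym: "path_hom X p q \<Longrightarrow> path_hom X q p"
  using path_hom_ends[of X p q] unfolding path_hom_def by (simp add: homotopic_with_symD)

lemma path_hom_trans [trans]: "path_hom X p q \<Longrightarrow> path_hom X q r \<Longrightarrow> path_hom X p r"
  using path_hom_ends[of X p q] homotopic_with_trans[of _ "top_of_set {0..1}" X p q r]
  unfolding path_hom_def by simp

lemma path_hom_subtopology: "path_hom (subtopology X A) p q \<Longrightarrow> path_hom X p q"
  unfolding path_hom_def homotopic_with_def continuous_map_in_subtopology by blast

lemma path_hom_compose:
  "path_hom X p q \<Longrightarrow> continuous_map X Y f \<Longrightarrow> path_hom Y (f \<circ> p) (f \<circ> q)"
  unfolding path_hom_def by (erule homotopic_with_compose_continuous_map_left) auto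

lemma path_hom_eq:
  assumes "pathin X p" "\<And>t. t \<in> {0..1} \<Longrightarrow> p t = q t"
  shows "path_hom X p q"
  unfolding path_hom_def
  by (rule homotopic_with_equal) (use assms in \<open>auto simp: pathin_def\<close>)

text \<open>The parameter interval is convex, so \<open>f\<close> and \<open>g\<close> are joined by
  the line \<open>f t + s * (g t - f t)\<close> before \<open>p\<close> is applied. The groupoid
  laws below all come from this: associativity, units and inverses each compare two parametrizations
  of one path.\<close>

lemma path_hom_reparametrize:
  assumes p: "pathin X p" and f: "continuous_on {0..1} f" "f ` {0..1} \<subseteq> {0..1}"
    and g: "continuous_on {0..1} g" "g ` {0..1} \<subseteq> {0..1}" and e: "f 0 = g 0" "f 1 = g 1"
  shows "path_hom X (p \<circ> f) (p \<circ> g)"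
proof (rule path_homI)
  let ?k = "\<lambda>(s::real,t). f t + s * (g t - f t)"
  show "continuous_map (top_of_set ({0..1} \<times> {0..1})) X (p \<circ> ?k)"
  proof (rule continuous_map_compose[OF _ p[unfolded pathin_def]])
    have 1: "continuous_on ({0..1} \<times> {0..1}) (\<lambda>x. f (snd x))"
      by (rule continuous_on_compose2[OF f(1)]) (auto intro!: continuous_intros)
    have 2: "continuous_on ({0..1} \<times> {0..1}) (\<lambda>x. g (snd x))"
      by (rule continuous_on_compose2[OF g(1)]) (auto intro!: continuous_intros)
    have "continuous_on ({0..1} \<times> {0..1}) (\<lambda>x. f (snd x) + fst x * (g (snd x) - f (snd x)))"
      by (intro continuous_intros 1 2)
    moreover have "?k \<in> {0..1} \<times> {0..1} \<rightarrow> {0..1}"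
      using f(2) g(2) affine_01 by (fastforce simp: image_subset_iff)
    ultimately show "continuous_map (top_of_set ({0..1} \<times> {0..1})) (top_of_set {0..1}) ?k"
      by (simp add: continuous_map_in_subtopology case_prod_unfold)
  qed
qed (use e in auto)

lemma path_hom_concat:
  fixes X :: "'x topology"
  assumes p: "path_hom X p p'" and q: "path_hom X q q'" and pq: "p 1 = q 0"
  shows "path_hom X (path_concat p q) (path_concat p' q')"
proof -
  obtain h :: "real \<times> real \<Rightarrow> 'x" where h: "continuous_map (top_of_set ({0..1} \<times> {0..1})) X h"
    "\<And>x. h (0, x) = p x" "\<And>x. h (1, x) = p' x"
    "\<And>t. t \<in> {0..1} \<Longrightarrow> h (t, 0) = p 0" "\<And>t. t \<in> {0..1} \<Longrightarrow> h (t, 1) = p 1"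
    using path_homD[OF p] by metis
  obtain k :: "real \<times> real \<Rightarrow> 'x" where k: "continuous_map (top_of_set ({0..1} \<times> {0..1})) X k"
    "\<And>x. k (0, x) = q x" "\<And>x. k (1, x) = q' x"
    "\<And>t. t \<in> {0..1} \<Longrightarrow> k (t, 0) = q 0" "\<And>t. t \<in> {0..1} \<Longrightarrow> k (t, 1) = q 1"
    using path_homD[OF q] by metis
  let ?j = "\<lambda>x::real\<times>real. if snd x \<le> 1/2 then (h \<circ> (\<lambda>x. (fst x, 2 * snd x))) x else (k \<circ> (\<lambda>x. (fst x, 2 * snd x - 1))) x"
  have c: "continuous_map (top_of_set ({0..1} \<times> {0..1})) X ?j"
  proof (rule continuous_map_cases_le)
    show "continuous_map (subtopology (top_of_set ({0..1} \<times> {0..1})) {x \<in> topspace (top_of_set ({0..1} \<times> {0..1})). snd x \<le> 1 / 2}) X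
      (h \<circ> (\<lambda>x. (fst x, 2 * snd x)))"
      by (rule continuous_map_compose[OF _ h(1)])
        (auto simp: continuous_map_in_subtopology subtopology_subtopology intro!: continuous_intros)
    show "continuous_map (subtopology (top_of_set ({0..1} \<times> {0..1})) {x \<in> topspace (top_of_set ({0..1} \<times> {0..1})). 1 / 2 \<le> snd x}) X
      (k \<circ> (\<lambda>x. (fst x, 2 * snd x - 1)))"
      by (rule continuous_map_compose[OF _ k(1)])
        (auto simp: continuous_map_in_subtopology subtopology_subtopology intro!: continuous_intros)
    show "(h \<circ> (\<lambda>x. (fst x, 2 * snd x))) x = (k \<circ> (\<lambda>x. (fst x, 2 * snd x - 1))) x"
      if "x \<in> topspace (top_of_set ({0..1} \<times> {0..1}))" "snd x = 1/2" for x
    proof -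
      have "2 * snd x = 1" "2 * snd x - 1 = 0" using that by auto
      then show ?thesis using that pq h(5) k(4) by (simp only: o_def) auto
    qed
  qed (auto intro!: continuous_intros)
  show ?thesis
    by (rule path_homI[OF c]) (use h k in \<open>auto simp: path_concat_def\<close>)
qed

lemma path_hom_assoc:
  assumes p: "pathin X p" and q: "pathin X q" and r: "pathin X r" and "p 1 = q 0" "q 1 = r 0"
  shows "path_hom X (path_concat (path_concat p q) r) (path_concat p (path_concat q r))"
proof -
  let ?c = "path_concat p (path_concat q r)"
  \<comment> \<open>The piecewise linear map with slopes 2, 1, 1/2 and breaks at 1/4 and 1/2. Being
    concave, it is the minimum of three affine maps, so its continuity needs no case
    distinction.\<close>
  let ?f = "\<lambda>t::real. min (2 * t) (min (t + 1/4) ((t + 1) / 2))"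
  have f: "?f t = (if t \<le> 1/4 then 2 * t else if t \<le> 1/2 then t + 1/4 else (t + 1) / 2)" for t
    by (simp add: min_def)
  have "path_concat (path_concat p q) r = ?c \<circ> ?f"
    unfolding fun_eq_iff o_def f
    by (auto simp: path_concat_def intro: arg_cong[where f = q] arg_cong[where f = r])
  moreover have "path_hom X (?c \<circ> ?f) (?c \<circ> (\<lambda>t. t))"
  proof (rule path_hom_reparametrize)
    show "?f ` {0..1} \<subseteq> {0..1}" by (auto simp: min_def)
  qed (use assms in \<open>auto intro!: pathin_concat continuous_intros\<close>)
  ultimately show ?thesis by (simp add: o_def)
qed

lemma path_hom_rid:
  assumes p: "pathin X p" and "c = p 1"
  shows "path_hom X (path_concat p (\<lambda>_. c)) p"
proof -
  let ?f = "\<lambda>t::real. min (2 * t) 1"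
  have "path_concat p (\<lambda>_. c) = p \<circ> ?f"
    using assms by (auto simp: path_concat_def fun_eq_iff min_def)
  moreover have "path_hom X (p \<circ> ?f) (p \<circ> (\<lambda>t. t))"
    by (rule path_hom_reparametrize) (use assms in \<open>auto intro!: continuous_intros\<close>)
  ultimately show ?thesis by (simp add: o_def)
qed

lemma path_hom_lid:
  assumes p: "pathin X p" and "c = p 0"
  shows "path_hom X (path_concat (\<lambda>_. c) p) p"
proof -
  let ?f = "\<lambda>t::real. max (2 * t - 1) 0"
  have "path_concat (\<lambda>_. c) p = p \<circ> ?f"
    using assms by (auto simp: path_concat_def fun_eq_iff max_def)
  moreover have "path_hom X (p \<circ> ?f) (p \<circ> (\<lambda>t. t))"
    by (rule path_hom_reparametrize) (use assms in \<open>auto intro!: continuous_intros\<close>)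
  ultimately show ?thesis by (simp add: o_def)
qed

lemma path_hom_rinv:
  assumes p: "pathin X p" and "c = p 0"
  shows "path_hom X (path_concat p (path_reverse p)) (\<lambda>_. c)"
proof -
  \<comment> \<open>The tent map: out along \<open>p\<close> and back. It starts and ends at 0, so
    it deforms to the constant map 0.\<close>
  let ?f = "\<lambda>t::real. min (2 * t) (2 - 2 * t)"
  have "path_concat p (path_reverse p) = p \<circ> ?f"
    by (auto simp: path_concat_def path_reverse_def fun_eq_iff min_def)
  moreover have "path_hom X (p \<circ> ?f) (p \<circ> (\<lambda>t. 0))"
  proof (rule path_hom_reparametrize)
    show "?f ` {0..1} \<subseteq> {0..1}" by (auto simp: min_def)
  qed (use assms in \<open>auto intro!: continuous_intros\<close>)
  ultimately show ?thesis using assms by (simp add: o_def)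
qed

lemma path_reverse_reverse [simp]: "path_reverse (path_reverse p) = p"
  by (simp add: path_reverse_def)

lemma path_hom_linv:
  assumes p: "pathin X p" and "c = p 1"
  shows "path_hom X (path_concat (path_reverse p) p) (\<lambda>_. c)"
  using path_hom_rinv[OF pathin_reverse[OF p], of c] assms by simp

lemma path_hom_sub:
  assumes p: "pathin X p" and "0 \<le> a" "a \<le> b" "b \<le> c" "c \<le> 1"
  shows "path_hom X (path_concat (path_sub p a b) (path_sub p b c)) (path_sub p a c)"
proof -
  \<comment> \<open>Clipping lets the first term run during the first half and then rest at
    \<open>b\<close>, while the second term starts only at 1/2; continuity is again
    immediate.\<close>
  let ?f = "\<lambda>t::real. a + min (2 * t) 1 * (b - a) + max (2 * t - 1) 0 * (c - b)"
  have f: "?f t = (if t \<le> 1/2 then a + (2 * t) * (b - a) else b + (2 * t - 1) * (c - b))" for t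
    by (simp add: min_def max_def)
  have "path_concat (path_sub p a b) (path_sub p b c) = p \<circ> ?f"
    unfolding fun_eq_iff o_def f by (auto simp: path_concat_def path_sub_def)
  moreover have "path_hom X (p \<circ> ?f) (p \<circ> (\<lambda>t. a + t * (c - a)))"
  proof (rule path_hom_reparametrize)
    show "?f ` {0..1} \<subseteq> {0..1}"
    proof clarify
      fix t :: real assume t: "t \<in> {0..1}"
      show "?f t \<in> {0..1}"
        unfolding f using t assms affine_01[of a b "2 * t"] affine_01[of b c "2 * t - 1"] by auto
    qed
  qed (use assms affine_01 in \<open>auto intro!: continuous_intros\<close>)
  moreover have "p \<circ> (\<lambda>t. a + t * (c - a)) = path_sub p a c"
    by (simp add: path_sub_def o_def)
  ultimately show ?thesis by simp
qed

lemma path_hom_cancel_left: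
  assumes "pathin X d" "pathin X p" "d 1 = p 0"
  shows "path_hom X (path_concat (path_reverse d) (path_concat d p)) p"
proof -
  have "path_hom X (path_concat (path_reverse d) (path_concat d p)) (path_concat (path_concat (path_reverse d) d) p)"
    by (rule path_hom_sym[OF path_hom_assoc]) (use assms in \<open>auto intro: pathin_reverse[OF assms(1)]\<close>)
  also have "path_hom X \<dots> (path_concat (\<lambda>_. p 0) p)"
    by (rule path_hom_concat) (use assms in \<open>auto intro!: path_hom_linv path_hom_refl\<close>)
  also have "path_hom X \<dots> p" by (rule path_hom_lid) (use assms in auto)
  finally show ?thesis .
qed

lemma path_hom_cancel_left':
  assumes "pathin X d" "pathin X p" "d 0 = p 0"
  shows "path_hom X (path_concat d (path_concat (path_reverse d) p)) p"
  using path_hom_cancel_left[of X "path_reverse d" p] assms pathin_reverse[OF assms(1)] by simp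

lemma path_hom_cancel_right:
  assumes "pathin X d" "pathin X p" "p 1 = d 0"
  shows "path_hom X (path_concat (path_concat p d) (path_reverse d)) p"
proof -
  have "path_hom X (path_concat (path_concat p d) (path_reverse d)) (path_concat p (path_concat d (path_reverse d)))"
    by (rule path_hom_assoc) (use assms in \<open>auto intro: pathin_reverse[OF assms(1)]\<close>)
  also have "path_hom X \<dots> (path_concat p (\<lambda>_. p 1))"
    by (rule path_hom_concat) (use assms in \<open>auto intro!: path_hom_rinv path_hom_refl\<close>)
  also have "path_hom X \<dots> p" by (rule path_hom_rid) (use assms in auto)
  finally show ?thesis .
qed

lemma path_hom_cancel_right':
  assumes "pathin X d" "pathin X p" "p 1 = d 1"
  shows "path_hom X (path_concat (path_concat p (path_reverse d)) d) p"
  using path_hom_cancel_right[of X "path_reverse d" p] assms pathin_reverse[OF assms(1)] by simp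

section \<open>Recognising a fundamental group\<close>

text \<open>\<open>L\<close> is a choice of representatives for an isomorphism from \<open>H\<close> onto the fundamental group.\<close>

definition has_pi1 :: "'x topology \<Rightarrow> 'x \<Rightarrow> ('h, 'b) monoid_scheme \<Rightarrow> ('h \<Rightarrow> real \<Rightarrow> 'x) \<Rightarrow> bool" where
  "has_pi1 X x H L \<longleftrightarrow>
     (\<forall>a\<in>carrier H. L a \<in> loops X x) \<and>
     (\<forall>a\<in>carrier H. \<forall>b\<in>carrier H. path_hom X (L (a \<otimes>\<^bsub>H\<^esub> b)) (path_concat (L a) (L b))) \<and>
     (\<forall>a\<in>carrier H. \<forall>b\<in>carrier H. path_hom X (L a) (L b) \<longrightarrow> a = b) \<and>
     (\<forall>p\<in>loops X x. \<exists>a\<in>carrier H. path_hom X p (L a))"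

lemma loop_homotopy_iff:
  "(p, q) \<in> loop_homotopy X x \<longleftrightarrow> p \<in> loops X x \<and> q \<in> loops X x \<and> path_hom X p q"
  by (auto simp: loop_homotopy_def path_hom_def loops_def)

lemma loop_homotopy_iff':
  "p \<in> loops X x \<Longrightarrow> (p, q) \<in> loop_homotopy X x \<longleftrightarrow> path_hom X p q"
  using path_hom_ends[of X p q] path_hom_pathin[of X p q] by (auto simp: loop_homotopy_iff loops_def)

lemma equiv_loop_homotopy: "equiv (loops X x) (loop_homotopy X x)"
proof (rule equivI)
  show "loop_homotopy X x \<subseteq> loops X x \<times> loops X x" by (auto simp: loop_homotopy_iff)
  show "refl_on (loops X x) (loop_homotopy X x)"
    by (auto simp: refl_on_def loop_homotopy_iff loops_def path_hom_refl)
  show "sym (loop_homotopy X x)" by (auto simp: sym_def loop_homotopy_iff path_hom_sym)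
  show "trans (loop_homotopy X x)"
    unfolding trans_def loop_homotopy_iff using path_hom_trans by metis
qed

lemma loops_concat: "p \<in> loops X x \<Longrightarrow> q \<in> loops X x \<Longrightarrow> path_concat p q \<in> loops X x"
  by (auto simp: loops_def intro: pathin_concat)

text \<open>Homotopy classes are handled here so that later arguments can speak of individual loops:
  the clauses of \<open>has_pi1\<close> say that sending \<open>a\<close> to the class of
  \<open>L a\<close> is well placed, multiplicative, injective and surjective.\<close>

lemma fundamental_group_iso:
  assumes H: "group H" and L: "has_pi1 X x H L"
  shows "fundamental_group X x \<cong> H"
proof -
  let ?R = "loop_homotopy X x"
  let ?f = "\<lambda>a. ?R `` {L a}"
  note eq = equiv_loop_homotopy[of X x]
  have lo: "L a \<in> loops X x" if "a \<in> carrier H" for a using L that by (simp add: has_pi1_def)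
  have "?f \<in> iso H (fundamental_group X x)"
    unfolding iso_def
  proof (intro CollectI conjI homI)
    fix a b assume ab: "a \<in> carrier H" "b \<in> carrier H"
    then show "?f a \<in> carrier (fundamental_group X x)"
      by (simp add: fundamental_group_def quotientI lo)
    have ab': "a \<otimes>\<^bsub>H\<^esub> b \<in> carrier H" using H ab by (simp add: group.is_monoid monoid.m_closed)
    have h: "path_hom X (L (a \<otimes>\<^bsub>H\<^esub> b)) (path_concat (L a) (L b))"
      using L ab by (auto simp: has_pi1_def)
    have "r \<in> ?f (a \<otimes>\<^bsub>H\<^esub> b) \<longleftrightarrow> (\<exists>p\<in>?f a. \<exists>q\<in>?f b. (path_concat p q, r) \<in> ?R)" (is "?l \<longleftrightarrow> ?r") for r
    proof
      assume ?l
      then have "path_hom X (L (a \<otimes>\<^bsub>H\<^esub> b)) r" using loop_homotopy_iff'[OF lo[OF ab']] by simp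
      then have "path_hom X (path_concat (L a) (L b)) r" using h path_hom_sym path_hom_trans by metis
      then have "(path_concat (L a) (L b), r) \<in> ?R"
        using loop_homotopy_iff' loops_concat lo ab by metis
      then show ?r using lo ab equiv_class_self[OF eq] by blast
    next
      assume ?r
      then obtain p q where pq: "(L a, p) \<in> ?R" "(L b, q) \<in> ?R" "(path_concat p q, r) \<in> ?R" by blast
      then have "path_hom X (L a) p" "path_hom X (L b) q" "path_hom X (path_concat p q) r"
        by (simp_all add: loop_homotopy_iff)
      moreover have "L a 1 = L b 0" using lo[OF ab(1)] lo[OF ab(2)] by (simp add: loops_def)
      ultimately have "path_hom X (path_concat (L a) (L b)) r"
        using path_hom_concat path_hom_trans by metis
      then have "path_hom X (L (a \<otimes>\<^bsub>H\<^esub> b)) r" using h path_hom_trans by metis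
      then show ?l using loop_homotopy_iff'[OF lo[OF ab']] by simp
    qed
    then have "?f (a \<otimes>\<^bsub>H\<^esub> b) = {r. \<exists>p\<in>?f a. \<exists>q\<in>?f b. (path_concat p q, r) \<in> ?R}"
      unfolding set_eq_iff mem_Collect_eq by (rule allI)
    then show "?f (a \<otimes>\<^bsub>H\<^esub> b) = ?f a \<otimes>\<^bsub>fundamental_group X x\<^esub> ?f b"
      by (simp only: fundamental_group_def monoid.simps)
  next
    show "bij_betw ?f (carrier H) (carrier (fundamental_group X x))"
    proof (rule bij_betw_imageI)
      show "inj_on ?f (carrier H)"
      proof (rule inj_onI)
        fix a b assume ab: "a \<in> carrier H" "b \<in> carrier H" "?f a = ?f b"
        then have "(L a, L b) \<in> ?R" using eq_equiv_class[OF ab(3) eq lo[OF ab(2)]] by simp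
        then show "a = b" using L ab by (auto simp: has_pi1_def loop_homotopy_iff)
      qed
      show "?f ` carrier H = carrier (fundamental_group X x)"
      proof (intro equalityI subsetI)
        fix c assume "c \<in> carrier (fundamental_group X x)"
        then obtain p where p: "p \<in> loops X x" "c = ?R `` {p}"
          by (auto simp: fundamental_group_def quotient_def)
        then obtain a where "a \<in> carrier H" "path_hom X p (L a)" using L by (auto simp: has_pi1_def)
        then have "c = ?f a" using p equiv_class_eq[OF eq, of p "L a"] loop_homotopy_iff'[OF p(1)] by simp
        then show "c \<in> ?f ` carrier H" using \<open>a \<in> carrier H\<close> by blast
      qed (auto simp: fundamental_group_def quotientI lo)
    qed
  qed
  then have "H \<cong> fundamental_group X x" by (auto simp: is_iso_def)
  then show ?thesis by (rule group.iso_sym[OF H])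
qed

text \<open>Composing with \<open>f\<close> and with its inverse undo each other up to path
  homotopy. This carries the answer from the development over \<open>T2\<close> to the toric
  variety.\<close>

lemma has_pi1_homeomorphic:
  assumes L: "has_pi1 X x H L" and f: "homeomorphic_map X Y f" and x: "x \<in> topspace X"
  shows "has_pi1 Y (f x) H (\<lambda>a. f \<circ> L a)"
proof -
  obtain g where g: "homeomorphic_maps X Y f g" using f homeomorphic_map_maps by blast
  then have cf: "continuous_map X Y f" and cg: "continuous_map Y X g"
    and gf: "\<And>x. x \<in> topspace X \<Longrightarrow> g (f x) = x" and fg: "\<And>y. y \<in> topspace Y \<Longrightarrow> f (g y) = y"
    by (auto simp: homeomorphic_maps_def)
  have gfp: "path_hom X (g \<circ> (f \<circ> p)) p" if "pathin X p" for p
    by (rule path_hom_sym, rule path_hom_eq)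
      (use that gf path_image_subset_topspace[OF that] in \<open>auto simp: Pi_iff\<close>)
  have fgp: "path_hom Y (f \<circ> (g \<circ> p)) p" if "pathin Y p" for p
    by (rule path_hom_sym, rule path_hom_eq)
      (use that fg path_image_subset_topspace[OF that] in \<open>auto simp: Pi_iff\<close>)
  have pa: "pathin X (L a)" "L a 0 = x" "L a 1 = x" if "a \<in> carrier H" for a
    using L that by (auto simp: has_pi1_def loops_def)
  show ?thesis
    unfolding has_pi1_def
  proof (intro conjI ballI impI)
    fix a assume a: "a \<in> carrier H"
    then show "f \<circ> L a \<in> loops Y (f x)"
      using pa cf by (auto simp: loops_def intro: pathin_compose)
    fix b assume b: "b \<in> carrier H"
    show "path_hom Y (f \<circ> L (a \<otimes>\<^bsub>H\<^esub> b)) (path_concat (f \<circ> L a) (f \<circ> L b))"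
      using L a b path_hom_compose[OF _ cf] by (fastforce simp: has_pi1_def simp flip: path_concat_compose)
    assume "path_hom Y (f \<circ> L a) (f \<circ> L b)"
    then have "path_hom X (g \<circ> (f \<circ> L a)) (g \<circ> (f \<circ> L b))"
      using path_hom_compose cg by blast
    then have "path_hom X (L a) (L b)"
      using path_hom_trans[OF path_hom_sym[OF gfp[OF pa(1)[OF a]]]] path_hom_trans[OF _ gfp[OF pa(1)[OF b]]] by blast
    then show "a = b" using L a b by (auto simp: has_pi1_def)
  next
    fix p assume p: "p \<in> loops Y (f x)"
    have gp: "g \<circ> p \<in> loops X x" using p cg gf[OF x] by (auto simp: loops_def intro: pathin_compose)
    then obtain a where a: "a \<in> carrier H" "path_hom X (g \<circ> p) (L a)" using L by (auto simp: has_pi1_def)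
    then have "path_hom Y (f \<circ> (g \<circ> p)) (f \<circ> L a)" using path_hom_compose cf by blast
    then show "\<exists>a\<in>carrier H. path_hom Y p (f \<circ> L a)"
      using a(1) path_hom_trans[OF path_hom_sym[OF fgp]] p by (auto simp: loops_def)
  qed
qed

text \<open>Conjugation by \<open>d\<close>; the maps \<open>c\<close> and \<open>c'\<close> in the
  two directions are inverse up to homotopy. Loops made of words exist at a chamber centre only,
  while the theorem speaks of every base point.\<close>

lemma has_pi1_change_base:
  assumes L: "has_pi1 X x H L" and d: "pathin X d" "d 0 = y" "d 1 = x" and H: "group H"
  shows "has_pi1 X y H (\<lambda>a. path_concat d (path_concat (L a) (path_reverse d)))"
proof -
  define c where "c p = path_concat d (path_concat p (path_reverse d))" for p
  define c' where "c' p = path_concat (path_reverse d) (path_concat p d)" for p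
  have rd: "pathin X (path_reverse d)" using d pathin_reverse by blast
  have pl: "pathin X p" "p 0 = z" "p 1 = z" if "p \<in> loops X z" for p z using that by (auto simp: loops_def)
  have cl: "c p \<in> loops X y" if "p \<in> loops X x" for p
    using that d rd by (auto simp: loops_def c_def intro!: pathin_concat)
  have c'l: "c' p \<in> loops X x" if "p \<in> loops X y" for p
    using that d rd by (auto simp: loops_def c'_def intro!: pathin_concat)
  have ch: "path_hom X (c p) (c q)" if "path_hom X p q" "p \<in> loops X x" for p q
    unfolding c_def
    by (rule path_hom_concat[OF path_hom_refl[OF d(1)] path_hom_concat[OF that(1) path_hom_refl[OF rd]]])
      (use that(2) d in \<open>auto simp: loops_def\<close>)
  have c'h: "path_hom X (c' p) (c' q)" if "path_hom X p q" "p \<in> loops X y" for p q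
    unfolding c'_def
    by (rule path_hom_concat[OF path_hom_refl[OF rd] path_hom_concat[OF that(1) path_hom_refl[OF d(1)]]])
      (use that(2) d in \<open>auto simp: loops_def\<close>)
  have c'c: "path_hom X (c' (c p)) p" if p: "p \<in> loops X x" for p
  proof -
    note pp = pl[OF p]
    have "path_hom X (path_concat (c p) d) (path_concat d (path_concat (path_concat p (path_reverse d)) d))"
      unfolding c_def by (rule path_hom_assoc) (use pp d rd in \<open>auto intro!: pathin_concat\<close>)
    also have "path_hom X \<dots> (path_concat d p)"
      by (rule path_hom_concat[OF path_hom_refl path_hom_cancel_right']) (use pp d rd in auto)
    finally have "path_hom X (c' (c p)) (path_concat (path_reverse d) (path_concat d p))"
      unfolding c'_def by (intro path_hom_concat[OF path_hom_refl]) (use d rd in \<open>auto simp: c_def\<close>)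
    also have "path_hom X \<dots> p" by (rule path_hom_cancel_left) (use pp d in auto)
    finally show ?thesis .
  qed
  have cc': "path_hom X (c (c' p)) p" if p: "p \<in> loops X y" for p
  proof -
    note pp = pl[OF p]
    have "path_hom X (path_concat (c' p) (path_reverse d)) (path_concat (path_reverse d) (path_concat (path_concat p d) (path_reverse d)))"
      unfolding c'_def by (rule path_hom_assoc) (use pp d rd in \<open>auto intro!: pathin_concat\<close>)
    also have "path_hom X \<dots> (path_concat (path_reverse d) p)"
      by (rule path_hom_concat[OF path_hom_refl path_hom_cancel_right]) (use pp d rd in auto)
    finally have "path_hom X (c (c' p)) (path_concat d (path_concat (path_reverse d) p))"
      unfolding c_def by (intro path_hom_concat[OF path_hom_refl]) (use d rd in \<open>auto simp: c'_def\<close>)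
    also have "path_hom X \<dots> p" by (rule path_hom_cancel_left') (use pp d in auto)
    finally show ?thesis .
  qed
  have cm: "path_hom X (c (path_concat p q)) (path_concat (c p) (c q))"
    if p: "p \<in> loops X x" and q: "q \<in> loops X x" for p q
  proof -
    note pp = pl[OF p] and qq = pl[OF q]
    let ?e = "path_concat q (path_reverse d)"
    have "path_hom X (path_concat (c p) (c q)) (path_concat d (path_concat (path_concat p (path_reverse d)) (c q)))"
      unfolding c_def by (rule path_hom_assoc) (use pp qq d rd in \<open>auto intro!: pathin_concat\<close>)
    also have "path_hom X \<dots> (path_concat d (path_concat p (path_concat (path_reverse d) (c q))))"
      by (rule path_hom_concat[OF path_hom_refl path_hom_assoc])
        (use pp qq d rd pl[OF cl[OF q]] in \<open>auto intro!: pathin_concat\<close>)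
    also have "path_hom X \<dots> (path_concat d (path_concat p ?e))"
      unfolding c_def by (rule path_hom_concat[OF path_hom_refl path_hom_concat[OF path_hom_refl path_hom_cancel_left]])
        (use pp qq d rd in \<open>auto intro!: pathin_concat\<close>)
    also have "path_hom X \<dots> (path_concat d (path_concat (path_concat p q) (path_reverse d)))"
      by (rule path_hom_concat[OF path_hom_refl path_hom_sym[OF path_hom_assoc]])
        (use pp qq d rd in \<open>auto intro!: pathin_concat\<close>)
    finally show ?thesis unfolding c_def[of "path_concat p q"] by (rule path_hom_sym)
  qed
  have lo: "L a \<in> loops X x" if "a \<in> carrier H" for a using L that by (auto simp: has_pi1_def)
  have "has_pi1 X y H (\<lambda>a. c (L a))"
    unfolding has_pi1_def
  proof (intro conjI ballI impI)
    fix a assume a: "a \<in> carrier H"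
    show "c (L a) \<in> loops X y" using a lo cl by blast
    fix b assume b: "b \<in> carrier H"
    have ab: "a \<otimes>\<^bsub>H\<^esub> b \<in> carrier H" using H a b by (simp add: group.is_monoid monoid.m_closed)
    have "path_hom X (L (a \<otimes>\<^bsub>H\<^esub> b)) (path_concat (L a) (L b))" using L a b by (auto simp: has_pi1_def)
    then show "path_hom X (c (L (a \<otimes>\<^bsub>H\<^esub> b))) (path_concat (c (L a)) (c (L b)))"
      by (rule path_hom_trans[OF ch[OF _ lo[OF ab]] cm[OF lo[OF a] lo[OF b]]])
    assume "path_hom X (c (L a)) (c (L b))"
    then have "path_hom X (c' (c (L a))) (c' (c (L b)))" by (rule c'h[OF _ cl[OF lo[OF a]]])
    then have "path_hom X (L a) (L b)"
      by (rule path_hom_trans[OF path_hom_trans[OF path_hom_sym[OF c'c[OF lo[OF a]]]] c'c[OF lo[OF b]]])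
    then show "a = b" using L a b by (auto simp: has_pi1_def)
  next
    fix p assume p: "p \<in> loops X y"
    then obtain a where a: "a \<in> carrier H" "path_hom X (c' p) (L a)" using L c'l[OF p] unfolding has_pi1_def by blast
    have "path_hom X p (c (L a))"
      by (rule path_hom_trans[OF path_hom_sym[OF cc'[OF p]] ch[OF a(2) c'l[OF p]]])
    then show "\<exists>a\<in>carrier H. path_hom X p (c (L a))"
      by (rule bexI[OF _ a(1)])
  qed
  then show ?thesis by (simp add: c_def)
qed

section \<open>Coverings\<close>

lemma covering_map_sheet:
  assumes "covering_map E X p" "x \<in> topspace X"
  obtains T \<V> where "x \<in> T" "openin X T" "\<Union>\<V> = {e \<in> topspace E. p e \<in> T}"
    "\<forall>V\<in>\<V>. openin E V" "pairwise disjnt \<V>"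
    "\<forall>V\<in>\<V>. homeomorphic_map (subtopology E V) (subtopology X T) p"
proof -
  note c = assms(1)[unfolded covering_map_def, THEN conjunct2, THEN conjunct2, rule_format, OF assms(2)]
  show ?thesis
    using c by (elim exE conjE) (rule that; assumption)
qed

lemma connected_space_top_of_set: "connected S \<Longrightarrow> connected_space (top_of_set S)"
  using connectedin_iff_connected[of S] unfolding connectedin_def by blast

text \<open>The sets where the lifts agree and where they differ are both open: in a common sheet
  \<open>p\<close> is injective, so equal images force equal values nearby, while different sheets
  are disjoint, so the lifts differ nearby. Connectedness leaves one of the two sets empty.\<close>

lemma covering_unique_lift:
  assumes p: "covering_map E X p" and f: "continuous_map Z E f" and g: "continuous_map Z E g"
    and Z: "connected_space Z" and eq: "\<And>z. z \<in> topspace Z \<Longrightarrow> p (f z) = p (g z)"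
    and z0: "z0 \<in> topspace Z" "f z0 = g z0" and z: "z \<in> topspace Z"
  shows "f z = g z"
proof -
  let ?A = "{z \<in> topspace Z. f z = g z}" and ?B = "{z \<in> topspace Z. f z \<noteq> g z}"
  have *: "\<exists>U. openin Z U \<and> z \<in> U \<and> (if f z = g z then U \<subseteq> ?A else U \<subseteq> ?B)" if z: "z \<in> topspace Z" for z
  proof -
    have fz: "f z \<in> topspace E" "g z \<in> topspace E"
      using f g z by (auto simp: continuous_map_def)
    then have "p (f z) \<in> topspace X" using p by (auto simp: covering_map_def)
    then obtain T \<V> where T: "p (f z) \<in> T" "openin X T" "\<Union>\<V> = {e \<in> topspace E. p e \<in> T}"
      "\<forall>V\<in>\<V>. openin E V" "pairwise disjnt \<V>"
      "\<forall>V\<in>\<V>. homeomorphic_map (subtopology E V) (subtopology X T) p"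
      by (rule covering_map_sheet[OF p]) (rule that; assumption)
    obtain V where V: "V \<in> \<V>" "f z \<in> V" using T(1,3) fz by blast
    obtain V' where V': "V' \<in> \<V>" "g z \<in> V'" using T(1,3) fz eq[OF z] by (metis (mono_tags, lifting) UnionE mem_Collect_eq)
    let ?U = "{z \<in> topspace Z. f z \<in> V} \<inter> {z \<in> topspace Z. g z \<in> V'}"
    have U: "openin Z ?U" "z \<in> ?U"
      using V V' z T(4) f g by (auto intro!: openin_Int openin_continuous_map_preimage)
    have "inj_on p (topspace (subtopology E V))" using bspec[OF T(6) V(1)] by (rule homeomorphic_imp_injective_map)
    moreover have "topspace (subtopology E V) = V" using bspec[OF T(4) V(1)] openin_subset by fastforce
    ultimately have inj: "inj_on p V" by simp
    show ?thesis
    proof (cases "V = V'")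
      case True
      then have "f w = g w" if "w \<in> ?U" for w using that inj eq[of w] by (auto dest: inj_onD)
      then show ?thesis using U by (intro exI[of _ ?U]) auto
    next
      case False
      then have "V \<inter> V' = {}" using T(5) V V' by (auto simp: pairwise_def disjnt_def)
      then show ?thesis using U by (intro exI[of _ ?U]) auto
    qed
  qed
  have A: "openin Z ?A"
  proof (subst openin_subopen, intro ballI)
    fix z assume "z \<in> ?A"
    then show "\<exists>T. openin Z T \<and> z \<in> T \<and> T \<subseteq> ?A" using *[of z] by auto
  qed
  have B: "openin Z ?B"
  proof (subst openin_subopen, intro ballI)
    fix z assume "z \<in> ?B"
    then show "\<exists>T. openin Z T \<and> z \<in> T \<and> T \<subseteq> ?B" using *[of z] by auto
  qed
  have "?A \<union> ?B = topspace Z" "?A \<inter> ?B = {}" "?A \<noteq> {}" using z0 by auto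
  then have "?B = {}" using Z A B unfolding connected_space_def by blast
  then show ?thesis using z by blast
qed

text \<open>Lifting over rectangles: local lifts are glued along edges, where they agree by uniqueness.\<close>

definition lifts_on :: "'x topology \<Rightarrow> 'y topology \<Rightarrow> ('x \<Rightarrow> 'y) \<Rightarrow> (real \<times> real \<Rightarrow> 'y) \<Rightarrow> (real \<times> real) set \<Rightarrow> bool" where
  "lifts_on E X p h S \<longleftrightarrow> (\<forall>z\<in>S. \<forall>e\<in>topspace E. p e = h z \<longrightarrow>
     (\<exists>k. continuous_map (top_of_set S) E k \<and> (\<forall>w\<in>S. p (k w) = h w) \<and> k z = e))"

text \<open>Over an evenly covered set \<open>T\<close> the lift is \<open>h\<close> followed by the
  inverse of \<open>p\<close> on the sheet through \<open>e\<close>.\<close>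

lemma lifts_on_subset_sheet:
  assumes p: "covering_map E X p" and h: "continuous_map (top_of_set S) X h"
    and x: "x \<in> topspace X"
  shows "\<exists>T. openin X T \<and> x \<in> T \<and> (\<forall>S'. S' \<subseteq> S \<longrightarrow> h ` S' \<subseteq> T \<longrightarrow> lifts_on E X p h S')"
proof -
  obtain T \<V> where T: "x \<in> T" "openin X T" and un: "\<Union>\<V> = {e \<in> topspace E. p e \<in> T}"
    and op: "\<forall>V\<in>\<V>. openin E V" "pairwise disjnt \<V>"
    and hom: "\<forall>V\<in>\<V>. homeomorphic_map (subtopology E V) (subtopology X T) p"
    by (rule covering_map_sheet[OF p x]) (rule that; assumption)
  have "lifts_on E X p h S'" if S': "S' \<subseteq> S" "h ` S' \<subseteq> T" for S'
    unfolding lifts_on_def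
  proof (intro ballI impI)
    fix z e assume z: "z \<in> S'" and e: "e \<in> topspace E" "p e = h z"
    then have "e \<in> \<Union>\<V>" using un S' by auto
    then obtain V where V: "V \<in> \<V>" "e \<in> V" by blast
    obtain q where q: "homeomorphic_maps (subtopology E V) (subtopology X T) p q"
      using bspec[OF hom V(1)] homeomorphic_map_maps by blast
    have tV: "topspace (subtopology E V) = V" using bspec[OF op(1) V(1)] openin_subset by fastforce
    have tT: "topspace (subtopology X T) = T" using T(2) openin_subset by fastforce
    have hS: "continuous_map (top_of_set S') (subtopology X T) h"
      using continuous_map_from_subtopology_mono[OF h S'(1)] S'(2)
      by (simp add: continuous_map_in_subtopology image_subset_iff_funcset)
    have "continuous_map (subtopology X T) E q"
      using q by (auto simp: homeomorphic_maps_def continuous_map_in_subtopology)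
    then have 1: "continuous_map (top_of_set S') E (q \<circ> h)" using hS continuous_map_compose by blast
    have 2: "p (q (h w)) = h w" if "w \<in> S'" for w
      using q that S'(2) tT by (auto simp: homeomorphic_maps_def)
    have 3: "q (h z) = e" using q V(2) tV by (auto simp: homeomorphic_maps_def simp flip: e(2))
    show "\<exists>k. continuous_map (top_of_set S') E k \<and> (\<forall>w\<in>S'. p (k w) = h w) \<and> k z = e"
      by (rule exI[of _ "q \<circ> h"]) (use 1 2 3 in auto)
  qed
  then show ?thesis using T by blast
qed

text \<open>A lift over the piece that contains the start point prescribes a value over the other
  piece at a common point, and connectedness of the overlap makes the two lifts agree on all of it.
  The auxiliary claim fixes which piece contains the start point and is then used both ways
  round.\<close>

lemma lifts_on_Un:
  assumes p: "covering_map E X p" and 1: "lifts_on E X p h S" and 2: "lifts_on E X p h T"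
    and clo: "closedin (top_of_set (S \<union> T)) S" "closedin (top_of_set (S \<union> T)) T"
    and con: "connected (S \<inter> T)" "S \<inter> T \<noteq> {}"
  shows "lifts_on E X p h (S \<union> T)"
proof -
  have *: "\<exists>k. continuous_map (top_of_set (A \<union> B)) E k \<and> (\<forall>w\<in>A \<union> B. p (k w) = h w) \<and> k z = e"
    if A: "lifts_on E X p h A" and B: "lifts_on E X p h B" and z: "z \<in> A" "e \<in> topspace E" "p e = h z"
      and clo: "closedin (top_of_set (A \<union> B)) A" "closedin (top_of_set (A \<union> B)) B"
      and con: "connected (A \<inter> B)" "A \<inter> B \<noteq> {}" for A B z e
  proof -
    obtain k where k: "continuous_map (top_of_set A) E k" "\<And>w. w \<in> A \<Longrightarrow> p (k w) = h w" "k z = e"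
      using A z unfolding lifts_on_def by meson
    obtain m where m: "m \<in> A" "m \<in> B" using con by blast
    have "k m \<in> topspace E" using k(1) m by (auto simp: continuous_map_def)
    then obtain l where l: "continuous_map (top_of_set B) E l" "\<And>w. w \<in> B \<Longrightarrow> p (l w) = h w" "l m = k m"
      using B m k(2) unfolding lifts_on_def by meson
    have eq: "k w = l w" if "w \<in> A \<inter> B" for w
    proof (rule covering_unique_lift[OF p, where f = k and g = l and z = w and ?z0.0 = m])
      show "continuous_map (top_of_set (A \<inter> B)) E k" "continuous_map (top_of_set (A \<inter> B)) E l"
        using k(1) l(1) continuous_map_from_subtopology_mono by blast+
      show "connected_space (top_of_set (A \<inter> B))" by (rule connected_space_top_of_set[OF con(1)])
    qed (use that m k l in auto)
    let ?g = "\<lambda>w. if w \<in> A then k w else l w"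
    have "continuous_map (top_of_set (A \<union> B)) E ?g"
    proof (rule pasting_lemma_closed[where I = "{True, False}" and T = "\<lambda>b. if b then A else B" and f = "\<lambda>b. if b then k else l"])
      fix i :: bool assume "i \<in> {True, False}"
      show "continuous_map (subtopology (top_of_set (A \<union> B)) (if i then A else B)) E (if i then k else l)"
        using k(1) l(1) by (auto simp: subtopology_subtopology Int_absorb1)
    qed (use clo eq in \<open>auto split: if_splits\<close>)
    then show ?thesis
      by (intro exI[of _ ?g]) (use k l z in auto)
  qed
  show ?thesis
    unfolding lifts_on_def
  proof (intro ballI impI)
    fix z e assume "z \<in> S \<union> T" "e \<in> topspace E" "p e = h z"
    then show "\<exists>k. continuous_map (top_of_set (S \<union> T)) E k \<and> (\<forall>w\<in>S \<union> T. p (k w) = h w) \<and> k z = e"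
      using *[OF 1 2, of z e] *[OF 2 1, of z e] clo con by (auto simp: Un_commute Int_commute)
  qed
qed

text \<open>Bisection takes the place of a Lebesgue number: small rectangles lift, and rectangles
  are glued along common edges, in the second coordinate to a thin strip of full height and then in
  the first coordinate to the square.\<close>

lemma lifts_on_square:
  fixes h :: "real \<times> real \<Rightarrow> 'y"
  assumes p: "covering_map E X p" and h: "continuous_map (top_of_set ({0..1} \<times> {0..1})) X h"
  shows "lifts_on E X p h ({0..1} \<times> {0..1})"
proof -
  let ?Q = "{0..1::real} \<times> {0..1::real}"
  have glue1: "lifts_on E X p h ({a..b} \<times> {c..e})"
    if "lifts_on E X p h ({a..b} \<times> {c..d})" "lifts_on E X p h ({a..b} \<times> {d..e})" "a \<le> b" "c \<le> d" "d \<le> e"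
    for a b c d e :: real
  proof -
    have eq: "{a..b} \<times> {c..e} = {a..b} \<times> {c..d} \<union> {a..b} \<times> {d..e}" using that by auto
    have int: "{a..b} \<times> {c..d} \<inter> {a..b} \<times> {d..e} = {a..b} \<times> {d}" using that by auto
    have "connected ({a..b} \<times> {c..d} \<inter> {a..b} \<times> {d..e})" "{a..b} \<times> {c..d} \<inter> {a..b} \<times> {d..e} \<noteq> {}"
      unfolding int using that by (auto intro!: connected_Times)
    then show ?thesis unfolding eq
      by (intro lifts_on_Un[OF p that(1,2)]) (auto intro!: closed_subset closed_Times)
  qed
  have glue2: "lifts_on E X p h ({a..c} \<times> {d..e})"
    if "lifts_on E X p h ({a..b} \<times> {d..e})" "lifts_on E X p h ({b..c} \<times> {d..e})" "a \<le> b" "b \<le> c" "d \<le> e"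
    for a b c d e :: real
  proof -
    have eq: "{a..c} \<times> {d..e} = {a..b} \<times> {d..e} \<union> {b..c} \<times> {d..e}" using that by auto
    have int: "{a..b} \<times> {d..e} \<inter> {b..c} \<times> {d..e} = {b} \<times> {d..e}" using that by auto
    have "connected ({a..b} \<times> {d..e} \<inter> {b..c} \<times> {d..e})" "{a..b} \<times> {d..e} \<inter> {b..c} \<times> {d..e} \<noteq> {}"
      unfolding int using that by (auto intro!: connected_Times)
    then show ?thesis unfolding eq
      by (intro lifts_on_Un[OF p that(1,2)]) (auto intro!: closed_subset closed_Times)
  qed
  have loc: "\<exists>d>0. \<forall>a b a' b'. a \<le> s \<and> s \<le> b \<and> b - a < d \<and> a' \<le> t \<and> t \<le> b' \<and> b' - a' < d \<and>
      0 \<le> a \<and> b \<le> 1 \<and> 0 \<le> a' \<and> b' \<le> 1 \<longrightarrow> lifts_on E X p h ({a..b} \<times> {a'..b'})"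
    if st: "(s, t) \<in> ?Q" for s t
  proof -
    have "h (s, t) \<in> topspace X" using h st by (auto simp: continuous_map_def)
    from lifts_on_subset_sheet[OF p h this] obtain T where T: "openin X T" "h (s, t) \<in> T"
      and T3: "\<forall>S'. S' \<subseteq> ?Q \<longrightarrow> h ` S' \<subseteq> T \<longrightarrow> lifts_on E X p h S'"
      by (elim exE conjE)
    note T = T T3[rule_format]
    have "openin (top_of_set ?Q) {z \<in> topspace (top_of_set ?Q). h z \<in> T}"
      using h T(1) by (rule openin_continuous_map_preimage)
    then obtain e where e: "e > 0" "\<And>z. z \<in> ?Q \<Longrightarrow> dist z (s, t) < e \<Longrightarrow> h z \<in> T"
      using st T(2) unfolding openin_euclidean_subtopology_iff topspace_euclidean_subtopology
        by (metis (no_types, lifting) mem_Collect_eq)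
    \<comment> \<open>Half of \<open>e\<close>, because the distance to \<open>(s, t)\<close> is
      bounded by the sum of the two side lengths.\<close>
    show ?thesis
    proof (intro exI[of _ "e/2"] conjI allI impI)
      fix a b a' b'
      assume *: "a \<le> s \<and> s \<le> b \<and> b - a < e/2 \<and> a' \<le> t \<and> t \<le> b' \<and> b' - a' < e/2 \<and>
        0 \<le> a \<and> b \<le> 1 \<and> 0 \<le> a' \<and> b' \<le> 1"
      show "lifts_on E X p h ({a..b} \<times> {a'..b'})"
      proof (rule T(3))
        show "h ` ({a..b} \<times> {a'..b'}) \<subseteq> T"
        proof clarify
          fix x y assume xy: "x \<in> {a..b}" "y \<in> {a'..b'}"
          have "dist (x, y) (s, t) \<le> dist x s + dist y t"
            unfolding dist_Pair_Pair by (rule sqrt_sum_squares_le_sum) auto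
          also have "\<dots> < e" using xy * by (auto simp: dist_real_def)
          finally show "h (x, y) \<in> T" using e(2)[of "(x, y)"] xy * by auto
        qed
      qed (use * in auto)
    qed (use e in auto)
  qed
  have strip: "\<exists>d>0. \<forall>a b. a \<le> s \<and> s \<le> b \<and> b - a < d \<and> 0 \<le> a \<and> b \<le> 1 \<longrightarrow> lifts_on E X p h ({a..b} \<times> {0..1})"
    if s: "s \<in> {0..1}" for s
  proof -
    \<comment> \<open>The width \<open>d\<close> of the strip may shrink at each gluing, so it is
      quantified inside the bisected property.\<close>
    let ?P = "\<lambda>a' b'. 0 \<le> a' \<and> b' \<le> 1 \<longrightarrow> (\<exists>d>0. \<forall>a b. a \<le> s \<and> s \<le> b \<and> b - a < d \<and> 0 \<le> a \<and> b \<le> 1 \<longrightarrow> lifts_on E X p h ({a..b} \<times> {a'..b'}))"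
    have "(0::real) \<le> 1" by simp
    then have "?P 0 1"
    proof (rule Bolzano[where P = ?P])
      fix a' b' c' :: real assume trans: "?P a' b'" "?P b' c'" "a' \<le> b'" "b' \<le> c'"
      show "?P a' c'"
      proof
        assume *: "0 \<le> a' \<and> c' \<le> 1"
        then have 1: "0 \<le> a' \<and> b' \<le> 1" and 2: "0 \<le> b' \<and> c' \<le> 1" using trans(3,4) by auto
        from mp[OF trans(1) 1] obtain d1 where d1: "d1 > 0"
          "\<forall>a b. a \<le> s \<and> s \<le> b \<and> b - a < d1 \<and> 0 \<le> a \<and> b \<le> 1 \<longrightarrow> lifts_on E X p h ({a..b} \<times> {a'..b'})"
          by (elim exE conjE)
        from mp[OF trans(2) 2] obtain d2 where d2: "d2 > 0"
          "\<forall>a b. a \<le> s \<and> s \<le> b \<and> b - a < d2 \<and> 0 \<le> a \<and> b \<le> 1 \<longrightarrow> lifts_on E X p h ({a..b} \<times> {b'..c'})"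
          by (elim exE conjE)
        show "\<exists>d>0. \<forall>a b. a \<le> s \<and> s \<le> b \<and> b - a < d \<and> 0 \<le> a \<and> b \<le> 1 \<longrightarrow> lifts_on E X p h ({a..b} \<times> {a'..c'})"
        proof (intro exI[of _ "min d1 d2"] conjI allI impI)
          fix a b assume "a \<le> s \<and> s \<le> b \<and> b - a < min d1 d2 \<and> 0 \<le> a \<and> b \<le> 1"
          then show "lifts_on E X p h ({a..b} \<times> {a'..c'})"
            using glue1[of a b a' b' c'] d1 d2 trans(3,4) by auto
        qed (use d1 d2 in auto)
      qed
    next
      fix t :: real assume "0 \<le> t" "t \<le> 1"
      then have "(s, t) \<in> ?Q" using s by auto
      from loc[OF this] obtain d where d: "d > 0" "\<forall>a b a' b'. a \<le> s \<and> s \<le> b \<and> b - a < d \<and> a' \<le> t \<and> t \<le> b' \<and> b' - a' < d \<and>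
      0 \<le> a \<and> b \<le> 1 \<and> 0 \<le> a' \<and> b' \<le> 1 \<longrightarrow> lifts_on E X p h ({a..b} \<times> {a'..b'})" by (elim exE conjE)
      show "\<exists>d>0. \<forall>a b. a \<le> t \<and> t \<le> b \<and> b - a < d \<longrightarrow> ?P a b"
        by (intro exI[of _ d] conjI allI impI) (use d in auto)
    qed
    then show ?thesis by simp
  qed
  let ?P = "\<lambda>a b. 0 \<le> a \<and> b \<le> 1 \<longrightarrow> lifts_on E X p h ({a..b} \<times> {0..1})"
  have "(0::real) \<le> 1" by simp
  then have "?P 0 1"
  proof (rule Bolzano[where P = ?P])
    fix a b c :: real assume "?P a b" "?P b c" "a \<le> b" "b \<le> c"
    then show "?P a c" using glue2[of a b 0 1 c] by auto
  next
    fix s :: real assume "0 \<le> s" "s \<le> 1"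
    then obtain d where "d > 0" "\<And>a b. a \<le> s \<and> s \<le> b \<and> b - a < d \<and> 0 \<le> a \<and> b \<le> 1 \<Longrightarrow> lifts_on E X p h ({a..b} \<times> {0..1})"
      using strip[of s] by auto
    then show "\<exists>d>0. \<forall>a b. a \<le> s \<and> s \<le> b \<and> b - a < d \<longrightarrow> ?P a b"
      by (intro exI[of _ d]) auto
  qed
  then show ?thesis by simp
qed

text \<open>The homotopy is lifted to a map \<open>k\<close> on the square, with the homotopy
  parameter as first coordinate. By uniqueness of lifts its sides at 0 and 1 are \<open>a\<close>
  and \<open>b\<close>; the two sides traced by the endpoints cover constant paths and are therefore
  constant.\<close>

theorem covering_monodromy:
  assumes p: "covering_map E X p" and a: "pathin E a" and b: "pathin E b" and ab: "a 0 = b 0"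
    and hom: "path_hom X (p \<circ> a) (p \<circ> b)"
  shows "a 1 = b 1"
proof -
  let ?Q = "{0..1::real} \<times> {0..1::real}"
  obtain h :: "real \<times> real \<Rightarrow> 'b" where h: "continuous_map (top_of_set ?Q) X h"
    "\<And>x. h (0, x) = p (a x)" "\<And>x. h (1, x) = p (b x)"
    "\<And>t. t \<in> {0..1} \<Longrightarrow> h (t, 0) = p (a 0)" "\<And>t. t \<in> {0..1} \<Longrightarrow> h (t, 1) = p (a 1)"
    by (rule path_homD[OF hom[unfolded o_def]]) (rule that; assumption)
  have aE: "a 0 \<in> topspace E" using a path_start_in_topspace by blast
  obtain k where k: "continuous_map (top_of_set ?Q) E k" "\<And>w. w \<in> ?Q \<Longrightarrow> p (k w) = h w" "k (0, 0) = a 0"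
  proof -
    have "(0, 0) \<in> ?Q" "p (a 0) = h (0, 0)" using h(2) by auto
    with lifts_on_square[OF p h(1)] aE show ?thesis
      unfolding lifts_on_def using that by blast
  qed
  have con: "connected_space (top_of_set {0..1::real})" by (rule connected_space_top_of_set) simp
  have line: "continuous_map (top_of_set {0..1::real}) E (\<lambda>t. k (f t))"
    if "continuous_on {0..1::real} f" "f ` {0..1} \<subseteq> ?Q" for f
    using continuous_map_compose[OF _ k(1), of "top_of_set {0..1::real}" f] that
    by (auto simp: continuous_map_in_subtopology o_def)
  have 1: "k (0, t) = a t" if "t \<in> {0..1}" for t
    by (rule covering_unique_lift[OF p line[of "\<lambda>t. (0, t)"] a[unfolded pathin_def] con, of 0 t])
      (use that k h in \<open>auto intro!: continuous_intros\<close>)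
  have 2: "k (t, 0) = a 0" if "t \<in> {0..1}" for t
    by (rule covering_unique_lift[OF p line[of "\<lambda>t. (t, 0)"] _ con, of "\<lambda>_. a 0" 0 t])
      (use that k h aE in \<open>auto intro!: continuous_intros\<close>)
  have 3: "k (1, t) = b t" if "t \<in> {0..1}" for t
    by (rule covering_unique_lift[OF p line[of "\<lambda>t. (1, t)"] b[unfolded pathin_def] con, of 0 t])
      (use that k h 2[of 1] ab in \<open>auto intro!: continuous_intros\<close>)
  have a1: "a 1 \<in> topspace E" using a path_finish_in_topspace by blast
  have 4: "k (t, 1) = a 1" if "t \<in> {0..1}" for t
    by (rule covering_unique_lift[OF p line[of "\<lambda>t. (t, 1)"] _ con, of "\<lambda>_. a 1" 0 t])
      (use that k h 1[of 1] a1 in \<open>auto intro!: continuous_intros\<close>)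
  show ?thesis using 3[of 1] 4[of 1] by simp
qed

text \<open>Evenly covered sets are moved along by \<open>f\<close>; the sheets above them stay the
  same.\<close>

lemma covering_map_homeomorphic_compose:
  assumes p: "covering_map E X p" and f: "homeomorphic_map X Y f"
  shows "covering_map E Y (f \<circ> p)"
proof -
  obtain g where g: "homeomorphic_maps X Y f g" using f homeomorphic_map_maps by blast
  have cf: "continuous_map X Y f" and cg: "continuous_map Y X g"
    and gf: "\<And>x. x \<in> topspace X \<Longrightarrow> g (f x) = x" and fg: "\<And>y. y \<in> topspace Y \<Longrightarrow> f (g y) = y"
    using g by (auto simp: homeomorphic_maps_def)
  have pE: "p ` topspace E = topspace X" and pc: "continuous_map E X p" using p by (auto simp: covering_map_def)
  have fX: "f ` topspace X = topspace Y" using f by (simp add: homeomorphic_imp_surjective_map)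
  have sheet: "\<exists>T. y \<in> T \<and> openin Y T \<and> (\<exists>\<V>. \<Union>\<V> = {e \<in> topspace E. (f \<circ> p) e \<in> T} \<and>
        (\<forall>V\<in>\<V>. openin E V) \<and> pairwise disjnt \<V> \<and>
        (\<forall>V\<in>\<V>. homeomorphic_map (subtopology E V) (subtopology Y T) (f \<circ> p)))" if y: "y \<in> topspace Y" for y
  proof -
    have "g y \<in> topspace X" using cg y by (auto simp: continuous_map_def)
    then obtain T \<V> where T: "g y \<in> T" "openin X T" and un: "\<Union>\<V> = {e \<in> topspace E. p e \<in> T}"
      and op: "\<forall>V\<in>\<V>. openin E V" "pairwise disjnt \<V>"
      and hom: "\<forall>V\<in>\<V>. homeomorphic_map (subtopology E V) (subtopology X T) p"
      by (rule covering_map_sheet[OF p]) (rule that; assumption)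
    have TX: "T \<subseteq> topspace X" using T openin_subset by blast
    have 1: "y \<in> f ` T" using T(1) fg[OF y] by force
    have 2: "openin Y (f ` T)" using f T(2) TX homeomorphic_map_openness by blast
    have 3: "\<Union>\<V> = {e \<in> topspace E. (f \<circ> p) e \<in> f ` T}"
    proof -
      have "f x \<in> f ` T \<longleftrightarrow> x \<in> T" if "x \<in> topspace X" for x
        using that gf TX by (metis imageE image_eqI subsetD)
      then show ?thesis unfolding un using pE by auto
    qed
    have 4: "homeomorphic_map (subtopology E V) (subtopology Y (f ` T)) (f \<circ> p)" if "V \<in> \<V>" for V
      by (rule homeomorphic_map_compose[OF bspec[OF hom that]], rule homeomorphic_map_subtopologies[OF f])
        (use TX fX in auto)
    show ?thesis using 1 2 3 4 op by (intro exI[of _ "f ` T"] conjI exI[of _ \<V>]) auto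
  qed
  show ?thesis
    unfolding covering_map_def
  proof (intro conjI ballI)
    show "continuous_map E Y (f \<circ> p)" using pc cf continuous_map_compose by blast
    show "(f \<circ> p) ` topspace E = topspace Y" unfolding image_comp[symmetric] pE fX ..
  qed (rule sheet)
qed

section \<open>Words and presented groups\<close>

definition lword :: "('g, 'b) monoid_scheme \<Rightarrow> ('v \<Rightarrow> 'g) \<Rightarrow> 'v list \<Rightarrow> 'g" where
  "lword G f vs = foldr (\<lambda>v x. f v \<otimes>\<^bsub>G\<^esub> x) vs \<one>\<^bsub>G\<^esub>"

context group
begin

lemma lword_Nil [simp]: "lword G f [] = \<one>"
  by (simp add: lword_def)

lemma lword_Cons [simp]: "lword G f (v # vs) = f v \<otimes> lword G f vs"
  by (simp add: lword_def)

lemma lword_closed [simp]: "f ` set vs \<subseteq> carrier G \<Longrightarrow> lword G f vs \<in> carrier G"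
  by (induction vs) auto

lemma lword_append:
  "f ` set us \<subseteq> carrier G \<Longrightarrow> f ` set vs \<subseteq> carrier G \<Longrightarrow> lword G f (us @ vs) = lword G f us \<otimes> lword G f vs"
  by (induction us) (auto simp: m_assoc)

end

lemma lword_hom:
  assumes "group G" "group H" "h \<in> hom G H" "f ` set vs \<subseteq> carrier G"
  shows "h (lword G f vs) = lword H (h \<circ> f) vs"
proof -
  interpret group_hom G H h using assms by (simp add: group_hom_def group_hom_axioms_def)
  show ?thesis using assms(4) by (induction vs) auto
qed

lemma word_eq_lists:
  "word_eq S R v w \<Longrightarrow> v \<in> lists (S \<times> UNIV) \<and> w \<in> lists (S \<times> UNIV)"
  by (induction rule: word_eq.induct) auto

text \<open>The elementary moves already act in the middle of a word, so the surrounding letters can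
  be enlarged. This is what makes multiplication of classes well defined.\<close>

lemma word_eq_context:
  assumes "word_eq S R v w" and "a \<in> lists (S \<times> UNIV)" "b \<in> lists (S \<times> UNIV)"
  shows "word_eq S R (a @ v @ b) (a @ w @ b)"
  using assms(1)
proof (induction rule: word_eq.induct)
  case (refl w)
  then show ?case using assms by (intro word_eq.refl) auto
next
  case (sym v w)
  then show ?case by (metis word_eq.sym)
next
  case (trans u v w)
  then show ?case by (metis word_eq.trans)
next
  case (cancel u v c e)
  then show ?case using assms word_eq.cancel[of "a @ u" S "v @ b" c R e] by simp
next
  case (relator u v r)
  then show ?case using assms word_eq.relator[of "a @ u" S "v @ b" r R] by simp
qed

definition inverse_word :: "'g word \<Rightarrow> 'g word" where
  "inverse_word w = rev (map (\<lambda>(a, e). (a, \<not> e)) w)"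

lemma inverse_word_lists: "w \<in> lists (S \<times> UNIV) \<Longrightarrow> inverse_word w \<in> lists (S \<times> UNIV)"
  by (auto simp: inverse_word_def)

lemma word_eq_inverse:
  "w \<in> lists (S \<times> UNIV) \<Longrightarrow> word_eq S R (inverse_word w @ w) []"
proof (induction w)
  case Nil
  then show ?case by (simp add: inverse_word_def word_eq.refl)
next
  case (Cons x w)
  obtain a e where x: "x = (a, e)" by (cases x)
  have l: "inverse_word w \<in> lists (S \<times> UNIV)" "w \<in> lists (S \<times> UNIV)" "a \<in> S"
    using Cons.prems inverse_word_lists x by auto
  have "word_eq S R (inverse_word w @ [(a, \<not> e), (a, \<not> \<not> e)] @ w) (inverse_word w @ w)"
    by (rule word_eq.cancel[OF l])
  then show ?case using Cons.IH[OF l(2)] by (auto simp: inverse_word_def x intro: word_eq.trans)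
qed

definition word_class :: "'g set \<Rightarrow> 'g word set \<Rightarrow> 'g word \<Rightarrow> 'g word set" where
  "word_class S R w = {v. word_eq S R w v}"

lemma word_class_eq_iff:
  assumes "v \<in> lists (S \<times> UNIV)" "w \<in> lists (S \<times> UNIV)"
  shows "word_class S R v = word_class S R w \<longleftrightarrow> word_eq S R v w"
proof
  assume "word_class S R v = word_class S R w"
  moreover have "w \<in> word_class S R w" using assms by (simp add: word_class_def word_eq.refl)
  ultimately have "w \<in> word_class S R v" by simp
  then show "word_eq S R v w" by (simp add: word_class_def)
next
  assume vw: "word_eq S R v w"
  show "word_class S R v = word_class S R w"
    unfolding word_class_def using word_eq.trans[OF vw] word_eq.trans[OF word_eq.sym[OF vw]] by blast
qed

lemma carrier_presented_group:
  "carrier (presented_group S R) = word_class S R ` lists (S \<times> UNIV)"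
  by (auto simp: presented_group_def quotient_def word_class_def Image_def)

lemma mult_presented_group:
  assumes "v \<in> lists (S \<times> UNIV)" "w \<in> lists (S \<times> UNIV)"
  shows "word_class S R v \<otimes>\<^bsub>presented_group S R\<^esub> word_class S R w = word_class S R (v @ w)"
proof -
  have "word_eq S R (v @ w) z" if "word_eq S R v a" "word_eq S R w b" "word_eq S R (a @ b) z" for a b z
  proof -
    have "word_eq S R (v @ w) (a @ w)"
      using word_eq_context[OF that(1), of "[]" w] assms by simp
    moreover have "word_eq S R (a @ w) (a @ b)"
      using word_eq_context[OF that(2), of a "[]"] word_eq_lists[OF that(1)] by simp
    ultimately show ?thesis using that(3) word_eq.trans by metis
  qed
  moreover have "word_eq S R v v" "word_eq S R w w" using assms word_eq.refl by auto
  ultimately show ?thesis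
    unfolding presented_group_def word_class_def monoid.simps by blast
qed

lemma one_presented_group: "\<one>\<^bsub>presented_group S R\<^esub> = word_class S R []"
  by (simp add: presented_group_def word_class_def)

lemma group_presented_group: "group (presented_group S R)"
proof (rule groupI)
  fix x y assume "x \<in> carrier (presented_group S R)" "y \<in> carrier (presented_group S R)"
  then obtain u v where uv: "u \<in> lists (S \<times> UNIV)" "v \<in> lists (S \<times> UNIV)"
    "x = word_class S R u" "y = word_class S R v" by (auto simp: carrier_presented_group)
  then have "u @ v \<in> lists (S \<times> UNIV)" by auto
  then show "x \<otimes>\<^bsub>presented_group S R\<^esub> y \<in> carrier (presented_group S R)"
    unfolding uv(3,4) mult_presented_group[OF uv(1,2)] carrier_presented_group by blast
next
  show "\<one>\<^bsub>presented_group S R\<^esub> \<in> carrier (presented_group S R)"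
    by (auto simp: carrier_presented_group one_presented_group)
next
  fix x y z assume "x \<in> carrier (presented_group S R)" "y \<in> carrier (presented_group S R)" "z \<in> carrier (presented_group S R)"
  then obtain u v w where *: "u \<in> lists (S \<times> UNIV)" "v \<in> lists (S \<times> UNIV)" "w \<in> lists (S \<times> UNIV)"
    "x = word_class S R u" "y = word_class S R v" "z = word_class S R w"
    by (auto simp: carrier_presented_group)
  moreover have "u @ v \<in> lists (S \<times> UNIV)" "v @ w \<in> lists (S \<times> UNIV)" using * by auto
  ultimately show "x \<otimes>\<^bsub>presented_group S R\<^esub> y \<otimes>\<^bsub>presented_group S R\<^esub> z =
      x \<otimes>\<^bsub>presented_group S R\<^esub> (y \<otimes>\<^bsub>presented_group S R\<^esub> z)"
    by (simp add: mult_presented_group del: append_in_lists_conv)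
next
  fix x assume "x \<in> carrier (presented_group S R)"
  then obtain w where w: "w \<in> lists (S \<times> UNIV)" "x = word_class S R w"
    by (auto simp: carrier_presented_group)
  have n: "[] \<in> lists (S \<times> UNIV)" by simp
  show "\<one>\<^bsub>presented_group S R\<^esub> \<otimes>\<^bsub>presented_group S R\<^esub> x = x"
    using mult_presented_group[OF n w(1), of R] by (simp add: w one_presented_group)
  have i: "inverse_word w \<in> lists (S \<times> UNIV)" using w inverse_word_lists by blast
  have iw: "inverse_word w @ w \<in> lists (S \<times> UNIV)" using w(1) i by auto
  show "\<exists>y\<in>carrier (presented_group S R). y \<otimes>\<^bsub>presented_group S R\<^esub> x = \<one>\<^bsub>presented_group S R\<^esub>"
  proof
    show "word_class S R (inverse_word w) \<otimes>\<^bsub>presented_group S R\<^esub> x = \<one>\<^bsub>presented_group S R\<^esub>"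
      using word_eq_inverse[OF w(1), of R]
      by (simp only: w(2) mult_presented_group[OF i w(1)] one_presented_group word_class_eq_iff[OF iw n])
    show "word_class S R (inverse_word w) \<in> carrier (presented_group S R)"
      using i by (simp add: carrier_presented_group)
  qed
qed

lemma presented_gen_eq: "presented_gen S R a = word_class S R [(a, True)]"
  by (simp add: presented_gen_def word_class_def)

lemma presented_gen_closed: "a \<in> S \<Longrightarrow> presented_gen S R a \<in> carrier (presented_group S R)"
  by (auto simp: presented_gen_eq carrier_presented_group)

lemma lword_presented_gen:
  assumes "vs \<in> lists S"
  shows "lword (presented_group S R) (presented_gen S R) vs = word_class S R (map (\<lambda>v. (v, True)) vs)"
  using assms
proof (induction vs)
  case Nil
  then show ?case by (simp add: lword_def one_presented_group)
next
  case (Cons v vs)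
  then have *: "[(v, True)] \<in> lists (S \<times> UNIV)" "map (\<lambda>v. (v, True)) vs \<in> lists (S \<times> UNIV)" "vs \<in> lists S" by auto
  have "lword (presented_group S R) (presented_gen S R) (v # vs) =
    presented_gen S R v \<otimes>\<^bsub>presented_group S R\<^esub> lword (presented_group S R) (presented_gen S R) vs"
    by (simp add: lword_def)
  then show ?case
    using Cons.IH mult_presented_group[OF *(1,2), of R] by (simp add: presented_gen_eq[symmetric])
qed

definition signed_word :: "('h, 'b) monoid_scheme \<Rightarrow> ('g \<Rightarrow> 'h) \<Rightarrow> 'g word \<Rightarrow> 'h" where
  "signed_word G f w = lword G (\<lambda>(a, e). if e then f a else inv\<^bsub>G\<^esub> f a) w"

text \<open>Von Dyck's theorem. Relators are tested only when they are words over \<open>S\<close>,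
  matching the side condition under which \<open>word_eq\<close> uses them. The homomorphism is
  taken extensional so that uniqueness can later be stated as an equation between functions.\<close>

lemma presented_group_universal:
  fixes G (structure)
  assumes G: "group G" and f: "f ` S \<subseteq> carrier G"
    and R: "\<And>r. r \<in> R \<Longrightarrow> r \<in> lists (S \<times> UNIV) \<Longrightarrow> signed_word G f r = \<one>\<^bsub>G\<^esub>"
  obtains h where "h \<in> hom (presented_group S R) G" "h \<in> extensional (carrier (presented_group S R))"
    "\<And>a. a \<in> S \<Longrightarrow> h (presented_gen S R a) = f a"
proof -
  interpret group G by fact
  let ?f = "\<lambda>(a, e). if e then f a else inv f a"
  have cl: "?f ` set w \<subseteq> carrier G" if "w \<in> lists (S \<times> UNIV)" for w
    using that f by (force simp: in_lists_conv_set)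
  have app: "signed_word G f (u @ v) = signed_word G f u \<otimes> signed_word G f v"
    if "u \<in> lists (S \<times> UNIV)" "v \<in> lists (S \<times> UNIV)" for u v
    unfolding signed_word_def by (rule lword_append) (use cl that in blast)+
  have scl: "signed_word G f w \<in> carrier G" if "w \<in> lists (S \<times> UNIV)" for w
    unfolding signed_word_def by (rule lword_closed[OF cl[OF that]])
  have eq: "signed_word G f v = signed_word G f w" if "word_eq S R v w" for v w
    using that
  proof (induction rule: word_eq.induct)
    case (cancel u v a e)
    then have a: "f a \<in> carrier G" using f by auto
    have c: "[(a, e), (a, \<not> e)] \<in> lists (S \<times> UNIV)" using cancel by auto
    have "signed_word G f [(a, e), (a, \<not> e)] = \<one>" using a by (auto simp: signed_word_def)
    moreover have "[(a, e), (a, \<not> e)] @ v \<in> lists (S \<times> UNIV)" using c cancel by auto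
    ultimately show ?case using cancel(1,2) c scl by (simp only: app l_one)
  next
    case (relator u v r)
    then show ?case using app scl R by (simp add: app[OF relator(1)])
  qed auto
  \<comment> \<open>Any representative will do: \<open>eq\<close> shows that
    \<open>signed_word\<close> is constant on classes.\<close>
  let ?h = "\<lambda>c\<in>carrier (presented_group S R). signed_word G f (SOME w. w \<in> c)"
  have h: "?h (word_class S R w) = signed_word G f w" if "w \<in> lists (S \<times> UNIV)" for w
  proof -
    have "w \<in> word_class S R w" using that by (simp add: word_class_def word_eq.refl)
    then have "(SOME v. v \<in> word_class S R w) \<in> word_class S R w" by (rule someI)
    then have "word_eq S R w (SOME v. v \<in> word_class S R w)" by (simp add: word_class_def)
    from eq[OF this] show ?thesis using that by (simp add: carrier_presented_group)
  qed
  show ?thesis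
  proof (rule that[of ?h])
    show "?h \<in> hom (presented_group S R) G"
    proof (rule homI)
      fix x assume "x \<in> carrier (presented_group S R)"
      then obtain w where w: "w \<in> lists (S \<times> UNIV)" "x = word_class S R w" by (auto simp: carrier_presented_group)
      show "?h x \<in> carrier G" unfolding w(2) h[OF w(1)] by (rule scl[OF w(1)])
    next
      fix x y assume "x \<in> carrier (presented_group S R)" "y \<in> carrier (presented_group S R)"
      then obtain u v where uv: "u \<in> lists (S \<times> UNIV)" "v \<in> lists (S \<times> UNIV)"
        "x = word_class S R u" "y = word_class S R v" by (auto simp: carrier_presented_group)
      have "u @ v \<in> lists (S \<times> UNIV)" using uv by auto
      then show "?h (x \<otimes>\<^bsub>presented_group S R\<^esub> y) = ?h x \<otimes> ?h y"
        unfolding uv(3,4) mult_presented_group[OF uv(1,2)] by (simp only: h uv app)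
    qed
    show "?h (presented_gen S R a) = f a" if "a \<in> S" for a
    proof -
      have "[(a, True)] \<in> lists (S \<times> UNIV)" "f a \<in> carrier G" using that f by auto
      then show ?thesis unfolding presented_gen_eq by (simp only: h) (simp add: signed_word_def)
    qed
  qed auto
qed

section \<open>Products of commuting involutions\<close>

text \<open>\<open>P T\<close> is the product of \<open>f\<close> over \<open>T\<close>, in a group
  that is not assumed commutative. The last clause is carried along for the induction: it lets the
  new involution \<open>f a\<close> pass the products already built.\<close>

lemma commuting_involutions:
  fixes G (structure)
  assumes G: "group G" and S: "finite S" and f: "\<And>v. v \<in> S \<Longrightarrow> f v \<in> carrier G"
    and inv: "\<And>v. v \<in> S \<Longrightarrow> f v \<otimes>\<^bsub>G\<^esub> f v = \<one>\<^bsub>G\<^esub>"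
    and com: "\<And>v w. v \<in> S \<Longrightarrow> w \<in> S \<Longrightarrow> f v \<otimes>\<^bsub>G\<^esub> f w = f w \<otimes>\<^bsub>G\<^esub> f v"
  shows "\<exists>P. (\<forall>T\<subseteq>S. P T \<in> carrier G) \<and> P {} = \<one>\<^bsub>G\<^esub> \<and> (\<forall>v\<in>S. P {v} = f v) \<and>
    (\<forall>T\<subseteq>S. \<forall>T'\<subseteq>S. P T \<otimes>\<^bsub>G\<^esub> P T' = P (sym_diff T T')) \<and>
    (\<forall>T\<subseteq>S. \<forall>c\<in>carrier G. (\<forall>v\<in>S. c \<otimes>\<^bsub>G\<^esub> f v = f v \<otimes>\<^bsub>G\<^esub> c) \<longrightarrow> c \<otimes>\<^bsub>G\<^esub> P T = P T \<otimes>\<^bsub>G\<^esub> c)"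
  using S f inv com
proof (induction S rule: finite_induct)
  case empty
  interpret group G by fact
  show ?case by (intro exI[of _ "\<lambda>_. \<one>"]) auto
next
  case (insert a S)
  interpret group G by fact
  have "\<exists>P. (\<forall>T\<subseteq>S. P T \<in> carrier G) \<and> P {} = \<one> \<and> (\<forall>v\<in>S. P {v} = f v) \<and>
    (\<forall>T\<subseteq>S. \<forall>T'\<subseteq>S. P T \<otimes> P T' = P (sym_diff T T')) \<and>
    (\<forall>T\<subseteq>S. \<forall>c\<in>carrier G. (\<forall>v\<in>S. c \<otimes> f v = f v \<otimes> c) \<longrightarrow> c \<otimes> P T = P T \<otimes> c)"
    by (rule insert.IH) (simp_all add: insert.prems)
  then obtain P where P: "\<forall>T\<subseteq>S. P T \<in> carrier G" "P {} = \<one>" "\<forall>v\<in>S. P {v} = f v"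
    "\<forall>T\<subseteq>S. \<forall>T'\<subseteq>S. P T \<otimes> P T' = P (sym_diff T T')"
    "\<forall>T\<subseteq>S. \<forall>c\<in>carrier G. (\<forall>v\<in>S. c \<otimes> f v = f v \<otimes> c) \<longrightarrow> c \<otimes> P T = P T \<otimes> c"
    by (elim exE conjE)
  have a: "f a \<in> carrier G" "f a \<otimes> f a = \<one>" using insert by auto
  have aP: "f a \<otimes> P T = P T \<otimes> f a" if "T \<subseteq> S" for T
    using P(5) that a insert.prems(3) by blast
  define Q where "Q T = (if a \<in> T then f a \<otimes> P (T - {a}) else P T)" for T
  have sub: "T - {a} \<subseteq> S" if "T \<subseteq> insert a S" for T using that by blast
  have mult: "Q T \<otimes> Q T' = Q (sym_diff T T')" if T: "T \<subseteq> insert a S" "T' \<subseteq> insert a S" for T T'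
  proof -
    let ?A = "T - {a}" and ?B = "T' - {a}"
    note A = sub[OF T(1)] and B = sub[OF T(2)]
    have PA: "P ?A \<in> carrier G" "P ?B \<in> carrier G" and PAB: "P ?A \<otimes> P ?B = P (sym_diff ?A ?B)"
      using P A B by auto
    have D: "sym_diff T T' - {a} = sym_diff ?A ?B" by blast
    have Q: "Q U = (if a \<in> U then f a \<otimes> P (U - {a}) else P (U - {a}))" for U
      by (simp add: Q_def)
    have 1: "P ?A \<otimes> (f a \<otimes> P ?B) = f a \<otimes> P (sym_diff ?A ?B)"
      using PA a aP[OF A] PAB by (metis m_assoc)
    have 2: "f a \<otimes> P ?A \<otimes> P ?B = f a \<otimes> P (sym_diff ?A ?B)"
      using PA a PAB by (metis m_assoc)
    have 3: "f a \<otimes> P ?A \<otimes> (f a \<otimes> P ?B) = P (sym_diff ?A ?B)"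
    proof -
      have "f a \<otimes> P ?A \<otimes> (f a \<otimes> P ?B) = f a \<otimes> (P ?A \<otimes> (f a \<otimes> P ?B))" using PA a by (simp add: m_assoc)
      also have "\<dots> = f a \<otimes> f a \<otimes> (P ?A \<otimes> P ?B)" unfolding 1 PAB[symmetric] using PA a by (intro m_assoc[symmetric]) auto
      finally show ?thesis using a(2) PA PAB by (metis l_one m_closed)
    qed
    show ?thesis
      unfolding Q[of T] Q[of T'] Q[of "sym_diff T T'"] D using 1 2 3 PAB by auto
  qed
  have com: "c \<otimes> Q T = Q T \<otimes> c" if T: "T \<subseteq> insert a S" and c: "c \<in> carrier G" "\<forall>v\<in>insert a S. c \<otimes> f v = f v \<otimes> c" for T c
  proof -
    have *: "P (T - {a}) \<in> carrier G" "c \<otimes> P (T - {a}) = P (T - {a}) \<otimes> c" "c \<otimes> f a = f a \<otimes> c"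
      using P(1,5) sub[OF T] c by auto
    have "c \<otimes> (f a \<otimes> P (T - {a})) = f a \<otimes> P (T - {a}) \<otimes> c"
      using * a c by (metis m_assoc)
    then show ?thesis using * by (cases "a \<in> T") (auto simp: Q_def)
  qed
  have cl: "Q T \<in> carrier G" if "T \<subseteq> insert a S" for T
    using P(1) sub[OF that] a by (auto simp: Q_def)
  have one: "Q {v} = f v" if "v \<in> insert a S" for v
    using that P(2,3) a insert.hyps(2) by (auto simp: Q_def)
  show ?case
    by (rule exI[of _ Q]) (use cl one mult com P(2) in \<open>auto simp: Q_def\<close>)
qed

section \<open>Elementary abelian 2-groups\<close>

text \<open>The factors over \<open>T \<inter> T'\<close> occur twice and cancel.\<close>

lemma (in comm_group) finprod_symdiff:
  assumes "finite T" "finite T'" "f \<in> T \<union> T' \<rightarrow> carrier G"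
    and "\<And>v. v \<in> T \<union> T' \<Longrightarrow> f v \<otimes> f v = \<one>"
  shows "finprod G f T \<otimes> finprod G f T' = finprod G f (sym_diff T T')"
proof -
  have 1: "finprod G f T = finprod G f (T - T') \<otimes> finprod G f (T \<inter> T')"
    using assms finprod_Un_disjoint[of "T - T'" "T \<inter> T'" f] by (auto simp: Un_Diff_Int Pi_iff)
  have 2: "finprod G f T' = finprod G f (T' - T) \<otimes> finprod G f (T \<inter> T')"
  proof -
    have "T' = (T' - T) \<union> (T \<inter> T')" by blast
    then have "finprod G f T' = finprod G f ((T' - T) \<union> (T \<inter> T'))" by simp
    also have "\<dots> = finprod G f (T' - T) \<otimes> finprod G f (T \<inter> T')"
      by (rule finprod_Un_disjoint) (use assms in auto)
    finally show ?thesis .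
  qed
  have 3: "finprod G f (sym_diff T T') = finprod G f (T - T') \<otimes> finprod G f (T' - T)"
    using assms by (subst finprod_Un_disjoint) (auto simp: Pi_iff)
  have "finprod G f (T \<inter> T') \<otimes> finprod G f (T \<inter> T') = finprod G (\<lambda>v. f v \<otimes> f v) (T \<inter> T')"
    using assms by (subst finprod_multf) (auto simp: Pi_iff)
  also have "\<dots> = \<one>" by (rule finprod_one_eqI) (use assms in auto)
  finally have 4: "finprod G f (T \<inter> T') \<otimes> finprod G f (T \<inter> T') = \<one>" .
  have c: "finprod G f (T - T') \<in> carrier G" "finprod G f (T' - T) \<in> carrier G" "finprod G f (T \<inter> T') \<in> carrier G"
    using assms by (auto intro!: finprod_closed simp: Pi_iff)
  have "finprod G f T \<otimes> finprod G f T' = finprod G f (T - T') \<otimes> finprod G f (T' - T) \<otimes> (finprod G f (T \<inter> T') \<otimes> finprod G f (T \<inter> T'))"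
    unfolding 1 2 using c by (simp add: m_ac)
  then show ?thesis using 3 4 c by simp
qed

lemma carrier_Z2_power: "carrier (Z2_power k) = {..<k} \<rightarrow>\<^sub>E {0, 1}"
proof -
  have "{0..<2::int} = {0, 1}" by auto
  then show ?thesis by (simp add: Z2_power_def carrier_integer_mod_group)
qed

lemma card_Z2_power: "card (carrier (Z2_power k)) = 2 ^ k"
  by (simp add: carrier_Z2_power card_PiE numeral_2_eq_2)

lemma finite_Z2_power: "finite (carrier (Z2_power k))"
  by (simp add: carrier_Z2_power finite_PiE)

lemma mult_Z2_power: "x \<otimes>\<^bsub>Z2_power k\<^esub> y = (\<lambda>i\<in>{..<k}. (x i + y i) mod 2)"
  by (simp add: Z2_power_def)

lemma one_Z2_power: "\<one>\<^bsub>Z2_power k\<^esub> = (\<lambda>i\<in>{..<k}. 0)"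
  by (simp add: Z2_power_def)

lemma group_Z2_power: "group (Z2_power k)"
  by (simp add: Z2_power_def)

lemma Z2_power_square: "x \<in> carrier (Z2_power k) \<Longrightarrow> x \<otimes>\<^bsub>Z2_power k\<^esub> x = \<one>\<^bsub>Z2_power k\<^esub>"
  unfolding mult_Z2_power one_Z2_power carrier_Z2_power by (rule restrict_ext) (auto simp: PiE_iff)

lemma comm_group_square_one:
  fixes G (structure)
  assumes "group G" "\<And>x. x \<in> carrier G \<Longrightarrow> x \<otimes>\<^bsub>G\<^esub> x = \<one>\<^bsub>G\<^esub>"
  shows "comm_group G"
proof -
  interpret group G by fact
  show ?thesis
  proof (rule group_comm_groupI)
    fix x y assume xy: "x \<in> carrier G" "y \<in> carrier G"
    have i: "inv z = z" if "z \<in> carrier G" for z using assms(2)[OF that] that by (metis inv_equality)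
    have "inv (x \<otimes> y) = inv y \<otimes> inv x" using xy by (rule inv_mult_group)
    then show "x \<otimes> y = y \<otimes> x" using i xy by simp
  qed
qed

text \<open>Linear algebra over the field with two elements, carried out with subset products.
  \<open>?I A\<close> says that different subsets of \<open>A\<close> have different products, so
  that \<open>A\<close> is independent; an independent set of largest size spans, and its subsets
  become 0-1 vectors.\<close>

lemma elementary_abelian_iso_Z2_power:
  fixes G :: "('a, 'b) monoid_scheme" (structure)
  assumes G: "group G" and fin: "finite (carrier G)" and sq: "\<And>x. x \<in> carrier G \<Longrightarrow> x \<otimes>\<^bsub>G\<^esub> x = \<one>\<^bsub>G\<^esub>"
  obtains k where "G \<cong> Z2_power k" "card (carrier G) = 2 ^ k"
proof -
  interpret comm_group G using comm_group_square_one[OF G sq] .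
  let ?P = "\<lambda>T :: 'a set. finprod G (\<lambda>x. x) T"
  let ?I = "\<lambda>A :: 'a set. A \<subseteq> carrier G \<and> inj_on ?P (Pow A)"
  have Pcl: "?P T \<in> carrier G" if "T \<subseteq> carrier G" for T using that by (auto intro!: finprod_closed)
  have Psd: "?P T \<otimes> ?P T' = ?P (sym_diff T T')" if "T \<subseteq> carrier G" "T' \<subseteq> carrier G" for T T'
    by (rule finprod_symdiff) (use that sq finite_subset[OF _ fin] in auto)
  have Pid: "T = T'" if "?P (sym_diff T T') = \<one>" "inj_on ?P (Pow A)" "T \<subseteq> A" "T' \<subseteq> A" for T T' A
  proof -
    have "sym_diff T T' = {}" using that by (intro inj_onD[OF that(2)]) auto
    then show ?thesis by blast
  qed
  have I0: "?I {}" by (simp add: inj_on_def)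
  have bound: "card A \<le> card (carrier G)" if "?I A" for A using that fin card_mono by blast
  obtain A where A: "?I A" "\<And>B. ?I B \<Longrightarrow> card B \<le> card A"
  proof -
    have "\<exists>A. ?I A \<and> (\<forall>B. ?I B \<longrightarrow> card B \<le> card A)"
      by (rule ex_has_greatest_nat[where P = ?I and b = "Suc (card (carrier G))", OF I0])
        (use bound in \<open>auto simp: less_Suc_eq_le\<close>)
    then show ?thesis using that by blast
  qed
  \<comment> \<open>If \<open>g\<close> is no subset product, adding it to \<open>A\<close> would
    keep independence, against maximality: a relation that involves \<open>g\<close> would express
    \<open>g\<close> as the product of a subset of \<open>A\<close>.\<close>
  have surj: "?P ` Pow A = carrier G"
  proof (rule ccontr)
    assume "?P ` Pow A \<noteq> carrier G"
    moreover have "?P ` Pow A \<subseteq> carrier G"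
    proof
      fix g assume "g \<in> ?P ` Pow A"
      then obtain T where T: "T \<subseteq> A" "g = ?P T" by auto
      show "g \<in> carrier G" unfolding T(2) by (rule Pcl) (use T A in auto)
    qed
    ultimately obtain g where g: "g \<in> carrier G" "g \<notin> ?P ` Pow A" by auto
    have gA: "g \<notin> A"
    proof
      assume "g \<in> A"
      then have "?P {g} = g" "{g} \<in> Pow A" using g by auto
      then show False using g(2) by force
    qed
    have fA: "finite A" using A fin finite_subset by blast
    have "inj_on ?P (Pow (insert g A))"
    proof (rule inj_onI)
      fix T T' assume T: "T \<in> Pow (insert g A)" "T' \<in> Pow (insert g A)" and e: "?P T = ?P T'"
      have Tc: "T \<subseteq> carrier G" "T' \<subseteq> carrier G" using T A g by auto
      let ?D = "sym_diff T T'"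
      have D1: "?P ?D = \<one>" using Psd[OF Tc] e sq Pcl Tc by simp
      show "T = T'"
      proof (cases "g \<in> ?D")
        case False
        then have "?D \<in> Pow A" using T by auto
        then have "?D = {}" using A D1 by (auto dest: inj_onD[where y = "{}"])
        then show ?thesis by blast
      next
        case True
        let ?E = "?D - {g}"
        have E: "?E \<subseteq> A" "?E \<subseteq> carrier G" using T Tc by auto
        have D: "?D = insert g ?E" using True by blast
        have "?P (insert g ?E) = g \<otimes> ?P ?E"
          by (rule finprod_insert) (use finite_subset[OF E(2) fin] E g in auto)
        then have gE: "g \<otimes> ?P ?E = \<one>" using D1 D by simp
        have c: "?P ?E \<in> carrier G" using Pcl E by blast
        have "g = g \<otimes> (?P ?E \<otimes> ?P ?E)" using sq[OF c] g by simp
        also have "\<dots> = g \<otimes> ?P ?E \<otimes> ?P ?E" using c g by (intro m_assoc[symmetric]) auto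
        also have "\<dots> = ?P ?E" using gE c by simp
        finally have "g = ?P ?E" .
        then show ?thesis using g(2) E by blast
      qed
    qed
    then have "card (insert g A) \<le> card A" using A(1) g(1) by (intro A(2)) auto
    then show False using gA fA by simp
  qed
  have fA: "finite A" using A fin finite_subset by blast
  obtain a where a: "bij_betw a {..<card A} A" using ex_bij_betw_nat_finite[OF fA] unfolding atLeast0LessThan by blast
  let ?s = "\<lambda>x::nat \<Rightarrow> int. a ` {i. i < card A \<and> x i = 1}"
  have sA: "?s x \<subseteq> A" for x using a by (auto simp: bij_betw_def)
  have ainj: "inj_on a {..<card A}" using a by (auto simp: bij_betw_def)
  have "(\<lambda>x. ?P (?s x)) \<in> iso (Z2_power (card A)) G"
    unfolding iso_def
  proof (intro CollectI conjI homI)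
    fix x y assume x: "x \<in> carrier (Z2_power (card A))" and y: "y \<in> carrier (Z2_power (card A))"
    show "?P (?s x) \<in> carrier G" by (rule Pcl[OF subset_trans[OF sA conjunct1[OF A(1)]]])
    have 01: "x i = 0 \<or> x i = 1" "y i = 0 \<or> y i = 1" if "i < card A" for i
      using x y that by (auto simp: carrier_Z2_power PiE_iff)
    have "{i. i < card A \<and> (x \<otimes>\<^bsub>Z2_power (card A)\<^esub> y) i = 1} = sym_diff {i. i < card A \<and> x i = 1} {i. i < card A \<and> y i = 1}"
    proof (rule Set.set_eqI)
      fix i show "i \<in> {i. i < card A \<and> (x \<otimes>\<^bsub>Z2_power (card A)\<^esub> y) i = 1} \<longleftrightarrow>
        i \<in> sym_diff {i. i < card A \<and> x i = 1} {i. i < card A \<and> y i = 1}"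
        using 01[of i] by (auto simp: mult_Z2_power)
    qed
    moreover have "a ` sym_diff X Y = sym_diff (a ` X) (a ` Y)" if "X \<subseteq> {..<card A}" "Y \<subseteq> {..<card A}" for X Y
      unfolding image_Un using that inj_on_image_set_diff[OF ainj, of X Y] inj_on_image_set_diff[OF ainj, of Y X] by auto
    ultimately have e: "?s (x \<otimes>\<^bsub>Z2_power (card A)\<^esub> y) = sym_diff (?s x) (?s y)"
      by (simp add: subset_iff)
    show "?P (?s (x \<otimes>\<^bsub>Z2_power (card A)\<^esub> y)) = ?P (?s x) \<otimes> ?P (?s y)"
      unfolding e by (rule Psd[symmetric]; rule subset_trans[OF sA conjunct1[OF A(1)]])
  next
    show "bij_betw (\<lambda>x. ?P (?s x)) (carrier (Z2_power (card A))) (carrier G)"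
    proof (rule bij_betw_imageI)
      show "inj_on (\<lambda>x. ?P (?s x)) (carrier (Z2_power (card A)))"
      proof (rule inj_onI)
        fix x y assume x: "x \<in> carrier (Z2_power (card A))" and y: "y \<in> carrier (Z2_power (card A))"
          and xy: "?P (?s x) = ?P (?s y)"
        have "?s x = ?s y" by (rule inj_onD[OF conjunct2[OF A(1)] xy]; rule PowI[OF sA])
        then have e: "{i. i < card A \<and> x i = 1} = {i. i < card A \<and> y i = 1}"
          using inj_on_image_eq_iff[OF ainj, of "{i. i < card A \<and> x i = 1}" "{i. i < card A \<and> y i = 1}"] by auto
        show "x = y"
        proof (rule PiE_ext)
          show "x \<in> {..<card A} \<rightarrow>\<^sub>E {0, 1}" "y \<in> {..<card A} \<rightarrow>\<^sub>E {0, 1}" using x y by (simp_all add: carrier_Z2_power)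
          fix i assume i: "i \<in> {..<card A}"
          then have "x i = 0 \<or> x i = 1" "y i = 0 \<or> y i = 1" using x y by (auto simp: carrier_Z2_power PiE_iff)
          then show "x i = y i" using e[unfolded Set.set_eq_iff mem_Collect_eq, rule_format, of i] i by auto
        qed
      qed
      show "(\<lambda>x. ?P (?s x)) ` carrier (Z2_power (card A)) = carrier G"
      proof (intro equalityI subsetI)
        fix g assume "g \<in> carrier G"
        then obtain T where T: "T \<subseteq> A" "g = ?P T" unfolding surj[symmetric] by auto
        let ?x = "\<lambda>i\<in>{..<card A}. if a i \<in> T then 1 else 0 :: int"
        have "{i. i < card A \<and> ?x i = 1} = {i. i < card A \<and> a i \<in> T}" by auto
        moreover have "a ` {i. i < card A \<and> a i \<in> T} = T"
          using T(1) bij_betw_imp_surj_on[OF a] by (auto simp: image_iff)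
        ultimately have "?s ?x = T" by simp
        then show "g \<in> (\<lambda>x. ?P (?s x)) ` carrier (Z2_power (card A))"
          using T(2) by (intro image_eqI[of _ _ ?x]) (simp_all add: carrier_Z2_power)
      qed (use Pcl[OF subset_trans[OF sA conjunct1[OF A(1)]]] in auto)
    qed
  qed
  then have i: "Z2_power (card A) \<cong> G" by (rule is_isoI)
  show ?thesis
    by (rule that[of "card A"])
      (use i group.iso_sym[OF group_Z2_power i] iso_same_card[OF i] card_Z2_power in auto)
qed

text \<open>The first isomorphism theorem combined with Lagrange: every fibre is a coset of the
  kernel.\<close>

lemma card_surj_hom:
  fixes G (structure) and H (structure)
  assumes G: "group G" and H: "group H" and f: "f \<in> hom G H" and s: "f ` carrier G = carrier H" and fin: "finite (carrier G)"
  shows "card (carrier G) = card (carrier H) * card (kernel G H f)"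
proof -
  interpret group_hom G H f using G H f by (simp add: group_hom_def group_hom_axioms_def)
  have "G Mod kernel G H f \<cong> H" by (rule FactGroup_iso[OF s])
  then have "card (carrier (G Mod kernel G H f)) = card (carrier H)" by (rule iso_same_card)
  moreover have "card (rcosets kernel G H f) * card (kernel G H f) = order G"
    using G.lagrange[OF subgroup_kernel] .
  ultimately show ?thesis by (simp add: FactGroup_def order_def)
qed

text \<open>A group generated by \<open>d\<close> involutions has an abelianisation of order at most \<open>2\<^sup>d\<close>, and at least
  \<open>2\<^sup>d\<close> if it maps onto an abelian group of that order.\<close>

lemma abelianisation_involutions:
  assumes W: "group W" and V: "finite V" "s ` V \<subseteq> carrier W" "\<And>v. v \<in> V \<Longrightarrow> s v \<otimes>\<^bsub>W\<^esub> s v = \<one>\<^bsub>W\<^esub>"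
    and gen: "\<And>w. w \<in> carrier W \<Longrightarrow> \<exists>vs\<in>lists V. w = lword W s vs"
    and H: "comm_group H" "h \<in> hom W H" "h ` carrier W = carrier H" "card (carrier H) = 2 ^ card V"
  shows "abelianisation W \<cong> Z2_power (card V)"
proof -
  interpret W: group W by fact
  interpret H: comm_group H by fact
  interpret h: group_hom W H h using H by unfold_locales auto
  let ?D = "derived W (carrier W)"
  let ?A = "W Mod ?D"
  interpret D: normal ?D W by (rule W.derived_is_normal[OF W.normal_self])
  interpret A: comm_group ?A by (rule W.derived_quot_is_comm_group)
  let ?q = "\<lambda>w. ?D #>\<^bsub>W\<^esub> w"
  have q: "?q \<in> hom W ?A" by (rule D.r_coset_hom_Mod)
  have qc: "carrier ?A = ?q ` carrier W" by (auto simp: FactGroup_def RCOSETS_def)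
  define qs where "qs = ?q \<circ> s"
  have sc: "qs v \<in> carrier ?A" if "v \<in> V" for v using that V(2) qc by (auto simp: qs_def)
  have s2: "qs v \<otimes>\<^bsub>?A\<^esub> qs v = \<one>\<^bsub>?A\<^esub>" if "v \<in> V" for v
  proof -
    have "s v \<in> carrier W" using V that by auto
    then have "qs v \<otimes>\<^bsub>?A\<^esub> qs v = ?q (s v \<otimes>\<^bsub>W\<^esub> s v)" using hom_mult[OF q] by (simp add: qs_def)
    then show ?thesis using V(3)[OF that] hom_one[OF q W.is_group A.is_group] by simp
  qed
  \<comment> \<open>In the abelian quotient a repeated generator cancels, so a word keeps only the
    set of letters that occur an odd number of times. This bounds the order by the number of subsets
    of \<open>V\<close>.\<close>
  have words: "\<exists>T\<subseteq>V. lword ?A qs vs = finprod ?A qs T" if "vs \<in> lists V" for vs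
    using that
  proof (induction vs)
    case Nil
    show ?case by (rule exI[of _ "{}"]) (simp only: A.lword_Nil A.finprod_empty empty_subsetI simp_thms)
  next
    case (Cons v vs)
    then have "\<exists>T\<subseteq>V. lword ?A qs vs = finprod ?A qs T" by simp
    then obtain T where T: "T \<subseteq> V" "lword ?A qs vs = finprod ?A qs T" by (elim exE conjE)
    have v: "v \<in> V" using Cons by auto
    have "qs v = finprod ?A qs {v}"
      using A.finprod_insert[of "{}" v qs] A.r_one sc[OF v] by (simp del: mult_FactGroup one_FactGroup)
    then have "lword ?A qs (v # vs) = finprod ?A qs {v} \<otimes>\<^bsub>?A\<^esub> finprod ?A qs T"
      unfolding A.lword_Cons T(2) by (rule arg_cong)
    also have "\<dots> = finprod ?A qs (sym_diff {v} T)"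
      by (rule A.finprod_symdiff) (use T v sc s2 finite_subset[OF _ V(1)] in auto)
    finally show ?case using T(1) v by (intro exI[of _ "sym_diff {v} T"] conjI) auto
  qed
  have sub: "carrier ?A \<subseteq> finprod ?A qs ` Pow V"
  proof
    fix c assume "c \<in> carrier ?A"
    then obtain w where w: "w \<in> carrier W" "c = ?q w" using qc by auto
    obtain vs where vs: "vs \<in> lists V" "w = lword W s vs" using gen[OF w(1)] by auto
    have "c = lword ?A qs vs"
      unfolding w vs qs_def by (rule lword_hom[OF W.is_group A.is_group q]) (use vs V in auto)
    then show "c \<in> finprod ?A qs ` Pow V" using words[OF vs(1)] by auto
  qed
  then have fin: "finite (carrier ?A)" using V(1) finite_subset by blast
  have le: "card (carrier ?A) \<le> 2 ^ card V"
    using card_mono[OF _ sub] card_image_le[of "Pow V" "finprod ?A qs"] V(1) by (simp add: card_Pow)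
  have sq: "c \<otimes>\<^bsub>?A\<^esub> c = \<one>\<^bsub>?A\<^esub>" if c: "c \<in> carrier ?A" for c
  proof -
    obtain T where T: "T \<subseteq> V" "c = finprod ?A qs T" using sub c by auto
    have "c \<otimes>\<^bsub>?A\<^esub> c = finprod ?A qs (sym_diff T T)"
      unfolding T(2) by (rule A.finprod_symdiff) (use T sc s2 finite_subset[OF _ V(1)] in auto)
    then show ?thesis by simp
  qed
  obtain k where k: "?A \<cong> Z2_power k" "card (carrier ?A) = 2 ^ k"
    by (rule elementary_abelian_iso_Z2_power[OF A.is_group fin sq])
  \<comment> \<open>\<open>H\<close> is abelian, so \<open>h\<close> kills commutators and is
    constant on the cosets of the derived group. Its values on cosets map the quotient onto
    \<open>H\<close>, which bounds the order from below.\<close>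
  have "?D \<subseteq> kernel W H h"
    unfolding derived_def
  proof (rule W.generate_subgroup_incl[OF _ h.subgroup_kernel], clarify)
    fix x y assume xy: "x \<in> carrier W" "y \<in> carrier W"
    then have "h (x \<otimes>\<^bsub>W\<^esub> y \<otimes>\<^bsub>W\<^esub> inv\<^bsub>W\<^esub> x \<otimes>\<^bsub>W\<^esub> inv\<^bsub>W\<^esub> y) = h x \<otimes>\<^bsub>H\<^esub> h y \<otimes>\<^bsub>H\<^esub> inv\<^bsub>H\<^esub> h x \<otimes>\<^bsub>H\<^esub> inv\<^bsub>H\<^esub> h y"
      by simp
    also have "\<dots> = h y \<otimes>\<^bsub>H\<^esub> h x \<otimes>\<^bsub>H\<^esub> inv\<^bsub>H\<^esub> h x \<otimes>\<^bsub>H\<^esub> inv\<^bsub>H\<^esub> h y"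
      using xy by (subst H.m_comm[of "h x" "h y"]) auto
    also have "\<dots> = \<one>\<^bsub>H\<^esub>"
      using xy by (subst H.m_assoc[of "h y" "h x"]) auto
    finally show "x \<otimes>\<^bsub>W\<^esub> y \<otimes>\<^bsub>W\<^esub> inv\<^bsub>W\<^esub> x \<otimes>\<^bsub>W\<^esub> inv\<^bsub>W\<^esub> y \<in> kernel W H h"
      using xy by (simp add: kernel_def)
  qed
  then have hq: "h ` ?q w = {h w}" if "w \<in> carrier W" for w
  proof -
    have "h z = h w" if z: "z \<in> ?q w" for z
    proof -
      obtain d where d: "d \<in> ?D" "z = d \<otimes>\<^bsub>W\<^esub> w" using z by (auto simp: r_coset_def)
      then have "d \<in> carrier W" "h d = \<one>\<^bsub>H\<^esub>" using \<open>?D \<subseteq> kernel W H h\<close> by (auto simp: kernel_def)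
      then show ?thesis using d \<open>w \<in> carrier W\<close> by simp
    qed
    moreover have "w \<in> ?q w" using that by (rule W.rcos_self[OF _ D.subgroup_axioms])
    ultimately show ?thesis by blast
  qed
  have "carrier H = (\<lambda>c. the_elem (h ` c)) ` carrier ?A"
    unfolding qc image_image H(3)[symmetric] using hq by (intro image_cong) auto
  then have "card (carrier H) \<le> card (carrier ?A)" using card_image_le[OF fin] by metis
  then have "k = card V" using le k(2) H(4) by simp
  then show ?thesis using k(1) by (simp add: abelianisation_def)
qed

section \<open>Spaces with corners and their developments\<close>

text \<open>\<open>tau y\<close> is the set of walls through \<open>y\<close>; the chart \<open>e S\<close> has one nonnegative coordinate for
  each wall in \<open>S\<close> and positive coordinates otherwise.\<close>

locale corner_space =
  fixes Y :: "'y topology" and K :: "'v set set" and tau :: "'y \<Rightarrow> 'v set"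
    and B :: "'v set \<Rightarrow> 'v set" and e :: "'v set \<Rightarrow> ('v \<Rightarrow> real) \<Rightarrow> 'y"
  assumes empty_K: "{} \<in> K"
    and face_K: "S \<in> K \<Longrightarrow> T \<subseteq> S \<Longrightarrow> T \<in> K"
    and finite_K: "S \<in> K \<Longrightarrow> finite S"
    and B_sub: "S \<in> K \<Longrightarrow> S \<subseteq> B S"
    and tau_K: "y \<in> topspace Y \<Longrightarrow> tau y \<in> K"
    and star_open: "S \<in> K \<Longrightarrow> openin Y {y \<in> topspace Y. tau y \<subseteq> S}"
    and chart: "S \<in> K \<Longrightarrow> homeomorphic_map
      (subtopology (powertop_real (B S)) {f. \<forall>b\<in>B S. if b \<in> S then 0 \<le> f b else 0 < f b})
      (subtopology Y {y \<in> topspace Y. tau y \<subseteq> S}) (e S)"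
    and tau_chart: "S \<in> K \<Longrightarrow> f \<in> extensional (B S) \<Longrightarrow>
      (\<forall>b\<in>B S. if b \<in> S then 0 \<le> f b else 0 < f b) \<Longrightarrow> tau (e S f) = {b \<in> S. f b = 0}"
begin

definition star :: "'v set \<Rightarrow> 'y set" where
  "star S = {y \<in> topspace Y. tau y \<subseteq> S}"

definition corner :: "'v set \<Rightarrow> ('v \<Rightarrow> real) topology" where
  "corner S = subtopology (powertop_real (B S)) {f. \<forall>b\<in>B S. if b \<in> S then 0 \<le> f b else 0 < f b}"

text \<open>The corner reflected in all of its walls: coordinates in \<open>S\<close> may have any
  sign. It is convex, and it is the local model of every development.\<close>

definition region :: "'v set \<Rightarrow> ('v \<Rightarrow> real) topology" where
  "region S = subtopology (powertop_real (B S)) {f. \<forall>b\<in>B S. b \<notin> S \<longrightarrow> 0 < f b}"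

definition absval :: "'v set \<Rightarrow> ('v \<Rightarrow> real) \<Rightarrow> 'v \<Rightarrow> real" where
  "absval S f = (\<lambda>b\<in>B S. \<bar>f b\<bar>)"

text \<open>For \<open>T\<close> inside \<open>S\<close>, a section of the folding map
  \<open>absval S\<close> over the corner, with values in the orthant where the coordinates in
  \<open>T\<close> are at most 0.\<close>

definition flip :: "'v set \<Rightarrow> 'v set \<Rightarrow> ('v \<Rightarrow> real) \<Rightarrow> 'v \<Rightarrow> real" where
  "flip S T f = (\<lambda>b\<in>B S. if b \<in> T then - f b else f b)"

lemma topspace_region: "topspace (region S) = {f \<in> extensional (B S). \<forall>b\<in>B S. b \<notin> S \<longrightarrow> 0 < f b}"
  by (auto simp: region_def PiE_def)

lemma topspace_corner:
  "topspace (corner S) = {f \<in> extensional (B S). \<forall>b\<in>B S. if b \<in> S then 0 \<le> f b else 0 < f b}"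
  by (auto simp: corner_def PiE_def)

lemma continuous_map_region:
  "continuous_map X (region S) f \<longleftrightarrow> f \<in> topspace X \<rightarrow> topspace (region S) \<and>
     (\<forall>b\<in>B S. continuous_map X euclideanreal (\<lambda>x. f x b))"
  unfolding topspace_region unfolding region_def continuous_map_in_subtopology continuous_map_componentwise
  by (auto simp: Pi_iff image_subset_iff)

lemma continuous_map_corner:
  "continuous_map X (corner S) f \<longleftrightarrow> f \<in> topspace X \<rightarrow> topspace (corner S) \<and>
     (\<forall>b\<in>B S. continuous_map X euclideanreal (\<lambda>x. f x b))"
  unfolding topspace_corner unfolding corner_def continuous_map_in_subtopology continuous_map_componentwise
  by (auto simp: Pi_iff image_subset_iff)

lemma region_component: "b \<in> B S \<Longrightarrow> continuous_map (region S) euclideanreal (\<lambda>f. f b)"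
  unfolding region_def by (intro continuous_map_from_subtopology continuous_map_product_projection)

lemma corner_component: "b \<in> B S \<Longrightarrow> continuous_map (corner S) euclideanreal (\<lambda>f. f b)"
  unfolding corner_def by (intro continuous_map_from_subtopology continuous_map_product_projection)

lemma convex_pos: "0 < a \<Longrightarrow> 0 < b \<Longrightarrow> 0 \<le> t \<Longrightarrow> t \<le> 1 \<Longrightarrow> 0 < a + t * (b - a)" for a b t :: real
proof -
  assume *: "0 < a" "0 < b" "0 \<le> t" "t \<le> 1"
  have "a + t * (b - a) = (1 - t) * a + t * b" by (simp add: algebra_simps)
  also have "\<dots> > 0"
  proof (cases "t = 0")
    case False
    then have "0 < t * b" "0 \<le> (1 - t) * a" using * by auto
    then show ?thesis by linarith
  qed (use * in auto)
  finally show ?thesis .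
qed

text \<open>Straight-line homotopy in a convex set, coordinate by coordinate. The homotopies between
  different routes in a development all go back to this one.\<close>

lemma region_path_hom:
  assumes p: "pathin (region S) p" and q: "pathin (region S) q" and "p 0 = q 0" "p 1 = q 1"
  shows "path_hom (region S) p q"
proof -
  let ?h = "\<lambda>z::real\<times>real. \<lambda>b\<in>B S. p (snd z) b + fst z * (q (snd z) b - p (snd z) b)"
  have pt: "p t \<in> topspace (region S)" "q t \<in> topspace (region S)" if "t \<in> {0..1}" for t
    using that path_image_subset_topspace[OF p] path_image_subset_topspace[OF q] by (simp_all add: Pi_iff)
  have ext: "(\<lambda>b\<in>B S. p t b) = p t" "(\<lambda>b\<in>B S. q t b) = q t" if "t \<in> {0..1}" for t
    using pt[OF that] by (simp_all add: topspace_region extensional_restrict)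
  have c: "continuous_on ({0..1} \<times> {0..1}) (\<lambda>z::real\<times>real. f (snd z) b)"
    if "pathin (region S) f" "b \<in> B S" for f b
  proof -
    have "continuous_map (top_of_set {0..1}) euclideanreal (\<lambda>t. f t b)"
      using that by (simp add: pathin_def continuous_map_region)
    then have "continuous_on {0..1} (\<lambda>t. f t b)" by simp
    then show ?thesis by (rule continuous_on_compose2) (auto intro!: continuous_intros)
  qed
  have h: "continuous_map (top_of_set ({0..1} \<times> {0..1})) (region S) ?h"
    unfolding continuous_map_region
  proof (intro conjI ballI)
    show "?h \<in> topspace (top_of_set ({0..1} \<times> {0..1})) \<rightarrow> topspace (region S)"
      using pt by (auto simp: topspace_region intro!: convex_pos)
    fix b assume b: "b \<in> B S"
    have "continuous_on ({0..1} \<times> {0..1}) (\<lambda>z::real\<times>real. p (snd z) b + fst z * (q (snd z) b - p (snd z) b))"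
      by (intro continuous_intros c[OF p b] c[OF q b])
    then show "continuous_map (top_of_set ({0..1} \<times> {0..1})) euclideanreal (\<lambda>z. ?h z b)"
      using b by simp
  qed
  show ?thesis
    by (rule path_homI[OF h]) (use ext assms(3,4) in \<open>simp_all\<close>)
qed

lemma region_path:
  assumes "f \<in> topspace (region S)" "g \<in> topspace (region S)"
  shows "\<exists>p. pathin (region S) p \<and> p 0 = f \<and> p 1 = g"
proof (intro exI conjI)
  let ?p = "\<lambda>t::real. \<lambda>b\<in>B S. f b + t * (g b - f b)"
  show "pathin (region S) ?p"
    unfolding pathin_def continuous_map_region
    using assms by (auto simp: topspace_region intro!: convex_pos continuous_intros)
  show "?p 0 = f" "?p 1 = g" using assms by (simp_all add: topspace_region extensional_restrict)
qed

lemma star_openin: "S \<in> K \<Longrightarrow> openin Y (star S)"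
  unfolding star_def by (rule star_open)

lemma chart_homeo: "S \<in> K \<Longrightarrow> homeomorphic_map (corner S) (subtopology Y (star S)) (e S)"
  unfolding corner_def star_def by (rule chart)

lemma chart_continuous: "S \<in> K \<Longrightarrow> continuous_map (corner S) Y (e S)"
  using homeomorphic_imp_continuous_map[OF chart_homeo] by (simp add: continuous_map_in_subtopology)

lemma topspace_star: "topspace (subtopology Y (star S)) = star S"
  by (auto simp: star_def)

lemma chart_image: "S \<in> K \<Longrightarrow> e S ` topspace (corner S) = star S"
  using homeomorphic_imp_surjective_map[OF chart_homeo] unfolding topspace_star .

lemma chart_inj: "S \<in> K \<Longrightarrow> inj_on (e S) (topspace (corner S))"
  by (rule homeomorphic_imp_injective_map[OF chart_homeo])

lemma chart_open:
  assumes S: "S \<in> K" and U: "openin (corner S) U"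
  shows "openin Y (e S ` U)"
proof -
  have "openin (subtopology Y (star S)) (e S ` U)"
    using homeomorphic_map_openness[OF chart_homeo[OF S] openin_subset[OF U]] U by simp
  then show ?thesis using star_openin[OF S] openin_trans_full by blast
qed

lemma chart_in_star: "S \<in> K \<Longrightarrow> f \<in> topspace (corner S) \<Longrightarrow> e S f \<in> star S"
  using chart_image by blast

lemma star_subset: "star S \<subseteq> topspace Y"
  by (auto simp: star_def)

lemma tau_chart': "S \<in> K \<Longrightarrow> f \<in> topspace (corner S) \<Longrightarrow> tau (e S f) = {b \<in> S. f b = 0}"
  by (rule tau_chart) (auto simp: topspace_corner)

lemma absval_corner: "f \<in> topspace (region S) \<Longrightarrow> absval S f \<in> topspace (corner S)"
  by (force simp: topspace_region topspace_corner absval_def)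

lemma absval_continuous: "continuous_map (region S) (corner S) (absval S)"
  unfolding continuous_map_corner
proof (intro conjI ballI)
  fix b assume "b \<in> B S"
  then show "continuous_map (region S) euclideanreal (\<lambda>f. absval S f b)"
    using continuous_map_real_abs[OF region_component] by (simp add: absval_def)
qed (use absval_corner in auto)

lemma flip_region: "T \<subseteq> S \<Longrightarrow> f \<in> topspace (corner S) \<Longrightarrow> flip S T f \<in> topspace (region S)"
  by (auto simp: topspace_region topspace_corner flip_def split: if_splits)

lemma flip_continuous: "T \<subseteq> S \<Longrightarrow> continuous_map (corner S) (region S) (flip S T)"
  unfolding continuous_map_region
proof (intro conjI ballI)
  fix b assume "b \<in> B S" 
  then show "continuous_map (corner S) euclideanreal (\<lambda>f. flip S T f b)"
    using corner_component[of b S] continuous_map_minus[OF corner_component[of b S]] by (simp add: flip_def)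
qed (use flip_region in auto)

lemma absval_flip: "f \<in> topspace (corner S) \<Longrightarrow> absval S (flip S T f) = f"
proof (rule extensionalityI[of _ "B S"])
  fix b assume "f \<in> topspace (corner S)" "b \<in> B S"
  then show "absval S (flip S T f) b = f b"
    by (cases "b \<in> S") (force simp: absval_def flip_def topspace_corner)+
qed (auto simp: absval_def topspace_corner)

end

section \<open>Developments over a space with corners and their orthant charts\<close>

lemma openin_discrete_prod:
  "openin (prod_topology (discrete_topology A) Y) W \<longleftrightarrow>
     W \<subseteq> A \<times> topspace Y \<and> (\<forall>a\<in>A. openin Y {y \<in> topspace Y. (a, y) \<in> W})"
proof (intro iffI conjI ballI)
  assume W: "openin (prod_topology (discrete_topology A) Y) W"
  show "W \<subseteq> A \<times> topspace Y" using openin_subset[OF W] by simp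
  fix a assume "a \<in> A"
  then have "continuous_map Y (prod_topology (discrete_topology A) Y) (\<lambda>y. (a, y))"
    by (simp add: continuous_map_pairwise o_def)
  from openin_continuous_map_preimage[OF this W] show "openin Y {y \<in> topspace Y. (a, y) \<in> W}" .
next
  assume *: "W \<subseteq> A \<times> topspace Y \<and> (\<forall>a\<in>A. openin Y {y \<in> topspace Y. (a, y) \<in> W})"
  have eq: "W = (\<Union>a\<in>A. {a} \<times> {y \<in> topspace Y. (a, y) \<in> W})" using * by auto
  show "openin (prod_topology (discrete_topology A) Y) W"
    by (subst eq) (use * in \<open>auto intro!: openin_Union simp: openin_prod_Times_iff\<close>)
qed

text \<open>\<open>P T\<close> plays the product of the reflections in the walls of
  \<open>T\<close>. On the subsets of a face, with symmetric difference as addition, it embeds the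
  elementary abelian 2-group of that face in \<open>G\<close>; using one function for all faces
  makes these embeddings compatible.\<close>

locale development_space = corner_space Y K tau B e + group G
  for Y :: "'y topology" and K :: "'v set set" and tau B e and G :: "('g, 'm) monoid_scheme" (structure) +
  fixes P :: "'v set \<Rightarrow> 'g"
  assumes P_closed: "S \<in> K \<Longrightarrow> P S \<in> carrier G"
    and P_mult: "S \<in> K \<Longrightarrow> T \<subseteq> S \<Longrightarrow> T' \<subseteq> S \<Longrightarrow> P T \<otimes> P T' = P (sym_diff T T')"
    and P_inj: "S \<in> K \<Longrightarrow> inj_on P (Pow S)"
begin

definition near :: "'v set \<Rightarrow> 'g \<Rightarrow> 'g \<Rightarrow> bool" where
  "near S g h \<longleftrightarrow> (\<exists>T\<subseteq>S. h = g \<otimes> P T)"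

definition Rel :: "(('g \<times> 'y) \<times> ('g \<times> 'y)) set" where
  "Rel = {((g, x), (g', x')). g \<in> carrier G \<and> g' \<in> carrier G \<and> x \<in> topspace Y \<and> x = x' \<and>
     inv g \<otimes> g' \<in> P ` Pow (tau x)}"

definition D :: "('g \<times> 'y) set topology" where
  "D = quotient_space (prod_topology (discrete_topology (carrier G)) Y) Rel"

definition cls :: "'g \<Rightarrow> 'y \<Rightarrow> ('g \<times> 'y) set" where
  "cls g x = Rel `` {(g, x)}"

text \<open>Absolute values determine the point of the chamber, signs determine which of the
  chambers around the corner it lies in. A zero coordinate counts as positive; the identifications
  make this choice harmless.\<close>

definition chamber_chart :: "'g \<Rightarrow> 'v set \<Rightarrow> ('v \<Rightarrow> real) \<Rightarrow> ('g \<times> 'y) set" where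
  "chamber_chart g S f = cls (g \<otimes> P {b \<in> S. f b < 0}) (e S (absval S f))"

text \<open>The image of \<open>chamber_chart g S\<close>. It depends on \<open>g\<close> only up to
  reflections in the walls of the face \<open>S\<close>.\<close>

definition A :: "'g \<Rightarrow> 'v set \<Rightarrow> ('g \<times> 'y) set set" where
  "A g S = {cls h x | h x. near S g h \<and> x \<in> star S}"

lemma P_closed': "S \<in> K \<Longrightarrow> T \<subseteq> S \<Longrightarrow> P T \<in> carrier G"
  using P_closed face_K by blast

lemma P_empty: "P {} = \<one>"
proof -
  have "P {} \<otimes> P {} = P {}" using P_mult[OF empty_K, of "{}" "{}"] by simp
  then show ?thesis using P_closed[OF empty_K] by (simp add: r_cancel_one)
qed

lemma P_square: "S \<in> K \<Longrightarrow> P S \<otimes> P S = \<one>"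
  using P_mult[of S S S] P_empty by simp

lemma near_refl: "g \<in> carrier G \<Longrightarrow> near S g g"
  unfolding near_def using P_empty by (intro exI[of _ "{}"]) simp

lemma near_mono: "near S g h \<Longrightarrow> S \<subseteq> S' \<Longrightarrow> near S' g h"
  unfolding near_def by auto

lemma near_closed: "S \<in> K \<Longrightarrow> g \<in> carrier G \<Longrightarrow> near S g h \<Longrightarrow> h \<in> carrier G"
  unfolding near_def using P_closed' by auto

lemma near_trans:
  assumes S: "S \<in> K" and g: "g \<in> carrier G" and "near S g h" "near S h k"
  shows "near S g k"
proof -
  obtain T T' where T: "T \<subseteq> S" "T' \<subseteq> S" "h = g \<otimes> P T" "k = h \<otimes> P T'"
    using assms(3,4) unfolding near_def by auto
  have "k = g \<otimes> P (sym_diff T T')"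
    unfolding T(3,4) P_mult[OF S T(1,2), symmetric] using S T g P_closed' by (intro m_assoc) auto
  then show ?thesis unfolding near_def using T(1,2) by (intro exI[of _ "sym_diff T T'"]) auto
qed

lemma near_sym:
  assumes S: "S \<in> K" and g: "g \<in> carrier G" and "near S g h"
  shows "near S h g"
proof -
  obtain T where T: "T \<subseteq> S" "h = g \<otimes> P T"
    using assms(3) unfolding near_def by auto
  have TK: "T \<in> K" using face_K[OF S T(1)] .
  have "h \<otimes> P T = g \<otimes> (P T \<otimes> P T)" unfolding T(2) using g P_closed[OF TK] by (intro m_assoc) auto
  then have "g = h \<otimes> P T" using P_square[OF TK] g by simp
  then show ?thesis unfolding near_def using T(1) by auto
qed

lemma near_mult: "S \<in> K \<Longrightarrow> g \<in> carrier G \<Longrightarrow> k \<in> carrier G \<Longrightarrow> near S g h \<Longrightarrow> near S (k \<otimes> g) (k \<otimes> h)"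
  unfolding near_def using P_closed' by (auto simp: m_assoc)

lemma near_P: "T \<subseteq> S \<Longrightarrow> near S g (g \<otimes> P T)"
  unfolding near_def by auto

lemma near_iff: "S \<in> K \<Longrightarrow> g \<in> carrier G \<Longrightarrow> h \<in> carrier G \<Longrightarrow> inv g \<otimes> h \<in> P ` Pow S \<longleftrightarrow> near S g h"
proof -
  assume *: "S \<in> K" "g \<in> carrier G" "h \<in> carrier G"
  have "inv g \<otimes> h = P T \<longleftrightarrow> h = g \<otimes> P T" if "T \<subseteq> S" for T
    using * P_closed'[OF _ that] inv_solve_left[of "P T" g h] by auto
  then show ?thesis unfolding near_def by auto
qed

lemma Rel_iff: "((g, x), (g', x')) \<in> Rel \<longleftrightarrow>
  g \<in> carrier G \<and> g' \<in> carrier G \<and> x \<in> topspace Y \<and> x = x' \<and> near (tau x) g g'"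
  unfolding Rel_def using near_iff[OF tau_K] by auto

lemma equiv_Rel: "equiv (carrier G \<times> topspace Y) Rel"
proof (rule equivI)
  show "Rel \<subseteq> (carrier G \<times> topspace Y) \<times> (carrier G \<times> topspace Y)" by (auto simp: Rel_def)
  show "refl_on (carrier G \<times> topspace Y) Rel"
    by (auto simp: refl_on_def Rel_iff near_refl)
  show "sym Rel" by (auto simp: sym_def Rel_iff intro: near_sym[OF tau_K])
  show "trans Rel"
  proof (rule transI, clarify)
    fix g x g' x' g'' x'' assume "((g, x), (g', x')) \<in> Rel" "((g', x'), (g'', x'')) \<in> Rel"
    then show "((g, x), (g'', x'')) \<in> Rel" using near_trans[OF tau_K, of x g g' g''] by (auto simp: Rel_iff)
  qed
qed

lemma equiv_Rel': "equiv (topspace (prod_topology (discrete_topology (carrier G)) Y)) Rel"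
  using equiv_Rel by simp

lemma cls_eq_iff:
  assumes "g \<in> carrier G" "x \<in> topspace Y" "g' \<in> carrier G" "x' \<in> topspace Y"
  shows "cls g x = cls g' x' \<longleftrightarrow> x = x' \<and> near (tau x) g g'"
  unfolding cls_def using eq_equiv_class_iff[OF equiv_Rel, of "(g, x)" "(g', x')"] assms by (auto simp: Rel_iff)

lemma topspace_D: "topspace D = {cls g x | g x. g \<in> carrier G \<and> x \<in> topspace Y}"
proof -
  have "topspace D = (\<lambda>z. Rel `` {z}) ` topspace (prod_topology (discrete_topology (carrier G)) Y)"
    unfolding D_def using quotient_imp_surjective_map[OF quotient_map_quotient_space[OF equiv_Rel']] by simp
  then show ?thesis by (auto simp: cls_def)
qed

lemma cls_in_D: "g \<in> carrier G \<Longrightarrow> x \<in> topspace Y \<Longrightarrow> cls g x \<in> topspace D"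
  by (auto simp: topspace_D)

lemma openin_D:
  "openin D U \<longleftrightarrow> U \<subseteq> topspace D \<and> (\<forall>g\<in>carrier G. openin Y {x \<in> topspace Y. cls g x \<in> U})"
proof -
  have q: "quotient_map (prod_topology (discrete_topology (carrier G)) Y) D (\<lambda>z. Rel `` {z})"
    unfolding D_def by (rule quotient_map_quotient_space[OF equiv_Rel'])
  have "openin D U \<longleftrightarrow> openin (prod_topology (discrete_topology (carrier G)) Y) {z \<in> carrier G \<times> topspace Y. Rel `` {z} \<in> U}"
    if "U \<subseteq> topspace D"
    using q that unfolding quotient_map_def by auto
  moreover have "{x \<in> topspace Y. (g, x) \<in> {z \<in> carrier G \<times> topspace Y. Rel `` {z} \<in> U}} = {x \<in> topspace Y. cls g x \<in> U}"
    if "g \<in> carrier G" for g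
    using that by (auto simp: cls_def)
  ultimately show ?thesis using openin_subset[of D U] unfolding openin_discrete_prod by (auto simp del: mem_Collect_eq)
qed

lemma continuous_map_from_D:
  assumes "\<And>g. g \<in> carrier G \<Longrightarrow> continuous_map Y Z (\<lambda>x. f (cls g x))"
  shows "continuous_map D Z f"
  unfolding continuous_map_def
proof (intro conjI allI impI)
  show "f \<in> topspace D \<rightarrow> topspace Z" using assms by (fastforce simp: topspace_D continuous_map_def Pi_iff)
  fix U assume U: "openin Z U"
  show "openin D {c \<in> topspace D. f c \<in> U}"
    unfolding openin_D
  proof (intro conjI ballI)
    fix g assume g: "g \<in> carrier G"
    have "{x \<in> topspace Y. cls g x \<in> {c \<in> topspace D. f c \<in> U}} = {x \<in> topspace Y. f (cls g x) \<in> U}"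
      using g cls_in_D by auto
    then show "openin Y {x \<in> topspace Y. cls g x \<in> {c \<in> topspace D. f c \<in> U}}"
      using openin_continuous_map_preimage[OF assms[OF g] U] by simp
  qed auto
qed

lemma cls_continuous: "g \<in> carrier G \<Longrightarrow> continuous_map Y D (cls g)"
  unfolding continuous_map_def using cls_in_D openin_D by auto

text \<open>\<open>T\<close> can differ from the set of negative coordinates only at zeros of
  \<open>f\<close>. The walls belonging to these pass through the point, so reflecting in them does
  not change its class.\<close>

lemma chamber_chart_orthant:
  assumes S: "S \<in> K" and g: "g \<in> carrier G" and f: "f \<in> topspace (region S)" and T: "T \<subseteq> S"
    and fT: "\<forall>b\<in>S. if b \<in> T then f b \<le> 0 else 0 \<le> f b"
  shows "chamber_chart g S f = cls (g \<otimes> P T) (e S (absval S f))"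
proof -
  let ?N = "{b \<in> S. f b < 0}"
  have a: "absval S f \<in> topspace (corner S)" using f by (rule absval_corner)
  have y: "e S (absval S f) \<in> topspace Y" using chart_in_star[OF S a] star_subset by blast
  have "tau (e S (absval S f)) = {b \<in> S. f b = 0}"
    unfolding tau_chart'[OF S a] using B_sub[OF S] by (auto simp: absval_def)
  moreover have "sym_diff ?N T \<subseteq> {b \<in> S. f b = 0}" using T fT by (force split: if_splits)
  moreover have "g \<otimes> P T = (g \<otimes> P ?N) \<otimes> P (sym_diff ?N T)"
  proof -
    have "P ?N \<otimes> P (sym_diff ?N T) = P (sym_diff ?N (sym_diff ?N T))"
      by (rule P_mult[OF S]) (use T in auto)
    also have "sym_diff ?N (sym_diff ?N T) = T" by auto
    finally have "P ?N \<otimes> P (sym_diff ?N T) = P T" .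
    moreover have "P ?N \<in> carrier G" "P (sym_diff ?N T) \<in> carrier G" by (rule P_closed'[OF S]; use T in auto)+
    ultimately show ?thesis using g m_assoc[of g "P ?N" "P (sym_diff ?N T)"] by simp
  qed
  ultimately have "near (tau (e S (absval S f))) (g \<otimes> P ?N) (g \<otimes> P T)" by (simp only: near_P)
  then show ?thesis
    unfolding chamber_chart_def using cls_eq_iff y g P_closed'[OF S, of ?N] P_closed'[OF S T] by simp
qed

lemma chamber_chart_flip:
  assumes S: "S \<in> K" and g: "g \<in> carrier G" and f: "f \<in> topspace (corner S)" and T: "T \<subseteq> S"
  shows "chamber_chart g S (flip S T f) = cls (g \<otimes> P T) (e S f)"
proof -
  have "\<forall>b\<in>S. if b \<in> T then flip S T f b \<le> 0 else 0 \<le> flip S T f b"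
    using f B_sub[OF S] by (force simp: flip_def topspace_corner)
  from chamber_chart_orthant[OF S g flip_region[OF T f] T this] show ?thesis
    by (simp add: absval_flip[OF f])
qed

text \<open>The closed orthants, one for each subset \<open>T\<close> of the finite set
  \<open>S\<close>, cover the region. On each of them the chart stays in one chamber, where it is
  the folded corner chart; on overlaps the pieces agree because both equal the chart.\<close>

lemma chamber_chart_continuous:
  assumes S: "S \<in> K" and g: "g \<in> carrier G"
  shows "continuous_map (region S) D (chamber_chart g S)"
proof (rule pasting_lemma_closed[where I = "Pow S"
      and T = "\<lambda>T. {f \<in> topspace (region S). \<forall>b\<in>S. if b \<in> T then f b \<le> 0 else 0 \<le> f b}"
      and f = "\<lambda>T f. cls (g \<otimes> P T) (e S (absval S f))"])
  show "finite (Pow S)" using finite_K[OF S] by simp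
next
  fix T assume T: "T \<in> Pow S"
  have *: "{f \<in> topspace (region S). \<forall>b\<in>S. if b \<in> T then f b \<le> 0 else 0 \<le> f b} =
    topspace (region S) \<inter> (\<Inter>b\<in>S. {f \<in> topspace (region S). f b \<in> (if b \<in> T then {..0} else {0..})})"
    by (auto split: if_splits)
  have c: "closedin (region S) {f \<in> topspace (region S). f b \<in> (if b \<in> T then {..0} else {0..})}" if "b \<in> S" for b
    by (rule closedin_continuous_map_preimage[OF region_component]) (use that B_sub[OF S] in auto)
  show "closedin (region S) {f \<in> topspace (region S). \<forall>b\<in>S. if b \<in> T then f b \<le> 0 else 0 \<le> f b}"
  proof (cases "S = {}")
    case False
    then show ?thesis unfolding * by (intro closedin_Int closedin_topspace closedin_Inter) (use c in auto)
  qed auto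
  have "continuous_map (region S) Y (\<lambda>f. e S (absval S f))"
    using continuous_map_compose[OF absval_continuous chart_continuous[OF S]] by (simp add: o_def)
  moreover have "g \<otimes> P T \<in> carrier G" using T g P_closed'[OF S] by auto
  ultimately have "continuous_map (region S) D (\<lambda>f. cls (g \<otimes> P T) (e S (absval S f)))"
    using continuous_map_compose[OF _ cls_continuous] by (fastforce simp: o_def)
  then show "continuous_map (subtopology (region S) {f \<in> topspace (region S). \<forall>b\<in>S. if b \<in> T then f b \<le> 0 else 0 \<le> f b}) D
    (\<lambda>f. cls (g \<otimes> P T) (e S (absval S f)))" by (rule continuous_map_from_subtopology)
next
  fix T T' f
  assume T: "T \<in> Pow S" "T' \<in> Pow S" and f: "f \<in> topspace (region S) \<inter>
    {f \<in> topspace (region S). \<forall>b\<in>S. if b \<in> T then f b \<le> 0 else 0 \<le> f b} \<inter>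
    {f \<in> topspace (region S). \<forall>b\<in>S. if b \<in> T' then f b \<le> 0 else 0 \<le> f b}"
  then show "cls (g \<otimes> P T) (e S (absval S f)) = cls (g \<otimes> P T') (e S (absval S f))"
    using chamber_chart_orthant[OF S g, of f T] chamber_chart_orthant[OF S g, of f T'] by auto
next
  fix f assume "f \<in> topspace (region S)"
  then show "\<exists>T. T \<in> Pow S \<and> f \<in> {f \<in> topspace (region S). \<forall>b\<in>S. if b \<in> T then f b \<le> 0 else 0 \<le> f b} \<and>
      chamber_chart g S f = cls (g \<otimes> P T) (e S (absval S f))"
    by (intro exI[of _ "{b \<in> S. f b < 0}"]) (auto simp: chamber_chart_def)
qed

text \<open>Points with the same class have the same folded coordinates, and their chambers differ
  by reflections in a set \<open>T\<close> of zero coordinates. Injectivity of \<open>P\<close> on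
  the subsets of \<open>S\<close> then forces the signs to agree wherever \<open>f\<close> is
  nonzero.\<close>

lemma chamber_chart_inj:
  assumes S: "S \<in> K" and g: "g \<in> carrier G"
  shows "inj_on (chamber_chart g S) (topspace (region S))"
proof (rule inj_onI)
  fix f f' assume f: "f \<in> topspace (region S)" and f': "f' \<in> topspace (region S)"
    and eq: "chamber_chart g S f = chamber_chart g S f'"
  let ?N = "{b \<in> S. f b < 0}" and ?N' = "{b \<in> S. f' b < 0}"
  have a: "absval S f \<in> topspace (corner S)" "absval S f' \<in> topspace (corner S)" using f f' absval_corner by auto
  have y: "e S (absval S f) \<in> topspace Y" "e S (absval S f') \<in> topspace Y"
    using chart_in_star[OF S] a star_subset by blast+
  have N: "?N \<subseteq> S" "?N' \<subseteq> S" by auto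
  have PN: "P ?N \<in> carrier G" "P ?N' \<in> carrier G" using P_closed'[OF S] N by auto
  have gP: "g \<otimes> P ?N \<in> carrier G" "g \<otimes> P ?N' \<in> carrier G" using g PN by auto
  have e: "e S (absval S f) = e S (absval S f')" and n: "near (tau (e S (absval S f))) (g \<otimes> P ?N) (g \<otimes> P ?N')"
    using eq unfolding chamber_chart_def using cls_eq_iff[OF gP(1) y(1) gP(2) y(2)] by auto
  have ab: "absval S f = absval S f'" using inj_onD[OF chart_inj[OF S] e a] .
  have abb: "\<bar>f b\<bar> = \<bar>f' b\<bar>" if "b \<in> B S" for b using fun_cong[OF ab, of b] that by (simp add: absval_def)
  have tau: "tau (e S (absval S f)) = {b \<in> S. f b = 0}"
    unfolding tau_chart'[OF S a(1)] using B_sub[OF S] by (auto simp: absval_def)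
  obtain T where T: "T \<subseteq> {b \<in> S. f b = 0}" "g \<otimes> P ?N' = g \<otimes> P ?N \<otimes> P T"
    using n unfolding near_def tau by auto
  have TS: "T \<subseteq> S" using T by auto
  have "g \<otimes> P ?N \<otimes> P T = g \<otimes> (P ?N \<otimes> P T)" using g PN P_closed'[OF S TS] by (intro m_assoc) auto
  then have "P ?N' = P (sym_diff ?N T)"
  proof -
    have c: "P (sym_diff ?N T) \<in> carrier G" by (rule P_closed'[OF S]) (use TS in auto)
    assume "g \<otimes> P ?N \<otimes> P T = g \<otimes> (P ?N \<otimes> P T)"
    then have "g \<otimes> P ?N' = g \<otimes> P (sym_diff ?N T)" unfolding P_mult[OF S N(1) TS] T(2)[symmetric] .
    from arg_cong[OF this, of "\<lambda>z. inv g \<otimes> z"] show ?thesis using g PN c by (simp only: m_assoc[symmetric] inv_closed l_inv l_one)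
  qed
  then have N': "?N' = sym_diff ?N T" by (rule inj_onD[OF P_inj[OF S]]) (use TS in auto)
  show "f = f'"
  proof (rule extensionalityI[of _ "B S"])
    show "f \<in> extensional (B S)" "f' \<in> extensional (B S)" using f f' by (auto simp: topspace_region)
    fix b assume b: "b \<in> B S"
    show "f b = f' b"
    proof (cases "b \<in> S")
      case True
      show ?thesis
      proof (cases "f b = 0")
        case False
        then have "b \<notin> T" using T by auto
        then have "f' b < 0 \<longleftrightarrow> f b < 0" using N' True by auto
        then show ?thesis using abb[OF b] by (auto simp: abs_if split: if_splits)
      qed (use abb[OF b] in auto)
    next
      case False
      then have "0 < f b" "0 < f' b" using f f' b by (auto simp: topspace_region)
      then show ?thesis using abb[OF b] by auto
    qed
  qed
qed

lemma chamber_chart_image: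
  assumes S: "S \<in> K" and g: "g \<in> carrier G"
  shows "chamber_chart g S ` topspace (region S) = A g S"
proof (intro equalityI subsetI)
  fix c assume "c \<in> chamber_chart g S ` topspace (region S)"
  then obtain f where f: "f \<in> topspace (region S)" "c = chamber_chart g S f" by auto
  show "c \<in> A g S"
    unfolding f(2) chamber_chart_def A_def
    using near_P[of "{b \<in> S. f b < 0}" S g] chart_in_star[OF S absval_corner[OF f(1)]] by blast
next
  fix c assume "c \<in> A g S"
  then obtain h x where c: "c = cls h x" "near S g h" "x \<in> star S" by (auto simp: A_def)
  obtain T where T: "T \<subseteq> S" "h = g \<otimes> P T" using c by (auto simp: near_def)
  obtain f where f: "f \<in> topspace (corner S)" "x = e S f" using c chart_image[OF S] by auto
  have "c = chamber_chart g S (flip S T f)" unfolding c(1) T(2) f(2) by (rule chamber_chart_flip[OF S g f(1) T(1), symmetric])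
  then show "c \<in> chamber_chart g S ` topspace (region S)" using flip_region[OF T(1) f(1)] by auto
qed

text \<open>Openness is tested in each chamber \<open>h\<close>. If \<open>h\<close> is not around
  the corner, the image has no point in it; otherwise \<open>h\<close> is \<open>g\<close> times
  some \<open>P T\<close>, and the part of the image in \<open>h\<close> is the corner chart applied
  to the preimage of the open set under \<open>flip S T\<close>.\<close>

lemma chamber_chart_open:
  assumes S: "S \<in> K" and g: "g \<in> carrier G"
  shows "open_map (region S) D (chamber_chart g S)"
  unfolding open_map_def
proof (intro allI impI)
  fix U assume U: "openin (region S) U"
  have UR: "U \<subseteq> topspace (region S)" using openin_subset[OF U] .
  show "openin D (chamber_chart g S ` U)"
    unfolding openin_D
  proof (intro conjI ballI)
    show "chamber_chart g S ` U \<subseteq> topspace D"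
      using UR chamber_chart_continuous[OF S g] by (auto simp: continuous_map_def Pi_iff)
    fix h assume h: "h \<in> carrier G"
    show "openin Y {x \<in> topspace Y. cls h x \<in> chamber_chart g S ` U}"
    proof (cases "near S g h")
      case False
      have "{x \<in> topspace Y. cls h x \<in> chamber_chart g S ` U} = {}"
      proof (rule ccontr)
        assume "{x \<in> topspace Y. cls h x \<in> chamber_chart g S ` U} \<noteq> {}"
        then obtain x f where x: "x \<in> topspace Y" "cls h x = chamber_chart g S f" "f \<in> U" by blast
        have a: "absval S f \<in> topspace (corner S)" using UR x absval_corner by auto
        have y: "e S (absval S f) \<in> star S" using chart_in_star[OF S a] .
        let ?N = "{b \<in> S. f b < 0}"
        have PN: "g \<otimes> P ?N \<in> carrier G" using g P_closed'[OF S, of ?N] by auto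
        have "near (tau x) h (g \<otimes> P ?N)" "x = e S (absval S f)"
          using x(2) unfolding chamber_chart_def using cls_eq_iff[OF h x(1) PN] y star_subset by auto
        moreover have "tau (e S (absval S f)) \<subseteq> S" using y by (simp add: star_def)
        ultimately have "near S h (g \<otimes> P ?N)" using near_mono by blast
        then have "near S (g \<otimes> P ?N) h" by (rule near_sym[OF S h])
        moreover have "near S g (g \<otimes> P ?N)" by (rule near_P) auto
        ultimately show False using False near_trans[OF S g] by blast
      qed
      then show ?thesis by (simp only: openin_empty)
    next
      case True
      then obtain T where T: "T \<subseteq> S" "h = g \<otimes> P T" by (auto simp: near_def)
      let ?C = "{c \<in> topspace (corner S). flip S T c \<in> U}"
      have "{x \<in> topspace Y. cls h x \<in> chamber_chart g S ` U} = e S ` ?C"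
      proof (intro equalityI subsetI)
        fix x assume "x \<in> e S ` ?C"
        then obtain c where c: "c \<in> topspace (corner S)" "flip S T c \<in> U" "x = e S c" by auto
        have "cls h x = chamber_chart g S (flip S T c)"
          unfolding T(2) c(3) by (rule chamber_chart_flip[OF S g c(1) T(1), symmetric])
        then show "x \<in> {x \<in> topspace Y. cls h x \<in> chamber_chart g S ` U}"
          using c chart_in_star[OF S c(1)] star_subset by auto
      next
        fix x assume "x \<in> {x \<in> topspace Y. cls h x \<in> chamber_chart g S ` U}"
        then obtain f where x: "x \<in> topspace Y" "cls h x = chamber_chart g S f" "f \<in> U" by auto
        have fR: "f \<in> topspace (region S)" using UR x by auto
        have a: "absval S f \<in> topspace (corner S)" using fR by (rule absval_corner)
        have y: "e S (absval S f) \<in> topspace Y" using chart_in_star[OF S a] star_subset by blast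
        have PN: "g \<otimes> P {b \<in> S. f b < 0} \<in> carrier G" using g P_closed'[OF S, of "{b \<in> S. f b < 0}"] by auto
        have xe: "x = e S (absval S f)"
          using x(2) unfolding chamber_chart_def using cls_eq_iff[OF h x(1) PN y] by auto
        have "chamber_chart g S (flip S T (absval S f)) = chamber_chart g S f"
          using chamber_chart_flip[OF S g a T(1)] x(2) by (simp add: T(2) xe)
        then have "flip S T (absval S f) = f"
          by (rule inj_onD[OF chamber_chart_inj[OF S g]]) (use flip_region[OF T(1) a] fR in auto)
        then show "x \<in> e S ` ?C" using a x(3) xe by (intro image_eqI[of _ _ "absval S f"]) auto
      qed
      moreover have "openin (corner S) ?C" by (rule openin_continuous_map_preimage[OF flip_continuous[OF T(1)] U])
      ultimately show ?thesis using chart_open[OF S] by simp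
    qed
  qed
qed

lemma chamber_chart_homeo:
  assumes S: "S \<in> K" and g: "g \<in> carrier G"
  shows "homeomorphic_map (region S) (subtopology D (A g S)) (chamber_chart g S)"
  using injective_open_imp_embedding_map[OF chamber_chart_continuous[OF S g] chamber_chart_open[OF S g] chamber_chart_inj[OF S g]]
  unfolding embedding_map_def chamber_chart_image[OF S g] .

lemma A_open:
  assumes S: "S \<in> K" and g: "g \<in> carrier G"
  shows "openin D (A g S)"
  using chamber_chart_open[OF S g] openin_topspace[of "region S"]
  unfolding open_map_def chamber_chart_image[OF S g, symmetric] by blast

lemma A_memI: "near S g h \<Longrightarrow> x \<in> star S \<Longrightarrow> cls h x \<in> A g S"
  by (auto simp: A_def)

text \<open>The star is homeomorphic to the convex \<open>region S\<close>, so only the endpoints of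
  a path in it matter.\<close>

lemma A_path_hom:
  assumes S: "S \<in> K" and g: "g \<in> carrier G"
    and p: "pathin (subtopology D (A g S)) p" and q: "pathin (subtopology D (A g S)) q"
    and "p 0 = q 0" "p 1 = q 1"
  shows "path_hom D p q"
proof -
  let ?E = "subtopology D (A g S)"
  obtain k where k: "homeomorphic_maps (region S) ?E (chamber_chart g S) k"
    using chamber_chart_homeo[OF S g] homeomorphic_map_maps by blast
  then have ck: "continuous_map ?E (region S) k" and cc: "continuous_map (region S) ?E (chamber_chart g S)"
    and kk: "\<And>z. z \<in> topspace ?E \<Longrightarrow> chamber_chart g S (k z) = z"
    by (auto simp: homeomorphic_maps_def)
  have "path_hom (region S) (k \<circ> p) (k \<circ> q)"
    by (rule region_path_hom) (use pathin_compose[OF p ck] pathin_compose[OF q ck] assms(5,6) in auto)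
  from path_hom_compose[OF this cc] have 1: "path_hom ?E (chamber_chart g S \<circ> (k \<circ> p)) (chamber_chart g S \<circ> (k \<circ> q))" .
  have 2: "path_hom ?E r (chamber_chart g S \<circ> (k \<circ> r))" if r: "pathin ?E r" for r
  proof (rule path_hom_eq[OF r])
    fix t :: real assume "t \<in> {0..1}"
    then have "r t \<in> topspace ?E" using path_image_subset_topspace[OF r] by (simp only: Pi_iff)
    then show "r t = (chamber_chart g S \<circ> (k \<circ> r)) t" using kk by simp
  qed
  show ?thesis
    by (rule path_hom_subtopology[OF path_hom_trans[OF path_hom_trans[OF 2[OF p] 1] path_hom_sym[OF 2[OF q]]]])
qed

lemma A_path:
  assumes S: "S \<in> K" and g: "g \<in> carrier G" and y: "y \<in> A g S" "z \<in> A g S"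
  shows "\<exists>p. pathin (subtopology D (A g S)) p \<and> p 0 = y \<and> p 1 = z"
proof -
  obtain f f' where f: "f \<in> topspace (region S)" "f' \<in> topspace (region S)"
    "y = chamber_chart g S f" "z = chamber_chart g S f'"
    using y unfolding chamber_chart_image[OF S g, symmetric] by auto
  obtain p where p: "pathin (region S) p" "p 0 = f" "p 1 = f'" using region_path[OF f(1,2)] by auto
  have "pathin (subtopology D (A g S)) (chamber_chart g S \<circ> p)"
    by (rule pathin_compose[OF p(1) homeomorphic_imp_continuous_map[OF chamber_chart_homeo[OF S g]]])
  then show ?thesis using p f by (intro exI[of _ "chamber_chart g S \<circ> p"]) auto
qed

end

section \<open>Paths in a development as words of wall crossings\<close>

text \<open>The congruence on words generated by the relations of \<open>W(\<Delta>)\<close>.\<close>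

inductive cox_eq :: "'v set set \<Rightarrow> 'v list \<Rightarrow> 'v list \<Rightarrow> bool" for K where
  refl: "w \<in> lists {v. {v} \<in> K} \<Longrightarrow> cox_eq K w w"
| sym: "cox_eq K u w \<Longrightarrow> cox_eq K w u"
| trans: "cox_eq K u v \<Longrightarrow> cox_eq K v w \<Longrightarrow> cox_eq K u w"
| square: "u \<in> lists {v. {v} \<in> K} \<Longrightarrow> w \<in> lists {v. {v} \<in> K} \<Longrightarrow> {a} \<in> K \<Longrightarrow> cox_eq K (u @ [a, a] @ w) (u @ w)"
| commute: "u \<in> lists {v. {v} \<in> K} \<Longrightarrow> w \<in> lists {v. {v} \<in> K} \<Longrightarrow> {a, b} \<in> K \<Longrightarrow>
    cox_eq K (u @ [a, b, a, b] @ w) (u @ w)"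

lemma pathin_subtopology_mono:
  "pathin (subtopology X S) p \<Longrightarrow> S \<subseteq> T \<Longrightarrow> pathin (subtopology X T) p"
  by (auto simp: pathin_subtopology)

lemma pathin_subtopologyD: "pathin (subtopology X S) p \<Longrightarrow> pathin X p"
  by (simp add: pathin_subtopology)

context development_space
begin

text \<open>A point of the open stratum, with all coordinates 1. It lies on no wall, hence in every
  star, and its copies in the chambers are pairwise different: they serve as chamber
  centres.\<close>

definition x0 :: 'y where "x0 = e {} (\<lambda>b\<in>B {}. 1)"

abbreviation vertices :: "'v set" where "vertices \<equiv> {v. {v} \<in> K}"

definition ev :: "'v list \<Rightarrow> 'g" where "ev vs = lword G (\<lambda>v. P {v}) vs"

lemma x0_star: "x0 \<in> star {}"
  unfolding x0_def by (rule chart_in_star[OF empty_K]) (auto simp: topspace_corner)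

lemma x0_star': "x0 \<in> star S"
  using x0_star by (auto simp: star_def)

lemma x0_Y: "x0 \<in> topspace Y"
  using x0_star by (simp add: star_def)

lemma tau_x0: "tau x0 = {}"
  using x0_star by (simp add: star_def)

lemma cls_x0_eq_iff: "g \<in> carrier G \<Longrightarrow> h \<in> carrier G \<Longrightarrow> cls g x0 = cls h x0 \<longleftrightarrow> g = h"
  using cls_eq_iff[of g x0 h x0] x0_Y by (auto simp: tau_x0 near_def P_empty)

lemma ev_Nil [simp]: "ev [] = \<one>" and ev_Cons [simp]: "ev (v # vs) = P {v} \<otimes> ev vs"
  by (simp_all add: ev_def)

lemma ev_closed: "vs \<in> lists vertices \<Longrightarrow> ev vs \<in> carrier G"
  unfolding ev_def by (rule lword_closed) (auto intro: P_closed)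

lemma ev_append: "us \<in> lists vertices \<Longrightarrow> vs \<in> lists vertices \<Longrightarrow> ev (us @ vs) = ev us \<otimes> ev vs"
  unfolding ev_def by (rule lword_append) (auto intro: P_closed)

lemma face_vertices: "S \<in> K \<Longrightarrow> set vs \<subseteq> S \<Longrightarrow> vs \<in> lists vertices"
  using face_K by (auto simp: in_lists_conv_set)

lemma ev_distinct:
  assumes S: "S \<in> K"
  shows "distinct vs \<Longrightarrow> set vs \<subseteq> S \<Longrightarrow> ev vs = P (set vs)"
proof (induction vs)
  case (Cons v vs)
  have "P {v} \<otimes> P (set vs) = P (sym_diff {v} (set vs))"
    by (rule P_mult[OF S]) (use Cons.prems in auto)
  also have "sym_diff {v} (set vs) = set (v # vs)" using Cons.prems by auto
  finally show ?case using Cons by simp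
qed (simp add: P_empty)

lemma ev_face:
  assumes S: "S \<in> K" and T: "T \<subseteq> S"
  obtains vs where "set vs = T" "vs \<in> lists vertices" "ev vs = P T"
proof -
  have "finite T" using finite_K[OF S] T finite_subset by blast
  then obtain vs where vs: "set vs = T" "distinct vs" using finite_distinct_list by blast
  show ?thesis
    by (rule that[OF vs(1) face_vertices[OF S]]) (use vs T ev_distinct[OF S vs(2)] in auto)
qed

lemma A_mono:
  assumes S: "S \<in> K" and g: "g \<in> carrier G" and gk: "near S g k" and S': "S' \<subseteq> S"
  shows "A k S' \<subseteq> A g S"
proof
  fix c assume "c \<in> A k S'"
  then obtain h x where c: "c = cls h x" "near S' k h" "x \<in> star S'" by (auto simp: A_def)
  have "near S g h" by (rule near_trans[OF S g gk near_mono[OF c(2) S']])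
  moreover have "x \<in> star S" using c(3) S' by (auto simp: star_def)
  ultimately show "c \<in> A g S" unfolding c(1) by (rule A_memI)
qed

text \<open>Membership in \<open>A g S\<close> is existential in the representative, so the given
  chamber must be compared with the witness. Both represent the same point, and its walls belong to
  \<open>S\<close>.\<close>

lemma A_memD:
  assumes S: "S \<in> K" and g: "g \<in> carrier G" and h: "h \<in> carrier G" and x: "x \<in> topspace Y"
    and c: "cls h x \<in> A g S"
  shows "near S g h" "x \<in> star S"
proof -
  obtain k y where k: "cls h x = cls k y" "near S g k" "y \<in> star S" using c by (auto simp: A_def)
  have kc: "k \<in> carrier G" using near_closed[OF S g k(2)] .
  have yY: "y \<in> topspace Y" using k(3) star_subset by blast
  have xy: "x = y" "near (tau x) h k" using k(1) cls_eq_iff[OF h x kc yY] by auto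
  then show xs: "x \<in> star S" using k(3) by simp
  then have "near S h k" using xy(2) near_mono by (simp add: star_def)
  then show "near S g h" by (rule near_trans[OF S g k(2) near_sym[OF S h]])
qed

text \<open>A crossing of the wall \<open>v\<close> from the centre of chamber \<open>g\<close> to
  the centre of the adjacent chamber. Any two choices are homotopic, as they lie in one
  star.\<close>

definition edge :: "'g \<Rightarrow> 'v \<Rightarrow> real \<Rightarrow> ('g \<times> 'y) set" where
  "edge g v = (SOME p. pathin (subtopology D (A g {v})) p \<and> p 0 = cls g x0 \<and> p 1 = cls (g \<otimes> P {v}) x0)"

lemma edge:
  assumes "{v} \<in> K" "g \<in> carrier G"
  shows "pathin (subtopology D (A g {v})) (edge g v) \<and> edge g v 0 = cls g x0 \<and> edge g v 1 = cls (g \<otimes> P {v}) x0"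
proof -
  have "\<exists>p. pathin (subtopology D (A g {v})) p \<and> p 0 = cls g x0 \<and> p 1 = cls (g \<otimes> P {v}) x0"
    by (rule A_path[OF assms A_memI[OF near_refl[OF assms(2)] x0_star'] A_memI[OF near_P x0_star']]) simp
  then show ?thesis unfolding edge_def by (rule someI_ex)
qed

text \<open>Letters name walls as seen from the current chamber. Crossing therefore multiplies on
  the right, and the word is read from left to right.\<close>

primrec wpath :: "'v list \<Rightarrow> 'g \<Rightarrow> real \<Rightarrow> ('g \<times> 'y) set" where
  "wpath [] g = (\<lambda>_. cls g x0)"
| "wpath (v # vs) g = path_concat (edge g v) (wpath vs (g \<otimes> P {v}))"

lemma wpath_0: "vs \<in> lists vertices \<Longrightarrow> g \<in> carrier G \<Longrightarrow> wpath vs g 0 = cls g x0"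
  by (cases vs) (auto simp: edge)

lemma wpath_1: "vs \<in> lists vertices \<Longrightarrow> g \<in> carrier G \<Longrightarrow> wpath vs g 1 = cls (g \<otimes> ev vs) x0"
proof (induction vs arbitrary: g)
  case (Cons v vs)
  then have "P {v} \<in> carrier G" "ev vs \<in> carrier G" by (auto intro: P_closed ev_closed)
  then show ?case using Cons by (simp add: m_assoc)
qed simp

text \<open>Crossing walls of \<open>S\<close> only leads to chambers around the same corner, so the
  whole path can be deformed inside one star.\<close>

lemma wpath_in_A:
  assumes S: "S \<in> K" and g: "g \<in> carrier G"
  shows "set vs \<subseteq> S \<Longrightarrow> near S g k \<Longrightarrow> pathin (subtopology D (A g S)) (wpath vs k)"
proof (induction vs arbitrary: k)
  case Nil
  then have "cls k x0 \<in> A g S" using A_memI x0_star' by blast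
  moreover have "A g S \<subseteq> topspace D" using openin_subset[OF A_open[OF S g]] .
  ultimately show ?case by auto
next
  case (Cons v vs)
  have k: "k \<in> carrier G" using near_closed[OF S g] Cons.prems by blast
  have v: "{v} \<in> K" "{v} \<subseteq> S" using face_K[OF S, of "{v}"] Cons.prems by auto
  have Pv: "P {v} \<in> carrier G" by (rule P_closed[OF v(1)])
  have n: "near S g (k \<otimes> P {v})" by (rule near_trans[OF S g Cons.prems(2) near_P[OF v(2)]])
  have 1: "pathin (subtopology D (A g S)) (edge k v)"
    by (rule pathin_subtopology_mono[OF conjunct1[OF edge[OF v(1) k]] A_mono[OF S g Cons.prems(2) v(2)]])
  have 2: "pathin (subtopology D (A g S)) (wpath vs (k \<otimes> P {v}))"
    by (rule Cons.IH[OF _ n]) (use Cons.prems in auto)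
  have 3: "edge k v 1 = wpath vs (k \<otimes> P {v}) 0"
    using edge[OF v(1) k] wpath_0[OF face_vertices[OF S]] Cons.prems k Pv by simp
  show ?case unfolding wpath.simps by (rule pathin_concat[OF 1 2 3])
qed

lemma wpath_pathin: "vs \<in> lists vertices \<Longrightarrow> g \<in> carrier G \<Longrightarrow> pathin D (wpath vs g)"
proof (induction vs arbitrary: g)
  case Nil
  then show ?case using cls_in_D x0_Y by simp
next
  case (Cons v vs)
  then have v: "{v} \<in> K" "vs \<in> lists vertices" "P {v} \<in> carrier G" by (auto intro: P_closed)
  show ?case unfolding wpath.simps
    by (rule pathin_concat[OF pathin_subtopologyD[OF conjunct1[OF edge[OF v(1) Cons.prems(2)]]] Cons.IH[OF v(2)]])
      (use Cons.prems v edge[OF v(1) Cons.prems(2)] wpath_0[OF v(2)] in auto)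
qed

lemma wpath_append:
  "us \<in> lists vertices \<Longrightarrow> vs \<in> lists vertices \<Longrightarrow> g \<in> carrier G \<Longrightarrow>
   path_hom D (wpath (us @ vs) g) (path_concat (wpath us g) (wpath vs (g \<otimes> ev us)))"
proof (induction us arbitrary: g)
  case Nil
  show ?case
    using path_hom_sym[OF path_hom_lid[OF wpath_pathin[OF Nil(2,3)], of "cls g x0"]] wpath_0[OF Nil(2,3)] Nil(3)
    by simp
next
  case (Cons u us)
  then have u: "{u} \<in> K" "us \<in> lists vertices" "P {u} \<in> carrier G" "ev us \<in> carrier G"
    by (auto intro: P_closed ev_closed)
  let ?g = "g \<otimes> P {u}"
  have g: "?g \<in> carrier G" using u Cons.prems by auto
  note ed = edge[OF u(1) Cons.prems(3)]
  have pe: "pathin D (edge g u)" using pathin_subtopologyD[OF conjunct1[OF ed]] .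
  have e1: "edge g u 1 = wpath (us @ vs) ?g 0"
    using ed wpath_0[of "us @ vs" ?g] u Cons.prems g by simp
  have e2: "edge g u 1 = wpath us ?g 0" using ed wpath_0[OF u(2) g] by simp
  have e3: "wpath us ?g 1 = wpath vs (?g \<otimes> ev us) 0"
    using wpath_1[OF u(2) g] wpath_0[OF Cons.prems(2)] g u by simp
  have "path_hom D (wpath ((u # us) @ vs) g) (path_concat (edge g u) (path_concat (wpath us ?g) (wpath vs (?g \<otimes> ev us))))"
    using path_hom_concat[OF path_hom_refl[OF pe] Cons.IH[OF u(2) Cons.prems(2) g] e1] by simp
  also have "path_hom D \<dots> (path_concat (path_concat (edge g u) (wpath us ?g)) (wpath vs (?g \<otimes> ev us)))"
    by (rule path_hom_sym[OF path_hom_assoc[OF pe wpath_pathin[OF u(2) g] wpath_pathin[OF Cons.prems(2)] e2 e3]])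
      (use g u in auto)
  also have "?g \<otimes> ev us = g \<otimes> ev (u # us)" using u Cons.prems by (simp add: m_assoc)
  finally show ?case by simp
qed

text \<open>The letters of \<open>z\<close> are walls of one face, so this part of the path stays in
  one star; as \<open>ev z\<close> is trivial it is a closed loop there and contracts. Both kinds of
  moves of \<open>cox_eq\<close> are of this form.\<close>

lemma wpath_trivial:
  assumes S: "S \<in> K" and z: "set z \<subseteq> S" "ev z = \<one>" and u: "u \<in> lists vertices" and w: "w \<in> lists vertices"
    and g: "g \<in> carrier G"
  shows "path_hom D (wpath (u @ z @ w) g) (wpath (u @ w) g)"
proof -
  let ?k = "g \<otimes> ev u"
  have zl: "z \<in> lists vertices" using face_vertices[OF S z(1)] .
  have k: "?k \<in> carrier G" using g ev_closed[OF u] by simp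
  have kz: "?k \<otimes> ev z = ?k" using z(2) k by simp
  have pz: "path_hom D (wpath z ?k) (\<lambda>_. cls ?k x0)"
  proof (rule A_path_hom[OF S k wpath_in_A[OF S k z(1) near_refl[OF k]]])
    show "pathin (subtopology D (A ?k S)) (\<lambda>_. cls ?k x0)"
      using wpath_in_A[OF S k _ near_refl[OF k], of "[]"] by simp
  qed (use wpath_0[OF zl k] wpath_1[OF zl k] kz in auto)
  have "path_hom D (wpath (u @ z @ w) g) (path_concat (wpath u g) (wpath (z @ w) ?k))"
    by (rule wpath_append[OF u _ g]) (use zl w in auto)
  also have "path_hom D \<dots> (path_concat (wpath u g) (wpath w ?k))"
  proof (rule path_hom_concat[OF path_hom_refl[OF wpath_pathin[OF u g]]])
    have "path_hom D (wpath (z @ w) ?k) (path_concat (wpath z ?k) (wpath w ?k))"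
      using wpath_append[OF zl w k] unfolding kz .
    also have "path_hom D \<dots> (path_concat (\<lambda>_. cls ?k x0) (wpath w ?k))"
      by (rule path_hom_concat[OF pz path_hom_refl[OF wpath_pathin[OF w k]]])
        (use wpath_0[OF w k] wpath_1[OF zl k] kz in simp)
    also have "path_hom D \<dots> (wpath w ?k)"
      by (rule path_hom_lid[OF wpath_pathin[OF w k]]) (use wpath_0[OF w k] in simp)
    finally show "path_hom D (wpath (z @ w) ?k) (wpath w ?k)" .
    show "wpath u g 1 = wpath (z @ w) ?k 0"
      using wpath_1[OF u g] wpath_0[of "z @ w" ?k] zl w k by simp
  qed
  also have "path_hom D \<dots> (wpath (u @ w) g)"
    by (rule path_hom_sym[OF wpath_append[OF u w g]])
  finally show ?thesis .
qed

lemma ev_square: "{a} \<in> K \<Longrightarrow> ev [a, a] = \<one>"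
  using P_square[of "{a}"] P_closed[of "{a}"] by simp

lemma ev_commute:
  assumes K: "{a, b} \<in> K"
  shows "ev [a, b, a, b] = \<one>"
proof -
  have c: "P {a} \<in> carrier G" "P {b} \<in> carrier G" using P_closed'[OF K] by auto
  have ab: "P {a} \<otimes> P {b} = P (sym_diff {a} {b})" by (rule P_mult[OF K]) auto
  have "P (sym_diff {a} {b}) \<otimes> P (sym_diff {a} {b}) = \<one>" by (rule P_square[OF face_K[OF K]]) auto
  then have "(P {a} \<otimes> P {b}) \<otimes> (P {a} \<otimes> P {b}) = \<one>" unfolding ab .
  then show ?thesis using c by (simp add: m_assoc)
qed

lemma wpath_cox:
  assumes "cox_eq K u w"
  shows "u \<in> lists vertices \<and> w \<in> lists vertices \<and> (\<forall>g\<in>carrier G. path_hom D (wpath u g) (wpath w g))"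
  using assms
proof (induction rule: cox_eq.induct)
  case (refl w)
  then show ?case using path_hom_refl[OF wpath_pathin] by blast
next
  case (sym u w)
  then show ?case using path_hom_sym by fast
next
  case (trans u v w)
  have "path_hom D (wpath u g) (wpath w g)" if "g \<in> carrier G" for g
    using path_hom_trans[of D "wpath u g" "wpath v g" "wpath w g"] trans that by simp
  then show ?case using trans by simp
next
  case (square u w a)
  have "path_hom D (wpath (u @ [a, a] @ w) g) (wpath (u @ w) g)" if "g \<in> carrier G" for g
    by (rule wpath_trivial[OF square(3)]) (use square that ev_square[OF square(3)] in auto)
  then show ?case using square by auto
next
  case (commute u w a b)
  have "path_hom D (wpath (u @ [a, b, a, b] @ w) g) (wpath (u @ w) g)" if "g \<in> carrier G" for g
    by (rule wpath_trivial[OF commute(3)]) (use commute that ev_commute[OF commute(3)] in auto)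
  moreover have "{a} \<in> K" "{b} \<in> K" using face_K[OF commute(3)] by auto
  ultimately show ?case using commute by auto
qed

text \<open>A connection from the centre of chamber \<open>g\<close> to a point of that chamber,
  inside the star of the point. It lets subpaths with arbitrary ends be compared with paths through
  chamber centres.\<close>

definition bet :: "'g \<Rightarrow> 'y \<Rightarrow> real \<Rightarrow> ('g \<times> 'y) set" where
  "bet g x = (SOME p. pathin (subtopology D (A g (tau x))) p \<and> p 0 = cls g x0 \<and> p 1 = cls g x)"

lemma bet:
  assumes "g \<in> carrier G" "x \<in> topspace Y"
  shows "pathin (subtopology D (A g (tau x))) (bet g x) \<and> bet g x 0 = cls g x0 \<and> bet g x 1 = cls g x"
proof -
  have "x \<in> star (tau x)" using assms by (simp add: star_def)
  then have "\<exists>p. pathin (subtopology D (A g (tau x))) p \<and> p 0 = cls g x0 \<and> p 1 = cls g x"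
    by (intro A_path[OF tau_K assms(1)] A_memI near_refl assms x0_star')
  then show ?thesis unfolding bet_def by (rule someI_ex)
qed

lemma topspace_D_cases:
  assumes "z \<in> topspace D"
  obtains g x where "g \<in> carrier G" "x \<in> topspace Y" "z = cls g x"
  using assms by (auto simp: topspace_D)

text \<open>Bisection of the parameter interval. The bisected property \<open>Q\<close> quantifies
  over all representatives of both ends: a cut point on a wall belongs to several chambers, and the
  two halves must be read from the same one.\<close>

lemma path_word:
  assumes p: "pathin D p" and g: "g \<in> carrier G" "x \<in> topspace Y" "p 0 = cls g x"
    and g': "g' \<in> carrier G" "x' \<in> topspace Y" "p 1 = cls g' x'"
  shows "\<exists>w\<in>lists vertices. g' = g \<otimes> ev w \<and>
    path_hom D (path_concat (wpath w g) (bet g' x')) (path_concat (bet g x) p)"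
proof -
  define Q where "Q a b \<longleftrightarrow> 0 \<le> a \<and> b \<le> 1 \<longrightarrow> (\<forall>g\<in>carrier G. \<forall>x\<in>topspace Y. \<forall>g'\<in>carrier G. \<forall>x'\<in>topspace Y.
     p a = cls g x \<longrightarrow> p b = cls g' x' \<longrightarrow> (\<exists>w\<in>lists vertices. g' = g \<otimes> ev w \<and>
    path_hom D (path_concat (wpath w g) (bet g' x')) (path_concat (bet g x) (path_sub p a b))))" for a b
  have pD: "p t \<in> topspace D" if "0 \<le> t" "t \<le> 1" for t
    using path_image_subset_topspace[OF p] that by (simp add: Pi_iff)
  have "Q 0 1"
  proof (rule Bolzano[where P = Q])
    fix a b c :: real assume Q: "Q a b" "Q b c" and abc: "a \<le> b" "b \<le> c"
    show "Q a c"
      unfolding Q_def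
    proof (intro impI ballI)
      fix g x g'' x'' assume ac: "0 \<le> a \<and> c \<le> 1" and g: "g \<in> carrier G" "x \<in> topspace Y"
        and g'': "g'' \<in> carrier G" "x'' \<in> topspace Y" and pa: "p a = cls g x" and pc: "p c = cls g'' x''"
      obtain g' x' where g': "g' \<in> carrier G" "x' \<in> topspace Y" "p b = cls g' x'"
        using topspace_D_cases[OF pD[of b]] ac abc by auto
      obtain u where u: "u \<in> lists vertices" "g' = g \<otimes> ev u"
        "path_hom D (path_concat (wpath u g) (bet g' x')) (path_concat (bet g x) (path_sub p a b))"
        using Q(1) ac abc g g' pa unfolding Q_def by (meson order.trans)
      obtain w where w: "w \<in> lists vertices" "g'' = g' \<otimes> ev w"
        "path_hom D (path_concat (wpath w g') (bet g'' x'')) (path_concat (bet g' x') (path_sub p b c))"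
        using Q(2) ac abc g' g'' pc unfolding Q_def by (meson order.trans)
      note b0 = bet[OF g(1,2)] and b1 = bet[OF g'(1,2)] and b2 = bet[OF g''(1,2)]
      have pb: "pathin D (bet g x)" "pathin D (bet g' x')" "pathin D (bet g'' x'')"
        using b0 b1 b2 pathin_subtopologyD by fast+
      have ps: "pathin D (path_sub p a b)" "pathin D (path_sub p b c)"
        by (rule pathin_sub[OF p]; use ac abc in linarith)+
      note wu = wpath_pathin[OF u(1) g(1)] and ww = wpath_pathin[OF w(1) g'(1)]
      have e: "wpath u g 1 = cls g' x0" "wpath w g' 0 = cls g' x0" "wpath w g' 1 = cls g'' x0"
        using wpath_1[OF u(1) g(1)] wpath_0[OF w(1) g'(1)] wpath_1[OF w(1) g'(1)] u(2) w(2) by auto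
      have "path_hom D (path_concat (wpath (u @ w) g) (bet g'' x''))
        (path_concat (path_concat (wpath u g) (wpath w g')) (bet g'' x''))"
        by (rule path_hom_concat[OF _ path_hom_refl[OF pb(3)]])
          (use wpath_append[OF u(1) w(1) g(1)] u w b2 g g' wpath_1[of "u @ w" g] ev_append[OF u(1) w(1)]
            ev_closed[OF u(1)] ev_closed[OF w(1)] in \<open>auto simp: m_assoc\<close>)
      also have "path_hom D \<dots> (path_concat (wpath u g) (path_concat (wpath w g') (bet g'' x'')))"
        by (rule path_hom_assoc[OF wu ww pb(3)]) (use e b2 in auto)
      also have "path_hom D \<dots> (path_concat (wpath u g) (path_concat (bet g' x') (path_sub p b c)))"
        by (rule path_hom_concat[OF path_hom_refl[OF wu] w(3)]) (use e in auto)
      also have "path_hom D \<dots> (path_concat (path_concat (wpath u g) (bet g' x')) (path_sub p b c))"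
        by (rule path_hom_sym[OF path_hom_assoc[OF wu pb(2) ps(2)]]) (use e b1 g' in auto)
      also have "path_hom D \<dots> (path_concat (path_concat (bet g x) (path_sub p a b)) (path_sub p b c))"
        by (rule path_hom_concat[OF u(3) path_hom_refl[OF ps(2)]]) (use b1 g' in auto)
      also have "path_hom D \<dots> (path_concat (bet g x) (path_concat (path_sub p a b) (path_sub p b c)))"
        by (rule path_hom_assoc[OF pb(1) ps]) (use b0 pa in auto)
      also have "path_hom D \<dots> (path_concat (bet g x) (path_sub p a c))"
        by (rule path_hom_concat[OF path_hom_refl[OF pb(1)] path_hom_sub[OF p]]) (use b0 pa ac abc in auto)
      finally have "path_hom D (path_concat (wpath (u @ w) g) (bet g'' x'')) (path_concat (bet g x) (path_sub p a c))" .
      moreover have "g'' = g \<otimes> ev (u @ w)"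
        using u w g ev_closed[OF u(1)] ev_closed[OF w(1)] ev_append[OF u(1) w(1)] by (simp add: m_assoc)
      moreover have "u @ w \<in> lists vertices" using u w by auto
      ultimately show "\<exists>w\<in>lists vertices. g'' = g \<otimes> ev w \<and>
        path_hom D (path_concat (wpath w g) (bet g'' x'')) (path_concat (bet g x) (path_sub p a c))" by (intro bexI[of _ "u @ w"] conjI)
    qed
  next
    fix s :: real assume s: "0 \<le> s" "s \<le> 1"
    obtain h y where h: "h \<in> carrier G" "y \<in> topspace Y" "p s = cls h y"
      by (rule topspace_D_cases[OF pD[OF s]])
    let ?S = "tau y"
    note S = tau_K[OF h(2)]
    have "p s \<in> A h ?S" unfolding h(3) by (rule A_memI[OF near_refl[OF h(1)]]) (use h in \<open>simp add: star_def\<close>)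
    moreover have "openin (top_of_set {0..1}) {t \<in> topspace (top_of_set {0..1}). p t \<in> A h ?S}"
      by (rule openin_continuous_map_preimage[OF p[unfolded pathin_def] A_open[OF S h(1)]])
    ultimately have "\<exists>d>0. \<forall>t\<in>{0..1}. dist t s < d \<longrightarrow> p t \<in> A h ?S"
      using s unfolding openin_euclidean_subtopology_iff by auto
    then obtain d where "d > 0" and d': "\<forall>t\<in>{0..1}. dist t s < d \<longrightarrow> p t \<in> A h ?S"
      by (elim exE conjE)
    note d = \<open>d > 0\<close> d'[rule_format]
    \<comment> \<open>A short piece lies in the star around \<open>p s\<close>. The chambers of its
      two ends are both around that corner, so they differ by some \<open>P T\<close>, and the word
      path and the given piece are two routes in one convex star.\<close>
    have "Q a b" if ab: "a \<le> s" "s \<le> b" "b - a < d" for a b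
      unfolding Q_def
    proof (intro impI ballI)
      fix g x g' x' assume ab1: "0 \<le> a \<and> b \<le> 1" and g: "g \<in> carrier G" "x \<in> topspace Y"
        and g': "g' \<in> carrier G" "x' \<in> topspace Y" and pa: "p a = cls g x" and pb: "p b = cls g' x'"
      have inA: "p t \<in> A h ?S" if "a \<le> t" "t \<le> b" for t
        by (rule d(2)) (use that ab ab1 in \<open>auto simp: dist_real_def abs_if\<close>)
      have ga: "near ?S h g" "x \<in> star ?S" using A_memD[OF S h(1) g] inA[of a] ab pa by auto
      have gb: "near ?S h g'" "x' \<in> star ?S" using A_memD[OF S h(1) g'] inA[of b] ab pb by auto
      have "near ?S g g'" by (rule near_trans[OF S g(1) near_sym[OF S h(1) ga(1)] gb(1)])
      then obtain T where T: "T \<subseteq> ?S" "g' = g \<otimes> P T" by (auto simp: near_def)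
      obtain w where w: "set w = T" "w \<in> lists vertices" "ev w = P T" by (rule ev_face[OF S T(1)])
      let ?E = "subtopology D (A h ?S)"
      have 1: "pathin ?E (wpath w g)" by (rule wpath_in_A[OF S h(1) _ ga(1)]) (use w T in simp)
      have 2: "pathin ?E (bet g' x')"
        by (rule pathin_subtopology_mono[OF conjunct1[OF bet[OF g']] A_mono[OF S h(1) gb(1)]]) (use gb in \<open>simp add: star_def\<close>)
      have 3: "pathin ?E (bet g x)"
        by (rule pathin_subtopology_mono[OF conjunct1[OF bet[OF g]] A_mono[OF S h(1) ga(1)]]) (use ga in \<open>simp add: star_def\<close>)
      have 4: "pathin ?E (path_sub p a b)"
        unfolding pathin_subtopology
      proof (intro conjI ballI)
        show "pathin D (path_sub p a b)" by (rule pathin_sub[OF p]) (use ab ab1 in auto)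
        fix t :: real assume t: "t \<in> {0..1}"
        have "0 \<le> t * (b - a)" "t * (b - a) \<le> b - a" using t ab by (auto intro: mult_left_le_one_le)
        then show "path_sub p a b t \<in> A h ?S" unfolding path_sub_def by (intro inA) auto
      qed
      have ends: "wpath w g 0 = cls g x0" "wpath w g 1 = cls g' x0"
        using wpath_0[OF w(2) g(1)] wpath_1[OF w(2) g(1)] w(3) T(2) by auto
      have "path_hom D (path_concat (wpath w g) (bet g' x')) (path_concat (bet g x) (path_sub p a b))"
        by (rule A_path_hom[OF S h(1) pathin_concat[OF 1 2] pathin_concat[OF 3 4]])
          (use ends bet[OF g] bet[OF g'] pa pb in auto)
      then show "\<exists>w\<in>lists vertices. g' = g \<otimes> ev w \<and>
        path_hom D (path_concat (wpath w g) (bet g' x')) (path_concat (bet g x) (path_sub p a b))"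
        using w T by (intro bexI[of _ w]) auto
    qed
    then show "\<exists>d>0. \<forall>a b. a \<le> s \<and> s \<le> b \<and> b - a < d \<longrightarrow> Q a b" using d(1) by blast
  qed simp
  moreover have "path_sub p 0 1 = p" by (simp add: path_sub_def)
  ultimately show ?thesis using g g' unfolding Q_def by simp
qed

text \<open>At the base point the connecting path \<open>bet g x0\<close> is itself a loop in a
  star, so it contracts and disappears from the statement of \<open>path_word\<close>.\<close>

lemma loop_word:
  assumes p: "pathin D p" "p 0 = cls g x0" "p 1 = cls g x0" and g: "g \<in> carrier G"
  shows "\<exists>w\<in>lists vertices. ev w = \<one> \<and> path_hom D p (wpath w g)"
proof -
  obtain w where w: "w \<in> lists vertices" "g = g \<otimes> ev w"
    "path_hom D (path_concat (wpath w g) (bet g x0)) (path_concat (bet g x0) p)"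
    using path_word[OF p(1) g x0_Y p(2) g x0_Y p(3)] by (elim bexE conjE)
  have ev: "ev w = \<one>" using w(2) g ev_closed[OF w(1)] by simp
  let ?c = "\<lambda>_::real. cls g x0"
  note b = bet[OF g x0_Y]
  have pb: "pathin D (bet g x0)" using b pathin_subtopologyD by fast
  have bc: "path_hom D (bet g x0) ?c"
    by (rule A_path_hom[OF tau_K[OF x0_Y] g conjunct1[OF b]])
      (use b wpath_in_A[OF tau_K[OF x0_Y] g _ near_refl[OF g], of "[]"] in auto)
  have "path_hom D p (path_concat ?c p)" by (rule path_hom_sym[OF path_hom_lid]) (use p in auto)
  also have "path_hom D \<dots> (path_concat (bet g x0) p)"
    by (rule path_hom_concat[OF path_hom_sym[OF bc] path_hom_refl[OF p(1)]]) (use p in auto)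
  also have "path_hom D \<dots> (path_concat (wpath w g) (bet g x0))" by (rule path_hom_sym[OF w(3)])
  also have "path_hom D \<dots> (path_concat (wpath w g) ?c)"
    by (rule path_hom_concat[OF path_hom_refl[OF wpath_pathin[OF w(1) g]] bc])
      (use wpath_1[OF w(1) g] b ev g in auto)
  also have "path_hom D \<dots> (wpath w g)"
    by (rule path_hom_rid[OF wpath_pathin[OF w(1) g]]) (use wpath_1[OF w(1) g] ev g in auto)
  finally show ?thesis using w(1) ev by blast
qed

lemma path_connected_D:
  assumes gen: "\<And>g. g \<in> carrier G \<Longrightarrow> \<exists>w\<in>lists vertices. g = ev w"
  shows "path_connected_space D"
proof -
  have *: "\<exists>p. pathin D p \<and> p 0 = cls \<one> x0 \<and> p 1 = z" if "z \<in> topspace D" for z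
  proof -
    obtain g x where g: "g \<in> carrier G" "x \<in> topspace Y" "z = cls g x" by (rule topspace_D_cases[OF \<open>z \<in> topspace D\<close>])
    obtain w where w: "w \<in> lists vertices" "g = ev w" using gen[OF g(1)] by auto
    note b = bet[OF g(1,2)]
    have pb: "pathin D (bet g x)" using b pathin_subtopologyD by fast
    have "pathin D (path_concat (wpath w \<one>) (bet g x))"
      by (rule pathin_concat[OF wpath_pathin[OF w(1)] pb]) (use wpath_1[OF w(1), of \<one>] w g b in auto)
    then show ?thesis
      using b g wpath_0[OF w(1), of \<one>] by (intro exI[of _ "path_concat (wpath w \<one>) (bet g x)"]) auto
  qed
  show ?thesis
    unfolding path_connected_space_def
  proof (intro ballI)
    fix y z assume "y \<in> topspace D" "z \<in> topspace D"
    then obtain p q where pq: "pathin D p" "p 0 = cls \<one> x0" "p 1 = y" "pathin D q" "q 0 = cls \<one> x0" "q 1 = z"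
      using *[of y] *[of z] by auto
    show "\<exists>g. pathin D g \<and> g 0 = y \<and> g 1 = z"
      by (intro exI[of _ "path_concat (path_reverse p) q"] conjI pathin_concat pathin_reverse) (use pq in auto)
  qed
qed

text \<open>Chambers that meet differ by reflections in walls, so passing between them never leaves
  a coset of the subgroup formed by the words. The chambers in this subgroup and the remaining
  chambers give two disjoint open sets that cover the space.\<close>

lemma connected_D_imp_generated:
  assumes con: "connected_space D" and g: "g \<in> carrier G"
  shows "\<exists>w\<in>lists vertices. g = ev w"
proof -
  let ?H = "ev ` lists vertices"
  have HG: "?H \<subseteq> carrier G" using ev_closed by auto
  have step: "h \<in> ?H \<longleftrightarrow> k \<in> ?H" if hk: "near S h k" "S \<in> K" "h \<in> carrier G" for S h k
  proof -
    have *: "k \<in> ?H" if "near S h k" "h \<in> ?H" for h k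
    proof -
      obtain T where T: "T \<subseteq> S" "k = h \<otimes> P T" using \<open>near S h k\<close> by (auto simp: near_def)
      obtain u where u: "u \<in> lists vertices" "h = ev u" using \<open>h \<in> ?H\<close> by auto
      obtain w where w: "set w = T" "w \<in> lists vertices" "ev w = P T" by (rule ev_face[OF hk(2) T(1)])
      have "k = ev (u @ w)" using ev_append[OF u(1) w(2)] T u w by simp
      then show ?thesis using u w by (intro image_eqI[of _ _ "u @ w"]) auto
    qed
    show ?thesis using *[OF hk(1)] *[OF near_sym[OF hk(2,3,1)]] by blast
  qed
  let ?U = "\<lambda>I. {cls h x | h x. h \<in> I \<and> x \<in> topspace Y}"
  have op: "openin D (?U I)" if I: "I \<subseteq> carrier G" "\<And>S h k. near S h k \<Longrightarrow> S \<in> K \<Longrightarrow> h \<in> carrier G \<Longrightarrow> k \<in> I \<Longrightarrow> h \<in> I" for I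
    unfolding openin_D
  proof (intro conjI ballI)
    show "?U I \<subseteq> topspace D" using I(1) by (auto simp: topspace_D)
    fix h assume h: "h \<in> carrier G"
    have "h \<in> I" if c: "cls h x \<in> ?U I" "x \<in> topspace Y" for x
    proof -
      obtain k y where k: "cls h x = cls k y" "k \<in> I" "y \<in> topspace Y" using c by auto
      then have "near (tau x) h k" using cls_eq_iff[OF h c(2), of k y] I(1) by auto
      then show ?thesis using I(2) tau_K[OF c(2)] h k(2) by simp
    qed
    then have "{x \<in> topspace Y. cls h x \<in> ?U I} = (if h \<in> I then topspace Y else {})" by auto
    then show "openin Y {x \<in> topspace Y. cls h x \<in> ?U I}" by (auto split: if_splits)
  qed
  have 1: "openin D (?U ?H)" by (rule op[OF HG]) (simp only: step)
  have 2: "openin D (?U (carrier G - ?H))"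
  proof (rule op)
    fix S h k assume *: "near S h k" "S \<in> K" "h \<in> carrier G" "k \<in> carrier G - ?H"
    then show "h \<in> carrier G - ?H" using step[OF *(1-3)] by blast
  qed blast
  have 3: "topspace D \<subseteq> ?U ?H \<union> ?U (carrier G - ?H)"
  proof
    fix z assume "z \<in> topspace D"
    then obtain h x where "h \<in> carrier G" "x \<in> topspace Y" "z = cls h x" by (rule topspace_D_cases)
    then show "z \<in> ?U ?H \<union> ?U (carrier G - ?H)" by (cases "h \<in> ?H") blast+
  qed
  have disj: "?U ?H \<inter> ?U (carrier G - ?H) = {}"
  proof (rule ccontr)
    assume "?U ?H \<inter> ?U (carrier G - ?H) \<noteq> {}"
    then obtain h x k y where *: "cls h x = cls k y" "h \<in> ?H" "k \<in> carrier G - ?H" "x \<in> topspace Y" "y \<in> topspace Y" by blast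
    then have "near (tau x) h k" using cls_eq_iff[of h x k y] HG by blast
    then show False using step[OF _ tau_K[OF *(4)], of h k] * HG by blast
  qed
  have ne: "?U ?H \<noteq> {}"
  proof -
    have "\<one> \<in> ?H" by (intro image_eqI[of _ _ "[]"]) auto
    then show ?thesis using x0_Y by blast
  qed
  have 4: "?U (carrier G - ?H) = {}"
    using con[unfolded connected_space_def, simplified, rule_format, OF 1 disj 3 2] ne by (simp only: simp_thms)
  have "g \<in> ?H"
  proof (rule ccontr)
    assume "g \<notin> ?H"
    then have "cls g x0 \<in> ?U (carrier G - ?H)" using g x0_Y by blast
    then show False using 4 by blast
  qed
  then show ?thesis by auto
qed

end

section \<open>The group action, the strata and the fundamental domain\<close>

context development_space
begin

definition act :: "'g \<Rightarrow> ('g \<times> 'y) set \<Rightarrow> ('g \<times> 'y) set" where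
  "act k = (\<lambda>c\<in>topspace D. (\<lambda>(h, x). (k \<otimes> h, x)) ` c)"

lemma near_mult_iff:
  assumes "S \<in> K" "k \<in> carrier G" "h \<in> carrier G" "h' \<in> carrier G"
  shows "near S (k \<otimes> h) (k \<otimes> h') \<longleftrightarrow> near S h h'"
proof
  assume "near S (k \<otimes> h) (k \<otimes> h')"
  from near_mult[OF assms(1) _ _ this, of "inv k"] show "near S h h'"
    using assms by (simp add: m_assoc[symmetric])
qed (rule near_mult[OF assms(1,3,2)])

lemma act_cls:
  assumes k: "k \<in> carrier G" and h: "h \<in> carrier G" and x: "x \<in> topspace Y"
  shows "act k (cls h x) = cls (k \<otimes> h) x"
proof -
  have "(\<lambda>(h, x). (k \<otimes> h, x)) ` cls h x = cls (k \<otimes> h) x"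
  proof (intro equalityI subsetI)
    fix z assume "z \<in> (\<lambda>(h, x). (k \<otimes> h, x)) ` cls h x"
    then obtain h' x' where z: "((h, x), (h', x')) \<in> Rel" "z = (k \<otimes> h', x')" by (auto simp: cls_def)
    then show "z \<in> cls (k \<otimes> h) x"
      using k near_mult[OF tau_K[OF x] h k, of h'] by (auto simp: cls_def Rel_iff)
  next
    fix z assume "z \<in> cls (k \<otimes> h) x"
    then obtain h' where z: "z = (h', x)" "h' \<in> carrier G" "near (tau x) (k \<otimes> h) h'"
      by (cases z) (auto simp: cls_def Rel_iff)
    have e: "k \<otimes> (inv k \<otimes> h') = h'" using z k by (simp add: m_assoc[symmetric])
    have "near (tau x) h (inv k \<otimes> h')"
      using near_mult_iff[OF tau_K[OF x] k h, of "inv k \<otimes> h'"] z k e by simp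
    then have "(inv k \<otimes> h', x) \<in> cls h x" using h z k x by (simp add: cls_def Rel_iff)
    then show "z \<in> (\<lambda>(h, x). (k \<otimes> h, x)) ` cls h x" using z e by force
  qed
  then show ?thesis using cls_in_D[OF h x] by (simp add: act_def)
qed

lemma act_mult: "k \<in> carrier G \<Longrightarrow> l \<in> carrier G \<Longrightarrow> c \<in> topspace D \<Longrightarrow> act (k \<otimes> l) c = act k (act l c)"
  by (erule topspace_D_cases) (simp add: act_cls m_assoc)

lemma act_one: "c \<in> topspace D \<Longrightarrow> act \<one> c = c"
  by (erule topspace_D_cases) (simp add: act_cls)

lemma act_continuous:
  assumes k: "k \<in> carrier G"
  shows "continuous_map D D (act k)"
proof (rule continuous_map_from_D)
  fix g assume g: "g \<in> carrier G"
  show "continuous_map Y D (\<lambda>x. act k (cls g x))"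
    by (rule continuous_map_eq[OF cls_continuous[of "k \<otimes> g"]]) (use k g in \<open>simp_all add: act_cls\<close>)
qed

lemma act_homeo:
  assumes k: "k \<in> carrier G"
  shows "homeomorphic_map D D (act k)"
  unfolding homeomorphic_map_maps
proof (intro exI[of _ "act (inv k)"])
  have "act (inv k) (act k c) = c" "act k (act (inv k) c) = c" if "c \<in> topspace D" for c
    using that k act_mult[of "inv k" k c] act_mult[of k "inv k" c] act_one by simp_all
  then show "homeomorphic_maps D D (act k) (act (inv k))"
    using k act_continuous by (simp add: homeomorphic_maps_def)
qed

lemma act_group_action: "group_action G (topspace D) act"
proof -
  have bij: "act g \<in> Bij (topspace D)" if "g \<in> carrier G" for g
    using homeomorphic_imp_injective_map[OF act_homeo[OF that]] homeomorphic_imp_surjective_map[OF act_homeo[OF that]]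
    by (simp add: Bij_def bij_betw_def) (simp add: act_def)
  have "act \<in> hom G (BijGroup (topspace D))"
  proof (rule homI)
    fix g assume "g \<in> carrier G"
    then show "act g \<in> carrier (BijGroup (topspace D))" using bij by (simp add: BijGroup_def)
  next
    fix g h assume gh: "g \<in> carrier G" "h \<in> carrier G"
    have "act (g \<otimes> h) = compose (topspace D) (act g) (act h)"
    proof (rule extensionalityI[of _ "topspace D"])
      show "act (g \<otimes> h) \<in> extensional (topspace D)" by (simp add: act_def)
      fix c assume "c \<in> topspace D"
      then show "act (g \<otimes> h) c = compose (topspace D) (act g) (act h) c" using gh act_mult by (simp add: compose_def)
    qed (rule compose_extensional)
    then show "act (g \<otimes> h) = act g \<otimes>\<^bsub>BijGroup (topspace D)\<^esub> act h"
      using bij gh by (simp add: BijGroup_def)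
  qed
  then show ?thesis
    unfolding group_action_def group_hom_def group_hom_axioms_def
    using is_group group_BijGroup by blast
qed

definition strata :: "'y set set \<Rightarrow> ('g \<times> 'y) set set set" where
  "strata \<V> = {act g ` cls \<one> ` V | g V. g \<in> carrier G \<and> V \<in> \<V>}"

lemma act_stratum:
  assumes "g \<in> carrier G" "V \<subseteq> topspace Y"
  shows "act g ` cls \<one> ` V = cls g ` V"
  unfolding image_image using assms by (intro image_cong) (auto simp: act_cls subsetD)

lemma act_stratum':
  assumes "g \<in> carrier G" "h \<in> carrier G" "V \<subseteq> topspace Y"
  shows "act g ` cls h ` V = cls (g \<otimes> h) ` V"
  unfolding image_image using assms by (intro image_cong) (auto simp: act_cls subsetD)

lemma strata_eq:
  assumes "\<Union>\<V> \<subseteq> topspace Y"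
  shows "strata \<V> = {cls g ` V | g V. g \<in> carrier G \<and> V \<in> \<V>}"
proof -
  have "act g ` cls \<one> ` V = cls g ` V" if "g \<in> carrier G" "V \<in> \<V>" for g V
    by (rule act_stratum) (use that assms in auto)
  then show ?thesis unfolding strata_def by (metis (no_types, lifting))
qed

lemma strata_preserving_D:
  assumes V: "\<Union>\<V> \<subseteq> topspace Y"
  shows "strata_preserving_action G D (strata \<V>) act"
  unfolding strata_preserving_action_def
proof (intro conjI ballI act_group_action act_homeo)
  fix g S assume g: "g \<in> carrier G" and "S \<in> strata \<V>"
  then obtain h V where h: "h \<in> carrier G" "V \<in> \<V>" "S = cls h ` V" unfolding strata_eq[OF V] by auto
  have "act g ` S = cls (g \<otimes> h) ` V" unfolding h(3) by (rule act_stratum'[OF g h(1)]) (use h V in auto)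
  moreover have "g \<otimes> h \<in> carrier G" using g h by simp
  ultimately show "act g ` S \<in> strata \<V>" unfolding strata_eq[OF V] using h(2) by blast
qed

text \<open>The point of \<open>Y\<close> underlying a class is the same for all representatives and
  is not moved by the action. So an orbit meets chamber 1 exactly once, and a translate of a stratum
  that lies in chamber 1 must be the copy there of the set it came from.\<close>

lemma strict_fundamental_domain_D:
  assumes V: "\<Union>\<V> = topspace Y"
  shows "strict_fundamental_domain G D (strata \<V>) act (cls \<one> ` topspace Y)"
  unfolding strict_fundamental_domain_def
proof (intro conjI ballI)
  have se: "strata \<V> = {cls g ` V | g V. g \<in> carrier G \<and> V \<in> \<V>}" by (rule strata_eq) (simp add: V)
  show "\<exists>\<F>\<subseteq>strata \<V>. cls \<one> ` topspace Y = \<Union>\<F>"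
  proof (intro exI conjI)
    show "(\<lambda>V. cls \<one> ` V) ` \<V> \<subseteq> strata \<V>" unfolding se by auto
    show "cls \<one> ` topspace Y = \<Union>((\<lambda>V. cls \<one> ` V) ` \<V>)" unfolding V[symmetric] by auto
  qed
  fix \<O> assume "\<O> \<in> orbits G (topspace D) act"
  then obtain c where c: "c \<in> topspace D" "\<O> = orbit G act c" by (auto simp: orbits_def)
  obtain h x where h: "h \<in> carrier G" "x \<in> topspace Y" "c = cls h x" by (rule topspace_D_cases[OF c(1)])
  have O: "\<O> = {cls (g \<otimes> h) x | g. g \<in> carrier G}"
    unfolding c(2) orbit_def h(3) using act_cls[OF _ h(1,2)] by (intro Collect_cong ex_cong1) auto
  show "\<exists>!y. y \<in> \<O> \<and> y \<in> cls \<one> ` topspace Y"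
  proof (rule ex1I[of _ "cls \<one> x"])
    have "cls \<one> x = cls (inv h \<otimes> h) x" using h by simp
    moreover have "inv h \<in> carrier G" using h by simp
    ultimately show "cls \<one> x \<in> \<O> \<and> cls \<one> x \<in> cls \<one> ` topspace Y" unfolding O using h by blast
    fix y assume "y \<in> \<O> \<and> y \<in> cls \<one> ` topspace Y"
    then obtain g z where "g \<in> carrier G" "y = cls (g \<otimes> h) x" "z \<in> topspace Y" "y = cls \<one> z" unfolding O by auto
    then show "y = cls \<one> x" using cls_eq_iff[of "g \<otimes> h" x \<one> z] h by auto
  qed
next
  have se: "strata \<V> = {cls g ` V | g V. g \<in> carrier G \<and> V \<in> \<V>}" by (rule strata_eq) (simp add: V)
  fix S assume "S \<in> strata \<V>"
  then obtain h U where h: "h \<in> carrier G" "U \<in> \<V>" "S = cls h ` U" unfolding se by auto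
  have U: "U \<subseteq> topspace Y" using h V by auto
  have tr: "{act g ` S | g. g \<in> carrier G} = {cls (g \<otimes> h) ` U | g. g \<in> carrier G}"
    unfolding h(3)
    by (intro Collect_cong ex_cong1 iffI; elim conjE; simp only: act_stratum'[OF _ h(1) U] simp_thms)
  show "\<exists>!S'. S' \<in> {act g ` S | g. g \<in> carrier G} \<and> S' \<subseteq> cls \<one> ` topspace Y"
    unfolding tr
  proof (rule ex1I[of _ "cls \<one> ` U"])
    have "inv h \<in> carrier G" "inv h \<otimes> h = \<one>" using h by auto
    then have "cls \<one> ` U \<in> {cls (g \<otimes> h) ` U | g. g \<in> carrier G}" by (metis (mono_tags, lifting) mem_Collect_eq)
    then show "cls \<one> ` U \<in> {cls (g \<otimes> h) ` U | g. g \<in> carrier G} \<and> cls \<one> ` U \<subseteq> cls \<one> ` topspace Y"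
      using U by auto
    fix S' assume "S' \<in> {cls (g \<otimes> h) ` U | g. g \<in> carrier G} \<and> S' \<subseteq> cls \<one> ` topspace Y"
    then obtain g where g: "g \<in> carrier G" "S' = cls (g \<otimes> h) ` U" and sub: "S' \<subseteq> cls \<one> ` topspace Y" by auto
    have "cls (g \<otimes> h) x = cls \<one> x" if x: "x \<in> U" for x
    proof -
      obtain z where "z \<in> topspace Y" "cls (g \<otimes> h) x = cls \<one> z" using sub g(2) x by auto
      then show ?thesis using cls_eq_iff[of "g \<otimes> h" x \<one> z] g h U x by auto
    qed
    then show "S' = cls \<one> ` U" unfolding g(2) by (intro image_cong) auto
  qed
qed

end

section \<open>Morphisms of developments: coverings, fundamental groups and deck groups\<close>

locale development_morphism =
  dom: development_space Y K tau B e G P + cod: development_space Y K tau B e H Q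
  for Y :: "'y topology" and K :: "'v set set" and tau B e and G :: "('g, 'm) monoid_scheme" (structure) and P
    and H :: "('h, 'n) monoid_scheme" and Q +
  fixes f :: "'g \<Rightarrow> 'h"
  assumes hom: "f \<in> hom G H" and surj: "f ` carrier G = carrier H"
    and f_P: "S \<in> K \<Longrightarrow> f (P S) = Q S"
begin

sublocale f: group_hom G H f
  using hom by unfold_locales

definition pmap :: "('g \<times> 'y) set \<Rightarrow> ('h \<times> 'y) set" where
  "pmap c = (case SOME z. z \<in> c of (g, x) \<Rightarrow> cod.cls (f g) x)"

lemma near_map: "S \<in> K \<Longrightarrow> g \<in> carrier G \<Longrightarrow> dom.near S g h \<Longrightarrow> cod.near S (f g) (f h)"
proof -
  assume S: "S \<in> K" and g: "g \<in> carrier G" and "dom.near S g h"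
  then obtain T where T: "T \<subseteq> S" "h = g \<otimes> P T" by (auto simp: dom.near_def)
  have TK: "T \<in> K" using dom.face_K[OF S T(1)] .
  show ?thesis unfolding T(2) cod.near_def using g dom.P_closed[OF TK] f_P[OF TK] T(1) by auto
qed

lemma pmap_cls:
  assumes g: "g \<in> carrier G" and x: "x \<in> topspace Y"
  shows "pmap (dom.cls g x) = cod.cls (f g) x"
proof -
  obtain h y where hy: "(SOME z. z \<in> dom.cls g x) = (h, y)" by fastforce
  have "(g, x) \<in> dom.cls g x" using g x dom.near_refl[OF g] by (simp add: dom.cls_def dom.Rel_iff)
  then have "(h, y) \<in> dom.cls g x" unfolding hy[symmetric] by (rule someI)
  then have h: "h \<in> carrier G" "y = x" "dom.near (tau x) g h" by (auto simp: dom.cls_def dom.Rel_iff)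
  have "cod.near (tau x) (f g) (f h)" by (rule near_map[OF dom.tau_K[OF x] g h(3)])
  then have "cod.cls (f g) x = cod.cls (f h) x" using cod.cls_eq_iff[of "f g" x "f h" x] g h x by simp
  then show ?thesis unfolding pmap_def hy by (simp add: h)
qed

lemma pmap_continuous: "continuous_map dom.D cod.D pmap"
proof (rule dom.continuous_map_from_D)
  fix g assume g: "g \<in> carrier G"
  show "continuous_map Y cod.D (\<lambda>x. pmap (dom.cls g x))"
    by (rule continuous_map_eq[OF cod.cls_continuous[of "f g"]]) (use g in \<open>simp_all add: pmap_cls\<close>)
qed

lemma pmap_A:
  assumes S: "S \<in> K" and g: "g \<in> carrier G" and c: "c \<in> dom.A g S"
  shows "pmap c \<in> cod.A (f g) S"
proof -
  obtain h x where h: "c = dom.cls h x" "dom.near S g h" "x \<in> dom.star S" using c by (auto simp: dom.A_def)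
  have hc: "h \<in> carrier G" by (rule dom.near_closed[OF S g h(2)])
  have "pmap c = cod.cls (f h) x" unfolding h(1) by (rule pmap_cls[OF hc]) (use h(3) dom.star_subset in blast)
  then show ?thesis using cod.A_memI[OF near_map[OF S g h(2)]] h(3) by simp
qed

lemma pmap_chart:
  assumes S: "S \<in> K" and g: "g \<in> carrier G" and c: "c \<in> topspace (dom.region S)"
  shows "pmap (dom.chamber_chart g S c) = cod.chamber_chart (f g) S c"
proof -
  let ?N = "{b \<in> S. c b < 0}"
  have N: "?N \<in> K" by (rule dom.face_K[OF S]) auto
  have "e S (dom.absval S c) \<in> topspace Y"
    using dom.chart_in_star[OF S dom.absval_corner[OF c]] dom.star_subset by blast
  then show ?thesis
    unfolding dom.chamber_chart_def cod.chamber_chart_def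
    using pmap_cls[of "g \<otimes> P ?N"] g dom.P_closed[OF N] f_P[OF N] by simp
qed

lemma pmap_homeo_A:
  assumes S: "S \<in> K" and g: "g \<in> carrier G"
  shows "homeomorphic_map (subtopology dom.D (dom.A g S)) (subtopology cod.D (cod.A (f g) S)) pmap"
proof -
  obtain k where k: "homeomorphic_maps (dom.region S) (subtopology dom.D (dom.A g S)) (dom.chamber_chart g S) k"
    using dom.chamber_chart_homeo[OF S g] homeomorphic_map_maps by blast
  have 1: "homeomorphic_map (subtopology dom.D (dom.A g S)) (dom.region S) k"
    using k homeomorphic_maps_map by blast
  have 2: "homeomorphic_map (dom.region S) (subtopology cod.D (cod.A (f g) S)) (cod.chamber_chart (f g) S)"
    by (rule cod.chamber_chart_homeo[OF S]) (use g in simp)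
  show ?thesis
  proof (rule homeomorphic_map_eq[OF homeomorphic_map_compose[OF 1 2]])
    fix z assume z: "z \<in> topspace (subtopology dom.D (dom.A g S))"
    have kz: "k z \<in> topspace (dom.region S)" "dom.chamber_chart g S (k z) = z"
      using k z by (auto simp: homeomorphic_maps_def continuous_map_def Pi_iff)
    then show "(cod.chamber_chart (f g) S \<circ> k) z = pmap z" using pmap_chart[OF S g kz(1)] by simp
  qed
qed

text \<open>Over the star \<open>A k S\<close> the sheets are the stars \<open>A g S\<close> with
  \<open>f g = k\<close>. In the orthant charts \<open>pmap\<close> is the identity on each of
  them.\<close>

theorem covering: "covering_map dom.D cod.D pmap"
  unfolding covering_map_def
proof (intro conjI ballI)
  show "continuous_map dom.D cod.D pmap" by (rule pmap_continuous)
  show "pmap ` topspace dom.D = topspace cod.D"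
  proof (intro equalityI subsetI)
    fix z assume "z \<in> pmap ` topspace dom.D"
    then show "z \<in> topspace cod.D" using pmap_continuous by (auto simp: continuous_map_def)
  next
    fix z assume "z \<in> topspace cod.D"
    then obtain h x where h: "h \<in> carrier H" "x \<in> topspace Y" "z = cod.cls h x" by (rule cod.topspace_D_cases)
    obtain g where g: "g \<in> carrier G" "h = f g" using h(1) surj by blast
    have "z = pmap (dom.cls g x)" using pmap_cls[OF g(1) h(2)] h g by simp
    then show "z \<in> pmap ` topspace dom.D" using dom.cls_in_D[OF g(1) h(2)] by blast
  qed
  fix z assume "z \<in> topspace cod.D"
  then obtain k x where k: "k \<in> carrier H" "x \<in> topspace Y" "z = cod.cls k x" by (rule cod.topspace_D_cases)
  let ?S = "tau x"
  note S = dom.tau_K[OF k(2)]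
  let ?V = "{dom.A g ?S | g. g \<in> carrier G \<and> f g = k}"
  have xs: "x \<in> dom.star ?S" using k(2) by (simp add: dom.star_def)
  have un: "\<Union>?V = {c \<in> topspace dom.D. pmap c \<in> cod.A k ?S}"
  proof (intro equalityI subsetI)
    fix c assume "c \<in> \<Union>?V"
    then obtain g where g: "g \<in> carrier G" "f g = k" "c \<in> dom.A g ?S" by blast
    then show "c \<in> {c \<in> topspace dom.D. pmap c \<in> cod.A k ?S}"
      using pmap_A[OF S g(1,3)] openin_subset[OF dom.A_open[OF S g(1)]] by auto
  next
    fix c assume "c \<in> {c \<in> topspace dom.D. pmap c \<in> cod.A k ?S}"
    then have c: "c \<in> topspace dom.D" "pmap c \<in> cod.A k ?S" by auto
    obtain h y where h: "h \<in> carrier G" "y \<in> topspace Y" "c = dom.cls h y" by (rule dom.topspace_D_cases[OF c(1)])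
    have m: "cod.cls (f h) y \<in> cod.A k ?S" using c(2) pmap_cls[OF h(1,2)] h(3) by simp
    have fh: "f h \<in> carrier H" using h by simp
    have n: "cod.near ?S k (f h)" "y \<in> dom.star ?S"
      using cod.A_memD[OF S k(1) fh h(2) m] by auto
    \<comment> \<open>The chamber \<open>h\<close> lies over some chamber near \<open>k\<close>. The
      reflection that leads to \<open>k\<close> downstairs exists upstairs as well and moves
      \<open>h\<close> to a chamber exactly over \<open>k\<close>.\<close>
    obtain U where U: "U \<subseteq> ?S" "k = f h \<otimes>\<^bsub>H\<^esub> Q U" using cod.near_sym[OF S k(1) n(1)] by (auto simp: cod.near_def)
    have UK: "U \<in> K" using dom.face_K[OF S U(1)] .
    have g: "h \<otimes> P U \<in> carrier G" "f (h \<otimes> P U) = k" using h dom.P_closed[OF UK] f_P[OF UK] U(2) by auto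
    have "dom.near ?S (h \<otimes> P U) h" by (rule dom.near_sym[OF S h(1) dom.near_P[OF U(1)]])
    then have "c \<in> dom.A (h \<otimes> P U) ?S" unfolding h(3) using n(2) by (rule dom.A_memI)
    then show "c \<in> \<Union>?V" using g by blast
  qed
  \<comment> \<open>Two sheets that meet differ by some \<open>P U\<close>, and its image
    \<open>Q U\<close> must be trivial because both lie over \<open>k\<close>. As \<open>Q\<close>
    is injective on the face, \<open>U\<close> is empty.\<close>
  have disj: "pairwise disjnt ?V"
  proof (rule pairwiseI)
    fix A1 A2 assume A: "A1 \<in> ?V" "A2 \<in> ?V" "A1 \<noteq> A2"
    obtain g h where g: "g \<in> carrier G" "f g = k" "A1 = dom.A g ?S" and h: "h \<in> carrier G" "f h = k" "A2 = dom.A h ?S"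
      using A by blast
    show "disjnt A1 A2"
    proof (rule ccontr)
      assume "\<not> disjnt A1 A2"
      then obtain c where c: "c \<in> dom.A g ?S" "c \<in> dom.A h ?S" unfolding g(3) h(3) disjnt_def by blast
      obtain u y where u: "c = dom.cls u y" "dom.near ?S g u" "y \<in> dom.star ?S" using c(1) by (auto simp: dom.A_def)
      have uc: "u \<in> carrier G" by (rule dom.near_closed[OF S g(1) u(2)])
      have yY: "y \<in> topspace Y" using u(3) dom.star_subset by blast
      have hu: "dom.near ?S h u" by (rule dom.A_memD(1)[OF S h(1) uc yY]) (use c(2) u(1) in simp)
      have "dom.near ?S g h" by (rule dom.near_trans[OF S g(1) u(2) dom.near_sym[OF S h(1) hu]])
      then obtain U where U: "U \<subseteq> ?S" "h = g \<otimes> P U" by (auto simp: dom.near_def)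
      have UK: "U \<in> K" using dom.face_K[OF S U(1)] .
      have "k = k \<otimes>\<^bsub>H\<^esub> Q U" using h(2) g(1,2) dom.P_closed[OF UK] f_P[OF UK] unfolding U(2) by simp
      then have "Q U = Q {}" using k(1) cod.P_closed[OF UK] cod.P_empty by simp
      then have "U = {}" by (rule inj_onD[OF cod.P_inj[OF S]]) (use U(1) in auto)
      then have "h = g" using U(2) g(1) dom.P_empty by simp
      then show False using A(3) g(3) h(3) by simp
    qed
  qed
  show "\<exists>T. z \<in> T \<and> openin cod.D T \<and> (\<exists>\<V>. \<Union>\<V> = {e \<in> topspace dom.D. pmap e \<in> T} \<and>
       (\<forall>V\<in>\<V>. openin dom.D V) \<and> pairwise disjnt \<V> \<and>
       (\<forall>V\<in>\<V>. homeomorphic_map (subtopology dom.D V) (subtopology cod.D T) pmap))"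
  proof (intro exI conjI)
    show "z \<in> cod.A k ?S" unfolding k(3) by (rule cod.A_memI[OF cod.near_refl[OF k(1)] xs])
    show "openin cod.D (cod.A k ?S)" by (rule cod.A_open[OF S k(1)])
    show "\<Union>?V = {c \<in> topspace dom.D. pmap c \<in> cod.A k ?S}" by (rule un)
    show "\<forall>V\<in>?V. openin dom.D V" using dom.A_open[OF S] by auto
    show "pairwise disjnt ?V" by (rule disj)
    show "\<forall>V\<in>?V. homeomorphic_map (subtopology dom.D V) (subtopology cod.D (cod.A k ?S)) pmap"
      using pmap_homeo_A[OF S] by auto
  qed
qed

lemma f_ev: "w \<in> lists dom.vertices \<Longrightarrow> f (dom.ev w) = cod.ev w"
proof (induction w)
  case (Cons v w)
  then have "{v} \<in> K" "w \<in> lists dom.vertices" by auto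
  then show ?case using Cons.IH f_P[of "{v}"] dom.P_closed[of "{v}"] dom.ev_closed[of w] by simp
qed simp

text \<open>The image of a chosen edge need not be the edge chosen downstairs, but both run in the
  same star between the same centres.\<close>

lemma pmap_wpath:
  "vs \<in> lists dom.vertices \<Longrightarrow> g \<in> carrier G \<Longrightarrow> path_hom cod.D (pmap \<circ> dom.wpath vs g) (cod.wpath vs (f g))"
proof (induction vs arbitrary: g)
  case Nil
  then have "pmap \<circ> dom.wpath [] g = cod.wpath [] (f g)" by (auto simp: pmap_cls dom.x0_Y)
  moreover have "pathin cod.D (cod.wpath [] (f g))" by (rule cod.wpath_pathin) (use Nil in auto)
  ultimately show ?case using path_hom_refl by metis
next
  case (Cons v vs)
  then have v: "{v} \<in> K" "vs \<in> lists dom.vertices" by auto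
  have fg: "f g \<in> carrier H" using Cons.prems by simp
  have gv: "g \<otimes> P {v} \<in> carrier G" "f (g \<otimes> P {v}) = f g \<otimes>\<^bsub>H\<^esub> Q {v}"
    using Cons.prems dom.P_closed[OF v(1)] f_P[OF v(1)] by auto
  note ed = dom.edge[OF v(1) Cons.prems(2)] and ec = cod.edge[OF v(1) fg]
  have 1: "path_hom cod.D (pmap \<circ> dom.edge g v) (cod.edge (f g) v)"
  proof (rule cod.A_path_hom[OF v(1) fg _ conjunct1[OF ec]])
    show "pathin (subtopology cod.D (cod.A (f g) {v})) (pmap \<circ> dom.edge g v)"
      using pathin_compose[OF pathin_subtopologyD[OF conjunct1[OF ed]] pmap_continuous] conjunct1[OF ed]
        pmap_A[OF v(1) Cons.prems(2)]
      by (auto simp: pathin_subtopology)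
  qed (use ed ec gv Cons.prems in \<open>auto simp: pmap_cls dom.x0_Y\<close>)
  show ?case
    unfolding dom.wpath.simps cod.wpath.simps path_concat_compose gv(2)[symmetric]
    by (rule path_hom_concat[OF 1 Cons.IH[OF v(2) gv(1)]])
      (use ed dom.wpath_0[OF v(2) gv(1)] in simp)
qed

lemma cod_generated:
  assumes gen: "\<And>g. g \<in> carrier G \<Longrightarrow> \<exists>w\<in>lists dom.vertices. g = dom.ev w" and h: "h \<in> carrier H"
  shows "\<exists>w\<in>lists dom.vertices. h = cod.ev w"
proof -
  obtain g where g: "g \<in> carrier G" "h = f g" using h surj by blast
  obtain w where w: "w \<in> lists dom.vertices" "g = dom.ev w" using gen[OF g(1)] by blast
  show ?thesis using w g f_ev[OF w(1)] by (intro bexI[of _ w]) auto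
qed

text \<open>A kernel element is represented by the path of some word for it. By \<open>pres\<close>
  the word does not matter up to homotopy, which gives multiplicativity; \<open>loop_word\<close>
  gives surjectivity. Injectivity is monodromy: the path lifted from chamber 1 ends in the chamber
  of the element.\<close>

theorem pi1:
  assumes gen: "\<And>g. g \<in> carrier G \<Longrightarrow> \<exists>w\<in>lists dom.vertices. g = dom.ev w"
    and pres: "\<And>u w. u \<in> lists dom.vertices \<Longrightarrow> w \<in> lists dom.vertices \<Longrightarrow> dom.ev u = dom.ev w \<Longrightarrow> cox_eq K u w"
    and y: "y \<in> topspace cod.D"
  shows "\<exists>L. has_pi1 cod.D y (G\<lparr>carrier := kernel G H f\<rparr>) L"
proof -
  let ?N = "G\<lparr>carrier := kernel G H f\<rparr>"
  let ?b = "cod.cls \<one>\<^bsub>H\<^esub> cod.x0"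
  have N: "group ?N" using f.subgroup_kernel dom.subgroup_imp_group by blast
  have "\<exists>w. w \<in> lists dom.vertices \<and> g = dom.ev w" if "g \<in> carrier G" for g using gen[OF that] by blast
  then obtain word where word: "\<And>g. g \<in> carrier G \<Longrightarrow> word g \<in> lists dom.vertices \<and> g = dom.ev (word g)" by metis
  let ?L = "\<lambda>g. cod.wpath (word g) \<one>\<^bsub>H\<^esub>"
  have ker: "g \<in> carrier G" "f g = \<one>\<^bsub>H\<^esub>" if "g \<in> carrier ?N" for g using that by (auto simp: kernel_def)
  have wl: "word g \<in> lists dom.vertices" and we: "dom.ev (word g) = g" and wc: "cod.ev (word g) = \<one>\<^bsub>H\<^esub>" if "g \<in> carrier ?N" for g
    using word[of g] ker[OF that] f_ev[of "word g"] by auto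
  have L: "has_pi1 cod.D ?b ?N ?L"
    unfolding has_pi1_def
  proof (intro conjI ballI impI)
    fix a assume a: "a \<in> carrier ?N"
    show "?L a \<in> loops cod.D ?b"
      using cod.wpath_pathin[OF wl[OF a]] cod.wpath_0[OF wl[OF a]] cod.wpath_1[OF wl[OF a]] wc[OF a] by (simp add: loops_def)
    fix b assume b: "b \<in> carrier ?N"
    have ab: "a \<otimes> b \<in> carrier ?N" using f.subgroup_kernel a b by (simp add: subgroup.m_closed)
    have "dom.ev (word (a \<otimes> b)) = dom.ev (word a @ word b)"
      using we[OF a] we[OF b] we[OF ab] dom.ev_append[OF wl[OF a] wl[OF b]] by simp
    then have "cox_eq K (word (a \<otimes> b)) (word a @ word b)" using wl[OF a] wl[OF b] wl[OF ab] by (intro pres) auto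
    from cod.wpath_cox[OF this] have "path_hom cod.D (?L (a \<otimes> b)) (cod.wpath (word a @ word b) \<one>\<^bsub>H\<^esub>)" by simp
    also have "path_hom cod.D \<dots> (path_concat (?L a) (?L b))"
      using cod.wpath_append[OF wl[OF a] wl[OF b], of "\<one>\<^bsub>H\<^esub>"] wc[OF a] by simp
    finally show "path_hom cod.D (?L (a \<otimes>\<^bsub>?N\<^esub> b)) (path_concat (?L a) (?L b))" by simp
    assume "path_hom cod.D (?L a) (?L b)"
    then have "path_hom cod.D (pmap \<circ> dom.wpath (word a) \<one>) (pmap \<circ> dom.wpath (word b) \<one>)"
      using pmap_wpath[OF wl[OF a] dom.one_closed] pmap_wpath[OF wl[OF b] dom.one_closed]
      by (simp only: f.hom_one) (rule path_hom_trans[OF path_hom_trans path_hom_sym])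
    then have "dom.wpath (word a) \<one> 1 = dom.wpath (word b) \<one> 1"
      by (rule covering_monodromy[OF covering dom.wpath_pathin[OF wl[OF a] dom.one_closed] dom.wpath_pathin[OF wl[OF b] dom.one_closed], rotated])
        (simp only: dom.wpath_0[OF wl[OF a] dom.one_closed] dom.wpath_0[OF wl[OF b] dom.one_closed])
    then show "a = b"
      using dom.wpath_1[OF wl[OF a] dom.one_closed] dom.wpath_1[OF wl[OF b] dom.one_closed]
        dom.cls_x0_eq_iff we[OF a] we[OF b] ker(1)[OF a] ker(1)[OF b] by simp
  next
    fix p assume "p \<in> loops cod.D ?b"
    then have p: "pathin cod.D p" "p 0 = ?b" "p 1 = ?b" by (auto simp: loops_def)
    obtain w where w: "w \<in> lists dom.vertices" "cod.ev w = \<one>\<^bsub>H\<^esub>" "path_hom cod.D p (cod.wpath w \<one>\<^bsub>H\<^esub>)"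
      using cod.loop_word[OF p cod.one_closed] by blast
    let ?a = "dom.ev w"
    have a: "?a \<in> carrier ?N" using dom.ev_closed[OF w(1)] f_ev[OF w(1)] w(2) by (simp add: kernel_def)
    have "cox_eq K w (word ?a)" by (rule pres[OF w(1) wl[OF a]]) (simp add: we[OF a])
    from cod.wpath_cox[OF this] have "path_hom cod.D (cod.wpath w \<one>\<^bsub>H\<^esub>) (?L ?a)" by simp
    from path_hom_trans[OF w(3) this] show "\<exists>a\<in>carrier ?N. path_hom cod.D p (?L a)" using a by (rule bexI)
  qed
  have "path_connected_space cod.D" by (rule cod.path_connected_D[OF cod_generated[OF gen]])
  then have "\<exists>d. pathin cod.D d \<and> d 0 = y \<and> d 1 = ?b"
    using y cod.cls_in_D[OF cod.one_closed cod.x0_Y] unfolding path_connected_space_def by blast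
  then obtain d where d: "pathin cod.D d" "d 0 = y" "d 1 = ?b" by (elim exE conjE)
  show ?thesis by (rule exI, rule has_pi1_change_base[OF L d N])
qed

text \<open>A deck transformation moves the base point to another point over the same centre, and
  this is the centre of a chamber \<open>g\<close> with \<open>g\<close> in the kernel. Left
  multiplication by \<open>g\<close> is a lift of \<open>pmap\<close> with the same value there, and
  lifts from a connected space are unique.\<close>

theorem deck_group_iso:
  assumes con: "connected_space dom.D"
  shows "deck_group dom.D pmap \<cong> G\<lparr>carrier := kernel G H f\<rparr>"
proof -
  let ?N = "G\<lparr>carrier := kernel G H f\<rparr>"
  have N: "group ?N" using f.subgroup_kernel dom.subgroup_imp_group by blast
  let ?b = "dom.cls \<one> dom.x0"
  have b: "?b \<in> topspace dom.D" by (rule dom.cls_in_D[OF dom.one_closed dom.x0_Y])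
  have ker: "g \<in> carrier G" "f g = \<one>\<^bsub>H\<^esub>" if "g \<in> carrier ?N" for g using that by (auto simp: kernel_def)
  have proj: "pmap (dom.act k c) = pmap c" if k: "k \<in> carrier ?N" and c: "c \<in> topspace dom.D" for k c
  proof -
    obtain h x where h: "h \<in> carrier G" "x \<in> topspace Y" "c = dom.cls h x" by (rule dom.topspace_D_cases[OF c])
    show ?thesis unfolding h(3) using ker[OF k] h by (simp add: dom.act_cls pmap_cls)
  qed
  have deck: "dom.act k \<in> carrier (deck_group dom.D pmap)" if k: "k \<in> carrier ?N" for k
    using proj[OF k] dom.act_homeo[OF ker(1)[OF k]] by (simp add: deck_group_def) (simp add: dom.act_def)
  have "dom.act \<in> iso ?N (deck_group dom.D pmap)"
    unfolding iso_def
  proof (intro CollectI conjI homI)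
    fix k l assume kl: "k \<in> carrier ?N" "l \<in> carrier ?N"
    show "dom.act k \<in> carrier (deck_group dom.D pmap)" by (rule deck[OF kl(1)])
    have "dom.act (k \<otimes> l) = compose (topspace dom.D) (dom.act k) (dom.act l)"
    proof (rule extensionalityI[of _ "topspace dom.D"])
      show "dom.act (k \<otimes> l) \<in> extensional (topspace dom.D)" by (simp add: dom.act_def)
      fix c assume "c \<in> topspace dom.D"
      then show "dom.act (k \<otimes> l) c = compose (topspace dom.D) (dom.act k) (dom.act l) c"
        using ker(1)[OF kl(1)] ker(1)[OF kl(2)] dom.act_mult by (simp add: compose_def)
    qed (rule compose_extensional)
    then show "dom.act (k \<otimes>\<^bsub>?N\<^esub> l) = dom.act k \<otimes>\<^bsub>deck_group dom.D pmap\<^esub> dom.act l" by (simp add: deck_group_def)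
  next
    show "bij_betw dom.act (carrier ?N) (carrier (deck_group dom.D pmap))"
    proof (rule bij_betw_imageI)
      show "inj_on dom.act (carrier ?N)"
      proof (rule inj_onI)
        fix k l assume kl: "k \<in> carrier ?N" "l \<in> carrier ?N" and eq: "dom.act k = dom.act l"
        from fun_cong[OF eq, of ?b] show "k = l"
          using ker(1)[OF kl(1)] ker(1)[OF kl(2)] by (simp add: dom.act_cls dom.x0_Y dom.cls_x0_eq_iff)
      qed
      show "dom.act ` carrier ?N = carrier (deck_group dom.D pmap)"
      proof (intro equalityI subsetI)
        fix F assume "F \<in> carrier (deck_group dom.D pmap)"
        then have F: "F \<in> extensional (topspace dom.D)" "homeomorphic_map dom.D dom.D F"
          "\<And>c. c \<in> topspace dom.D \<Longrightarrow> pmap (F c) = pmap c" by (auto simp: deck_group_def)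
        note cF = homeomorphic_imp_continuous_map[OF F(2)]
        have "F ?b \<in> topspace dom.D" using cF b by (auto simp: continuous_map_def)
        then obtain g x where g: "g \<in> carrier G" "x \<in> topspace Y" "F ?b = dom.cls g x" by (rule dom.topspace_D_cases)
        have "cod.cls (f g) x = cod.cls \<one>\<^bsub>H\<^esub> cod.x0"
          using F(3)[OF b] unfolding g(3) by (simp add: pmap_cls g dom.x0_Y)
        then have x: "x = cod.x0" "cod.cls (f g) cod.x0 = cod.cls \<one>\<^bsub>H\<^esub> cod.x0"
          using cod.cls_eq_iff[of "f g" x "\<one>\<^bsub>H\<^esub>" cod.x0] g cod.x0_Y by auto
        have fg: "f g = \<one>\<^bsub>H\<^esub>" using x(2) cod.cls_x0_eq_iff[of "f g" "\<one>\<^bsub>H\<^esub>"] g by simp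
        have gN: "g \<in> carrier ?N" using g fg by (simp add: kernel_def)
        have "F c = dom.act g c" if c: "c \<in> topspace dom.D" for c
          by (rule covering_unique_lift[OF covering cF dom.act_continuous[OF g(1)] con _ b _ c])
            (use F(3) proj[OF gN] g x in \<open>auto simp: dom.act_cls dom.x0_Y\<close>)
        then have "F = dom.act g"
          using F(1) by (intro extensionalityI[of _ "topspace dom.D"]) (auto simp: dom.act_def)
        then show "F \<in> dom.act ` carrier ?N" using gN by blast
      qed (use deck in auto)
    qed
  qed
  then show ?thesis by (rule group.iso_sym[OF N is_isoI])
qed

end

section \<open>Lattice bases and smooth cones\<close>

text \<open>The coordinate along \<open>b\<close>. It depends on the whole basis \<open>B\<close>,
  hence the first argument.\<close>

definition dual_vec :: "'a::real_vector set \<Rightarrow> 'a \<Rightarrow> 'a \<Rightarrow> real" where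
  "dual_vec B b = (SOME u. linear u \<and> (\<forall>c\<in>B. u c = (if c = b then 1 else 0)))"

locale lattice_basis =
  fixes N :: "'a::real_vector set" and B :: "'a set"
  assumes basis: "Z_basis N B"
begin

lemma finite_B: "finite B" and indep_B: "independent B" and span_B: "span B = UNIV"
  and N_eq: "N = range (\<lambda>c :: 'a \<Rightarrow> int. \<Sum>b\<in>B. of_int (c b) *\<^sub>R b)"
  using basis by (auto simp: Z_basis_def)

lemma dual_vec: "linear (dual_vec B b)" and dual_vec_basis: "c \<in> B \<Longrightarrow> dual_vec B b c = (if c = b then 1 else 0)"
proof -
  have "\<exists>u. linear u \<and> (\<forall>c\<in>B. u c = (if c = b then 1 else (0::real)))"
    by (rule linear_independent_extend[OF indep_B])
  then have "linear (dual_vec B b) \<and> (\<forall>c\<in>B. dual_vec B b c = (if c = b then 1 else 0))"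
    unfolding dual_vec_def by (rule someI_ex)
  then show "linear (dual_vec B b)" "c \<in> B \<Longrightarrow> dual_vec B b c = (if c = b then 1 else 0)" by auto
qed

lemma linear_eq_B:
  assumes "linear u" "linear w" "\<And>b. b \<in> B \<Longrightarrow> u b = w b"
  shows "u = w"
proof
  fix v show "u v = w v"
    by (rule linear_eq_on[OF assms(1,2), of v B]) (use span_B assms(3) in auto)
qed

lemma linear_sum_dual:
  assumes "C \<subseteq> B"
  shows "linear (\<lambda>v. \<Sum>b\<in>C. f b * dual_vec B b v :: real)"
proof (rule linearI)
  fix v w show "(\<Sum>b\<in>C. f b * dual_vec B b (v + w)) = (\<Sum>b\<in>C. f b * dual_vec B b v) + (\<Sum>b\<in>C. f b * dual_vec B b w)"
    by (simp add: linear_add[OF dual_vec] distrib_left sum.distrib)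
next
  fix c v show "(\<Sum>b\<in>C. f b * dual_vec B b (c *\<^sub>R v)) = c *\<^sub>R (\<Sum>b\<in>C. f b * dual_vec B b v)"
    by (simp add: linear_scale[OF dual_vec] sum_distrib_left mult.left_commute)
qed

lemma sum_dual_basis:
  assumes "C \<subseteq> B" "c \<in> B"
  shows "(\<Sum>b\<in>C. f b * dual_vec B b c :: real) = (if c \<in> C then f c else 0)"
proof -
  have "(\<Sum>b\<in>C. f b * dual_vec B b c) = (\<Sum>b\<in>C. if b = c then f c else 0)"
    by (rule sum.cong) (use assms dual_vec_basis in auto)
  moreover have "finite C" by (rule finite_subset[OF assms(1) finite_B])
  ultimately show ?thesis by simp
qed

lemma linear_expand:
  assumes "linear u"
  shows "u = (\<lambda>v. \<Sum>b\<in>B. u b * dual_vec B b v)"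
  by (rule linear_eq_B[OF assms linear_sum_dual[OF order_refl]]) (simp add: sum_dual_basis)

lemma vec_expand: "v = (\<Sum>b\<in>B. dual_vec B b v *\<^sub>R b)"
proof -
  have l1: "linear (\<lambda>v. \<Sum>b\<in>B. dual_vec B b v *\<^sub>R b)"
    by (rule linearI) (simp_all add: linear_add[OF dual_vec] linear_scale[OF dual_vec] scaleR_add_left sum.distrib scaleR_sum_right)
  have l2: "linear (\<lambda>v::'a. v)" by (rule linearI) auto
  show ?thesis
  proof (rule linear_eq_on[OF l2 l1, of v B])
    fix c assume c: "c \<in> B"
    have "(\<Sum>b\<in>B. dual_vec B b c *\<^sub>R b) = (\<Sum>b\<in>B. if b = c then c else 0)"
      by (rule sum.cong) (use c dual_vec_basis in auto)
    then show "c = (\<Sum>b\<in>B. dual_vec B b c *\<^sub>R b)" using c finite_B by simp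
  qed (use span_B in auto)
qed

lemma N_memI: "(\<Sum>b\<in>B. of_int (c b) *\<^sub>R b) \<in> N" for c :: "'a \<Rightarrow> int"
  unfolding N_eq by (rule range_eqI[of _ _ c]) simp

lemma N_memE:
  assumes "v \<in> N"
  obtains c :: "'a \<Rightarrow> int" where "v = (\<Sum>b\<in>B. of_int (c b) *\<^sub>R b)"
  using assms unfolding N_eq by (elim rangeE) blast

lemma B_in_N: "b \<in> B \<Longrightarrow> b \<in> N"
proof -
  assume b: "b \<in> B"
  have "(\<Sum>c\<in>B. of_int (if c = b then 1 else 0) *\<^sub>R c) = (\<Sum>c\<in>B. if c = b then b else 0)"
    by (rule sum.cong) auto
  then have "b = (\<Sum>c\<in>B. of_int (if c = b then 1 else 0) *\<^sub>R c)" using b finite_B by simp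
  then show ?thesis using N_memI[of "\<lambda>c. if c = b then 1 else 0"] by (simp only:)
qed

lemma N_add: "v \<in> N \<Longrightarrow> w \<in> N \<Longrightarrow> v + w \<in> N"
proof -
  assume v: "v \<in> N" and w: "w \<in> N"
  obtain c :: "'a \<Rightarrow> int" where "v = (\<Sum>b\<in>B. of_int (c b) *\<^sub>R b)" by (rule N_memE[OF v])
  moreover obtain d :: "'a \<Rightarrow> int" where "w = (\<Sum>b\<in>B. of_int (d b) *\<^sub>R b)" by (rule N_memE[OF w])
  ultimately have "v + w = (\<Sum>b\<in>B. of_int (c b + d b) *\<^sub>R b)" by (simp add: scaleR_add_left sum.distrib)
  then show ?thesis using N_memI[of "\<lambda>b. c b + d b"] by (simp only:)
qed

lemma N_uminus: "v \<in> N \<Longrightarrow> - v \<in> N"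
proof -
  assume v: "v \<in> N"
  obtain c :: "'a \<Rightarrow> int" where "v = (\<Sum>b\<in>B. of_int (c b) *\<^sub>R b)" by (rule N_memE[OF v])
  then have "- v = (\<Sum>b\<in>B. of_int (- c b) *\<^sub>R b)" by (simp add: sum_negf)
  then show ?thesis using N_memI[of "\<lambda>b. - c b"] by (simp only:)
qed

lemma zero_in_N: "0 \<in> N"
  using N_memI[of "\<lambda>_. 0"] by simp

lemma dual_vec_combination:
  assumes "c \<in> B"
  shows "dual_vec B c (\<Sum>b\<in>B. f b *\<^sub>R b) = f c"
proof -
  have "dual_vec B c (\<Sum>b\<in>B. f b *\<^sub>R b) = (\<Sum>b\<in>B. f b * dual_vec B c b)"
    by (simp add: linear_sum[OF dual_vec] linear_scale[OF dual_vec])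
  also have "\<dots> = (\<Sum>b\<in>B. if b = c then f c else 0)" by (rule sum.cong) (use dual_vec_basis in auto)
  finally show ?thesis using assms finite_B by simp
qed

lemma dual_vec_N: "b \<in> B \<Longrightarrow> v \<in> N \<Longrightarrow> dual_vec B b v \<in> \<int>"
  unfolding N_eq by (auto simp: dual_vec_combination)

lemma dual_lattice_iff: "u \<in> dual_lattice N \<longleftrightarrow> linear u \<and> (\<forall>b\<in>B. u b \<in> \<int>)"
proof
  assume "u \<in> dual_lattice N"
  then show "linear u \<and> (\<forall>b\<in>B. u b \<in> \<int>)" using B_in_N by (auto simp: dual_lattice_def)
next
  assume u: "linear u \<and> (\<forall>b\<in>B. u b \<in> \<int>)"
  have "u v \<in> \<int>" if v: "v \<in> N" for v
  proof -
    obtain c :: "'a \<Rightarrow> int" where "v = (\<Sum>b\<in>B. of_int (c b) *\<^sub>R b)" by (rule N_memE[OF v])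
    then have "u v = (\<Sum>b\<in>B. of_int (c b) * u b)" using u by (simp add: linear_sum linear_scale)
    also have "\<dots> \<in> \<int>" using u by (intro Ints_sum Ints_mult) auto
    finally show ?thesis .
  qed
  then show "u \<in> dual_lattice N" using u by (simp add: dual_lattice_def)
qed

text \<open>In coordinates a cone spanned by part of the basis is an orthant of a coordinate
  subspace. Its faces and their generators are read off from this.\<close>

lemma cone_coordinates:
  assumes S: "S \<subseteq> B"
  shows "convex_cone hull S = {v. \<forall>b\<in>B. if b \<in> S then 0 \<le> dual_vec B b v else dual_vec B b v = 0}" (is "_ = ?C")
proof
  have "convex_cone ?C"
    unfolding convex_cone_iff
    by (auto simp: linear_0[OF dual_vec] linear_add[OF dual_vec] linear_scale[OF dual_vec] split: if_splits)
  moreover have "S \<subseteq> ?C" using S dual_vec_basis by auto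
  ultimately show "convex_cone hull S \<subseteq> ?C" by (rule hull_minimal[rotated])
  show "?C \<subseteq> convex_cone hull S"
  proof
    fix v assume v: "v \<in> ?C"
    have "(\<Sum>b\<in>T. dual_vec B b v *\<^sub>R b) \<in> convex_cone hull S" if "finite T" "T \<subseteq> B" for T
      using that
    proof (induction T rule: finite_induct)
      case (insert b T)
      have "dual_vec B b v *\<^sub>R b \<in> convex_cone hull S"
      proof (cases "b \<in> S")
        case True
        then show ?thesis using v insert.prems hull_inc[of b S] by (intro convex_cone_hull_mul) auto
      next
        case False
        then show ?thesis using v insert.prems convex_cone_hull_contains_0 by auto
      qed
      then show ?case using insert by (auto intro: convex_cone_hull_add)
    qed (simp add: convex_cone_hull_contains_0)
    from this[OF finite_B order_refl] show "v \<in> convex_cone hull S" using vec_expand[of v] by simp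
  qed
qed

text \<open>A coordinate that is nonnegative at both ends of a segment and 0 at an inner point is 0
  at both ends.\<close>

lemma subcone_face:
  assumes S: "S \<subseteq> B" and T: "T \<subseteq> S"
  shows "convex_cone hull T face_of convex_cone hull S"
  unfolding face_of_def
proof (intro conjI ballI impI)
  have TB: "T \<subseteq> B" using S T by auto
  show "convex_cone hull T \<subseteq> convex_cone hull S" by (rule hull_mono[OF T])
  show "convex (convex_cone hull T)" by (rule convex_convex_cone_hull)
  fix x y z assume x: "x \<in> convex_cone hull S" and y: "y \<in> convex_cone hull S"
    and z: "z \<in> convex_cone hull T" "z \<in> open_segment x y"
  obtain t where t: "0 < t" "t < 1" "z = (1 - t) *\<^sub>R x + t *\<^sub>R y" using z(2) by (auto simp: in_segment)
  have *: "dual_vec B b x = 0 \<and> dual_vec B b y = 0" if b: "b \<in> S - T" for b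
  proof -
    have pos: "0 \<le> dual_vec B b x" "0 \<le> dual_vec B b y" using x y b S by (auto simp: cone_coordinates)
    have "dual_vec B b z = 0" using z(1) b S by (auto simp: cone_coordinates[OF TB])
    then have "(1 - t) * dual_vec B b x + t * dual_vec B b y = 0"
      unfolding t(3) by (simp add: linear_add[OF dual_vec] linear_scale[OF dual_vec])
    moreover have "0 \<le> (1 - t) * dual_vec B b x" "0 \<le> t * dual_vec B b y" using t pos by auto
    ultimately have "(1 - t) * dual_vec B b x = 0" "t * dual_vec B b y = 0" by linarith+
    then show ?thesis using t by auto
  qed
  show "x \<in> convex_cone hull T" "y \<in> convex_cone hull T"
    using x y * T unfolding cone_coordinates[OF S] cone_coordinates[OF TB] by (auto split: if_splits)
qed

text \<open>Faces are defined through open segments, not sums. Here \<open>x + y\<close> is the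
  midpoint of \<open>2 *\<^sub>R x\<close> and \<open>2 *\<^sub>R y\<close>, and
  \<open>2 *\<^sub>R z\<close> is the midpoint of \<open>z\<close> and \<open>3 *\<^sub>R z\<close>,
  which removes the factor 2 again. The case \<open>x = y\<close> is separate because the first
  segment is then degenerate.\<close>

lemma face_summand:
  assumes F: "F face_of C" and C: "convex_cone C" and x: "x \<in> C" and y: "y \<in> C" and xy: "x + y \<in> F"
  shows "x \<in> F"
proof -
  have 2: "2 *\<^sub>R x \<in> C" "2 *\<^sub>R y \<in> C" using convex_cone_scaleR[OF C _ x] convex_cone_scaleR[OF C _ y] by simp_all
  have half: "z \<in> F" if z: "2 *\<^sub>R z \<in> F" "z \<in> C" for z
  proof (cases "z = 0")
    case True
    then show ?thesis using z by simp
  next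
    case False
    have "z \<noteq> 3 *\<^sub>R z" using scaleR_cancel_right[of 1 z 3] False by simp
    then have "2 *\<^sub>R z \<in> open_segment z (3 *\<^sub>R z)"
      unfolding in_segment by (auto intro!: exI[of _ "1/2"] simp: scaleR_add_left[symmetric])
    moreover have "3 *\<^sub>R z \<in> C" using convex_cone_scaleR[OF C _ z(2)] by simp
    ultimately show ?thesis using F z by (meson face_ofD)
  qed
  show ?thesis
  proof (cases "x = y")
    case True
    then have "2 *\<^sub>R x \<in> F" using xy by (simp add: scaleR_2)
    then show ?thesis using half x by blast
  next
    case False
    then have "x + y \<in> open_segment (2 *\<^sub>R x) (2 *\<^sub>R y)"
      unfolding in_segment by (auto intro!: exI[of _ "1/2"])
    then have "2 *\<^sub>R x \<in> F" using F 2 xy by (meson face_ofD)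
    then show ?thesis using half x by blast
  qed
qed

lemma face_scale:
  assumes F: "F face_of C" and C: "convex_cone C" and x: "x \<in> F" and c: "0 \<le> c"
  shows "c *\<^sub>R x \<in> F"
proof -
  have "conic F" using face_of_conic F C unfolding convex_cone_def by blast
  then show ?thesis using x c by (simp add: conic_def)
qed

text \<open>\<open>v\<close> is its component along \<open>b\<close> plus a rest, and both lie in
  the cone. So the component lies in the face, and \<open>b\<close> is a positive multiple of
  it.\<close>

lemma face_generators:
  assumes S: "S \<subseteq> B" and F: "F face_of convex_cone hull S" and v: "v \<in> F" and b: "b \<in> B" "dual_vec B b v \<noteq> 0"
  shows "b \<in> S \<inter> F"
proof -
  note CC = convex_cone_convex_cone_hull[of S]
  have vS: "v \<in> convex_cone hull S" using F v face_of_imp_subset by blast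
  have bS: "b \<in> S" using vS b by (auto simp: cone_coordinates[OF S] split: if_splits)
  then have pos: "0 < dual_vec B b v" using vS b by (auto simp: cone_coordinates[OF S] order_less_le)
  let ?x = "dual_vec B b v *\<^sub>R b" and ?y = "v - dual_vec B b v *\<^sub>R b"
  have x: "?x \<in> convex_cone hull S" using bS pos hull_inc[of b S] by (intro convex_cone_hull_mul) auto
  have y: "?y \<in> convex_cone hull S"
    using vS b(1) dual_vec_basis[OF b(1)] unfolding cone_coordinates[OF S]
    by (auto simp: linear_diff[OF dual_vec] linear_scale[OF dual_vec])
  have "?x \<in> F" by (rule face_summand[OF F CC x y]) (use v in simp)
  from face_scale[OF F CC this, of "1 / dual_vec B b v"] have "b \<in> F" using pos by simp
  then show ?thesis using bS by simp
qed

lemma basis_primitive: "b \<in> B \<Longrightarrow> 0 < c \<Longrightarrow> c < 1 \<Longrightarrow> c *\<^sub>R b \<notin> N"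
proof
  assume b: "b \<in> B" "0 < c" "c < 1" "c *\<^sub>R b \<in> N"
  have "dual_vec B b (c *\<^sub>R b) = c" using b by (simp add: linear_scale[OF dual_vec] dual_vec_basis)
  then have "c \<in> \<int>" using dual_vec_N[OF b(1,4)] by simp
  then show False using b(2,3) by (auto simp: Ints_def)
qed

lemma dim_cone:
  assumes S: "S \<subseteq> B"
  shows "dim (convex_cone hull S) = card S"
proof -
  have "convex_cone hull S \<subseteq> span S"
    by (rule hull_minimal[OF span_superset]) (rule subspace_imp_convex_cone[OF subspace_span])
  moreover have "S \<subseteq> convex_cone hull S" by (rule hull_subset)
  ultimately have "span (convex_cone hull S) = span S"
    by (meson span_mono span_minimal subspace_span subset_antisym)
  then have "dim (convex_cone hull S) = dim (span S)" by (metis dim_span)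
  also have "\<dots> = card S" by (rule dim_span_eq_card_independent[OF independent_mono[OF indep_B S]])
  finally show ?thesis .
qed

end

section \<open>Smooth fans as simplicial complexes\<close>

locale smooth_fan_locale =
  fixes N :: "'a::real_vector set" and \<Delta> :: "'a set set"
  assumes smooth: "smooth_fan N \<Delta>"
begin

abbreviation "V \<equiv> primitive_vectors N \<Delta>"

lemma fan_face: "\<sigma> \<in> \<Delta> \<Longrightarrow> \<tau> face_of \<sigma> \<Longrightarrow> \<tau> \<noteq> {} \<Longrightarrow> \<tau> \<in> \<Delta>"
  and fan_Int: "\<sigma> \<in> \<Delta> \<Longrightarrow> \<tau> \<in> \<Delta> \<Longrightarrow> (\<sigma> \<inter> \<tau>) face_of \<sigma>"
  and fan_finite: "finite \<Delta>" and fan_nonempty: "\<Delta> \<noteq> {}"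
  using smooth by (auto simp: smooth_fan_def fan_def)

lemma smooth_cone:
  assumes "\<sigma> \<in> \<Delta>"
  obtains B S where "Z_basis N B" "S \<subseteq> B" "\<sigma> = convex_cone hull S"
  using smooth assms unfolding smooth_fan_def by blast

lemma primitive_unique:
  assumes b: "\<And>c. 0 < c \<Longrightarrow> c < 1 \<Longrightarrow> c *\<^sub>R b \<notin> N" "b \<in> N"
    and v: "\<And>c. 0 < c \<Longrightarrow> c < 1 \<Longrightarrow> c *\<^sub>R v \<notin> N" "v \<in> N" and t: "0 < t" "b = t *\<^sub>R v"
  shows "b = v"
proof -
  have vb: "v = (1 / t) *\<^sub>R b" using t by simp
  have "\<not> t < 1" using v(1)[of t] t b(2) by auto
  moreover have "\<not> 1 < t" using b(1)[of "1 / t"] t(1) v(2) vb by auto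
  ultimately show ?thesis using t by simp
qed

text \<open>The generators of a cone are intrinsic: they do not depend on the lattice basis used to
  exhibit them. This turns the face relation between cones into inclusion of vertex sets.\<close>

lemma generators_eq:
  assumes \<sigma>: "\<sigma> \<in> \<Delta>" and B: "Z_basis N B" and S: "S \<subseteq> B" and eq: "\<sigma> = convex_cone hull S"
  shows "V \<inter> \<sigma> = S"
proof
  interpret lattice_basis N B using B by unfold_locales
  show SV: "S \<subseteq> V \<inter> \<sigma>"
  proof
    fix b assume b: "b \<in> S"
    then have bB: "b \<in> B" using S by auto
    have f: "convex_cone hull {b} face_of \<sigma>" unfolding eq by (rule subcone_face[OF S]) (use b in simp)
    have "convex_cone hull {b} \<in> \<Delta>" by (rule fan_face[OF \<sigma> f]) (simp add: convex_cone_hull_nonempty)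
    moreover have "dim (convex_cone hull {b}) = 1" using dim_cone[of "{b}"] bB by simp
    moreover have "b \<in> convex_cone hull {b}" by (rule hull_inc) simp
    moreover have "b \<noteq> 0" using indep_B bB dependent_zero by blast
    ultimately have "b \<in> V" using B_in_N[OF bB] basis_primitive[OF bB] unfolding primitive_vectors_def by blast
    moreover have "b \<in> \<sigma>" unfolding eq using b by (rule hull_inc)
    ultimately show "b \<in> V \<inter> \<sigma>" by simp
  qed
  show "V \<inter> \<sigma> \<subseteq> S"
  proof
    fix v assume v: "v \<in> V \<inter> \<sigma>"
    then obtain \<rho> where \<rho>: "\<rho> \<in> \<Delta>" "dim \<rho> = 1" "v \<in> \<rho>" and vN: "v \<in> N" "v \<noteq> 0"
      and vp: "\<And>c. 0 < c \<Longrightarrow> c < 1 \<Longrightarrow> c *\<^sub>R v \<notin> N"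
      unfolding primitive_vectors_def by blast
    obtain B' S' where B': "Z_basis N B'" "S' \<subseteq> B'" "\<rho> = convex_cone hull S'" by (rule smooth_cone[OF \<rho>(1)])
    interpret R: lattice_basis N B' using B' by unfold_locales
    have "card S' = 1" using R.dim_cone[OF B'(2)] \<rho>(2) B'(3) by simp
    then obtain b' where b': "S' = {b'}" by (meson card_1_singletonE)
    then have bB': "b' \<in> B'" using B'(2) by simp
    have ray: "\<exists>t\<ge>0. w = t *\<^sub>R b'" if "w \<in> \<rho>" for w
    proof -
      have w: "\<forall>b\<in>B'. if b = b' then 0 \<le> dual_vec B' b w else dual_vec B' b w = 0"
        using that unfolding B'(3) b' R.cone_coordinates[OF B'(2)[unfolded b']] by simp
      have "w = (\<Sum>b\<in>B'. dual_vec B' b w *\<^sub>R b)" by (rule R.vec_expand)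
      also have "\<dots> = (\<Sum>b\<in>B'. if b = b' then dual_vec B' b' w *\<^sub>R b' else 0)" by (rule sum.cong) (use w in \<open>auto split: if_splits\<close>)
      finally have "w = dual_vec B' b' w *\<^sub>R b'" using bB' R.finite_B by simp
      then show ?thesis using w bB' by (intro exI[of _ "dual_vec B' b' w"]) auto
    qed
    obtain t where t: "0 \<le> t" "v = t *\<^sub>R b'" using ray[OF \<rho>(3)] by blast
    have t0: "0 < t" using t vN(2) by (cases "t = 0") auto
    have vb: "v = b'"
      by (rule primitive_unique[OF vp vN(1) R.basis_primitive[OF bB'] R.B_in_N[OF bB'] t0 t(2)])
    \<comment> \<open>The ray of \<open>v\<close> meets the cone in a face of the cone, and a face
      contains the basis vectors that occur in its elements. Such a basis vector lies on the ray, so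
      by primitivity it equals \<open>v\<close>.\<close>
    have F: "(\<sigma> \<inter> \<rho>) face_of convex_cone hull S" using fan_Int[OF \<sigma> \<rho>(1)] unfolding eq .
    have "\<exists>b\<in>B. dual_vec B b v \<noteq> 0"
    proof (rule ccontr)
      assume "\<not> ?thesis"
      then have "(\<Sum>b\<in>B. dual_vec B b v *\<^sub>R b) = 0" by simp
      then show False using vec_expand[of v] vN(2) by simp
    qed
    then obtain b where b: "b \<in> B" "dual_vec B b v \<noteq> 0" by blast
    have bS: "b \<in> S \<inter> (\<sigma> \<inter> \<rho>)" by (rule face_generators[OF S F _ b]) (use v \<rho> in auto)
    obtain s where s: "0 \<le> s" "b = s *\<^sub>R v" using ray[of b] bS vb by auto
    have "b \<noteq> 0" using indep_B b(1) dependent_zero by blast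
    then have s0: "0 < s" using s by (cases "s = 0") auto
    have "b = v" by (rule primitive_unique[OF basis_primitive[OF b(1)] B_in_N[OF b(1)] vp vN(1) s0 s(2)])
    then show "v \<in> S" using bS by simp
  qed
qed

lemma cone_basis:
  assumes "\<sigma> \<in> \<Delta>"
  obtains B where "Z_basis N B" "V \<inter> \<sigma> \<subseteq> B" "\<sigma> = convex_cone hull (V \<inter> \<sigma>)"
  using smooth_cone[OF assms] generators_eq[OF assms] by metis

lemma cone_eq_hull: "\<sigma> \<in> \<Delta> \<Longrightarrow> convex_cone hull (V \<inter> \<sigma>) = \<sigma>"
  using cone_basis by metis

lemma subset_cone:
  assumes \<sigma>: "\<sigma> \<in> \<Delta>" and T: "T \<subseteq> V \<inter> \<sigma>"
  shows "convex_cone hull T \<in> \<Delta>" "V \<inter> (convex_cone hull T) = T" "convex_cone hull T face_of \<sigma>"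
proof -
  obtain B where B: "Z_basis N B" "V \<inter> \<sigma> \<subseteq> B" "\<sigma> = convex_cone hull (V \<inter> \<sigma>)" by (rule cone_basis[OF \<sigma>])
  interpret lattice_basis N B using B by unfold_locales
  show f: "convex_cone hull T face_of \<sigma>" by (subst B(3)) (rule subcone_face[OF B(2) T])
  show c: "convex_cone hull T \<in> \<Delta>" by (rule fan_face[OF \<sigma> f]) (simp add: convex_cone_hull_nonempty)
  show "V \<inter> (convex_cone hull T) = T" by (rule generators_eq[OF c B(1)]) (use T B(2) in auto)
qed

lemma zero_mem_cone: "\<sigma> \<in> \<Delta> \<Longrightarrow> 0 \<in> \<sigma>"
  using cone_eq_hull convex_cone_hull_contains_0 by metis

lemma Int_cone:
  assumes "\<sigma> \<in> \<Delta>" "\<tau> \<in> \<Delta>"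
  shows "\<sigma> \<inter> \<tau> \<in> \<Delta>"
  by (rule fan_face[OF assms(1) fan_Int[OF assms]]) (use zero_mem_cone assms in blast)

lemma face_iff:
  assumes "\<sigma> \<in> \<Delta>" "\<tau> \<in> \<Delta>"
  shows "\<tau> face_of \<sigma> \<longleftrightarrow> V \<inter> \<tau> \<subseteq> V \<inter> \<sigma>"
  using subset_cone(3)[OF assms(1), of "V \<inter> \<tau>"] cone_eq_hull[OF assms(2)] face_of_imp_subset by auto

lemma finite_generators:
  assumes "\<sigma> \<in> \<Delta>"
  shows "finite (V \<inter> \<sigma>)"
proof -
  obtain B where B: "Z_basis N B" "V \<inter> \<sigma> \<subseteq> B" using cone_basis[OF assms] by metis
  then show ?thesis using finite_subset by (auto simp: Z_basis_def)
qed

lemma finite_V: "finite V"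
proof -
  have "V \<subseteq> (\<Union>\<sigma>\<in>\<Delta>. V \<inter> \<sigma>)" unfolding primitive_vectors_def by blast
  moreover have "finite (\<Union>\<sigma>\<in>\<Delta>. V \<inter> \<sigma>)" using fan_finite finite_generators by blast
  ultimately show ?thesis by (rule finite_subset)
qed

lemma V_in_cone: "v \<in> V \<Longrightarrow> \<exists>\<sigma>\<in>\<Delta>. v \<in> V \<inter> \<sigma>"
  unfolding primitive_vectors_def by blast

text \<open>The fan as an abstract simplicial complex: a cone is encoded by its vertices and
  recovered as their hull.\<close>

definition complex :: "'a set set" where
  "complex = {V \<inter> \<sigma> | \<sigma>. \<sigma> \<in> \<Delta>}"

lemma complex_iff: "S \<in> complex \<longleftrightarrow> S \<subseteq> V \<and> convex_cone hull S \<in> \<Delta>"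
proof
  assume "S \<in> complex"
  then obtain \<sigma> where "\<sigma> \<in> \<Delta>" "S = V \<inter> \<sigma>" by (auto simp: complex_def)
  then show "S \<subseteq> V \<and> convex_cone hull S \<in> \<Delta>" using cone_eq_hull by auto
next
  assume *: "S \<subseteq> V \<and> convex_cone hull S \<in> \<Delta>"
  have "S \<subseteq> V \<inter> (convex_cone hull S)" using * hull_subset by fastforce
  then have "V \<inter> (convex_cone hull S) = S"
  proof -
    have c: "convex_cone hull S \<in> \<Delta>" using * by simp
    obtain B where B: "Z_basis N B" "V \<inter> (convex_cone hull S) \<subseteq> B" using cone_basis[OF c] by metis
    have "S \<subseteq> B" using \<open>S \<subseteq> V \<inter> (convex_cone hull S)\<close> B by auto
    then show ?thesis using generators_eq[OF c B(1)] by auto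
  qed
  then show "S \<in> complex" using * unfolding complex_def by blast
qed

lemma complex_face: "S \<in> complex \<Longrightarrow> T \<subseteq> S \<Longrightarrow> T \<in> complex"
  using subset_cone(1)[of "convex_cone hull S" T] subset_cone(2)[of "convex_cone hull S" S] hull_subset[of S convex_cone]
  unfolding complex_iff by auto

lemma complex_cone: "S \<in> complex \<Longrightarrow> convex_cone hull S \<in> \<Delta> \<and> V \<inter> (convex_cone hull S) = S"
  unfolding complex_def by (auto simp: cone_eq_hull)

lemma complex_finite: "S \<in> complex \<Longrightarrow> finite S"
  using finite_generators[of "convex_cone hull S"] complex_cone[of S] by simp

lemma complex_empty: "{} \<in> complex"
proof -
  obtain \<sigma> where "\<sigma> \<in> \<Delta>" using fan_nonempty by blast
  then show ?thesis using subset_cone(1)[of \<sigma> "{}"] by (simp add: complex_iff)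
qed

text \<open>One lattice basis for each face, with no relation between the bases of different faces.
  Charts of different faces thus have different coordinate sets, which is why
  \<open>corner_space\<close> lets \<open>B\<close> depend on the face.\<close>

definition bas :: "'a set \<Rightarrow> 'a set" where
  "bas S = (SOME B. Z_basis N B \<and> S \<subseteq> B)"

lemma bas:
  assumes "S \<in> complex"
  shows "Z_basis N (bas S)" "S \<subseteq> bas S"
proof -
  obtain \<sigma> where "\<sigma> \<in> \<Delta>" "S = V \<inter> \<sigma>" using assms unfolding complex_def by blast
  obtain B where "Z_basis N B" "V \<inter> \<sigma> \<subseteq> B" by (rule cone_basis[OF \<open>\<sigma> \<in> \<Delta>\<close>])
  then have "\<exists>B. Z_basis N B \<and> S \<subseteq> B" using \<open>S = V \<inter> \<sigma>\<close> by blast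
  then have "Z_basis N (bas S) \<and> S \<subseteq> bas S" unfolding bas_def by (rule someI_ex)
  then show "Z_basis N (bas S)" "S \<subseteq> bas S" by auto
qed

end

section \<open>Monomial coordinates on semigroup homomorphisms\<close>

lemma dual_semigroup_antimono: "\<tau> \<subseteq> \<sigma> \<Longrightarrow> dual_semigroup N \<sigma> \<subseteq> dual_semigroup N \<tau>"
  by (auto simp: dual_semigroup_def)

lemma dual_semigroup_zero: "(\<lambda>_. 0) \<in> dual_semigroup N \<sigma>"
  by (auto simp: dual_semigroup_def dual_lattice_def intro: linearI)

lemma dual_semigroup_add:
  "u \<in> dual_semigroup N \<sigma> \<Longrightarrow> w \<in> dual_semigroup N \<sigma> \<Longrightarrow> (\<lambda>a. u a + w a) \<in> dual_semigroup N \<sigma>"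
  by (auto simp: dual_semigroup_def dual_lattice_def linear_compose_add)

lemma dual_lattice_eq: "dual_lattice N = dual_semigroup N (convex_cone hull {})"
  by (auto simp: dual_semigroup_def dual_lattice_def linear_0)

lemma dual_semigroup_sub: "dual_semigroup N \<sigma> \<subseteq> dual_lattice N"
  by (auto simp: dual_semigroup_def)

lemma sg_hom_mono: "A \<subseteq> A' \<Longrightarrow> sg_hom S A \<subseteq> sg_hom S A'"
  unfolding sg_hom_def by (auto simp: PiE_iff)

lemma sg_hom_mult:
  "x \<in> sg_hom S A \<Longrightarrow> u \<in> S \<Longrightarrow> w \<in> S \<Longrightarrow> x (\<lambda>a. u a + w a) = x u * x w"
  by (auto simp: sg_hom_def)

lemma sg_hom_zero: "x \<in> sg_hom S A \<Longrightarrow> x (\<lambda>_. 0) = 1"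
  by (simp add: sg_hom_def)

lemma sg_hom_ext: "x \<in> sg_hom S A \<Longrightarrow> x \<in> extensional S"
  by (auto simp: sg_hom_def PiE_iff)

lemma sg_hom_range: "x \<in> sg_hom S A \<Longrightarrow> u \<in> S \<Longrightarrow> x u \<in> A"
  by (auto simp: sg_hom_def PiE_iff)

lemma sg_hom_restrict:
  assumes "x \<in> sg_hom S A" "S' \<subseteq> S" "(\<lambda>_. 0) \<in> S'" "\<And>u w. u \<in> S' \<Longrightarrow> w \<in> S' \<Longrightarrow> (\<lambda>a. u a + w a) \<in> S'"
  shows "restrict x S' \<in> sg_hom S' A"
proof -
  have "x (\<lambda>a. u a + w a) = x u * x w" if "u \<in> S'" "w \<in> S'" for u w
    by (rule sg_hom_mult[OF assms(1)]) (use that assms(2) in auto)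
  then show ?thesis using assms by (auto simp: sg_hom_def PiE_iff)
qed

lemma sg_hom_restrict_ds:
  "x \<in> sg_hom (dual_semigroup N \<tau>) A \<Longrightarrow> \<tau> \<subseteq> \<sigma> \<Longrightarrow> restrict x (dual_semigroup N \<sigma>) \<in> sg_hom (dual_semigroup N \<sigma>) A"
  by (rule sg_hom_restrict[OF _ dual_semigroup_antimono dual_semigroup_zero dual_semigroup_add])

lemma restrict_restrict_sub: "A' \<subseteq> A \<Longrightarrow> restrict (restrict x A) A' = restrict x A'"
  by (auto simp: restrict_def fun_eq_iff)

context lattice_basis
begin

text \<open>The homomorphism with coordinates \<open>f b\<close>, evaluated at \<open>u\<close>. For
  \<open>u\<close> in the dual lattice the floor only turns the integer \<open>u b\<close> into an
  exponent. A zero coordinate contributes the factor 1 where the exponent is 0, as distinguished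
  points require.\<close>

definition monomial :: "('a \<Rightarrow> real) \<Rightarrow> ('a \<Rightarrow> real) \<Rightarrow> real" where
  "monomial f u = (\<Prod>b\<in>B. f b powi \<lfloor>u b\<rfloor>)"

abbreviation ds :: "'a set \<Rightarrow> ('a \<Rightarrow> real) set" where
  "ds S \<equiv> dual_semigroup N (convex_cone hull S)"

lemma ds_iff:
  assumes "S \<subseteq> B"
  shows "u \<in> ds S \<longleftrightarrow> u \<in> dual_lattice N \<and> (\<forall>b\<in>S. 0 \<le> u b)"
proof
  assume "u \<in> ds S"
  then show "u \<in> dual_lattice N \<and> (\<forall>b\<in>S. 0 \<le> u b)" using hull_subset[of S convex_cone] by (auto simp: dual_semigroup_def)
next
  assume u: "u \<in> dual_lattice N \<and> (\<forall>b\<in>S. 0 \<le> u b)"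
  then have l: "linear u" by (simp add: dual_lattice_def)
  have "convex_cone hull S \<subseteq> {x. 0 \<le> u x}"
    by (rule hull_minimal)
      (use u in \<open>auto simp: convex_cone_iff linear_0[OF l] linear_add[OF l] linear_scale[OF l]\<close>)
  then show "u \<in> ds S" using u by (auto simp: dual_semigroup_def)
qed

lemma dual_lattice_floor: "u \<in> dual_lattice N \<Longrightarrow> b \<in> B \<Longrightarrow> of_int \<lfloor>u b\<rfloor> = u b"
  using B_in_N by (auto simp: dual_lattice_def Ints_def)

lemma dual_lattice_floor_add:
  "u \<in> dual_lattice N \<Longrightarrow> w \<in> dual_lattice N \<Longrightarrow> v \<in> N \<Longrightarrow> \<lfloor>u v + w v\<rfloor> = \<lfloor>u v\<rfloor> + \<lfloor>w v\<rfloor>"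
  by (auto simp: dual_lattice_def Ints_def)

lemma dual_vec_dual_lattice: "b \<in> B \<Longrightarrow> dual_vec B b \<in> dual_lattice N"
  unfolding dual_lattice_iff using dual_vec dual_vec_basis by auto

lemma dual_vec_ds: "S \<subseteq> B \<Longrightarrow> b \<in> B \<Longrightarrow> dual_vec B b \<in> ds S"
  unfolding ds_iff using dual_vec_dual_lattice dual_vec_basis by (auto simp: subset_iff)

lemma neg_dual_vec_ds: "S \<subseteq> B \<Longrightarrow> b \<in> B - S \<Longrightarrow> (\<lambda>v. - dual_vec B b v) \<in> ds S"
  unfolding ds_iff dual_lattice_iff using dual_vec dual_vec_basis by (auto simp: subset_iff linear_compose_neg)

lemma monomial_zero [simp]: "monomial f (\<lambda>_. 0) = 1"
  by (simp add: monomial_def)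

lemma monomial_add:
  assumes S: "S \<subseteq> B" and f: "\<And>b. b \<in> B - S \<Longrightarrow> f b \<noteq> 0" and u: "u \<in> ds S" and w: "w \<in> ds S"
  shows "monomial f (\<lambda>a. u a + w a) = monomial f u * monomial f w"
  unfolding monomial_def prod.distrib[symmetric]
proof (rule prod.cong)
  fix b assume b: "b \<in> B"
  have ul: "u \<in> dual_lattice N" "w \<in> dual_lattice N" using u w dual_semigroup_sub by auto
  have e: "\<lfloor>u b + w b\<rfloor> = \<lfloor>u b\<rfloor> + \<lfloor>w b\<rfloor>" by (rule dual_lattice_floor_add[OF ul B_in_N[OF b]])
  show "f b powi \<lfloor>u b + w b\<rfloor> = f b powi \<lfloor>u b\<rfloor> * f b powi \<lfloor>w b\<rfloor>"
  proof (cases "f b \<noteq> 0 \<or> \<lfloor>u b\<rfloor> + \<lfloor>w b\<rfloor> \<noteq> 0")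
    case True
    then show ?thesis unfolding e by (rule power_int_add)
  next
    case False
    \<comment> \<open>The delicate case is a zero coordinate whose exponents add up to 0. It belongs
      to \<open>S\<close>, where both exponents are nonnegative, so both are 0.\<close>
    then have "b \<in> S" using f b by auto
    then have "0 \<le> u b" "0 \<le> w b" using u w by (auto simp: ds_iff[OF S])
    then have "0 \<le> \<lfloor>u b\<rfloor>" "0 \<le> \<lfloor>w b\<rfloor>" by auto
    then have "\<lfloor>u b\<rfloor> = 0" "\<lfloor>w b\<rfloor> = 0" using False by linarith+
    then show ?thesis unfolding e by simp
  qed
qed simp

lemma monomial_dual_vec:
  assumes "b \<in> B"
  shows "monomial f (dual_vec B b) = f b"
proof -
  have "monomial f (dual_vec B b) = (\<Prod>c\<in>B. if c = b then f b else 1)"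
    unfolding monomial_def by (rule prod.cong) (use dual_vec_basis in auto)
  then show ?thesis using assms finite_B by simp
qed

lemma monomial_cong: "(\<And>b. b \<in> B \<Longrightarrow> f b = g b) \<Longrightarrow> monomial f u = monomial g u"
  unfolding monomial_def by (rule prod.cong) auto

lemma monomial_nonneg: "(\<And>b. b \<in> B \<Longrightarrow> 0 \<le> f b) \<Longrightarrow> 0 \<le> monomial f u"
  unfolding monomial_def by (intro prod_nonneg) auto

lemma monomial_pos: "(\<And>b. b \<in> B \<Longrightarrow> 0 < f b) \<Longrightarrow> 0 < monomial f u"
  unfolding monomial_def by (intro prod_pos) auto

lemma monomial_sg_hom:
  assumes S: "S \<subseteq> B" and f: "\<And>b. b \<in> B - S \<Longrightarrow> f b \<noteq> 0" and A: "\<And>u. u \<in> ds S \<Longrightarrow> monomial f u \<in> A"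
  shows "restrict (monomial f) (ds S) \<in> sg_hom (ds S) A"
proof -
  have "restrict (monomial f) (ds S) (\<lambda>a. u a + w a) = restrict (monomial f) (ds S) u * restrict (monomial f) (ds S) w"
    if "u \<in> ds S" "w \<in> ds S" for u w
    using that dual_semigroup_add[OF that] monomial_add[OF S f that] by simp
  moreover have "restrict (monomial f) (ds S) (\<lambda>_. 0) = 1" unfolding restrict_apply'[OF dual_semigroup_zero] by (rule monomial_zero)
  ultimately show ?thesis unfolding sg_hom_def using A by (auto simp: PiE_iff)
qed

text \<open>For \<open>b\<close> outside \<open>S\<close> the semigroup contains the dual vector
  together with its negative, so the value there is invertible.\<close>

lemma sg_hom_nonzero:
  assumes S: "S \<subseteq> B" and x: "x \<in> sg_hom (ds S) A" and b: "b \<in> B - S"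
  shows "x (dual_vec B b) \<noteq> 0"
proof -
  have "x (\<lambda>a. dual_vec B b a + - dual_vec B b a) = x (dual_vec B b) * x (\<lambda>a. - dual_vec B b a)"
    by (rule sg_hom_mult[OF x dual_vec_ds[OF S] neg_dual_vec_ds[OF S]]) (use b in auto)
  then show ?thesis using sg_hom_zero[OF x] by auto
qed

lemma sg_hom_nat_power:
  assumes x: "x \<in> sg_hom (dual_semigroup N \<sigma>) A" and d: "d \<in> dual_semigroup N \<sigma>"
  shows "(\<lambda>v. real k * d v) \<in> dual_semigroup N \<sigma> \<and> x (\<lambda>v. real k * d v) = x d ^ k"
proof (induction k)
  case 0
  then show ?case using sg_hom_zero[OF x] dual_semigroup_zero by simp
next
  case (Suc k)
  have e: "(\<lambda>v. real (Suc k) * d v) = (\<lambda>v. real k * d v + d v)" by (auto simp: algebra_simps)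
  show ?case unfolding e using Suc dual_semigroup_add[OF _ d] sg_hom_mult[OF x _ d] by auto
qed

lemma sg_hom_power:
  assumes S: "S \<subseteq> B" and x: "x \<in> sg_hom (ds S) A" and b: "b \<in> B" and u: "u \<in> ds S"
  shows "(\<lambda>v. u b * dual_vec B b v) \<in> ds S \<and> x (\<lambda>v. u b * dual_vec B b v) = x (dual_vec B b) powi \<lfloor>u b\<rfloor>"
proof -
  have ul: "u \<in> dual_lattice N" using u dual_semigroup_sub by auto
  note fl = dual_lattice_floor[OF ul b]
  show ?thesis
  proof (cases "0 \<le> u b")
    case True
    then have "u b = real (nat \<lfloor>u b\<rfloor>)" "\<lfloor>u b\<rfloor> = int (nat \<lfloor>u b\<rfloor>)" using fl by auto
    then show ?thesis using sg_hom_nat_power[OF x dual_vec_ds[OF S b], of "nat \<lfloor>u b\<rfloor>"]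
      by (metis power_int_of_nat)
  next
    case False
    then have bS: "b \<in> B - S" using u b by (auto simp: ds_iff[OF S])
    let ?k = "nat (- \<lfloor>u b\<rfloor>)"
    have k: "real ?k = - u b" "\<lfloor>u b\<rfloor> = - int ?k" using False fl by auto
    note d = dual_vec_ds[OF S b] and nd = neg_dual_vec_ds[OF S bS]
    have e: "(\<lambda>v. real ?k * - dual_vec B b v) = (\<lambda>v. u b * dual_vec B b v)" unfolding k(1) by auto
    have 1: "(\<lambda>v. u b * dual_vec B b v) \<in> ds S" "x (\<lambda>v. u b * dual_vec B b v) = x (\<lambda>v. - dual_vec B b v) ^ ?k"
      using sg_hom_nat_power[OF x nd, of ?k] unfolding e by auto
    have "x (\<lambda>a. dual_vec B b a + - dual_vec B b a) = x (dual_vec B b) * x (\<lambda>a. - dual_vec B b a)"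
      by (rule sg_hom_mult[OF x d nd])
    then have "x (\<lambda>a. - dual_vec B b a) = inverse (x (dual_vec B b))"
      using sg_hom_zero[OF x] by (simp add: inverse_unique)
    then have "x (\<lambda>v. u b * dual_vec B b v) = inverse (x (dual_vec B b) ^ ?k)"
      using 1(2) by (simp only: power_inverse)
    moreover have "x (dual_vec B b) powi \<lfloor>u b\<rfloor> = inverse (x (dual_vec B b) ^ ?k)"
      by (subst k(2)) (simp only: power_int_minus power_int_of_nat)
    ultimately show ?thesis using 1(1) by (simp only: simp_thms)
  qed
qed

text \<open>\<open>u\<close> is the sum of its components along the dual basis, and each component
  lies in the semigroup: negative multiples occur only for \<open>b\<close> outside
  \<open>S\<close>. So the values on the dual basis determine \<open>x\<close>, even if some of them
  are 0.\<close>

lemma sg_hom_expand: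
  assumes S: "S \<subseteq> B" and x: "x \<in> sg_hom (ds S) A" and u: "u \<in> ds S"
  shows "x u = monomial (\<lambda>b. x (dual_vec B b)) u"
proof -
  have "(\<lambda>v. \<Sum>b\<in>C. u b * dual_vec B b v) \<in> ds S \<and>
      x (\<lambda>v. \<Sum>b\<in>C. u b * dual_vec B b v) = (\<Prod>b\<in>C. x (dual_vec B b) powi \<lfloor>u b\<rfloor>)"
    if "finite C" "C \<subseteq> B" for C
    using that
  proof (induction C rule: finite_induct)
    case empty
    then show ?case using dual_semigroup_zero sg_hom_zero[OF x] by simp
  next
    case (insert c C)
    then have IH: "(\<lambda>v. \<Sum>b\<in>C. u b * dual_vec B b v) \<in> ds S"
      "x (\<lambda>v. \<Sum>b\<in>C. u b * dual_vec B b v) = (\<Prod>b\<in>C. x (dual_vec B b) powi \<lfloor>u b\<rfloor>)" by auto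
    have c: "(\<lambda>v. u c * dual_vec B c v) \<in> ds S" "x (\<lambda>v. u c * dual_vec B c v) = x (dual_vec B c) powi \<lfloor>u c\<rfloor>"
      using sg_hom_power[OF S x _ u, of c] insert.prems by auto
    show ?case
      using insert.hyps dual_semigroup_add[OF c(1) IH(1)] sg_hom_mult[OF x c(1) IH(1)] c(2) IH(2) by simp
  qed
  from this[OF finite_B order_refl] show ?thesis
    unfolding monomial_def using linear_expand[of u] u by (simp add: ds_iff[OF S] dual_lattice_iff)
qed

lemma sg_hom_eqI:
  assumes S: "S \<subseteq> B" and x: "x \<in> sg_hom (ds S) A" and y: "y \<in> sg_hom (ds S) A'"
    and eq: "\<And>b. b \<in> B \<Longrightarrow> x (dual_vec B b) = y (dual_vec B b)"
  shows "x = y"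
proof (rule extensionalityI[OF sg_hom_ext[OF x] sg_hom_ext[OF y]])
  fix u assume u: "u \<in> ds S"
  show "x u = y u" unfolding sg_hom_expand[OF S x u] sg_hom_expand[OF S y u] by (rule monomial_cong[OF eq])
qed

lemma sg_hom_eq_monomial:
  assumes S: "S \<subseteq> B" and x: "x \<in> sg_hom (ds S) A"
  shows "x = restrict (monomial (\<lambda>b. x (dual_vec B b))) (ds S)"
  by (rule extensionalityI[OF sg_hom_ext[OF x]]) (use sg_hom_expand[OF S x] in auto)

lemma restrict_monomial_dual_vec:
  "S \<subseteq> B \<Longrightarrow> b \<in> B \<Longrightarrow> restrict (monomial f) (ds S) (dual_vec B b) = f b"
  using dual_vec_ds monomial_dual_vec by simp

text \<open>\<open>U\<^sub>\<tau> \<subseteq> U\<^sub>\<sigma>\<close> is the locus where the coordinates belonging to \<open>\<sigma> \<setminus> \<tau>\<close> do not vanish.\<close>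

lemma sg_hom_extend:
  assumes S: "S \<subseteq> B" and T: "T \<subseteq> S" and x: "x \<in> sg_hom (ds S) UNIV"
    and nz: "\<And>b. b \<in> S - T \<Longrightarrow> x (dual_vec B b) \<noteq> 0"
  shows "restrict (monomial (\<lambda>b. x (dual_vec B b))) (ds T) \<in> sg_hom (ds T) UNIV"
    "restrict (restrict (monomial (\<lambda>b. x (dual_vec B b))) (ds T)) (ds S) = x"
proof -
  have sub: "ds S \<subseteq> ds T" by (rule dual_semigroup_antimono[OF hull_mono[OF T]])
  show "restrict (monomial (\<lambda>b. x (dual_vec B b))) (ds T) \<in> sg_hom (ds T) UNIV"
    by (rule monomial_sg_hom) (use S T nz sg_hom_nonzero[OF S x] in auto)
  show "restrict (restrict (monomial (\<lambda>b. x (dual_vec B b))) (ds T)) (ds S) = x"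
    unfolding restrict_restrict_sub[OF sub] by (rule sg_hom_eq_monomial[OF S x, symmetric])
qed

lemma sg_hom_restrict_inj:
  assumes S: "S \<subseteq> B" and T: "T \<subseteq> S" and x: "x \<in> sg_hom (ds T) A" and y: "y \<in> sg_hom (ds T) A'"
    and eq: "restrict x (ds S) = restrict y (ds S)"
  shows "x = y"
proof (rule sg_hom_eqI[OF _ x y])
  fix b assume "b \<in> B"
  then show "x (dual_vec B b) = y (dual_vec B b)" using fun_cong[OF eq, of "dual_vec B b"] dual_vec_ds[OF S] by simp
qed (use S T in auto)

lemma sg_hom_nonneg_iff:
  assumes S: "S \<subseteq> B" and x: "x \<in> sg_hom (ds S) UNIV"
  shows "x \<in> sg_hom (ds S) {0..} \<longleftrightarrow> (\<forall>b\<in>B. 0 \<le> x (dual_vec B b))"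
proof
  assume "x \<in> sg_hom (ds S) {0..}"
  then show "\<forall>b\<in>B. 0 \<le> x (dual_vec B b)" using sg_hom_range dual_vec_ds[OF S] by fastforce
next
  assume *: "\<forall>b\<in>B. 0 \<le> x (dual_vec B b)"
  have "x u \<in> {0..}" if "u \<in> ds S" for u
    using sg_hom_expand[OF S x that] monomial_nonneg[of "\<lambda>b. x (dual_vec B b)" u] * by simp
  then show "x \<in> sg_hom (ds S) {0..}" using x by (auto simp: sg_hom_def PiE_iff)
qed

section \<open>The group \<open>T\<^sub>2\<close>\<close>

lemma floor_sum_B:
  assumes u: "u \<in> dual_lattice N" and T: "T \<subseteq> B"
  shows "\<lfloor>u (\<Sum>T)\<rfloor> = (\<Sum>b\<in>T. \<lfloor>u b\<rfloor>)"
proof -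
  have "u (\<Sum>T) = (\<Sum>b\<in>T. u b)" using u linear_sum[of u "\<lambda>x. x" T] by (simp add: dual_lattice_def)
  also have "\<dots> = (\<Sum>b\<in>T. of_int \<lfloor>u b\<rfloor>)" by (intro sum.cong) (simp, rule dual_lattice_floor[OF u, symmetric], use T in blast)
  also have "\<dots> = of_int (\<Sum>b\<in>T. \<lfloor>u b\<rfloor>)" by simp
  finally show ?thesis by (simp only: floor_of_int)
qed

lemma T2_class_sum:
  assumes T: "T \<subseteq> B"
  shows "T2_class N (\<Sum>T) = restrict (monomial (\<lambda>b. if b \<in> T then - 1 else 1)) (dual_lattice N)"
proof -
  have "(-1) powi \<lfloor>u (\<Sum>T)\<rfloor> = monomial (\<lambda>b. if b \<in> T then - 1 else 1) u" if u: "u \<in> dual_lattice N" for u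
  proof -
    have fT: "finite C" if "C \<subseteq> T" for C using that T finite_B by (meson finite_subset)
    have "(-1 :: real) powi (\<Sum>b\<in>C. \<lfloor>u b\<rfloor>) = (\<Prod>b\<in>C. (-1) powi \<lfloor>u b\<rfloor>)" if "finite C" for C
      using that by (induction C rule: finite_induct) (auto simp: power_int_add)
    then have "(-1) powi \<lfloor>u (\<Sum>T)\<rfloor> = (\<Prod>b\<in>T. (-1 :: real) powi \<lfloor>u b\<rfloor>)"
      using floor_sum_B[OF u T] fT by simp
    also have "\<dots> = monomial (\<lambda>b. if b \<in> T then - 1 else 1) u"
      unfolding monomial_def by (rule prod.mono_neutral_cong_left) (use T finite_B in auto)
    finally show ?thesis .
  qed
  then show ?thesis unfolding T2_class_def by (rule restrict_ext)
qed

lemma carrier_torus: "carrier (torus N A) = sg_hom (ds {}) A"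
  by (simp add: torus_def dual_lattice_eq)

lemma T2_class_closed:
  assumes v: "v \<in> N"
  shows "T2_class N v \<in> carrier (T2 N)"
  unfolding torus_def sg_hom_def
proof (simp, intro conjI ballI)
  have s: "(-1 :: real) powi k = 1 \<or> (-1 :: real) powi k = - 1" for k by (simp add: power_int_minus_left)
  show "T2_class N v \<in> dual_lattice N \<rightarrow>\<^sub>E {1, - 1}" using s by (auto simp: T2_class_def)
  show "T2_class N v (\<lambda>_. 0) = 1" using dual_semigroup_zero[of N "convex_cone hull {}"] by (simp add: T2_class_def dual_lattice_eq)
  fix u w assume uw: "u \<in> dual_lattice N" "w \<in> dual_lattice N"
  have "(\<lambda>a. u a + w a) \<in> dual_lattice N" using uw unfolding dual_lattice_eq by (rule dual_semigroup_add)
  then show "T2_class N v (\<lambda>a. u a + w a) = T2_class N v u * T2_class N v w"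
    using uw dual_lattice_floor_add[OF uw v] by (simp add: T2_class_def power_int_add)
qed

lemma T2_class_dual_vec:
  assumes "T \<subseteq> B" "b \<in> B"
  shows "T2_class N (\<Sum>T) (dual_vec B b) = (if b \<in> T then - 1 else 1)"
  unfolding T2_class_sum[OF assms(1)] dual_lattice_eq by (rule restrict_monomial_dual_vec) (use assms in auto)

lemma T2_class_sum_inj: "inj_on (\<lambda>T. T2_class N (\<Sum>T)) (Pow B)"
proof (rule inj_onI)
  fix T T' assume T: "T \<in> Pow B" "T' \<in> Pow B" and eq: "T2_class N (\<Sum>T) = T2_class N (\<Sum>T')"
  have "b \<in> T \<longleftrightarrow> b \<in> T'" if "b \<in> B" for b
    using T2_class_dual_vec[of T b] T2_class_dual_vec[of T' b] T that eq by (auto split: if_splits)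
  then show "T = T'" using T by blast
qed

lemma sum_B_in_N: "T \<subseteq> B \<Longrightarrow> \<Sum>T \<in> N"
proof -
  assume T: "T \<subseteq> B"
  have "finite T" using T finite_B finite_subset by blast
  then show ?thesis using T by (induction T rule: finite_induct) (auto intro: zero_in_N N_add B_in_N)
qed

text \<open>An element of \<open>T2\<close> is a choice of signs on the dual basis; the sum of the
  basis vectors with sign -1 is a lattice vector that represents it.\<close>

lemma T2_element:
  assumes t: "t \<in> carrier (T2 N)"
  shows "t = T2_class N (\<Sum>{b \<in> B. t (dual_vec B b) = - 1})"
proof -
  let ?T = "{b \<in> B. t (dual_vec B b) = - 1}"
  have t': "t \<in> sg_hom (ds {}) {1, - 1}" using t by (simp add: carrier_torus)
  have c: "T2_class N (\<Sum>?T) \<in> sg_hom (ds {}) {1, - 1}"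
    using T2_class_closed[OF sum_B_in_N[of ?T]] by (simp add: carrier_torus)
  show ?thesis
  proof (rule sg_hom_eqI[OF _ t' c])
    fix b assume b: "b \<in> B"
    have "t (dual_vec B b) \<in> {1, -1}" by (rule sg_hom_range[OF t' dual_vec_ds]) (use b in auto)
    then show "t (dual_vec B b) = T2_class N (\<Sum>?T) (dual_vec B b)"
      using T2_class_dual_vec[of ?T b] b by auto
  qed simp
qed

lemma carrier_T2: "carrier (T2 N) = (\<lambda>T. T2_class N (\<Sum>T)) ` Pow B"
proof
  show "carrier (T2 N) \<subseteq> (\<lambda>T. T2_class N (\<Sum>T)) ` Pow B" using T2_element by blast
  show "(\<lambda>T. T2_class N (\<Sum>T)) ` Pow B \<subseteq> carrier (T2 N)" using T2_class_closed[OF sum_B_in_N] by auto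
qed

lemma card_T2: "card (carrier (T2 N)) = 2 ^ card B"
  unfolding carrier_T2 card_image[OF T2_class_sum_inj] by (rule card_Pow[OF finite_B])

lemma finite_T2: "finite (carrier (T2 N))"
  unfolding carrier_T2 using finite_B by simp

lemma torus_mult: "s \<otimes>\<^bsub>torus N A\<^esub> t = (\<lambda>u\<in>dual_lattice N. s u * t u)"
  by (simp add: torus_def)

lemma torus_one: "\<one>\<^bsub>torus N A\<^esub> = (\<lambda>u\<in>dual_lattice N. 1)"
  by (simp add: torus_def)

lemma T2_class_add:
  assumes "v \<in> N" "w \<in> N"
  shows "T2_class N v \<otimes>\<^bsub>T2 N\<^esub> T2_class N w = T2_class N (v + w)"
  unfolding torus_mult
proof (rule extensionalityI[of _ "dual_lattice N"])
  fix u assume u: "u \<in> dual_lattice N"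
  then have "u v \<in> \<int>" "u w \<in> \<int>" "u (v + w) = u v + u w" using assms by (auto simp: dual_lattice_def linear_add)
  then show "(\<lambda>u\<in>dual_lattice N. T2_class N v u * T2_class N w u) u = T2_class N (v + w) u"
    using u by (auto simp: T2_class_def power_int_add Ints_def)
qed (auto simp: T2_class_def)

lemma T2_class_zero: "T2_class N 0 = \<one>\<^bsub>T2 N\<^esub>"
  unfolding torus_one T2_class_def by (rule restrict_ext) (simp add: dual_lattice_def linear_0)

lemma T2_square: "t \<in> carrier (T2 N) \<Longrightarrow> t \<otimes>\<^bsub>T2 N\<^esub> t = \<one>\<^bsub>T2 N\<^esub>"
  unfolding torus_mult torus_one
proof (rule restrict_ext)
  fix u assume "t \<in> carrier (T2 N)" "u \<in> dual_lattice N"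
  then have "t u \<in> {1, -1}" using sg_hom_range by (fastforce simp: torus_def)
  then show "t u * t u = 1" by auto
qed

lemma torus_group:
  assumes A: "1 \<in> A" "0 \<notin> A" "\<And>a b. a \<in> A \<Longrightarrow> b \<in> A \<Longrightarrow> a * b \<in> A" "\<And>a. a \<in> A \<Longrightarrow> inverse a \<in> A"
  shows "comm_group (torus N A)"
proof (rule comm_groupI)
  have z: "(\<lambda>_. 0) \<in> dual_lattice N" unfolding dual_lattice_eq by (rule dual_semigroup_zero)
  have ad: "(\<lambda>a. u a + w a) \<in> dual_lattice N" if "u \<in> dual_lattice N" "w \<in> dual_lattice N" for u w
    using that unfolding dual_lattice_eq by (rule dual_semigroup_add)
  show "s \<otimes>\<^bsub>torus N A\<^esub> t \<in> carrier (torus N A)" if "s \<in> carrier (torus N A)" "t \<in> carrier (torus N A)" for s t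
    using that z ad A(3) by (auto simp: torus_def sg_hom_def PiE_iff)
  show "\<one>\<^bsub>torus N A\<^esub> \<in> carrier (torus N A)"
    using z ad A(1) by (auto simp: torus_def sg_hom_def PiE_iff)
  show "r \<otimes>\<^bsub>torus N A\<^esub> s \<otimes>\<^bsub>torus N A\<^esub> t = r \<otimes>\<^bsub>torus N A\<^esub> (s \<otimes>\<^bsub>torus N A\<^esub> t)" for r s t
    unfolding torus_mult by (rule restrict_ext) simp
  show "s \<otimes>\<^bsub>torus N A\<^esub> t = t \<otimes>\<^bsub>torus N A\<^esub> s" for s t
    unfolding torus_mult by (rule restrict_ext) simp
  show "\<one>\<^bsub>torus N A\<^esub> \<otimes>\<^bsub>torus N A\<^esub> t = t" if t: "t \<in> carrier (torus N A)" for t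
    unfolding torus_mult torus_one
    by (rule extensionalityI[of _ "dual_lattice N"]) (use t in \<open>auto simp: torus_def sg_hom_def PiE_iff\<close>)
  show "\<exists>s\<in>carrier (torus N A). s \<otimes>\<^bsub>torus N A\<^esub> t = \<one>\<^bsub>torus N A\<^esub>" if t: "t \<in> carrier (torus N A)" for t
  proof
    have nz: "t u \<noteq> 0" if "u \<in> dual_lattice N" for u using t that A(2) by (auto simp: torus_def sg_hom_def PiE_iff)
    show "(\<lambda>u\<in>dual_lattice N. inverse (t u)) \<in> carrier (torus N A)"
      using t z ad A(4) by (auto simp: torus_def sg_hom_def PiE_iff)
    show "(\<lambda>u\<in>dual_lattice N. inverse (t u)) \<otimes>\<^bsub>torus N A\<^esub> t = \<one>\<^bsub>torus N A\<^esub>"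
      unfolding torus_mult torus_one by (rule restrict_ext) (use nz in auto)
  qed
qed

lemma T2_comm_group: "comm_group (T2 N)"
  by (rule torus_group) auto

lemma T2_group: "group (T2 N)"
  using T2_comm_group by (simp add: comm_group_def)

text \<open>The sign at a dual basis vector is the parity of the coordinate, so vectors with equal
  classes differ by even coordinates.\<close>

lemma T2_class_kernel:
  assumes v: "v \<in> N" and w: "w \<in> N" and eq: "T2_class N v = T2_class N w"
  shows "v - w \<in> double_lattice N"
proof -
  have "v - w \<in> N" using N_add[OF v N_uminus[OF w]] by simp
  then obtain c :: "'a \<Rightarrow> int" where c: "v - w = (\<Sum>b\<in>B. of_int (c b) *\<^sub>R b)" by (rule N_memE)
  have ev: "even (c b)" if b: "b \<in> B" for b
  proof -
    have d: "dual_vec B b (v - w) = of_int (c b)" unfolding c by (rule dual_vec_combination[OF b])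
    have dl: "dual_vec B b \<in> dual_lattice N" by (rule dual_vec_dual_lattice[OF b])
    have "dual_vec B b v \<in> \<int>" "dual_vec B b w \<in> \<int>" using dual_vec_N[OF b] v w by auto
    then obtain k l where kl: "dual_vec B b v = of_int k" "dual_vec B b w = of_int l" by (auto simp: Ints_def)
    have "c b = k - l" using d kl linear_diff[OF dual_vec, of b v w] by linarith
    moreover have "(-1 :: real) powi k = (-1) powi l"
      using fun_cong[OF eq, of "dual_vec B b"] dl kl by (simp add: T2_class_def)
    ultimately show ?thesis by (auto simp: power_int_minus_left split: if_splits)
  qed
  let ?h = "\<Sum>b\<in>B. of_int (c b div 2) *\<^sub>R b"
  have "v - w = ?h + ?h"
    unfolding c sum.distrib[symmetric] scaleR_add_left[symmetric]
    by (rule sum.cong) (use ev in \<open>auto simp flip: of_int_add\<close>)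
  then show ?thesis unfolding double_lattice_def using N_memI[of "\<lambda>b. c b div 2"] by blast
qed

lemma lword_T2_class:
  assumes "vs \<in> lists V" "V \<subseteq> N"
  shows "sum_list vs \<in> N \<and> lword (T2 N) (T2_class N) vs = T2_class N (sum_list vs)"
  using assms(1)
proof (induction vs)
  case Nil
  then show ?case by (simp add: lword_def T2_class_zero zero_in_N)
next
  case (Cons v vs)
  then have "v \<in> N" "sum_list vs \<in> N" using assms(2) by auto
  then show ?case using Cons T2_class_add[of v "sum_list vs"] N_add by (simp add: lword_def)
qed

text \<open>The quotient of \<open>N\<close> by \<open>double_lattice N\<close> is compared with
  \<open>T2\<close> through \<open>T2_class\<close>, which is constant on cosets and separates them.
  The inverses in a generated subgroup become words without inverses, since \<open>- v\<close> and
  \<open>v\<close> agree modulo 2.\<close>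

lemma spans_mod2_iff:
  assumes V: "V \<subseteq> N"
  shows "spans_mod2 N V \<longleftrightarrow> (\<forall>t\<in>carrier (T2 N). \<exists>vs\<in>lists V. t = lword (T2 N) (T2_class N) vs)"
proof -
  let ?L = "lattice_group N" and ?D = "double_lattice N"
  have L: "comm_group ?L"
    by (rule comm_groupI) (auto simp: lattice_group_def N_add zero_in_N intro!: bexI[of _ "- _"] N_uminus)
  interpret L: comm_group ?L by fact
  have invL: "inv\<^bsub>?L\<^esub> v = - v" if "v \<in> N" for v
    by (rule L.inv_equality) (use that N_uminus in \<open>auto simp: lattice_group_def\<close>)
  have Dadd: "v + w \<in> ?D" if vw: "v \<in> ?D" "w \<in> ?D" for v w
  proof -
    obtain a b where "v = a + a" "w = b + b" "a \<in> N" "b \<in> N" using vw by (auto simp: double_lattice_def)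
    then have "v + w = (a + b) + (a + b)" "a + b \<in> N" using N_add by (auto simp: algebra_simps)
    then show ?thesis unfolding double_lattice_def by blast
  qed
  have Dneg: "- v \<in> ?D" if v: "v \<in> ?D" for v
  proof -
    obtain a where "v = a + a" "a \<in> N" using v by (auto simp: double_lattice_def)
    then have "- v = - a + - a" "- a \<in> N" using N_uminus by (auto simp: algebra_simps)
    then show ?thesis unfolding double_lattice_def by blast
  qed
  have DN: "?D \<subseteq> N" using N_add by (auto simp: double_lattice_def)
  have D0: "0 \<in> ?D" unfolding double_lattice_def using zero_in_N by force
  have "subgroup ?D ?L"
    by (rule L.subgroupI) (use DN D0 Dadd Dneg invL in \<open>auto simp: lattice_group_def[of N] subset_iff simp del: lattice_group_def\<close>)
  then interpret D: normal ?D ?L by (rule L.subgroup_imp_normal)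
  interpret Q: group "lattice_mod2 N" unfolding lattice_mod2_def by (rule D.factorgroup_is_group)
  let ?q = "\<lambda>v. ?D #>\<^bsub>?L\<^esub> v"
  have q: "?q v = {d + v | d. d \<in> ?D}" for v by (auto simp: r_coset_def lattice_group_def)
  have qhom: "?q \<in> hom ?L (lattice_mod2 N)" unfolding lattice_mod2_def by (rule D.r_coset_hom_Mod)
  interpret q: group_hom ?L "lattice_mod2 N" ?q using qhom by unfold_locales
  have qc: "carrier (lattice_mod2 N) = ?q ` N"
    by (auto simp: lattice_mod2_def FactGroup_def RCOSETS_def lattice_group_def)
  have qeq: "?q v = ?q w" if "v - w \<in> ?D" for v w
  proof -
    have "\<exists>d'. d + v = d' + w \<and> d' \<in> ?D" if "d \<in> ?D" for d
      by (rule exI[of _ "d + (v - w)"]) (use Dadd[OF that \<open>v - w \<in> ?D\<close>] in simp)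
    moreover have "\<exists>d'. d + w = d' + v \<and> d' \<in> ?D" if "d \<in> ?D" for d
      by (rule exI[of _ "d + - (v - w)"]) (use Dadd[OF that Dneg[OF \<open>v - w \<in> ?D\<close>]] in simp)
    ultimately show ?thesis unfolding q by blast
  qed
  have Tq: "T2_class N (d + v) = T2_class N v" if dv: "d \<in> ?D" "v \<in> N" for d v
  proof -
    obtain a where a: "d = a + a" "a \<in> N" using dv by (auto simp: double_lattice_def)
    have "T2_class N (a + a) = \<one>\<^bsub>T2 N\<^esub>"
      using T2_class_add[OF a(2) a(2)] T2_square[OF T2_class_closed[OF a(2)]] by simp
    then show ?thesis
      using T2_class_add[of d v] DN dv T2_class_closed[OF dv(2)] T2_group a by (simp add: group.is_monoid monoid.l_one subset_iff)
  qed
  have Vc: "?q ` V \<subseteq> carrier (lattice_mod2 N)" using V qc by auto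
  have Tv: "T2_class N ` V \<subseteq> carrier (T2 N)" using T2_class_closed V by auto
  interpret T: group "T2 N" by (rule T2_group)
  have lw: "lword (T2 N) (T2_class N) vs \<in> carrier (T2 N)" if "vs \<in> lists V" for vs
    by (rule T.lword_closed) (use that Tv in auto)
  have gen: "\<exists>vs\<in>lists V. \<forall>v\<in>c. v \<in> N \<and> T2_class N v = lword (T2 N) (T2_class N) vs" if "c \<in> generate (lattice_mod2 N) (?q ` V)" for c
  proof -
    have cl: "\<forall>v\<in>?q w. v \<in> N \<and> T2_class N v = T2_class N w" if "w \<in> N" for w
      unfolding q using Tq that DN N_add by auto
    have "\<exists>w\<in>N. \<exists>vs\<in>lists V. c = ?q w \<and> T2_class N w = lword (T2 N) (T2_class N) vs"
      using that
    proof (induction rule: generate.induct)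
      case one
      show ?case
        by (intro bexI[of _ 0] bexI[of _ "[]"]) (use q.hom_one in \<open>auto simp: T2_class_zero zero_in_N lattice_group_def\<close>)
    next
      case (incl c)
      then obtain v where v: "v \<in> V" "c = ?q v" by auto
      then have "T2_class N v = lword (T2 N) (T2_class N) [v]" using Tv by (simp add: image_subset_iff)
      then show ?case using v V by (intro bexI[of _ v] bexI[of _ "[v]"]) auto
    next
      case (inv c)
      then obtain v where v: "v \<in> V" "c = ?q v" by auto
      have vN: "v \<in> N" using v V by auto
      then have "T2_class N v = lword (T2 N) (T2_class N) [v]" using Tv v by (simp add: image_subset_iff)
      moreover have "T2_class N (- v) = T2_class N v"
        using Tq[of "- (v + v)" v] Dneg[of "v + v"] vN by (auto simp: double_lattice_def)
      moreover have "inv\<^bsub>lattice_mod2 N\<^esub> c = ?q (- v)"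
        using q.hom_inv[of v] vN invL[OF vN] v(2) by (simp add: lattice_group_def)
      ultimately show ?case using v vN N_uminus[OF vN] by (intro bexI[of _ "- v"] bexI[of _ "[v]"]) auto
    next
      case (eng c d)
      obtain v vs where v: "v \<in> N" "vs \<in> lists V" "c = ?q v" "T2_class N v = lword (T2 N) (T2_class N) vs"
        using eng.IH(1) by (elim bexE conjE)
      obtain w ws where w: "w \<in> N" "ws \<in> lists V" "d = ?q w" "T2_class N w = lword (T2 N) (T2_class N) ws"
        using eng.IH(2) by (elim bexE conjE)
      note vw = v w
      have "lword (T2 N) (T2_class N) (vs @ ws) = T2_class N (v + w)"
        using T.lword_append[of "T2_class N" vs ws] Tv vw T2_class_add[OF vw(1,5)] by (auto simp: image_subset_iff)
      moreover have "c \<otimes>\<^bsub>lattice_mod2 N\<^esub> d = ?q (v + w)"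
        using q.hom_mult[of v w] vw by (simp add: lattice_group_def)
      ultimately show ?case using vw(2,6) N_add[OF vw(1,5)] by (intro bexI[of _ "v + w"] bexI[of _ "vs @ ws"]) auto
    qed
    then obtain w vs where w: "w \<in> N" "vs \<in> lists V" "c = ?q w" "T2_class N w = lword (T2 N) (T2_class N) vs"
      by (elim bexE conjE)
    show ?thesis using cl[OF w(1)] w(2) unfolding w(3,4) by (rule bexI)
  qed
  show ?thesis
  proof
    assume sp: "spans_mod2 N V"
    show "\<forall>t\<in>carrier (T2 N). \<exists>vs\<in>lists V. t = lword (T2 N) (T2_class N) vs"
    proof
      fix t assume t: "t \<in> carrier (T2 N)"
      then obtain T where T: "T \<subseteq> B" "t = T2_class N (\<Sum>T)" unfolding carrier_T2 by blast
      then obtain v where v: "v \<in> N" "t = T2_class N v" using sum_B_in_N[OF T(1)] by blast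
      have "?q v \<in> carrier (lattice_mod2 N)" unfolding qc using v(1) by (rule imageI)
      then have "?q v \<in> generate (lattice_mod2 N) (?q ` V)" using sp unfolding spans_mod2_def by simp
      moreover have "v \<in> ?q v" unfolding q using D0 by force
      ultimately show "\<exists>vs\<in>lists V. t = lword (T2 N) (T2_class N) vs"
        unfolding v(2) using gen[of "?q v"] by blast
    qed
  next
    assume *: "\<forall>t\<in>carrier (T2 N). \<exists>vs\<in>lists V. t = lword (T2 N) (T2_class N) vs"
    have sl: "?q (sum_list vs) \<in> generate (lattice_mod2 N) (?q ` V)" if "vs \<in> lists V" for vs
      using that
    proof (induction vs)
      case Nil
      have "?q 0 = \<one>\<^bsub>lattice_mod2 N\<^esub>" using q.hom_one by (simp add: lattice_group_def)
      then show ?case using generate.one by simp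
    next
      case (Cons v vs)
      then have "v \<in> N" "sum_list vs \<in> N" using lword_T2_class[of vs V] V by auto
      then have "?q (sum_list (v # vs)) = ?q v \<otimes>\<^bsub>lattice_mod2 N\<^esub> ?q (sum_list vs)"
        using q.hom_mult[of v "sum_list vs"] by (simp add: lattice_group_def)
      then show ?case using Cons by (auto intro: generate.eng generate.incl)
    qed
    have "carrier (lattice_mod2 N) \<subseteq> generate (lattice_mod2 N) (?q ` V)"
    proof
      fix c assume "c \<in> carrier (lattice_mod2 N)"
      then obtain v where v: "v \<in> N" "c = ?q v" using qc by auto
      obtain vs where vs: "vs \<in> lists V" "T2_class N v = lword (T2 N) (T2_class N) vs" using bspec[OF * T2_class_closed[OF v(1)]] by (elim bexE)
      have "v - sum_list vs \<in> ?D"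
        by (rule T2_class_kernel[OF v(1)]) (use lword_T2_class[OF vs(1) V] vs(2) in auto)
      then show "c \<in> generate (lattice_mod2 N) (?q ` V)" using sl[OF vs(1)] qeq v(2) by simp
    qed
    then show "spans_mod2 N V" unfolding spans_mod2_def by (intro subset_antisym Q.generate_incl[OF Vc])
  qed
qed

end

section \<open>Affine charts of the real toric variety\<close>

lemma continuous_map_real_powi:
  assumes f: "continuous_map Z euclideanreal f" and nz: "(\<forall>z\<in>topspace Z. f z \<noteq> 0) \<or> 0 \<le> k"
  shows "continuous_map Z euclideanreal (\<lambda>z. f z powi k)"
proof (cases "0 \<le> k")
  case True
  have "(\<lambda>z. f z powi k) = (\<lambda>z. f z ^ nat k)" using True by (simp add: power_int_nonneg_exp)
  then show ?thesis using continuous_map_real_pow[OF f, of "nat k"] by simp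
next
  case False
  have e: "f z powi k = inverse (f z ^ nat (- k))" for z
    using False power_int_minus[of "f z" "- k"] by (simp add: power_int_nonneg_exp)
  show ?thesis unfolding e
    by (rule continuous_map_real_inverse[OF continuous_map_real_pow[OF f]]) (use nz False in auto)
qed

context smooth_fan_locale
begin

abbreviation "cn S \<equiv> convex_cone hull S"
abbreviation "dS S \<equiv> dual_semigroup N (cn S)"
abbreviation "U S \<equiv> sg_hom (dS S) UNIV"
abbreviation "Up S \<equiv> sg_hom (dS S) {0..}"
abbreviation "dv S b \<equiv> dual_vec (bas S) b"
abbreviation "cp S x \<equiv> chart_point N \<Delta> (cn S) x"
abbreviation "X \<equiv> real_toric_variety N \<Delta>"

lemma lattice_basis_bas: "S \<in> complex \<Longrightarrow> lattice_basis N (bas S)"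
  using bas by unfold_locales

lemma Delta_eq: "\<Delta> = (\<lambda>S. cn S) ` complex"
proof
  have "cn (V \<inter> \<sigma>) \<in> (\<lambda>S. cn S) ` complex" if s: "\<sigma> \<in> \<Delta>" for \<sigma>
    by (rule imageI) (use s in \<open>auto simp: complex_def\<close>)
  then show "\<Delta> \<subseteq> (\<lambda>S. cn S) ` complex" using cone_eq_hull by auto
qed (use complex_cone in blast)

lemma Delta_iff: "\<sigma> \<in> \<Delta> \<longleftrightarrow> (\<exists>S\<in>complex. \<sigma> = cn S)"
  by (subst Delta_eq) (simp only: image_iff)

lemma Delta_ball: "(\<forall>\<sigma>\<in>\<Delta>. P \<sigma>) \<longleftrightarrow> (\<forall>S\<in>complex. P (cn S))"
  unfolding Ball_def Delta_iff by blast

lemma Delta_cases: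
  assumes "\<sigma> \<in> \<Delta>"
  obtains S where "S \<in> complex" "\<sigma> = cn S"
  using assms unfolding Delta_iff by (elim bexE)

lemma cone_in_Delta: "S \<in> complex \<Longrightarrow> cn S \<in> \<Delta>"
  using complex_cone by blast

lemma cone_Int: "S \<in> complex \<Longrightarrow> S' \<in> complex \<Longrightarrow> cn S \<inter> cn S' = cn (S \<inter> S')"
proof -
  assume S: "S \<in> complex" "S' \<in> complex"
  have "V \<inter> (cn S \<inter> cn S') = S \<inter> S'" using complex_cone[OF S(1)] complex_cone[OF S(2)] by blast
  then show ?thesis using cone_eq_hull[OF Int_cone[OF cone_in_Delta[OF S(1)] cone_in_Delta[OF S(2)]]] by simp
qed

lemma dS_antimono: "T \<subseteq> S \<Longrightarrow> dS S \<subseteq> dS T"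
  by (rule dual_semigroup_antimono[OF hull_mono])

lemma U_restrict: "x \<in> sg_hom (dS T) A \<Longrightarrow> T \<subseteq> S \<Longrightarrow> restrict x (dS S) \<in> sg_hom (dS S) A"
  by (rule sg_hom_restrict_ds[OF _ hull_mono])

lemma dv_in_dS: "S \<in> complex \<Longrightarrow> b \<in> bas S \<Longrightarrow> dv S b \<in> dS S"
  by (rule lattice_basis.dual_vec_ds[OF lattice_basis_bas bas(2)])

text \<open>Whether a point of the chart of \<open>S\<close> lies in the open part that belongs to
  its face \<open>T\<close> is decided by the coordinates that \<open>T\<close> lacks: they must not
  vanish. Overlaps of charts are computed with this criterion.\<close>

lemma U_extend:
  assumes S: "S \<in> complex" and T: "T \<subseteq> S" and x: "x \<in> U S"
  shows "(\<exists>z\<in>U T. restrict z (dS S) = x) \<longleftrightarrow> (\<forall>b\<in>S - T. x (dv S b) \<noteq> 0)"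
proof
  interpret lattice_basis N "bas S" by (rule lattice_basis_bas[OF S])
  note SB = bas(2)[OF S]
  assume "\<exists>z\<in>U T. restrict z (dS S) = x"
  then obtain z where z: "z \<in> U T" "restrict z (dS S) = x" by blast
  show "\<forall>b\<in>S - T. x (dv S b) \<noteq> 0"
  proof
    fix b assume b: "b \<in> S - T"
    have "z (dv S b) \<noteq> 0" by (rule sg_hom_nonzero[OF _ z(1)]) (use b SB T in auto)
    moreover have "dv S b \<in> dS S" by (rule dual_vec_ds[OF SB]) (use b SB in auto)
    ultimately show "x (dv S b) \<noteq> 0" using z(2) by auto
  qed
next
  interpret lattice_basis N "bas S" by (rule lattice_basis_bas[OF S])
  assume "\<forall>b\<in>S - T. x (dv S b) \<noteq> 0"
  then show "\<exists>z\<in>U T. restrict z (dS S) = x" using sg_hom_extend[OF bas(2)[OF S] T x] by blast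
qed

lemma U_restrict_inj:
  assumes S: "S \<in> complex" and T: "T \<subseteq> S" and "x \<in> sg_hom (dS T) A" "y \<in> sg_hom (dS T) A'" "restrict x (dS S) = restrict y (dS S)"
  shows "x = y"
  by (rule lattice_basis.sg_hom_restrict_inj[OF lattice_basis_bas[OF S] bas(2)[OF S] T assms(3-5)])

lemma U_eqI:
  assumes S: "S \<in> complex" and x: "x \<in> sg_hom (dS S) A" and y: "y \<in> sg_hom (dS S) A'"
    and "\<And>b. b \<in> bas S \<Longrightarrow> x (dv S b) = y (dv S b)"
  shows "x = y"
  by (rule lattice_basis.sg_hom_eqI[OF lattice_basis_bas[OF S] bas(2)[OF S] x y assms(4)])

lemma U_nonzero: "S \<in> complex \<Longrightarrow> x \<in> sg_hom (dS S) A \<Longrightarrow> b \<in> bas S - S \<Longrightarrow> x (dv S b) \<noteq> 0"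
  by (rule lattice_basis.sg_hom_nonzero[OF lattice_basis_bas bas(2)])

lemma Up_iff: "S \<in> complex \<Longrightarrow> x \<in> U S \<Longrightarrow> x \<in> Up S \<longleftrightarrow> (\<forall>b\<in>bas S. 0 \<le> x (dv S b))"
  by (rule lattice_basis.sg_hom_nonneg_iff[OF lattice_basis_bas bas(2)])

lemma Up_U: "x \<in> Up S \<Longrightarrow> x \<in> U S"
  using sg_hom_mono[of "{0..}" UNIV] by auto

definition charts :: "('a set \<times> (('a \<Rightarrow> real) \<Rightarrow> real)) topology" where
  "charts = sum_topology (affine_chart N) \<Delta>"

lemma topspace_affine: "topspace (affine_chart N \<sigma>) = sg_hom (dual_semigroup N \<sigma>) UNIV"
  by (auto simp: affine_chart_def sg_hom_def)

lemma topspace_charts_Sigma: "topspace charts = Sigma \<Delta> (topspace \<circ> affine_chart N)"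
  by (simp add: charts_def)

lemma topspace_charts: "topspace charts = {(cn S, x) | S x. S \<in> complex \<and> x \<in> U S}"
proof (rule Set.set_eqI)
  fix p :: "'a set \<times> (('a \<Rightarrow> real) \<Rightarrow> real)"
  have "p \<in> topspace charts \<longleftrightarrow> fst p \<in> \<Delta> \<and> snd p \<in> sg_hom (dual_semigroup N (fst p)) UNIV"
    unfolding topspace_charts_Sigma by (cases p) (simp add: topspace_affine)
  also have "\<dots> \<longleftrightarrow> p \<in> {(cn S, x) | S x. S \<in> complex \<and> x \<in> U S}"
    unfolding Delta_iff by (cases p) auto
  finally show "p \<in> topspace charts \<longleftrightarrow> p \<in> {(cn S, x) | S x. S \<in> complex \<and> x \<in> U S}" .
qed

lemma gluing_iff:
  assumes "S \<in> complex" "S' \<in> complex"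
  shows "((cn S, x), (cn S', x')) \<in> gluing N \<Delta> \<longleftrightarrow>
    (\<exists>y\<in>U (S \<inter> S'). x = restrict y (dS S) \<and> x' = restrict y (dS S'))"
  using cone_in_Delta[OF assms(1)] cone_in_Delta[OF assms(2)] cone_Int[OF assms] by (simp add: gluing_def)

text \<open>The two gluings meet in the middle chart. There the point has nonzero coordinates off
  \<open>S \<inter> S'\<close> and off \<open>S' \<inter> S''\<close>, hence off the triple
  intersection, so it extends to that smaller cone. Injectivity of restriction identifies this
  extension with both given ones.\<close>

lemma gluing_trans:
  assumes S: "S \<in> complex" "S' \<in> complex" "S'' \<in> complex"
    and 1: "((cn S, x), (cn S', x')) \<in> gluing N \<Delta>" and 2: "((cn S', x'), (cn S'', x'')) \<in> gluing N \<Delta>"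
  shows "((cn S, x), (cn S'', x'')) \<in> gluing N \<Delta>"
proof -
  obtain y where y: "y \<in> U (S \<inter> S')" "x = restrict y (dS S)" "x' = restrict y (dS S')"
    using 1 unfolding gluing_iff[OF S(1,2)] by blast
  obtain y' where y': "y' \<in> U (S' \<inter> S'')" "x' = restrict y' (dS S')" "x'' = restrict y' (dS S'')"
    using 2 unfolding gluing_iff[OF S(2,3)] by blast
  have x': "x' \<in> U S'" unfolding y(3) by (rule U_restrict[OF y(1)]) auto
  have n1: "\<forall>b\<in>S' - S \<inter> S'. x' (dv S' b) \<noteq> 0"
    using U_extend[OF S(2) _ x', of "S \<inter> S'"] y by blast
  have n2: "\<forall>b\<in>S' - S' \<inter> S''. x' (dv S' b) \<noteq> 0"
    using U_extend[OF S(2) _ x', of "S' \<inter> S''"] y' by blast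
  have "\<exists>z\<in>U (S \<inter> S' \<inter> S''). restrict z (dS S') = x'"
    by (subst U_extend[OF S(2) _ x']) (use n1 n2 in auto)
  then obtain z where z: "z \<in> U (S \<inter> S' \<inter> S'')" "restrict z (dS S') = x'" by blast
  have zy: "restrict z (dS (S \<inter> S')) = y"
    by (rule U_restrict_inj[OF S(2) _ U_restrict[OF z(1)] y(1)])
      (use z(2) y(3) restrict_restrict_sub[OF dS_antimono[of "S \<inter> S'" S'], of z] in auto)
  have zy': "restrict z (dS (S' \<inter> S'')) = y'"
    by (rule U_restrict_inj[OF S(2) _ U_restrict[OF z(1)] y'(1)])
      (use z(2) y'(2) restrict_restrict_sub[OF dS_antimono[of "S' \<inter> S''" S'], of z] in auto)
  have xz: "x = restrict z (dS S)" unfolding y(2) zy[symmetric] by (rule restrict_restrict_sub[OF dS_antimono]) auto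
  have x''z: "x'' = restrict z (dS S'')" unfolding y'(3) zy'[symmetric] by (rule restrict_restrict_sub[OF dS_antimono]) auto
  show ?thesis
    unfolding gluing_iff[OF S(1,3)]
  proof (intro bexI conjI)
    show "restrict z (dS (S \<inter> S'')) \<in> U (S \<inter> S'')" by (rule U_restrict[OF z(1)]) auto
    show "x = restrict (restrict z (dS (S \<inter> S''))) (dS S)"
      unfolding xz by (rule restrict_restrict_sub[OF dS_antimono, symmetric]) auto
    show "x'' = restrict (restrict z (dS (S \<inter> S''))) (dS S'')"
      unfolding x''z by (rule restrict_restrict_sub[OF dS_antimono, symmetric]) auto
  qed
qed

lemma gluing_subset: "gluing N \<Delta> \<subseteq> topspace charts \<times> topspace charts"
proof clarify
  fix \<sigma> x \<sigma>' x' assume g: "((\<sigma>, x), (\<sigma>', x')) \<in> gluing N \<Delta>"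
  then have "\<sigma> \<in> \<Delta>" "\<sigma>' \<in> \<Delta>" by (auto simp: gluing_def)
  then obtain S S' where S: "S \<in> complex" "\<sigma> = cn S" "S' \<in> complex" "\<sigma>' = cn S'" by (elim Delta_cases)
  obtain y where y: "y \<in> U (S \<inter> S')" "x = restrict y (dS S)" "x' = restrict y (dS S')"
    using g unfolding S(2,4) gluing_iff[OF S(1,3)] by blast
  have "x \<in> U S" "x' \<in> U S'" unfolding y(2,3) by (rule U_restrict[OF y(1)]; auto)+
  then show "(\<sigma>, x) \<in> topspace charts \<and> (\<sigma>', x') \<in> topspace charts" using S by (auto simp: topspace_charts)
qed

lemma equiv_gluing: "equiv (topspace charts) (gluing N \<Delta>)"
proof (rule equivI[OF gluing_subset])
  show "refl_on (topspace charts) (gluing N \<Delta>)"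
  proof (rule refl_onI)
    fix p assume "p \<in> topspace charts"
    then obtain S x where p: "p = (cn S, x)" "S \<in> complex" "x \<in> U S" by (auto simp: topspace_charts)
    have "restrict x (dS S) = x" using sg_hom_ext[OF p(3)] by (rule extensional_restrict)
    then show "(p, p) \<in> gluing N \<Delta>" unfolding p(1) gluing_iff[OF p(2,2)] using p(3) by (intro bexI[of _ x]) auto
  qed
  show "sym (gluing N \<Delta>)"
  proof (rule symI)
    fix p q assume "(p, q) \<in> gluing N \<Delta>"
    then show "(q, p) \<in> gluing N \<Delta>" unfolding gluing_def by (auto simp: Int_commute)
  qed
  show "trans (gluing N \<Delta>)"
  proof (rule transI)
    fix p q r assume pq: "(p, q) \<in> gluing N \<Delta>" and qr: "(q, r) \<in> gluing N \<Delta>"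
    obtain S x where p: "p = (cn S, x)" "S \<in> complex" using pq gluing_subset by (auto simp: topspace_charts)
    obtain S' x' where q: "q = (cn S', x')" "S' \<in> complex" using pq gluing_subset by (auto simp: topspace_charts)
    obtain S'' x'' where r: "r = (cn S'', x'')" "S'' \<in> complex" using qr gluing_subset by (auto simp: topspace_charts)
    show "(p, r) \<in> gluing N \<Delta>"
      using gluing_trans[OF p(2) q(2) r(2)] pq qr unfolding p(1) q(1) r(1) by blast
  qed
qed

lemma cp_eq_iff:
  assumes S: "S \<in> complex" "S' \<in> complex" and x: "x \<in> U S" "x' \<in> U S'"
  shows "cp S x = cp S' x' \<longleftrightarrow> (\<exists>y\<in>U (S \<inter> S'). x = restrict y (dS S) \<and> x' = restrict y (dS S'))"
proof -
  have "(cn S, x) \<in> topspace charts" "(cn S', x') \<in> topspace charts" using assms by (auto simp: topspace_charts)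
  then show ?thesis
    unfolding chart_point_def gluing_iff[OF S, symmetric] by (intro eq_equiv_class_iff[OF equiv_gluing])
qed

lemma cp_inj:
  assumes S: "S \<in> complex"
  shows "inj_on (cp S) (U S)"
proof (rule inj_onI)
  fix x x' assume x: "x \<in> U S" "x' \<in> U S" "cp S x = cp S x'"
  have "\<exists>y\<in>U (S \<inter> S). x = restrict y (dS S) \<and> x' = restrict y (dS S)"
    using x(3) unfolding cp_eq_iff[OF S S x(1,2)] .
  then obtain y where y: "x = restrict y (dS S)" "x' = restrict y (dS S)" by (elim bexE conjE)
  show "x = x'" by (rule HOL.trans[OF y(1) y(2)[symmetric]])
qed

lemma quotient_map_X: "quotient_map charts X (\<lambda>p. gluing N \<Delta> `` {p})"
  unfolding real_toric_variety_def charts_def[symmetric] by (rule quotient_map_quotient_space[OF equiv_gluing])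

lemma topspace_X: "topspace X = {cp S x | S x. S \<in> complex \<and> x \<in> U S}"
proof -
  have "topspace X = (\<lambda>p. gluing N \<Delta> `` {p}) ` topspace charts"
    by (rule quotient_imp_surjective_map[OF quotient_map_X, symmetric])
  also have "\<dots> = {cp S x | S x. S \<in> complex \<and> x \<in> U S}"
    unfolding topspace_charts chart_point_def by (rule Set.set_eqI) (simp only: image_iff mem_Collect_eq bex_simps, blast)
  finally show ?thesis .
qed

lemma cp_in_X: "S \<in> complex \<Longrightarrow> x \<in> U S \<Longrightarrow> cp S x \<in> topspace X"
  by (auto simp: topspace_X)

lemma X_cases:
  assumes "p \<in> topspace X"
  obtains S x where "S \<in> complex" "x \<in> U S" "p = cp S x"
  using assms by (auto simp: topspace_X)

lemma charts_slice:
  assumes S: "S \<in> complex"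
  shows "{x. (cn S, x) \<in> {p \<in> topspace charts. gluing N \<Delta> `` {p} \<in> W}} = {x \<in> U S. cp S x \<in> W}"
proof -
  have "(cn S, x) \<in> topspace charts \<longleftrightarrow> x \<in> U S" for x
    using cone_in_Delta[OF S] by (simp add: topspace_charts_Sigma topspace_affine)
  then show ?thesis by (simp add: chart_point_def)
qed

lemma openin_X:
  "openin X W \<longleftrightarrow> W \<subseteq> topspace X \<and> (\<forall>S\<in>complex. openin (affine_chart N (cn S)) {x \<in> U S. cp S x \<in> W})"
proof -
  let ?P = "{p \<in> topspace charts. gluing N \<Delta> `` {p} \<in> W}"
  have "?P \<subseteq> Sigma \<Delta> (topspace \<circ> affine_chart N)" unfolding topspace_charts_Sigma by (rule Collect_restrict)
  then have "openin charts ?P \<longleftrightarrow> (\<forall>\<sigma>\<in>\<Delta>. openin (affine_chart N \<sigma>) {x. (\<sigma>, x) \<in> ?P})"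
    by (simp only: charts_def openin_sum_topology simp_thms)
  also have "\<dots> \<longleftrightarrow> (\<forall>S\<in>complex. openin (affine_chart N (cn S)) {x \<in> U S. cp S x \<in> W})"
    unfolding Delta_ball by (rule ball_cong[OF HOL.refl]) (simp only: charts_slice)
  finally have "openin charts ?P \<longleftrightarrow> (\<forall>S\<in>complex. openin (affine_chart N (cn S)) {x \<in> U S. cp S x \<in> W})" .
  moreover have "openin X W \<longleftrightarrow> openin charts ?P" if "W \<subseteq> topspace X"
    using quotient_map_X that unfolding quotient_map_def by blast
  ultimately show ?thesis using openin_subset[of X W] by blast
qed

lemma closedin_X:
  "closedin X W \<longleftrightarrow> W \<subseteq> topspace X \<and> (\<forall>S\<in>complex. closedin (affine_chart N (cn S)) {x \<in> U S. cp S x \<in> W})"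
proof -
  let ?P = "{p \<in> topspace charts. gluing N \<Delta> `` {p} \<in> W}"
  have "?P \<subseteq> Sigma \<Delta> (topspace \<circ> affine_chart N)" unfolding topspace_charts_Sigma by (rule Collect_restrict)
  then have "closedin charts ?P \<longleftrightarrow> (\<forall>\<sigma>\<in>\<Delta>. closedin (affine_chart N \<sigma>) {x. (\<sigma>, x) \<in> ?P})"
    by (simp only: charts_def closedin_sum_topology simp_thms)
  also have "\<dots> \<longleftrightarrow> (\<forall>S\<in>complex. closedin (affine_chart N (cn S)) {x \<in> U S. cp S x \<in> W})"
    unfolding Delta_ball by (rule ball_cong[OF HOL.refl]) (simp only: charts_slice)
  finally have "closedin charts ?P \<longleftrightarrow> (\<forall>S\<in>complex. closedin (affine_chart N (cn S)) {x \<in> U S. cp S x \<in> W})" .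
  moreover have "closedin X W \<longleftrightarrow> closedin charts ?P" if "W \<subseteq> topspace X"
    using quotient_map_X that unfolding quotient_map_closedin by blast
  ultimately show ?thesis using closedin_subset[of X W] by blast
qed

lemma cp_continuous:
  assumes S: "S \<in> complex"
  shows "continuous_map (affine_chart N (cn S)) X (cp S)"
  unfolding continuous_map_def
proof (intro conjI allI impI)
  show "cp S \<in> topspace (affine_chart N (cn S)) \<rightarrow> topspace X" using cp_in_X[OF S] by (auto simp: topspace_affine)
  fix W assume "openin X W"
  then show "openin (affine_chart N (cn S)) {x \<in> topspace (affine_chart N (cn S)). cp S x \<in> W}"
    using S unfolding openin_X topspace_affine by blast
qed

lemma continuous_map_from_X:
  assumes "\<And>S. S \<in> complex \<Longrightarrow> continuous_map (affine_chart N (cn S)) Z (\<lambda>x. f (cp S x))"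
  shows "continuous_map X Z f"
  unfolding continuous_map_def
proof (intro conjI allI impI)
  show "f \<in> topspace X \<rightarrow> topspace Z"
    using assms by (fastforce simp: topspace_X continuous_map_def topspace_affine Pi_iff)
  fix W assume W: "openin Z W"
  show "openin X {p \<in> topspace X. f p \<in> W}"
    unfolding openin_X
  proof (intro conjI ballI)
    fix S assume S: "S \<in> complex"
    have "{x \<in> U S. cp S x \<in> {p \<in> topspace X. f p \<in> W}} = {x \<in> topspace (affine_chart N (cn S)). f (cp S x) \<in> W}"
      using cp_in_X[OF S] by (auto simp: topspace_affine)
    then show "openin (affine_chart N (cn S)) {x \<in> U S. cp S x \<in> {p \<in> topspace X. f p \<in> W}}"
      using openin_continuous_map_preimage[OF assms[OF S] W] by simp
  qed auto
qed

lemma affine_component: "u \<in> dual_semigroup N \<sigma> \<Longrightarrow> continuous_map (affine_chart N \<sigma>) euclideanreal (\<lambda>x. x u)"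
  unfolding affine_chart_def by (intro continuous_map_from_subtopology continuous_map_product_projection)

lemma continuous_map_affine:
  "continuous_map Z (affine_chart N \<sigma>) f \<longleftrightarrow> f \<in> topspace Z \<rightarrow> sg_hom (dual_semigroup N \<sigma>) UNIV \<and>
     (\<forall>u\<in>dual_semigroup N \<sigma>. continuous_map Z euclideanreal (\<lambda>z. f z u))"
  unfolding affine_chart_def continuous_map_in_subtopology continuous_map_componentwise
  by (auto simp: Pi_iff image_subset_iff sg_hom_ext)

lemma continuous_map_monomial:
  assumes B: "lattice_basis N B"
    and c: "\<And>b. b \<in> B \<Longrightarrow> continuous_map Z euclideanreal (\<lambda>z. f z b)"
    and nz: "\<And>b. b \<in> B \<Longrightarrow> (\<forall>z\<in>topspace Z. f z b \<noteq> 0) \<or> 0 \<le> \<lfloor>u b\<rfloor>"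
  shows "continuous_map Z euclideanreal (\<lambda>z. lattice_basis.monomial B (f z) u)"
  unfolding lattice_basis.monomial_def[OF B]
  by (intro continuous_map_prod continuous_map_real_powi c nz lattice_basis.finite_B[OF B])

text \<open>Openness of the image is checked in every other chart \<open>S'\<close>. The preimage
  there lies in the open set \<open>W\<close> where the coordinates not belonging to
  \<open>S\<close> are nonzero, and on \<open>W\<close> the transition map \<open>m\<close> is
  monomial, hence continuous.\<close>

lemma cp_open:
  assumes S: "S \<in> complex"
  shows "open_map (affine_chart N (cn S)) X (cp S)"
  unfolding open_map_def
proof (intro allI impI)
  fix O' assume O: "openin (affine_chart N (cn S)) O'"
  have OU: "O' \<subseteq> U S" using openin_subset[OF O] by (simp add: topspace_affine)
  show "openin X (cp S ` O')"
    unfolding openin_X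
  proof (intro conjI ballI)
    show "cp S ` O' \<subseteq> topspace X" using OU cp_in_X[OF S] by auto
    fix S' assume S': "S' \<in> complex"
    interpret L: lattice_basis N "bas S'" by (rule lattice_basis_bas[OF S'])
    note SB = bas(2)[OF S']
    let ?A = "affine_chart N (cn S')"
    define W where "W = {x \<in> U S'. \<forall>b\<in>S' - S. x (dv S' b) \<noteq> 0}"
    define m where "m x = restrict (L.monomial (\<lambda>b. x (dv S' b))) (dS S)" for x
    have Weq: "W = topspace ?A \<inter> (\<Inter>b\<in>S' - S. {x \<in> topspace ?A. x (dv S' b) \<in> - {0}})"
      by (auto simp: W_def topspace_affine)
    have W: "openin ?A W"
    proof (cases "S' - S = {}")
      case True
      show ?thesis unfolding Weq True by simp
    next
      case False
      show ?thesis unfolding Weq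
      proof (intro openin_Int openin_topspace openin_Inter)
        fix T assume "T \<in> (\<lambda>b. {x \<in> topspace ?A. x (dv S' b) \<in> - {0}}) ` (S' - S)"
        then obtain b where b: "b \<in> S' - S" "T = {x \<in> topspace ?A. x (dv S' b) \<in> - {0}}" by blast
        show "openin ?A T" unfolding b(2)
          by (rule openin_continuous_map_preimage[OF affine_component[OF dv_in_dS[OF S']]]) (use b SB in auto)
      qed (use False complex_finite[OF S'] in auto)
    qed
    have ext: "\<exists>z\<in>U (S \<inter> S'). restrict z (dS S') = x \<and> restrict z (dS S) = m x" if x: "x \<in> W" for x
    proof -
      have xU: "x \<in> U S'" and nz: "\<And>b. b \<in> S' - S \<inter> S' \<Longrightarrow> x (dv S' b) \<noteq> 0" using x by (auto simp: W_def)
      note e = L.sg_hom_extend[OF SB _ xU nz, of "S \<inter> S'"]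
      have "restrict (restrict (L.monomial (\<lambda>b. x (dv S' b))) (dS (S \<inter> S'))) (dS S) = m x"
        unfolding m_def by (rule restrict_restrict_sub[OF dS_antimono]) auto
      then show ?thesis using e by (intro bexI[of _ "restrict (L.monomial (\<lambda>b. x (dv S' b))) (dS (S \<inter> S'))"]) auto
    qed
    have mU: "m x \<in> U S" if "x \<in> W" for x
    proof -
      obtain z where z: "z \<in> U (S \<inter> S')" "restrict z (dS S) = m x" using ext[OF \<open>x \<in> W\<close>] by blast
      show ?thesis unfolding z(2)[symmetric] by (rule U_restrict[OF z(1)]) auto
    qed
    have mc: "continuous_map (subtopology ?A W) (affine_chart N (cn S)) m"
      unfolding continuous_map_affine
    proof (intro conjI ballI)
      show "m \<in> topspace (subtopology ?A W) \<rightarrow> U S" using mU by auto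
      fix u assume u: "u \<in> dS S"
      have "continuous_map (subtopology ?A W) euclideanreal (\<lambda>x. L.monomial (\<lambda>b. x (dv S' b)) u)"
      proof (rule continuous_map_monomial[OF lattice_basis_bas[OF S']])
        fix b assume b: "b \<in> bas S'"
        show "continuous_map (subtopology ?A W) euclideanreal (\<lambda>x. x (dv S' b))"
          by (rule continuous_map_from_subtopology[OF affine_component[OF dv_in_dS[OF S' b]]])
        \<comment> \<open>On \<open>S\<close> the exponents are nonnegative because \<open>u\<close>
          is nonnegative on the cone; the remaining coordinates have no zeros on
          \<open>W\<close>.\<close>
        show "(\<forall>x\<in>topspace (subtopology ?A W). x (dv S' b) \<noteq> 0) \<or> 0 \<le> \<lfloor>u b\<rfloor>"
        proof (cases "b \<in> S")
          case True
          then have "b \<in> cn S" by (rule hull_inc)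
          then show ?thesis using u by (auto simp: dual_semigroup_def)
        next
          case False
          then show ?thesis using b U_nonzero[OF S'] unfolding W_def by (cases "b \<in> S'") auto
        qed
      qed
      then show "continuous_map (subtopology ?A W) euclideanreal (\<lambda>x. m x u)" using u by (simp add: m_def)
    qed
    have eq: "{x \<in> U S'. cp S' x \<in> cp S ` O'} = {x \<in> topspace (subtopology ?A W). m x \<in> O'}"
    proof (intro equalityI subsetI)
      fix x assume "x \<in> {x \<in> U S'. cp S' x \<in> cp S ` O'}"
      then obtain w where x: "x \<in> U S'" "w \<in> O'" "cp S w = cp S' x" by auto
      then obtain y where y: "y \<in> U (S \<inter> S')" "w = restrict y (dS S)" "x = restrict y (dS S')"
        using cp_eq_iff[OF S S', of w x] OU by blast
      have "\<forall>b\<in>S' - S \<inter> S'. x (dv S' b) \<noteq> 0" using U_extend[OF S' _ x(1), of "S \<inter> S'"] y by blast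
      then have xW: "x \<in> W" using x(1) by (auto simp: W_def)
      obtain z where z: "z \<in> U (S \<inter> S')" "restrict z (dS S') = x" "restrict z (dS S) = m x" using ext[OF xW] by blast
      have "z = y" by (rule U_restrict_inj[OF S' _ z(1) y(1)]) (use z y in auto)
      then have "m x = w" using z(3) y(2) by simp
      then show "x \<in> {x \<in> topspace (subtopology ?A W). m x \<in> O'}" using xW x by (simp add: topspace_affine)
    next
      fix x assume "x \<in> {x \<in> topspace (subtopology ?A W). m x \<in> O'}"
      then have x: "x \<in> W" "x \<in> U S'" "m x \<in> O'" by (auto simp: topspace_affine)
      obtain z where z: "z \<in> U (S \<inter> S')" "restrict z (dS S') = x" "restrict z (dS S) = m x" using ext[OF x(1)] by blast
      have "cp S' x = cp S (m x)"
        unfolding cp_eq_iff[OF S' S x(2) mU[OF x(1)]] Int_commute[of S' S] by (rule bexI[OF _ z(1)]) (simp only: z simp_thms)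
      then have "cp S' x \<in> cp S ` O'" using x(3) by (rule image_eqI)
      then show "x \<in> {x \<in> U S'. cp S' x \<in> cp S ` O'}" using x(2) by (intro CollectI conjI)
    qed
    have "openin (subtopology ?A W) {x \<in> topspace (subtopology ?A W). m x \<in> O'}"
      by (rule openin_continuous_map_preimage[OF mc O])
    then show "openin (affine_chart N (cn S')) {x \<in> U S'. cp S' x \<in> cp S ` O'}"
      unfolding eq using openin_trans_full[OF _ W] by blast
  qed
qed

lemma cp_homeo:
  assumes S: "S \<in> complex"
  shows "homeomorphic_map (affine_chart N (cn S)) (subtopology X (cp S ` U S)) (cp S)"
  using injective_open_imp_embedding_map[OF cp_continuous[OF S] cp_open[OF S]] cp_inj[OF S]
  unfolding embedding_map_def topspace_affine by blast

section \<open>The torus action\<close>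

definition tm :: "'a set \<Rightarrow> (('a \<Rightarrow> real) \<Rightarrow> real) \<Rightarrow> (('a \<Rightarrow> real) \<Rightarrow> real) \<Rightarrow> ('a \<Rightarrow> real) \<Rightarrow> real" where
  "tm S t x = (\<lambda>u\<in>dS S. t u * x u)"

lemma dS_dual_lattice: "dS S \<subseteq> dual_lattice N"
  by (rule dual_semigroup_sub)

lemma tm_U:
  assumes t: "t \<in> sg_hom (dual_lattice N) A" and x: "x \<in> sg_hom (dS S) A'" and AA: "\<And>a a'. a \<in> A \<Longrightarrow> a' \<in> A' \<Longrightarrow> a * a' \<in> A''"
  shows "tm S t x \<in> sg_hom (dS S) A''"
  unfolding sg_hom_def tm_def
proof (intro CollectI conjI ballI)
  show "(\<lambda>u\<in>dS S. t u * x u) \<in> dS S \<rightarrow>\<^sub>E A''"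
  proof (rule PiE_I)
    fix u assume u: "u \<in> dS S"
    then have "u \<in> dual_lattice N" using dS_dual_lattice by auto
    then show "(\<lambda>u\<in>dS S. t u * x u) u \<in> A''" using AA[OF sg_hom_range[OF t] sg_hom_range[OF x u]] u by simp
  qed simp
  show "(\<lambda>u\<in>dS S. t u * x u) (\<lambda>_. 0) = 1"
    using sg_hom_zero[OF t] sg_hom_zero[OF x] unfolding restrict_apply'[OF dual_semigroup_zero] by simp
  fix u w assume uw: "u \<in> dS S" "w \<in> dS S"
  have "u \<in> dual_lattice N" "w \<in> dual_lattice N" using uw dS_dual_lattice by auto
  then show "(\<lambda>u\<in>dS S. t u * x u) (\<lambda>a. u a + w a) = (\<lambda>u\<in>dS S. t u * x u) u * (\<lambda>u\<in>dS S. t u * x u) w"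
    using uw sg_hom_mult[OF t] sg_hom_mult[OF x uw] unfolding restrict_apply'[OF dual_semigroup_add[OF uw]] by simp
qed

lemma tm_U': "t \<in> sg_hom (dual_lattice N) A \<Longrightarrow> x \<in> U S \<Longrightarrow> tm S t x \<in> U S"
  by (rule tm_U) auto

lemma tm_restrict: "T \<subseteq> S \<Longrightarrow> restrict (tm T t y) (dS S) = tm S t (restrict y (dS S))"
  using dS_antimono[of T S] by (auto simp: tm_def fun_eq_iff)

lemma gluing_tm:
  assumes t: "t \<in> sg_hom (dual_lattice N) A" and S: "S \<in> complex" "S' \<in> complex"
    and g: "((cn S, x), (cn S', x')) \<in> gluing N \<Delta>"
  shows "((cn S, tm S t x), (cn S', tm S' t x')) \<in> gluing N \<Delta>"
proof -
  obtain y where y: "y \<in> U (S \<inter> S')" "x = restrict y (dS S)" "x' = restrict y (dS S')"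
    using g unfolding gluing_iff[OF S] by blast
  show ?thesis
    unfolding gluing_iff[OF S] y(2,3)
    by (rule bexI[of _ "tm (S \<inter> S') t y"]) (use tm_U'[OF t y(1)] in \<open>auto simp: tm_restrict\<close>)
qed

text \<open>\<open>toric_act\<close> multiplies all representatives of a point at once. That the
  result is a whole class and not part of one uses the inverse character \<open>?ti\<close>: every
  representative of the target comes from one of the source.\<close>

lemma toric_act_cp:
  assumes t: "t \<in> sg_hom (dual_lattice N) A" and A: "0 \<notin> A" and S: "S \<in> complex" and x: "x \<in> U S"
  shows "toric_act N t (cp S x) = cp S (tm S t x)"
proof (intro equalityI subsetI)
  fix q assume "q \<in> toric_act N t (cp S x)"
  then obtain \<sigma>' x' where q: "((cn S, x), (\<sigma>', x')) \<in> gluing N \<Delta>" "q = (\<sigma>', \<lambda>u\<in>dual_semigroup N \<sigma>'. t u * x' u)"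
    by (auto simp: toric_act_def chart_point_def)
  then have "\<sigma>' \<in> \<Delta>" by (auto simp: gluing_def)
  then obtain S' where S': "S' \<in> complex" "\<sigma>' = cn S'" by (rule Delta_cases)
  show "q \<in> cp S (tm S t x)"
    unfolding chart_point_def q(2) S'(2) tm_def[symmetric]
    using gluing_tm[OF t S S'(1)] q(1) S'(2) by simp
next
  let ?ti = "\<lambda>u\<in>dual_lattice N. inverse (t u)"
  have nz: "t u \<noteq> 0" if "u \<in> dual_lattice N" for u using sg_hom_range[OF t that] A by auto
  have ti: "?ti \<in> sg_hom (dual_lattice N) UNIV"
  proof -
    have "(\<lambda>_. 0) \<in> dual_lattice N" "\<And>u w. u \<in> dual_lattice N \<Longrightarrow> w \<in> dual_lattice N \<Longrightarrow> (\<lambda>a. u a + w a) \<in> dual_lattice N"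
      unfolding dual_lattice_eq by (rule dual_semigroup_zero, rule dual_semigroup_add)
    then show ?thesis using sg_hom_zero[OF t] sg_hom_mult[OF t] by (auto simp: sg_hom_def PiE_iff)
  qed
  fix q assume "q \<in> cp S (tm S t x)"
  then have g: "((cn S, tm S t x), q) \<in> gluing N \<Delta>" by (simp add: chart_point_def)
  then obtain S' x' where q: "q = (cn S', x')" "S' \<in> complex" "x' \<in> U S'" using gluing_subset by (auto simp: topspace_charts)
  have inv: "tm R ?ti (tm R t z) = z" "tm R t (tm R ?ti z) = z" if "z \<in> U R" for R z
  proof -
    have "tm R ?ti (tm R t z) u = z u \<and> tm R t (tm R ?ti z) u = z u" for u
      using nz[of u] dS_dual_lattice[of R] sg_hom_ext[OF that]
      by (cases "u \<in> dS R") (auto simp: tm_def extensional_def subset_iff)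
    then show "tm R ?ti (tm R t z) = z" "tm R t (tm R ?ti z) = z" by auto
  qed
  have "((cn S, tm S ?ti (tm S t x)), (cn S', tm S' ?ti x')) \<in> gluing N \<Delta>"
    using gluing_tm[OF ti S q(2)] g unfolding q(1) by blast
  then have m: "(cn S', tm S' ?ti x') \<in> cp S x" unfolding inv[OF x] by (simp add: chart_point_def)
  have "q = (\<lambda>(\<sigma>, x). (\<sigma>, \<lambda>u\<in>dual_semigroup N \<sigma>. t u * x u)) (cn S', tm S' ?ti x')"
    unfolding q(1) prod.case tm_def[of S' t "tm S' ?ti x'", symmetric] inv(2)[OF q(3)] ..
  then show "q \<in> toric_act N t (cp S x)" unfolding toric_act_def using m by (rule image_eqI)
qed

end

section \<open>The non-negative part\<close>

context smooth_fan_locale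
begin

abbreviation "Y \<equiv> nonneg_part N \<Delta>"

lemma topspace_Y: "topspace Y = {cp S x | S x. S \<in> complex \<and> x \<in> Up S}"
proof -
  have "{chart_point N \<Delta> \<sigma> x | \<sigma> x. \<sigma> \<in> \<Delta> \<and> x \<in> sg_hom (dual_semigroup N \<sigma>) {0..}} = {cp S x | S x. S \<in> complex \<and> x \<in> Up S}"
    unfolding Delta_iff by blast
  moreover have "{cp S x | S x. S \<in> complex \<and> x \<in> Up S} \<subseteq> topspace X" using cp_in_X Up_U by blast
  ultimately show ?thesis unfolding nonneg_part_def topspace_subtopology by (simp only: Int_absorb1)
qed

lemma Y_cases:
  assumes "y \<in> topspace Y"
  obtains S x where "S \<in> complex" "x \<in> Up S" "y = cp S x"
  using assms unfolding topspace_Y by blast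

lemma cp_in_Y: "S \<in> complex \<Longrightarrow> x \<in> Up S \<Longrightarrow> cp S x \<in> topspace Y"
  unfolding topspace_Y by blast

lemma Y_sub_X: "topspace Y \<subseteq> topspace X"
  unfolding nonneg_part_def by auto

lemma Y_eq_subtopology: "Y = subtopology X (topspace Y)"
  by (simp add: nonneg_part_def subtopology_restrict)

text \<open>The dual basis of the larger face \<open>S\<close> lies in the semigroup of
  \<open>S\<close>, so its values survive restriction, and they also decide nonnegativity on the
  larger semigroup of \<open>T\<close>.\<close>

lemma Up_of_restrict:
  assumes S: "S \<in> complex" and T: "T \<subseteq> S" and z: "z \<in> U T" and r: "restrict z (dS S) \<in> Up S"
  shows "z \<in> Up T"
proof -
  interpret L: lattice_basis N "bas S" by (rule lattice_basis_bas[OF S])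
  have TB: "T \<subseteq> bas S" using T bas(2)[OF S] by auto
  have "0 \<le> z (dv S b)" if b: "b \<in> bas S" for b
    using sg_hom_range[OF r dv_in_dS[OF S b]] dv_in_dS[OF S b] by simp
  then show ?thesis using L.sg_hom_nonneg_iff[OF TB z] by blast
qed

text \<open>Membership in the non-negative part may be witnessed in a different chart. Nonnegativity
  passes from there to the overlap of the charts and then by restriction to the given one.\<close>

lemma cp_in_Y_iff:
  assumes S: "S \<in> complex" and x: "x \<in> U S"
  shows "cp S x \<in> topspace Y \<longleftrightarrow> x \<in> Up S"
proof
  assume "cp S x \<in> topspace Y"
  then obtain S' x' where x': "S' \<in> complex" "x' \<in> Up S'" "cp S x = cp S' x'" by (rule Y_cases)
  obtain z where z: "z \<in> U (S \<inter> S')" "x = restrict z (dS S)" "x' = restrict z (dS S')"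
    using x'(3) unfolding cp_eq_iff[OF S x'(1) x Up_U[OF x'(2)]] by (elim bexE conjE)
  have "z \<in> Up (S \<inter> S')" by (rule Up_of_restrict[OF x'(1) _ z(1)]) (use x'(2) z(3) in auto)
  then show "x \<in> Up S" unfolding z(2) by (rule U_restrict) auto
qed (rule cp_in_Y[OF S])

definition xd :: "'a set \<Rightarrow> ('a \<Rightarrow> real) \<Rightarrow> real" where
  "xd T = (\<lambda>u\<in>dS T. if \<forall>a\<in>cn T. u a = 0 then 1 else 0)"

lemma xd_Up: "xd T \<in> Up T"
  unfolding sg_hom_def xd_def
proof (intro CollectI conjI ballI)
  show "(\<lambda>u\<in>dS T. if \<forall>a\<in>cn T. u a = 0 then 1 else 0) \<in> dS T \<rightarrow>\<^sub>E {0::real..}" by auto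
  show "(\<lambda>u\<in>dS T. if \<forall>a\<in>cn T. u a = 0 then 1 else (0::real)) (\<lambda>_. 0) = 1"
    unfolding restrict_apply'[OF dual_semigroup_zero] by simp
  fix u w assume uw: "u \<in> dS T" "w \<in> dS T"
  have "(\<forall>a\<in>cn T. u a + w a = 0) \<longleftrightarrow> (\<forall>a\<in>cn T. u a = 0) \<and> (\<forall>a\<in>cn T. w a = 0)"
    using uw unfolding dual_semigroup_def by (fastforce simp: add_nonneg_eq_0_iff)
  then show "(\<lambda>u\<in>dS T. if \<forall>a\<in>cn T. u a = 0 then 1 else (0::real)) (\<lambda>a. u a + w a) =
     (\<lambda>u\<in>dS T. if \<forall>a\<in>cn T. u a = 0 then 1 else 0) u * (\<lambda>u\<in>dS T. if \<forall>a\<in>cn T. u a = 0 then 1 else 0) w"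
    using uw unfolding restrict_apply'[OF dual_semigroup_add[OF uw]] by simp
qed

lemma distinguished_point_eq: "distinguished_point N \<Delta> (cn T) = cp T (xd T)"
  by (simp add: distinguished_point_def xd_def)

text \<open>The coordinates of the distinguished point of \<open>T\<close> in the basis of a larger
  face \<open>S\<close>: a dual vector of this basis vanishes on the cone of \<open>T\<close>
  exactly if its index lies outside \<open>T\<close>.\<close>

lemma xd_dv:
  assumes S: "S \<in> complex" and T: "T \<subseteq> S" and b: "b \<in> bas S"
  shows "xd T (dv S b) = (if b \<in> T then 0 else 1)"
proof -
  interpret L: lattice_basis N "bas S" by (rule lattice_basis_bas[OF S])
  have TB: "T \<subseteq> bas S" using T bas(2)[OF S] by auto
  have d: "dv S b \<in> dS T" by (rule L.dual_vec_ds[OF TB b])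
  have "(\<forall>a\<in>cn T. dv S b a = 0) \<longleftrightarrow> b \<notin> T"
  proof
    assume *: "\<forall>a\<in>cn T. dv S b a = 0"
    show "b \<notin> T"
    proof
      assume "b \<in> T"
      then have "b \<in> cn T" by (rule hull_inc)
      then show False using * L.dual_vec_basis[OF b, of b] by auto
    qed
  next
    assume "b \<notin> T"
    then show "\<forall>a\<in>cn T. dv S b a = 0" using L.cone_coordinates[OF TB] b by auto
  qed
  then show ?thesis using d by (simp add: xd_def)
qed

definition zeros :: "'a set \<Rightarrow> (('a \<Rightarrow> real) \<Rightarrow> real) \<Rightarrow> 'a set" where
  "zeros S x = {b \<in> S. x (dv S b) = 0}"

lemma nonneg_orbit_eq:
  assumes T: "T \<in> complex"
  shows "nonneg_orbit N \<Delta> (cn T) = {cp T (tm T t (xd T)) | t. t \<in> sg_hom (dual_lattice N) {0<..}}"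
proof -
  have e: "toric_act N t (cp T (xd T)) = cp T (tm T t (xd T))" if "t \<in> sg_hom (dual_lattice N) {0<..}" for t
    by (rule toric_act_cp[OF that _ T Up_U[OF xd_Up]]) simp
  have "nonneg_orbit N \<Delta> (cn T) = {toric_act N t (cp T (xd T)) | t. t \<in> sg_hom (dual_lattice N) {0<..}}"
    by (simp add: nonneg_orbit_def orbit_def distinguished_point_eq torus_def)
  also have "\<dots> = (\<lambda>t. toric_act N t (cp T (xd T))) ` sg_hom (dual_lattice N) {0<..}" by (rule Setcompr_eq_image)
  also have "\<dots> = (\<lambda>t. cp T (tm T t (xd T))) ` sg_hom (dual_lattice N) {0<..}" by (rule image_cong[OF HOL.refl e])
  finally show ?thesis unfolding Setcompr_eq_image .
qed

text \<open>Positive characters keep the set of zero coordinates, and on nonnegative points with a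
  fixed zero set they act transitively. So orbits are recognized by zeros, in whatever chart the
  point is given.\<close>

lemma orbit_iff:
  assumes S: "S \<in> complex" and x: "x \<in> Up S" and T: "T \<in> complex"
  shows "cp S x \<in> nonneg_orbit N \<Delta> (cn T) \<longleftrightarrow> zeros S x = T"
proof
  interpret L: lattice_basis N "bas S" by (rule lattice_basis_bas[OF S])
  assume "cp S x \<in> nonneg_orbit N \<Delta> (cn T)"
  then obtain t where t: "t \<in> sg_hom (dual_lattice N) {0<..}" "cp T (tm T t (xd T)) = cp S x"
    unfolding nonneg_orbit_eq[OF T] by auto
  have tU: "tm T t (xd T) \<in> U T" by (rule tm_U'[OF t(1) Up_U[OF xd_Up]])
  obtain z where z: "z \<in> U (T \<inter> S)" "tm T t (xd T) = restrict z (dS T)" "x = restrict z (dS S)"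
    using t(2) unfolding cp_eq_iff[OF T S tU Up_U[OF x]] by (elim bexE conjE)
  \<comment> \<open>Points of the orbit vanish at all coordinates in \<open>T\<close>, while a point
    that also lies in the chart of \<open>S\<close> cannot vanish at a coordinate outside
    \<open>S\<close>. Hence \<open>T\<close> is contained in \<open>S\<close>.\<close>
  have "\<forall>b\<in>T - T \<inter> S. tm T t (xd T) (dv T b) \<noteq> 0"
    using U_extend[OF T _ tU, of "T \<inter> S"] z(1) z(2)[symmetric] by blast
  moreover have "tm T t (xd T) (dv T b) = 0" if "b \<in> T" for b
    using xd_dv[OF T order_refl, of b] bas(2)[OF T] dv_in_dS[OF T, of b] that by (auto simp: tm_def)
  ultimately have TS: "T \<subseteq> S" by auto
  then have "T \<inter> S = T" by auto
  then have zt: "z = tm T t (xd T)" using z(2) sg_hom_ext[OF z(1)] by (simp add: extensional_restrict)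
  have "x (dv S b) = 0 \<longleftrightarrow> b \<in> T" if b: "b \<in> bas S" for b
  proof -
    have d: "dv S b \<in> dS S" by (rule dv_in_dS[OF S b])
    have "x (dv S b) = t (dv S b) * xd T (dv S b)"
      unfolding z(3) zt using d dS_antimono[OF TS] by (auto simp: tm_def)
    moreover have "0 < t (dv S b)" using sg_hom_range[OF t(1), of "dv S b"] d dS_dual_lattice by auto
    ultimately show ?thesis using xd_dv[OF S TS b] by simp
  qed
  then show "zeros S x = T" using TS bas(2)[OF S] by (auto simp: zeros_def)
next
  interpret L: lattice_basis N "bas S" by (rule lattice_basis_bas[OF S])
  note SB = bas(2)[OF S]
  assume z: "zeros S x = T"
  then have TS: "T \<subseteq> S" by (auto simp: zeros_def)
  have TB: "T \<subseteq> bas S" using TS SB by blast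
  \<comment> \<open>The coordinates of \<open>x\<close> themselves give the character; where
    \<open>x\<close> vanishes any positive value would do, and 1 is taken.\<close>
  let ?f = "\<lambda>b. if b \<in> T then 1 else x (dv S b)"
  define t where "t = restrict (L.monomial ?f) (dual_lattice N)"
  have fpos: "0 < ?f b" if b: "b \<in> bas S" for b
  proof (cases "b \<in> T")
    case False
    have "x (dv S b) \<noteq> 0" using U_nonzero[OF S x, of b] False z b by (auto simp: zeros_def)
    moreover have "0 \<le> x (dv S b)" using sg_hom_range[OF x dv_in_dS[OF S b]] by simp
    ultimately show ?thesis using False by simp
  qed simp
  have t: "t \<in> sg_hom (dual_lattice N) {0<..}"
    unfolding t_def dual_lattice_eq by (rule L.monomial_sg_hom) (use fpos L.monomial_pos[of ?f] in force)+
  have xT: "xd T \<in> U T" by (rule Up_U[OF xd_Up])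
  have tU: "tm T t (xd T) \<in> U T" by (rule tm_U'[OF t xT])
  have xr: "x = restrict (tm T t (xd T)) (dS S)"
  proof (rule U_eqI[OF S x U_restrict[OF tU TS]])
    fix b assume b: "b \<in> bas S"
    have d: "dv S b \<in> dS S" by (rule dv_in_dS[OF S b])
    have dl: "dv S b \<in> dual_lattice N" using d dS_dual_lattice by auto
    have "t (dv S b) = ?f b" using dl L.monomial_dual_vec[OF b] by (simp add: t_def)
    then have "restrict (tm T t (xd T)) (dS S) (dv S b) = ?f b * (if b \<in> T then 0 else 1)"
      using d dS_antimono[OF TS] xd_dv[OF S TS b] by (auto simp: tm_def)
    then show "x (dv S b) = restrict (tm T t (xd T)) (dS S) (dv S b)" using z TS by (auto simp: zeros_def)
  qed
  have rT: "tm T t (xd T) = restrict (tm T t (xd T)) (dS T)"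
    using sg_hom_ext[OF tU] by (simp add: extensional_restrict)
  have "cp S x = cp T (tm T t (xd T))"
    unfolding cp_eq_iff[OF S T Up_U[OF x] tU] using tU TS xr rT by (intro bexI[of _ "tm T t (xd T)"] conjI) (auto simp: Int_absorb1)
  then show "cp S x \<in> nonneg_orbit N \<Delta> (cn T)" unfolding nonneg_orbit_eq[OF T] using t by blast
qed

text \<open>The index of the orbit through \<open>y\<close>. By \<open>tau_cp\<close> it is the set
  of zero coordinates in every chart that contains \<open>y\<close>, and so the set of walls through
  \<open>y\<close>.\<close>

definition tau :: "'a toric_point \<Rightarrow> 'a set" where
  "tau y = (THE S. S \<in> complex \<and> y \<in> nonneg_orbit N \<Delta> (cn S))"

lemma zeros_complex: "S \<in> complex \<Longrightarrow> zeros S x \<in> complex"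
  by (rule complex_face) (auto simp: zeros_def)

lemma tau_cp:
  assumes "S \<in> complex" "x \<in> Up S"
  shows "tau (cp S x) = zeros S x"
  unfolding tau_def by (rule the_equality) (use orbit_iff[OF assms] zeros_complex[OF assms(1)] in blast)+

lemma tau_complex: "y \<in> topspace Y \<Longrightarrow> tau y \<in> complex"
  by (erule Y_cases) (simp add: tau_cp zeros_complex)

lemma orbit_tau_iff: "y \<in> topspace Y \<Longrightarrow> T \<in> complex \<Longrightarrow> y \<in> nonneg_orbit N \<Delta> (cn T) \<longleftrightarrow> tau y = T"
  by (erule Y_cases) (simp add: tau_cp orbit_iff)

lemma orbit_sub_Y: "T \<in> complex \<Longrightarrow> nonneg_orbit N \<Delta> (cn T) \<subseteq> topspace Y"
proof
  fix p assume T: "T \<in> complex" and "p \<in> nonneg_orbit N \<Delta> (cn T)"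
  then obtain t where t: "t \<in> sg_hom (dual_lattice N) {0<..}" "p = cp T (tm T t (xd T))"
    unfolding nonneg_orbit_eq[OF T] by auto
  have "tm T t (xd T) \<in> Up T" by (rule tm_U[OF t(1) xd_Up]) auto
  then show "p \<in> topspace Y" unfolding t(2) by (rule cp_in_Y[OF T])
qed

text \<open>A nonnegative point with zeros inside \<open>S\<close> has no zero among the coordinates
  that \<open>S\<close> lacks, so it extends to the overlap with the chart of
  \<open>S\<close>.\<close>

lemma star_eq:
  assumes S: "S \<in> complex"
  shows "{y \<in> topspace Y. tau y \<subseteq> S} = cp S ` Up S"
proof (intro equalityI subsetI)
  fix y assume "y \<in> {y \<in> topspace Y. tau y \<subseteq> S}"
  then have y: "y \<in> topspace Y" "tau y \<subseteq> S" by auto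
  obtain S' x' where x': "S' \<in> complex" "x' \<in> Up S'" "y = cp S' x'" using y(1) by (rule Y_cases)
  have "\<forall>b\<in>S' - S' \<inter> S. x' (dv S' b) \<noteq> 0" using y(2) unfolding x'(3) tau_cp[OF x'(1,2)] by (auto simp: zeros_def)
  then obtain z where z: "z \<in> U (S' \<inter> S)" "restrict z (dS S') = x'"
    using U_extend[OF x'(1) _ Up_U[OF x'(2)], of "S' \<inter> S"] by blast
  have u: "restrict z (dS S) \<in> U S" by (rule U_restrict[OF z(1)]) auto
  have e: "cp S' x' = cp S (restrict z (dS S))"
    unfolding cp_eq_iff[OF x'(1) S Up_U[OF x'(2)] u] by (rule bexI[OF _ z(1)]) (simp add: z(2))
  have "restrict z (dS S) \<in> Up S" using cp_in_Y_iff[OF S u] y(1) unfolding x'(3) e by blast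
  then show "y \<in> cp S ` Up S" unfolding x'(3) e by (rule imageI)
next
  fix y assume "y \<in> cp S ` Up S"
  then obtain x where x: "x \<in> Up S" "y = cp S x" by auto
  then show "y \<in> {y \<in> topspace Y. tau y \<subseteq> S}" using cp_in_Y[OF S x(1)] tau_cp[OF S x(1)] by (auto simp: zeros_def)
qed

lemma star_eq_Int: "S \<in> complex \<Longrightarrow> cp S ` Up S = cp S ` U S \<inter> topspace Y"
  using cp_in_Y_iff Up_U by blast

definition corner_set :: "'a set \<Rightarrow> ('a \<Rightarrow> real) set" where
  "corner_set S = {f. \<forall>b\<in>bas S. if b \<in> S then 0 \<le> f b else 0 < f b}"

definition point_of :: "'a set \<Rightarrow> ('a \<Rightarrow> real) \<Rightarrow> ('a \<Rightarrow> real) \<Rightarrow> real" where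
  "point_of S f = restrict (lattice_basis.monomial (bas S) f) (dS S)"

lemma point_of_dv: "S \<in> complex \<Longrightarrow> b \<in> bas S \<Longrightarrow> point_of S f (dv S b) = f b"
  unfolding point_of_def by (rule lattice_basis.restrict_monomial_dual_vec[OF lattice_basis_bas bas(2)])

lemma point_of_U:
  assumes S: "S \<in> complex" and f: "\<And>b. b \<in> bas S - S \<Longrightarrow> f b \<noteq> 0"
  shows "point_of S f \<in> U S"
  unfolding point_of_def by (rule lattice_basis.monomial_sg_hom[OF lattice_basis_bas[OF S] bas(2)[OF S] f]) auto

lemma point_of_Up:
  assumes S: "S \<in> complex" and f: "f \<in> corner_set S"
  shows "point_of S f \<in> Up S"
proof -
  have f': "if b \<in> S then 0 \<le> f b else 0 < f b" if "b \<in> bas S" for b using f that unfolding corner_set_def by blast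
  have u: "point_of S f \<in> U S"
  proof (rule point_of_U[OF S])
    fix b assume "b \<in> bas S - S"
    then show "f b \<noteq> 0" using f'[of b] by auto
  qed
  show ?thesis unfolding Up_iff[OF S u]
  proof
    fix b assume b: "b \<in> bas S"
    show "0 \<le> point_of S f (dv S b)" unfolding point_of_dv[OF S b] using f'[OF b] by (auto split: if_splits)
  qed
qed

text \<open>The inverse evaluates a homomorphism on the dual basis. It is continuous as a family of
  projections, and \<open>point_of S\<close> is continuous because it is monomial with negative
  exponents only at positive coordinates.\<close>

lemma point_of_homeo:
  assumes S: "S \<in> complex"
  shows "homeomorphic_map (subtopology (powertop_real (bas S)) (corner_set S)) (subtopology (affine_chart N (cn S)) (Up S)) (point_of S)"
proof (rule homeomorphic_maps_imp_map)
  let ?C = "subtopology (powertop_real (bas S)) (corner_set S)" and ?A = "subtopology (affine_chart N (cn S)) (Up S)"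
  let ?k = "\<lambda>x. \<lambda>b\<in>bas S. x (dv S b)"
  have topC: "topspace ?C = extensional (bas S) \<inter> corner_set S" by (auto simp: PiE_def)
  have topA: "topspace ?A = Up S" using Up_U by (auto simp: topspace_affine)
  have k: "?k x \<in> corner_set S" if x: "x \<in> Up S" for x
    using sg_hom_range[OF x dv_in_dS[OF S]] U_nonzero[OF S x] by (auto simp: corner_set_def order_less_le)
  show "homeomorphic_maps ?C ?A (point_of S) ?k"
    unfolding homeomorphic_maps_def
  proof (intro conjI ballI)
    show "continuous_map ?C ?A (point_of S)"
      unfolding continuous_map_in_subtopology continuous_map_affine
    proof (intro conjI ballI)
      show "point_of S \<in> topspace ?C \<rightarrow> U S" "point_of S \<in> topspace ?C \<rightarrow> Up S"
        using point_of_Up[OF S] Up_U unfolding topC by blast+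
      fix u assume u: "u \<in> dS S"
      have "continuous_map ?C euclideanreal (\<lambda>f. lattice_basis.monomial (bas S) f u)"
      proof (rule continuous_map_monomial[OF lattice_basis_bas[OF S]])
        fix b assume b: "b \<in> bas S"
        show "continuous_map ?C euclideanreal (\<lambda>f. f b)"
          by (rule continuous_map_from_subtopology[OF continuous_map_product_projection[OF b]])
        show "(\<forall>f\<in>topspace ?C. f b \<noteq> 0) \<or> 0 \<le> \<lfloor>u b\<rfloor>"
        proof (cases "b \<in> S")
          case True
          then have "b \<in> cn S" by (rule hull_inc)
          then show ?thesis using u by (auto simp: dual_semigroup_def)
        next
          case False
          have "f b \<noteq> 0" if "f \<in> topspace ?C" for f
          proof -
            have "f \<in> corner_set S" using that unfolding topC by blast
            then have "if b \<in> S then 0 \<le> f b else 0 < f b" using b unfolding corner_set_def by blast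
            then show ?thesis using False by auto
          qed
          then show ?thesis by blast
        qed
      qed
      then show "continuous_map ?C euclideanreal (\<lambda>f. point_of S f u)" using u by (simp add: point_of_def)
    qed
    show "continuous_map ?A ?C ?k"
      unfolding continuous_map_in_subtopology continuous_map_componentwise
    proof (intro conjI ballI)
      show "?k \<in> topspace ?A \<rightarrow> corner_set S" unfolding topA using k by blast
      fix b assume b: "b \<in> bas S"
      show "continuous_map ?A euclideanreal (\<lambda>x. ?k x b)"
        using continuous_map_from_subtopology[OF affine_component[OF dv_in_dS[OF S b]]] b by simp
    qed auto
    show "?k (point_of S f) = f" if "f \<in> topspace ?C" for f
      by (rule extensionalityI[of _ "bas S"]) (use that point_of_dv[OF S] in \<open>simp_all add: topC del: topspace_subtopology\<close>)
    show "point_of S (?k x) = x" if "x \<in> topspace ?A" for x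
    proof -
      have x: "x \<in> Up S" using that unfolding topA .
      show ?thesis by (rule U_eqI[OF S point_of_Up[OF S k[OF x]] x]) (simp add: point_of_dv[OF S])
    qed
  qed
qed

definition corner_chart :: "'a set \<Rightarrow> ('a \<Rightarrow> real) \<Rightarrow> 'a toric_point" where
  "corner_chart S f = cp S (point_of S f)"

lemma corner_space: "corner_space Y complex tau bas corner_chart"
proof
  show "{} \<in> complex" by (rule complex_empty)
  show "S \<in> complex \<Longrightarrow> T \<subseteq> S \<Longrightarrow> T \<in> complex" for S T by (rule complex_face)
  show "S \<in> complex \<Longrightarrow> finite S" for S by (rule complex_finite)
  show "S \<in> complex \<Longrightarrow> S \<subseteq> bas S" for S by (rule bas(2))
  show "y \<in> topspace Y \<Longrightarrow> tau y \<in> complex" for y by (rule tau_complex)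
  fix S assume S: "S \<in> complex"
  have "openin X (cp S ` U S)"
    using cp_open[OF S] openin_topspace[of "affine_chart N (cn S)"] unfolding open_map_def topspace_affine by blast
  then show "openin Y {y \<in> topspace Y. tau y \<subseteq> S}"
    unfolding star_eq[OF S] star_eq_Int[OF S] by (subst Y_eq_subtopology) (auto simp: openin_subtopology)
  have "homeomorphic_map (subtopology (affine_chart N (cn S)) (Up S)) (subtopology (subtopology X (cp S ` U S)) (cp S ` Up S)) (cp S)"
    by (rule homeomorphic_map_subtopologies[OF cp_homeo[OF S]]) (use Up_U cp_in_X[OF S] in \<open>auto simp: topspace_affine\<close>)
  moreover have "cp S ` U S \<inter> cp S ` Up S = topspace Y \<inter> cp S ` Up S"
    using star_eq_Int[OF S] by blast
  then have "subtopology (subtopology X (cp S ` U S)) (cp S ` Up S) = subtopology Y {y \<in> topspace Y. tau y \<subseteq> S}"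
    unfolding star_eq[OF S] by (subst Y_eq_subtopology) (simp only: subtopology_subtopology)
  ultimately have "homeomorphic_map (subtopology (affine_chart N (cn S)) (Up S)) (subtopology Y {y \<in> topspace Y. tau y \<subseteq> S}) (cp S)"
    by simp
  then have "homeomorphic_map (subtopology (powertop_real (bas S)) (corner_set S)) (subtopology Y {y \<in> topspace Y. tau y \<subseteq> S}) (cp S \<circ> point_of S)"
    by (rule homeomorphic_map_compose[OF point_of_homeo[OF S]])
  moreover have "cp S \<circ> point_of S = corner_chart S" by (simp add: fun_eq_iff corner_chart_def)
  ultimately show "homeomorphic_map (subtopology (powertop_real (bas S)) {f. \<forall>b\<in>bas S. if b \<in> S then 0 \<le> f b else 0 < f b})
      (subtopology Y {y \<in> topspace Y. tau y \<subseteq> S}) (corner_chart S)"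
    by (simp only: corner_set_def)
  fix f :: "'a \<Rightarrow> real" assume "\<forall>b\<in>bas S. if b \<in> S then 0 \<le> f b else 0 < f b"
  then have f: "f \<in> corner_set S" by (simp add: corner_set_def)
  show "tau (corner_chart S f) = {b \<in> S. f b = 0}"
    unfolding corner_chart_def tau_cp[OF S point_of_Up[OF S f]] zeros_def using point_of_dv[OF S] bas(2)[OF S] by auto
qed

text \<open>Nonnegativity is a closed condition in each chart. This is what later makes the map from
  the development to the toric variety closed.\<close>

lemma closedin_Y: "closedin X (topspace Y)"
  unfolding closedin_X
proof (intro conjI ballI)
  fix S assume S: "S \<in> complex"
  let ?A = "affine_chart N (cn S)"
  have "{x \<in> U S. cp S x \<in> topspace Y} = topspace ?A \<inter> (\<Inter>b\<in>bas S. {x \<in> topspace ?A. x (dv S b) \<in> {0..}})"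
    using cp_in_Y_iff[OF S] Up_iff[OF S] by (auto simp: topspace_affine)
  moreover have "closedin ?A (topspace ?A \<inter> (\<Inter>b\<in>bas S. {x \<in> topspace ?A. x (dv S b) \<in> {0..}}))"
  proof (cases "bas S = {}")
    case False
    show ?thesis
      by (intro closedin_Int closedin_topspace closedin_INT False closedin_continuous_map_preimage[OF affine_component[OF dv_in_dS[OF S]]])
        auto
  qed simp
  ultimately show "closedin ?A {x \<in> U S. cp S x \<in> topspace Y}" by simp
qed (rule Y_sub_X)

end

section \<open>Developments of the non-negative part\<close>

lemma (in lattice_basis) T2_class_symdiff:
  assumes R: "R \<subseteq> B" "R' \<subseteq> B"
  shows "T2_class N (\<Sum>R) \<otimes>\<^bsub>T2 N\<^esub> T2_class N (\<Sum>R') = T2_class N (\<Sum>(sym_diff R R'))"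
proof -
  interpret T: group "T2 N" by (rule T2_group)
  have c: "T2_class N (\<Sum>Q) \<in> carrier (T2 N)" if "Q \<subseteq> B" for Q by (rule T2_class_closed[OF sum_B_in_N[OF that]])
  have "sym_diff R R' \<subseteq> B" using R by auto
  then have d: "T2_class N (\<Sum>(sym_diff R R')) \<in> sg_hom (ds {}) {1, -1}" using c by (simp add: carrier_torus)
  have m: "T2_class N (\<Sum>R) \<otimes>\<^bsub>T2 N\<^esub> T2_class N (\<Sum>R') \<in> sg_hom (ds {}) {1, -1}"
    using T.m_closed[OF c[OF R(1)] c[OF R(2)]] by (simp add: carrier_torus)
  show ?thesis
  proof (rule sg_hom_eqI[OF _ m d])
    fix b assume b: "b \<in> B"
    show "(T2_class N (\<Sum>R) \<otimes>\<^bsub>T2 N\<^esub> T2_class N (\<Sum>R')) (dual_vec B b) = T2_class N (\<Sum>(sym_diff R R')) (dual_vec B b)"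
      using T2_class_dual_vec[OF R(1) b] T2_class_dual_vec[OF R(2) b] T2_class_dual_vec[OF \<open>sym_diff R R' \<subseteq> B\<close> b]
        dual_vec_dual_lattice[OF b] by (auto simp: torus_mult)
  qed simp
qed

context smooth_fan_locale
begin

text \<open>The class of the sum over \<open>R\<close> changes the sign of exactly the coordinates
  in \<open>R\<close>. The point is fixed iff these are 0, which can happen inside \<open>S\<close>
  only.\<close>

lemma T2_fix_iff:
  assumes S: "S \<in> complex" and x: "x \<in> U S" and R: "R \<subseteq> bas S"
  shows "toric_act N (T2_class N (\<Sum>R)) (cp S x) = cp S x \<longleftrightarrow> R \<subseteq> zeros S x"
proof -
  interpret L: lattice_basis N "bas S" by (rule lattice_basis_bas[OF S])
  let ?t = "T2_class N (\<Sum>R)"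
  have t: "?t \<in> sg_hom (dual_lattice N) {1, -1}" using L.T2_class_closed[OF L.sum_B_in_N[OF R]] by (simp add: torus_def)
  have tU: "tm S ?t x \<in> U S" by (rule tm_U'[OF t x])
  have v: "tm S ?t x (dv S b) = (if b \<in> R then - x (dv S b) else x (dv S b))" if "b \<in> bas S" for b
    using dv_in_dS[OF S that] L.T2_class_dual_vec[OF R that] by (simp add: tm_def)
  have "toric_act N ?t (cp S x) = cp S x \<longleftrightarrow> tm S ?t x = x"
    unfolding toric_act_cp[OF t _ S x, simplified] by (rule inj_on_eq_iff[OF cp_inj[OF S] tU x])
  also have "\<dots> \<longleftrightarrow> (\<forall>b\<in>bas S. tm S ?t x (dv S b) = x (dv S b))"
    using U_eqI[OF S tU x] by auto
  also have "\<dots> \<longleftrightarrow> (\<forall>b\<in>R. x (dv S b) = 0)" using v R by auto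
  also have "\<dots> \<longleftrightarrow> R \<subseteq> zeros S x" using U_nonzero[OF S x] R by (auto simp: zeros_def)
  finally show ?thesis .
qed

text \<open>The stabilizer of the distinguished point, whose zeros are all of \<open>T\<close>: its
  elements correspond to the subsets of the vertex set, and by \<open>local_group_symdiff\<close>
  the product is symmetric difference.\<close>

lemma carrier_local_group:
  assumes T: "T \<in> complex"
  shows "carrier (local_group N \<Delta> (cn T)) = (\<lambda>R. T2_class N (\<Sum>R)) ` Pow T"
proof -
  interpret L: lattice_basis N "bas T" by (rule lattice_basis_bas[OF T])
  have z: "zeros T (xd T) = T" using xd_dv[OF T order_refl] bas(2)[OF T] by (auto simp: zeros_def)
  have "carrier (local_group N \<Delta> (cn T)) = {t \<in> carrier (T2 N). toric_act N t (cp T (xd T)) = cp T (xd T)}"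
    by (simp add: local_group_def stabilizer_def distinguished_point_eq)
  also have "\<dots> = (\<lambda>R. T2_class N (\<Sum>R)) ` {R \<in> Pow (bas T). R \<subseteq> T}"
    unfolding L.carrier_T2 using T2_fix_iff[OF T Up_U[OF xd_Up]] z by auto
  also have "{R \<in> Pow (bas T). R \<subseteq> T} = Pow T" using bas(2)[OF T] by auto
  finally show ?thesis .
qed

lemma local_group_mult: "s \<otimes>\<^bsub>local_group N \<Delta> \<tau>\<^esub> t = s \<otimes>\<^bsub>T2 N\<^esub> t"
  by (simp add: local_group_def)

lemma local_group_symdiff:
  assumes T: "T \<in> complex" and R: "R \<subseteq> T" "R' \<subseteq> T"
  shows "T2_class N (\<Sum>R) \<otimes>\<^bsub>T2 N\<^esub> T2_class N (\<Sum>R') = T2_class N (\<Sum>(sym_diff R R'))"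
  by (rule lattice_basis.T2_class_symdiff[OF lattice_basis_bas[OF T]]) (use R bas(2)[OF T] in auto)

lemma Union_strata: "\<Union>{nonneg_stratum N \<Delta> \<tau> | \<tau>. \<tau> \<in> \<Delta>} = topspace Y"
proof (intro equalityI subsetI)
  fix y assume "y \<in> \<Union>{nonneg_stratum N \<Delta> \<tau> | \<tau>. \<tau> \<in> \<Delta>}"
  then obtain \<tau> where "y \<in> nonneg_stratum N \<Delta> \<tau>" by auto
  then show "y \<in> topspace Y"
    using closure_of_subset_topspace[of Y "nonneg_orbit N \<Delta> \<tau>"] by (auto simp: nonneg_stratum_def)
next
  fix y assume y: "y \<in> topspace Y"
  note T = tau_complex[OF y]
  have "y \<in> nonneg_orbit N \<Delta> (cn (tau y))" using orbit_tau_iff[OF y T] by simp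
  then have "y \<in> nonneg_stratum N \<Delta> (cn (tau y))"
    unfolding nonneg_stratum_def using closure_of_subset[OF orbit_sub_Y[OF T]] by blast
  then show "y \<in> \<Union>{nonneg_stratum N \<Delta> \<tau> | \<tau>. \<tau> \<in> \<Delta>}" using cone_in_Delta[OF T] by blast
qed

end

text \<open>The bridge from a simple morphism \<phi> to the general construction: an element of a
  local group is the class of the sum over a vertex set \<open>R\<close>, and \<open>P R\<close> is
  its image. As \<open>P R\<close> does not mention the cone, compatibility with the inclusions is
  built in.\<close>

locale fan_development = smooth_fan_locale N \<Delta> + group G
  for N :: "'a::real_vector set" and \<Delta> and G :: "('g, 'm) monoid_scheme" (structure) +
  fixes P :: "'a set \<Rightarrow> 'g" and \<phi> :: "'a set \<Rightarrow> (('a \<Rightarrow> real) \<Rightarrow> real) \<Rightarrow> 'g"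
  assumes P_closed: "S \<in> complex \<Longrightarrow> P S \<in> carrier G"
    and P_mult: "S \<in> complex \<Longrightarrow> T \<subseteq> S \<Longrightarrow> T' \<subseteq> S \<Longrightarrow> P T \<otimes> P T' = P (sym_diff T T')"
    and P_inj: "S \<in> complex \<Longrightarrow> inj_on P (Pow S)"
    and phi: "T \<in> complex \<Longrightarrow> R \<subseteq> T \<Longrightarrow> \<phi> (convex_cone hull T) (T2_class N (\<Sum>R)) = P R"
begin

sublocale dev: development_space "nonneg_part N \<Delta>" complex tau bas corner_chart G P
  by (intro development_space.intro development_space_axioms.intro corner_space group_axioms P_closed P_mult P_inj)

lemma phi_image: "T \<in> complex \<Longrightarrow> \<phi> (cn T) ` carrier (local_group N \<Delta> (cn T)) = P ` Pow T"
  unfolding carrier_local_group image_image by (rule image_cong) (auto simp: phi)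

text \<open>The orbits partition the non-negative part, so the only cone that can witness the
  relation at \<open>x\<close> is the one with vertex set \<open>tau x\<close>.\<close>

lemma dev_rel_eq: "dev_rel N \<Delta> G \<phi> = dev.Rel"
proof -
  have *: "(\<exists>\<tau>\<in>\<Delta>. x \<in> nonneg_orbit N \<Delta> \<tau> \<and> k \<in> \<phi> \<tau> ` carrier (local_group N \<Delta> \<tau>)) \<longleftrightarrow> k \<in> P ` Pow (tau x)"
    if x: "x \<in> topspace Y" for x k
  proof -
    have "(\<exists>\<tau>\<in>\<Delta>. x \<in> nonneg_orbit N \<Delta> \<tau> \<and> k \<in> \<phi> \<tau> ` carrier (local_group N \<Delta> \<tau>)) \<longleftrightarrow>
        (\<exists>T\<in>complex. x \<in> nonneg_orbit N \<Delta> (cn T) \<and> k \<in> \<phi> (cn T) ` carrier (local_group N \<Delta> (cn T)))"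
      unfolding Bex_def Delta_iff by blast
    also have "\<dots> \<longleftrightarrow> (\<exists>T\<in>complex. tau x = T \<and> k \<in> P ` Pow T)"
      by (rule bex_cong[OF HOL.refl]) (simp only: orbit_tau_iff[OF x] phi_image)
    also have "\<dots> \<longleftrightarrow> k \<in> P ` Pow (tau x)" using tau_complex[OF x] by blast
    finally show ?thesis .
  qed
  show ?thesis
  proof (rule Set.set_eqI)
    fix z :: "('g \<times> 'a toric_point) \<times> ('g \<times> 'a toric_point)"
    obtain g x g' x' where z: "z = ((g, x), (g', x'))" by (cases z) auto
    show "z \<in> dev_rel N \<Delta> G \<phi> \<longleftrightarrow> z \<in> dev.Rel"
      unfolding z dev_rel_def dev.Rel_def mem_Collect_eq prod.case using *[of x "inv g \<otimes> g'"] by blast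
  qed
qed

lemma development_eq: "development N \<Delta> G \<phi> = dev.D"
  by (simp add: development_def dev.D_def dev_rel_eq)

lemma dev_act_eq: "dev_act N \<Delta> G \<phi> = dev.act"
  by (rule ext) (simp add: dev_act_def dev.act_def development_eq)

lemma dev_emb_eq: "dev_emb N \<Delta> G \<phi> = dev.cls \<one>"
  by (rule ext) (simp add: dev_emb_def dev.cls_def dev_rel_eq)

lemma dev_strata_eq: "dev_strata N \<Delta> G \<phi> = dev.strata {nonneg_stratum N \<Delta> \<tau> | \<tau>. \<tau> \<in> \<Delta>}"
  unfolding dev_strata_def dev.strata_def dev_act_eq dev_emb_eq by blast

lemma strata_preserving: "strata_preserving_action G (development N \<Delta> G \<phi>) (dev_strata N \<Delta> G \<phi>) (dev_act N \<Delta> G \<phi>)"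
  unfolding development_eq dev_strata_eq dev_act_eq by (rule dev.strata_preserving_D) (simp add: Union_strata)

lemma strict_domain:
  "strict_fundamental_domain G (development N \<Delta> G \<phi>) (dev_strata N \<Delta> G \<phi>) (dev_act N \<Delta> G \<phi>)
     (dev_emb N \<Delta> G \<phi> ` topspace (nonneg_part N \<Delta>))"
  unfolding development_eq dev_strata_eq dev_act_eq dev_emb_eq by (rule dev.strict_fundamental_domain_D[OF Union_strata])

lemma simple_morphism: "simple_morphism N \<Delta> G \<phi>"
  unfolding simple_morphism_def
proof (intro conjI ballI impI)
  fix \<tau> assume "\<tau> \<in> \<Delta>"
  then obtain T where T: "T \<in> complex" "\<tau> = cn T" by (rule Delta_cases)
  show "\<phi> \<tau> \<in> hom (local_group N \<Delta> \<tau>) G"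
  proof (rule homI)
    fix s assume "s \<in> carrier (local_group N \<Delta> \<tau>)"
    then show "\<phi> \<tau> s \<in> carrier G"
      using P_closed complex_face[OF T(1)] phi[OF T(1)] unfolding T(2) carrier_local_group[OF T(1)] by auto
  next
    fix s t assume "s \<in> carrier (local_group N \<Delta> \<tau>)" "t \<in> carrier (local_group N \<Delta> \<tau>)"
    then obtain R R' where R: "R \<subseteq> T" "s = T2_class N (\<Sum>R)" "R' \<subseteq> T" "t = T2_class N (\<Sum>R')"
      unfolding T(2) carrier_local_group[OF T(1)] by auto
    have sd: "sym_diff R R' \<subseteq> T" using R by auto
    show "\<phi> \<tau> (s \<otimes>\<^bsub>local_group N \<Delta> \<tau>\<^esub> t) = \<phi> \<tau> s \<otimes> \<phi> \<tau> t"
      unfolding local_group_mult T(2) R(2,4) local_group_symdiff[OF T(1) R(1,3)]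
        phi[OF T(1) R(1)] phi[OF T(1) R(3)] phi[OF T(1) sd] by (rule P_mult[OF T(1) R(1,3), symmetric])
  qed
next
  fix \<sigma> \<tau> g assume s: "\<sigma> \<in> \<Delta>" and t: "\<tau> \<in> \<Delta>" and f: "\<tau> face_of \<sigma>" and g: "g \<in> carrier (local_group N \<Delta> \<tau>)"
  obtain S where S: "S \<in> complex" "\<sigma> = cn S" using s by (rule Delta_cases)
  obtain T where T: "T \<in> complex" "\<tau> = cn T" using t by (rule Delta_cases)
  have "V \<inter> \<tau> \<subseteq> V \<inter> \<sigma>" using f unfolding face_iff[OF s t] .
  then have TS: "T \<subseteq> S" unfolding T(2) S(2) conjunct2[OF complex_cone[OF S(1)]] conjunct2[OF complex_cone[OF T(1)]] .
  obtain R where R: "R \<subseteq> T" "g = T2_class N (\<Sum>R)" using g unfolding T(2) carrier_local_group[OF T(1)] by auto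
  show "\<phi> \<sigma> g = \<phi> \<tau> g"
    unfolding R(2) S(2) T(2) phi[OF T(1) R(1)] by (rule phi[OF S(1)]) (use R(1) TS in auto)
qed

lemma injective: "injective_at_local_groups N \<Delta> \<phi>"
  unfolding injective_at_local_groups_def
proof
  fix \<tau> assume "\<tau> \<in> \<Delta>"
  then obtain T where T: "T \<in> complex" "\<tau> = cn T" by (rule Delta_cases)
  show "inj_on (\<phi> \<tau>) (carrier (local_group N \<Delta> \<tau>))"
    unfolding T(2) carrier_local_group[OF T(1)]
  proof (rule inj_onI)
    fix s t assume "s \<in> (\<lambda>R. T2_class N (\<Sum>R)) ` Pow T" "t \<in> (\<lambda>R. T2_class N (\<Sum>R)) ` Pow T"
      and eq: "\<phi> (cn T) s = \<phi> (cn T) t"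
    then obtain R R' where R: "R \<subseteq> T" "s = T2_class N (\<Sum>R)" "R' \<subseteq> T" "t = T2_class N (\<Sum>R')" by auto
    have "P R = P R'" using eq unfolding R(2,4) phi[OF T(1) R(1)] phi[OF T(1) R(3)] .
    then have "R = R'" using inj_onD[OF P_inj[OF T(1)]] R(1,3) by blast
    then show "s = t" using R by simp
  qed
qed

end

section \<open>The real toric variety as a development\<close>

context smooth_fan_locale
begin

abbreviation "PT R \<equiv> T2_class N (\<Sum>R)"

lemma T2_is_group: "group (T2 N)"
  by (rule lattice_basis.T2_group[OF lattice_basis_bas[OF complex_empty]])

lemma PT_closed: "S \<in> complex \<Longrightarrow> R \<subseteq> bas S \<Longrightarrow> PT R \<in> carrier (T2 N)"
  using lattice_basis.T2_class_closed[OF lattice_basis_bas lattice_basis.sum_B_in_N[OF lattice_basis_bas]] by blast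

lemma T2_development: "fan_development N \<Delta> (T2 N) (\<lambda>R. PT R) incl_morphism"
proof (intro fan_development.intro fan_development_axioms.intro smooth_fan_locale_axioms T2_is_group)
  show "PT S \<in> carrier (T2 N)" if "S \<in> complex" for S by (rule PT_closed[OF that bas(2)[OF that]])
  show "PT T \<otimes>\<^bsub>T2 N\<^esub> PT T' = PT (sym_diff T T')" if "S \<in> complex" "T \<subseteq> S" "T' \<subseteq> S" for S T T'
    by (rule local_group_symdiff[OF that])
  show "inj_on (\<lambda>R. PT R) (Pow S)" if "S \<in> complex" for S
    by (rule inj_on_subset[OF lattice_basis.T2_class_sum_inj[OF lattice_basis_bas[OF that]]]) (use bas(2)[OF that] in auto)
qed (simp add: incl_morphism_def)

interpretation T2: fan_development N \<Delta> "T2 N" "\<lambda>R. PT R" incl_morphism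
  by (rule T2_development)

lemma carrier_T2_sg: "t \<in> carrier (T2 N) \<longleftrightarrow> t \<in> sg_hom (dual_lattice N) {1, -1}"
  by (simp add: torus_def)

lemma toric_act_T2:
  assumes t: "t \<in> carrier (T2 N)" and S: "S \<in> complex" and x: "x \<in> U S"
  shows "toric_act N t (cp S x) = cp S (tm S t x)"
  by (rule toric_act_cp[OF t[unfolded carrier_T2_sg] _ S x]) simp

lemma tm_T2_U: "t \<in> carrier (T2 N) \<Longrightarrow> x \<in> U S \<Longrightarrow> tm S t x \<in> U S"
  unfolding carrier_T2_sg by (rule tm_U')

lemma toric_act_mult:
  assumes s: "s \<in> carrier (T2 N)" and t: "t \<in> carrier (T2 N)" and p: "p \<in> topspace X"
  shows "toric_act N (s \<otimes>\<^bsub>T2 N\<^esub> t) p = toric_act N s (toric_act N t p)"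
proof -
  obtain S x where x: "S \<in> complex" "x \<in> U S" "p = cp S x" using p by (rule X_cases)
  have "tm S (s \<otimes>\<^bsub>T2 N\<^esub> t) x = tm S s (tm S t x)"
    using dS_dual_lattice[of S] by (auto simp: tm_def fun_eq_iff torus_def)
  then show ?thesis
    unfolding x(3) toric_act_T2[OF T2.m_closed[OF s t] x(1,2)] toric_act_T2[OF t x(1,2)]
      toric_act_T2[OF s x(1) tm_T2_U[OF t x(2)]] by simp
qed

lemma toric_act_one:
  assumes p: "p \<in> topspace X"
  shows "toric_act N \<one>\<^bsub>T2 N\<^esub> p = p"
proof -
  obtain S x where x: "S \<in> complex" "x \<in> U S" "p = cp S x" using p by (rule X_cases)
  have "tm S \<one>\<^bsub>T2 N\<^esub> x = x"
    by (rule extensionalityI[of _ "dS S"]) (use sg_hom_ext[OF x(2)] dS_dual_lattice[of S] in \<open>auto simp: tm_def torus_def\<close>)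
  then show ?thesis unfolding x(3) toric_act_T2[OF T2.one_closed x(1,2)] by simp
qed

lemma toric_act_continuous:
  assumes t: "t \<in> carrier (T2 N)"
  shows "continuous_map X X (toric_act N t)"
proof (rule continuous_map_from_X)
  fix S assume S: "S \<in> complex"
  let ?A = "affine_chart N (cn S)"
  have "continuous_map ?A ?A (tm S t)"
    unfolding continuous_map_affine
  proof (intro conjI ballI)
    show "tm S t \<in> topspace ?A \<rightarrow> U S" using tm_T2_U[OF t] by (auto simp: topspace_affine)
    fix u assume u: "u \<in> dS S"
    then show "continuous_map ?A euclideanreal (\<lambda>x. tm S t x u)"
      using continuous_map_real_mult_left[OF affine_component[OF u], of "t u"] by (simp add: tm_def)
  qed
  then have "continuous_map ?A X (cp S \<circ> tm S t)" by (rule continuous_map_compose[OF _ cp_continuous[OF S]])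
  then show "continuous_map ?A X (\<lambda>x. toric_act N t (cp S x))"
    by (rule continuous_map_eq) (simp add: topspace_affine toric_act_T2[OF t S])
qed

lemma T2_square': "t \<in> carrier (T2 N) \<Longrightarrow> t \<otimes>\<^bsub>T2 N\<^esub> t = \<one>\<^bsub>T2 N\<^esub>"
  by (rule lattice_basis.T2_square[OF lattice_basis_bas[OF complex_empty]])

lemma toric_act_homeo:
  assumes t: "t \<in> carrier (T2 N)"
  shows "homeomorphic_map X X (toric_act N t)"
proof (rule homeomorphic_maps_imp_map)
  show "homeomorphic_maps X X (toric_act N t) (toric_act N t)"
    unfolding homeomorphic_maps_def
    using toric_act_continuous[OF t] toric_act_mult[OF t t] toric_act_one T2_square'[OF t] by simp
qed

definition act_map :: "((('a \<Rightarrow> real) \<Rightarrow> real) \<times> 'a toric_point) set \<Rightarrow> 'a toric_point" where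
  "act_map c = case_prod (toric_act N) (SOME z. z \<in> c)"

lemma toric_act_near:
  assumes t: "t \<in> carrier (T2 N)" and y: "y \<in> topspace Y" and n: "T2.dev.near (tau y) t t'"
  shows "toric_act N t' y = toric_act N t y"
proof -
  obtain R where R: "R \<subseteq> tau y" "t' = t \<otimes>\<^bsub>T2 N\<^esub> PT R" using n unfolding T2.dev.near_def by blast
  obtain S x where x: "S \<in> complex" "x \<in> Up S" "y = cp S x" using y by (rule Y_cases)
  have Rz: "R \<subseteq> zeros S x" using R(1) unfolding x(3) tau_cp[OF x(1,2)] .
  have RB: "R \<subseteq> bas S" using Rz bas(2)[OF x(1)] by (auto simp: zeros_def)
  have "toric_act N (PT R) y = y" unfolding x(3) T2_fix_iff[OF x(1) Up_U[OF x(2)] RB] by (rule Rz)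
  then show ?thesis unfolding R(2) using toric_act_mult[OF t PT_closed[OF x(1) RB]] y Y_sub_X by auto
qed

lemma act_map_cls:
  assumes t: "t \<in> carrier (T2 N)" and y: "y \<in> topspace Y"
  shows "act_map (T2.dev.cls t y) = toric_act N t y"
proof -
  have "(t, y) \<in> T2.dev.cls t y"
    using T2.dev.near_refl[OF t] t y by (simp add: T2.dev.cls_def T2.dev.Rel_iff)
  then have "(SOME z. z \<in> T2.dev.cls t y) \<in> T2.dev.cls t y" by (rule someI)
  moreover obtain t' y' where z: "(SOME z. z \<in> T2.dev.cls t y) = (t', y')" by (rule prod.exhaust)
  ultimately have "(t', y') \<in> T2.dev.cls t y" by (simp only:)
  then have "y' = y" "T2.dev.near (tau y) t t'" by (auto simp: T2.dev.cls_def T2.dev.Rel_iff)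
  then show ?thesis unfolding act_map_def z using toric_act_near[OF t y] by simp
qed

text \<open>Elements of \<open>T2\<close> have values 1 and -1, so absolute values recover the
  nonnegative factor of a point. Taken on the overlap of the two charts, they give one homomorphism
  \<open>w\<close> that restricts to both factors.\<close>

lemma toric_act_eqD:
  assumes t: "t \<in> carrier (T2 N)" "t' \<in> carrier (T2 N)" and y: "y \<in> topspace Y" "y' \<in> topspace Y"
    and eq: "toric_act N t y = toric_act N t' y'"
  shows "y = y'"
proof -
  obtain S x where x: "S \<in> complex" "x \<in> Up S" "y = cp S x" using y(1) by (rule Y_cases)
  obtain S' x' where x': "S' \<in> complex" "x' \<in> Up S'" "y' = cp S' x'" using y(2) by (rule Y_cases)
  note xU = Up_U[OF x(2)] and xU' = Up_U[OF x'(2)]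
  have "cp S (tm S t x) = cp S' (tm S' t' x')"
    using eq unfolding x(3) x'(3) toric_act_T2[OF t(1) x(1) xU] toric_act_T2[OF t(2) x'(1) xU'] .
  then obtain z where z: "z \<in> U (S \<inter> S')" "tm S t x = restrict z (dS S)" "tm S' t' x' = restrict z (dS S')"
    unfolding cp_eq_iff[OF x(1) x'(1) tm_T2_U[OF t(1) xU] tm_T2_U[OF t(2) xU']] by (elim bexE conjE)
  define w where "w = (\<lambda>u\<in>dS (S \<inter> S'). \<bar>z u\<bar>)"
  have w: "w \<in> U (S \<inter> S')"
    unfolding sg_hom_def
  proof (intro CollectI conjI ballI)
    show "w \<in> dS (S \<inter> S') \<rightarrow>\<^sub>E UNIV" by (simp add: w_def)
    show "w (\<lambda>_. 0) = 1" unfolding w_def restrict_apply'[OF dual_semigroup_zero] sg_hom_zero[OF z(1)] by simp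
    fix u v assume uv: "u \<in> dS (S \<inter> S')" "v \<in> dS (S \<inter> S')"
    show "w (\<lambda>a. u a + v a) = w u * w v"
      unfolding w_def restrict_apply'[OF dual_semigroup_add[OF uv]] using uv sg_hom_mult[OF z(1) uv] by (simp add: abs_mult)
  qed
  have abs: "a = restrict w (dS R)" if a: "a \<in> Up R" and R: "S \<inter> S' \<subseteq> R" and s: "s \<in> carrier (T2 N)" and e: "tm R s a = restrict z (dS R)" for a R s
  proof (rule extensionalityI[OF sg_hom_ext[OF a]])
    fix u assume u: "u \<in> dS R"
    have "s u = 1 \<or> s u = -1" using sg_hom_range[OF s[unfolded carrier_T2_sg], of u] u dS_dual_lattice by auto
    moreover have "0 \<le> a u" using sg_hom_range[OF a u] by simp
    moreover have "s u * a u = z u" using fun_cong[OF e, of u] u by (simp add: tm_def)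
    ultimately have "a u = \<bar>z u\<bar>" by auto
    then show "a u = restrict w (dS R) u" using u dS_antimono[OF R] by (auto simp: w_def)
  qed simp
  show ?thesis
    unfolding x(3) x'(3) cp_eq_iff[OF x(1) x'(1) xU xU']
    using abs[OF x(2) _ t(1) z(2)] abs[OF x'(2) _ t(2) z(3)] by (intro bexI[OF _ w] conjI) auto
qed

text \<open>\<open>t\<close> is its own inverse, so the product of \<open>t\<close> and
  \<open>t'\<close> fixes \<open>y\<close>; by \<open>T2_fix_iff\<close> it is the class of the sum
  over a set of zero coordinates of \<open>y\<close>.\<close>

lemma toric_act_nearI:
  assumes t: "t \<in> carrier (T2 N)" "t' \<in> carrier (T2 N)" and y: "y \<in> topspace Y"
    and eq: "toric_act N t y = toric_act N t' y"
  shows "T2.dev.near (tau y) t t'"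
proof -
  obtain S x where x: "S \<in> complex" "x \<in> Up S" "y = cp S x" using y by (rule Y_cases)
  interpret L: lattice_basis N "bas S" by (rule lattice_basis_bas[OF x(1)])
  have yX: "y \<in> topspace X" using y Y_sub_X by auto
  let ?s = "t \<otimes>\<^bsub>T2 N\<^esub> t'"
  obtain R where R: "R \<subseteq> bas S" "?s = PT R" using T2.m_closed[OF t] unfolding L.carrier_T2 by auto
  have "toric_act N ?s y = toric_act N (t \<otimes>\<^bsub>T2 N\<^esub> t) y"
    unfolding toric_act_mult[OF t yX] toric_act_mult[OF t(1) t(1) yX] eq ..
  then have "toric_act N (PT R) y = y" using toric_act_one[OF yX] T2_square'[OF t(1)] R(2) by simp
  then have "R \<subseteq> tau y" unfolding x(3) tau_cp[OF x(1,2)] T2_fix_iff[OF x(1) Up_U[OF x(2)] R(1)] .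
  moreover have "t' = t \<otimes>\<^bsub>T2 N\<^esub> PT R"
    unfolding R(2)[symmetric] T2.m_assoc[OF t(1) t, symmetric] T2_square'[OF t(1)] using t by simp
  ultimately show ?thesis unfolding T2.dev.near_def by blast
qed

text \<open>Polar decomposition in one chart: the signs of the coordinates give \<open>t\<close>,
  their absolute values give \<open>y\<close>.\<close>

lemma toric_act_surj:
  assumes "p \<in> topspace X"
  obtains t y where "t \<in> carrier (T2 N)" "y \<in> topspace Y" "p = toric_act N t y"
proof -
  obtain S x where x: "S \<in> complex" "x \<in> U S" "p = cp S x" using assms by (rule X_cases)
  interpret L: lattice_basis N "bas S" by (rule lattice_basis_bas[OF x(1)])
  let ?R = "{b \<in> bas S. x (dv S b) < 0}" and ?a = "\<lambda>b. \<bar>x (dv S b)\<bar>"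
  have R: "?R \<subseteq> bas S" by auto
  have aU: "point_of S ?a \<in> U S" by (rule point_of_U[OF x(1)]) (use U_nonzero[OF x(1,2)] in auto)
  then have a: "point_of S ?a \<in> Up S" unfolding Up_iff[OF x(1) aU] using point_of_dv[OF x(1)] by simp
  note t = PT_closed[OF x(1) R]
  have "x = tm S (PT ?R) (point_of S ?a)"
  proof (rule U_eqI[OF x(1,2) tm_T2_U[OF t aU]])
    fix b assume b: "b \<in> bas S"
    show "x (dv S b) = tm S (PT ?R) (point_of S ?a) (dv S b)"
      using point_of_dv[OF x(1) b] L.T2_class_dual_vec[OF R b] dv_in_dS[OF x(1) b] b by (simp add: tm_def)
  qed
  then have "p = toric_act N (PT ?R) (cp S (point_of S ?a))" unfolding x(3) toric_act_T2[OF t x(1) aU] by simp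
  then show ?thesis by (rule that[OF t cp_in_Y[OF x(1) a]])
qed

text \<open>The map is a continuous bijection, and it is closed: the image of a closed set is the
  union of its parts in the chambers. There are finitely many chambers, each part is closed in the
  non-negative part and so in \<open>X\<close>, and \<open>T2\<close> acts by
  homeomorphisms.\<close>

theorem act_map_homeo: "homeomorphic_map (development N \<Delta> (T2 N) incl_morphism) X act_map"
  unfolding T2.development_eq
proof (rule bijective_closed_imp_homeomorphic_map)
  show "continuous_map T2.dev.D X act_map"
  proof (rule T2.dev.continuous_map_from_D)
    fix t assume t: "t \<in> carrier (T2 N)"
    have "continuous_map Y X (toric_act N t)"
      unfolding nonneg_part_def by (rule continuous_map_from_subtopology[OF toric_act_continuous[OF t]])
    then show "continuous_map Y X (\<lambda>y. act_map (T2.dev.cls t y))"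
      by (rule continuous_map_eq) (simp add: act_map_cls[OF t])
  qed
  show "act_map ` topspace T2.dev.D = topspace X"
  proof (intro equalityI subsetI)
    fix p assume "p \<in> act_map ` topspace T2.dev.D"
    then obtain c where c: "c \<in> topspace T2.dev.D" "p = act_map c" by (rule imageE)
    obtain t y where t: "t \<in> carrier (T2 N)" "y \<in> topspace Y" "c = T2.dev.cls t y" by (rule T2.dev.topspace_D_cases[OF c(1)])
    have "toric_act N t y \<in> topspace X"
      using continuous_map_image_subset_topspace[OF toric_act_continuous[OF t(1)]] t(2) Y_sub_X by blast
    then show "p \<in> topspace X" unfolding c(2) t(3) act_map_cls[OF t(1,2)] .
  next
    fix p assume "p \<in> topspace X"
    then obtain t y where t: "t \<in> carrier (T2 N)" "y \<in> topspace Y" "p = toric_act N t y" by (rule toric_act_surj)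
    show "p \<in> act_map ` topspace T2.dev.D"
      unfolding t(3) act_map_cls[OF t(1,2), symmetric] by (rule imageI[OF T2.dev.cls_in_D[OF t(1,2)]])
  qed
  show "inj_on act_map (topspace T2.dev.D)"
  proof (rule inj_onI)
    fix c c' assume cD: "c \<in> topspace T2.dev.D" "c' \<in> topspace T2.dev.D" and eq: "act_map c = act_map c'"
    obtain t y where c1: "t \<in> carrier (T2 N)" "y \<in> topspace Y" "c = T2.dev.cls t y" by (rule T2.dev.topspace_D_cases[OF cD(1)])
    obtain t' y' where c2: "t' \<in> carrier (T2 N)" "y' \<in> topspace Y" "c' = T2.dev.cls t' y'" by (rule T2.dev.topspace_D_cases[OF cD(2)])
    note c = c1 c2
    have e: "toric_act N t y = toric_act N t' y'" using eq unfolding c(3,6) act_map_cls[OF c(1,2)] act_map_cls[OF c(4,5)] .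
    have yy: "y = y'" by (rule toric_act_eqD[OF c(1,4,2,5) e])
    have "T2.dev.near (tau y) t t'" by (rule toric_act_nearI[OF c(1,4,2)]) (use e yy in simp)
    then show "c = c'" unfolding c(3,6) T2.dev.cls_eq_iff[OF c(1,2,4,5)] using yy by blast
  qed
  show "closed_map T2.dev.D X act_map"
    unfolding closed_map_def
  proof (intro allI impI)
    fix C assume C: "closedin T2.dev.D C"
    have eq: "act_map ` C = (\<Union>t\<in>carrier (T2 N). toric_act N t ` {y \<in> topspace Y. T2.dev.cls t y \<in> C})"
    proof (intro equalityI subsetI)
      fix p assume "p \<in> act_map ` C"
      then obtain c where c: "c \<in> C" "p = act_map c" by auto
      then have "c \<in> topspace T2.dev.D" using closedin_subset[OF C] by auto
      then obtain t y where t: "t \<in> carrier (T2 N)" "y \<in> topspace Y" "c = T2.dev.cls t y" by (rule T2.dev.topspace_D_cases)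
      have "p = toric_act N t y" using c(2) unfolding t(3) act_map_cls[OF t(1,2)] .
      moreover have "T2.dev.cls t y \<in> C" using c(1) unfolding t(3) .
      ultimately show "p \<in> (\<Union>t\<in>carrier (T2 N). toric_act N t ` {y \<in> topspace Y. T2.dev.cls t y \<in> C})"
        using t(1,2) by blast
    next
      fix p assume "p \<in> (\<Union>t\<in>carrier (T2 N). toric_act N t ` {y \<in> topspace Y. T2.dev.cls t y \<in> C})"
      then obtain t y where t: "t \<in> carrier (T2 N)" "y \<in> topspace Y" "T2.dev.cls t y \<in> C" "p = toric_act N t y" by auto
      show "p \<in> act_map ` C" unfolding t(4) act_map_cls[OF t(1,2), symmetric] by (rule imageI[OF t(3)])
    qed
    show "closedin X (act_map ` C)"
      unfolding eq
    proof (rule closedin_Union)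
      show "finite ((\<lambda>t. toric_act N t ` {y \<in> topspace Y. T2.dev.cls t y \<in> C}) ` carrier (T2 N))"
        by (rule finite_imageI[OF lattice_basis.finite_T2[OF lattice_basis_bas[OF complex_empty]]])
      fix Z assume "Z \<in> (\<lambda>t. toric_act N t ` {y \<in> topspace Y. T2.dev.cls t y \<in> C}) ` carrier (T2 N)"
      then obtain t where t: "t \<in> carrier (T2 N)" "Z = toric_act N t ` {y \<in> topspace Y. T2.dev.cls t y \<in> C}" by auto
      have "closedin Y {y \<in> topspace Y. T2.dev.cls t y \<in> C}"
        by (rule closedin_continuous_map_preimage[OF T2.dev.cls_continuous[OF t(1)] C])
      then have "closedin (subtopology X (topspace Y)) {y \<in> topspace Y. T2.dev.cls t y \<in> C}"
        by (subst Y_eq_subtopology[symmetric])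
      then have "closedin X {y \<in> topspace Y. T2.dev.cls t y \<in> C}" by (rule closedin_trans_full[OF _ closedin_Y])
      then show "closedin X Z"
        unfolding t(2) using homeomorphic_imp_closed_map[OF toric_act_homeo[OF t(1)]] unfolding closed_map_def by blast
    qed
  qed
qed

end

section \<open>The group \<open>W(\<Delta>)\<close>\<close>

text \<open>\<open>Q\<close> and \<open>Q'\<close> are homomorphisms on the group of subsets under
  symmetric difference, and a finite subset is a sum of singletons.\<close>

lemma symdiff_determined:
  fixes G (structure)
  assumes G: "group G" and S: "finite R" "R \<subseteq> S"
    and Q: "\<And>T. T \<subseteq> S \<Longrightarrow> Q T \<in> carrier G" "\<And>T T'. T \<subseteq> S \<Longrightarrow> T' \<subseteq> S \<Longrightarrow> Q T \<otimes> Q T' = Q (sym_diff T T')"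
    and Q': "\<And>T. T \<subseteq> S \<Longrightarrow> Q' T \<in> carrier G" "\<And>T T'. T \<subseteq> S \<Longrightarrow> T' \<subseteq> S \<Longrightarrow> Q' T \<otimes> Q' T' = Q' (sym_diff T T')"
    and eq: "\<And>v. v \<in> S \<Longrightarrow> Q {v} = Q' {v}"
  shows "Q R = Q' R"
  using S
proof (induction R rule: finite_induct)
  case empty
  interpret group G by fact
  have "Q {} = \<one>" using Q(2)[of "{}" "{}"] Q(1)[of "{}"] by (simp add: r_cancel_one)
  moreover have "Q' {} = \<one>" using Q'(2)[of "{}" "{}"] Q'(1)[of "{}"] by (simp add: r_cancel_one)
  ultimately show ?case by simp
next
  case (insert v R)
  have i: "insert v R = sym_diff {v} R" using insert.hyps by auto
  have "Q {v} \<otimes> Q R = Q (sym_diff {v} R)" "Q' {v} \<otimes> Q' R = Q' (sym_diff {v} R)"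
    by (rule Q(2) Q'(2); use insert.prems in auto)+
  then show ?case unfolding i using insert.IH insert.prems eq[of v] by simp
qed

context smooth_fan_locale
begin

abbreviation "W \<equiv> W_group N \<Delta>"
abbreviation "sg \<equiv> W_gen N \<Delta>"
abbreviation "wc \<equiv> word_class V (W_relators N \<Delta>)"

lemma W_is_group: "group W"
  unfolding W_group_def by (rule group_presented_group)

interpretation W: group W
  by (rule W_is_group)

lemma V_complex: "{v} \<in> complex \<longleftrightarrow> v \<in> V"
proof
  assume "v \<in> V"
  then obtain \<sigma> where s: "\<sigma> \<in> \<Delta>" "v \<in> V \<inter> \<sigma>" using V_in_cone by blast
  then have "V \<inter> \<sigma> \<in> complex" unfolding complex_def by blast
  then show "{v} \<in> complex" by (rule complex_face) (use s in auto)
qed (simp add: complex_iff)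

lemma vertices_eq: "{v. {v} \<in> complex} = V"
  by (simp add: V_complex)

lemma sg_eq: "sg v = wc [(v, True)]"
  by (simp add: W_gen_def presented_gen_eq)

lemma sg_closed: "v \<in> V \<Longrightarrow> sg v \<in> carrier W"
  unfolding W_gen_def W_group_def by (rule presented_gen_closed)

lemma W_word: "vs \<in> lists V \<Longrightarrow> lword W sg vs = wc (map (\<lambda>v. (v, True)) vs)"
  unfolding W_gen_def W_group_def by (rule lword_presented_gen)

lemma W_word_closed: "vs \<in> lists V \<Longrightarrow> lword W sg vs \<in> carrier W"
  by (rule W.lword_closed) (use sg_closed in auto)

lemma word_lists: "vs \<in> lists V \<Longrightarrow> map (\<lambda>v. (v, True)) vs \<in> lists (V \<times> UNIV)"
  by auto

lemma W_one: "\<one>\<^bsub>W\<^esub> = wc []"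
  unfolding W_group_def by (rule one_presented_group)

lemma W_square: "v \<in> V \<Longrightarrow> sg v \<otimes>\<^bsub>W\<^esub> sg v = \<one>\<^bsub>W\<^esub>"
proof -
  assume v: "v \<in> V"
  have "word_eq V (W_relators N \<Delta>) ([] @ [(v, True), (v, True)] @ []) ([] @ [])"
    by (rule word_eq.relator) (use v in \<open>auto simp: W_relators_def\<close>)
  then have e: "wc [(v, True), (v, True)] = wc []" using v word_class_eq_iff[of "[(v, True), (v, True)]" V "[]"] by simp
  have l: "[v, v] \<in> lists V" using v by simp
  have "lword W sg [v, v] = \<one>\<^bsub>W\<^esub>" unfolding W_word[OF l] W_one e[symmetric] by simp
  then show ?thesis using sg_closed[OF v] by simp
qed

lemma W_commute:
  assumes vw: "{v, w} \<in> complex"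
  shows "sg v \<otimes>\<^bsub>W\<^esub> sg w = sg w \<otimes>\<^bsub>W\<^esub> sg v"
proof -
  have v: "v \<in> V" "w \<in> V" "convex_cone hull {v, w} \<in> \<Delta>" using vw by (auto simp: complex_iff)
  have "word_eq V (W_relators N \<Delta>) ([] @ [(v, True), (w, True), (v, True), (w, True)] @ []) ([] @ [])"
    by (rule word_eq.relator) (use v in \<open>auto simp: W_relators_def\<close>)
  then have e: "wc [(v, True), (w, True), (v, True), (w, True)] = wc []"
    using v word_class_eq_iff[of "[(v, True), (w, True), (v, True), (w, True)]" V "[]"] by simp
  have l: "[v, w, v, w] \<in> lists V" using v by simp
  have "lword W sg [v, w, v, w] = \<one>\<^bsub>W\<^esub>" unfolding W_word[OF l] W_one e[symmetric] by simp
  then have "(sg v \<otimes>\<^bsub>W\<^esub> sg w) \<otimes>\<^bsub>W\<^esub> (sg v \<otimes>\<^bsub>W\<^esub> sg w) = \<one>\<^bsub>W\<^esub>" using sg_closed v by (simp add: W.m_assoc)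
  then have "inv\<^bsub>W\<^esub> (sg v \<otimes>\<^bsub>W\<^esub> sg w) = sg v \<otimes>\<^bsub>W\<^esub> sg w" using sg_closed v by (intro W.inv_equality) auto
  moreover have "inv\<^bsub>W\<^esub> (sg v) = sg v" by (rule W.inv_equality) (simp_all add: W_square sg_closed v)
  moreover have "inv\<^bsub>W\<^esub> (sg w) = sg w" by (rule W.inv_equality) (simp_all add: W_square sg_closed v)
  ultimately show ?thesis using W.inv_mult_group[of "sg v" "sg w"] sg_closed v by simp
qed

lemma W_generated:
  assumes g: "g \<in> carrier W"
  shows "\<exists>vs\<in>lists V. g = lword W sg vs"
proof -
  obtain w where w: "w \<in> lists (V \<times> UNIV)" "g = wc w" using g unfolding W_group_def carrier_presented_group by blast
  have "\<exists>vs\<in>lists V. wc w = lword W sg vs"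
    using w(1)
  proof (induction w rule: list.induct)
    case Nil
    have "wc [] = lword W sg []" using W_word[of "[]"] by simp
    then show ?case by (intro bexI[of _ "[]"]) auto
  next
    case (Cons a w)
    obtain v e where a: "a = (v, e)" by (cases a)
    have v: "v \<in> V" and wl: "w \<in> lists (V \<times> UNIV)" using Cons.prems a by auto
    obtain vs where vs: "vs \<in> lists V" "wc w = lword W sg vs" using Cons.IH wl by auto
    have "wc [(v, e)] = sg v"
    proof (cases e)
      case False
      have "wc [(v, True)] \<otimes>\<^bsub>W\<^esub> wc [(v, False)] = wc [(v, True), (v, False)]"
        using mult_presented_group[of "[(v, True)]" V "[(v, False)]" "W_relators N \<Delta>"] v by (simp add: W_group_def)
      also have "\<dots> = wc []"
        using word_class_eq_iff[of "[(v, True), (v, False)]" V "[]"] word_eq.cancel[of "[]" V "[]" v "W_relators N \<Delta>" True] v by simp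
      also have "\<dots> = \<one>\<^bsub>W\<^esub>" by (simp only: W_one)
      finally have 1: "sg v \<otimes>\<^bsub>W\<^esub> wc [(v, False)] = \<one>\<^bsub>W\<^esub>" by (simp add: sg_eq)
      have c: "wc [(v, False)] \<in> carrier W" using v unfolding W_group_def carrier_presented_group by auto
      have "wc [(v, False)] = sg v"
        using W.Units_l_cancel[of "sg v" "wc [(v, False)]" "sg v"] 1 W_square[OF v] c sg_closed[OF v] by (simp add: W.Units_eq)
      then show ?thesis using False by simp
    qed (simp add: sg_eq)
    moreover have "wc (a # w) = wc [(v, e)] \<otimes>\<^bsub>W\<^esub> wc w"
      using mult_presented_group[of "[(v, e)]" V w "W_relators N \<Delta>"] v wl by (simp add: W_group_def a)
    ultimately have "wc (a # w) = lword W sg (v # vs)" using vs(2) by simp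
    then show ?case using v vs(1) by (intro bexI[of _ "v # vs"]) auto
  qed
  then show ?thesis using w(2) by simp
qed

text \<open>Forgetting signs turns a cancellation into the deletion of a square and each relator
  into one of the two moves on wall words. This ties the presentation of \<open>W\<close> to
  homotopies of paths.\<close>

lemma word_eq_cox:
  "word_eq V (W_relators N \<Delta>) u w \<Longrightarrow> cox_eq complex (map fst u) (map fst w)"
proof (induction rule: word_eq.induct)
  case (refl w)
  then show ?case by (intro cox_eq.refl) (force simp: V_complex)
next
  case (sym v w)
  show ?case by (rule cox_eq.sym[OF sym.IH])
next
  case (trans u v w)
  show ?case by (rule cox_eq.trans[OF trans.IH])
next
  case (cancel u v a e)
  have "cox_eq complex (map fst u @ [a, a] @ map fst v) (map fst u @ map fst v)"
    by (rule cox_eq.square) (use cancel in \<open>force simp: V_complex\<close>)+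
  then show ?case by simp
next
  case (relator u v r)
  have l: "map fst u \<in> lists {v. {v} \<in> complex}" "map fst v \<in> lists {v. {v} \<in> complex}"
    using relator(1,2) by (force simp: V_complex)+
  consider a where "a \<in> V" "r = [(a, True), (a, True)]"
    | a b where "{a, b} \<in> complex" "r = [(a, True), (b, True), (a, True), (b, True)]"
    using relator(3) unfolding W_relators_def by (auto simp: complex_iff)
  then show ?case
  proof cases
    case 1
    then show ?thesis using cox_eq.square[OF l, of a] by (simp add: V_complex)
  next
    case 2
    then show ?thesis using cox_eq.commute[OF l, of a b] by simp
  qed
qed

lemma W_cox:
  assumes l: "u \<in> lists V" "w \<in> lists V" and eq: "lword W sg u = lword W sg w"
  shows "cox_eq complex u w"
proof -
  have "word_eq V (W_relators N \<Delta>) (map (\<lambda>v. (v, True)) u) (map (\<lambda>v. (v, True)) w)"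
    using eq unfolding W_word[OF l(1)] W_word[OF l(2)] word_class_eq_iff[OF word_lists[OF l(1)] word_lists[OF l(2)]] .
  then show ?thesis using word_eq_cox by (fastforce simp: comp_def)
qed

lemma W_hom_unique:
  assumes G: "group G" and f: "f \<in> hom W G" "f \<in> extensional (carrier W)" and g: "g \<in> hom W G" "g \<in> extensional (carrier W)"
    and eq: "\<And>v. v \<in> V \<Longrightarrow> f (sg v) = g (sg v)"
  shows "f = g"
proof (rule extensionalityI[OF f(2) g(2)])
  fix w assume "w \<in> carrier W"
  then obtain vs where vs: "vs \<in> lists V" "w = lword W sg vs" using W_generated by blast
  have c: "sg ` set vs \<subseteq> carrier W" using vs(1) sg_closed by auto
  have "lword G (f \<circ> sg) vs = lword G (g \<circ> sg) vs"
    using vs(1) by (induction vs) (auto simp: lword_def eq)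
  then show "f w = g w" unfolding vs(2) lword_hom[OF W_is_group G f(1) c] lword_hom[OF W_is_group G g(1) c] .
qed

lemma W_universal:
  assumes G: "group G" and f: "\<And>v. v \<in> V \<Longrightarrow> f v \<in> carrier G" and sq: "\<And>v. v \<in> V \<Longrightarrow> f v \<otimes>\<^bsub>G\<^esub> f v = \<one>\<^bsub>G\<^esub>"
    and com: "\<And>v w. {v, w} \<in> complex \<Longrightarrow> f v \<otimes>\<^bsub>G\<^esub> f w = f w \<otimes>\<^bsub>G\<^esub> f v"
  shows "\<exists>h. h \<in> hom W G \<and> h \<in> extensional (carrier W) \<and> (\<forall>v\<in>V. h (sg v) = f v)"
proof (rule presented_group_universal[OF G, of f V "W_relators N \<Delta>"])
  interpret G: group G by fact
  fix r assume "r \<in> W_relators N \<Delta>"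
  then consider a where "a \<in> V" "r = [(a, True), (a, True)]"
    | a b where "{a, b} \<in> complex" "r = [(a, True), (b, True), (a, True), (b, True)]"
    unfolding W_relators_def by (auto simp: complex_iff)
  then show "signed_word G f r = \<one>\<^bsub>G\<^esub>"
  proof cases
    case 1
    then show ?thesis using f sq by (simp add: signed_word_def)
  next
    case 2
    then have ab: "a \<in> V" "b \<in> V" by (auto simp: complex_iff)
    have "f a \<otimes>\<^bsub>G\<^esub> (f b \<otimes>\<^bsub>G\<^esub> (f a \<otimes>\<^bsub>G\<^esub> f b)) = f a \<otimes>\<^bsub>G\<^esub> (f b \<otimes>\<^bsub>G\<^esub> (f b \<otimes>\<^bsub>G\<^esub> f a))"
      by (simp only: com[OF 2(1)])
    also have "\<dots> = f a \<otimes>\<^bsub>G\<^esub> (f b \<otimes>\<^bsub>G\<^esub> f b \<otimes>\<^bsub>G\<^esub> f a)" using f ab by (simp add: G.m_assoc)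
    also have "\<dots> = \<one>\<^bsub>G\<^esub>" using f sq ab by simp
    finally show ?thesis using f ab 2(2) by (simp add: signed_word_def)
  qed
next
  show "\<exists>h. h \<in> hom W G \<and> h \<in> extensional (carrier W) \<and> (\<forall>v\<in>V. h (sg v) = f v)"
    if "h \<in> hom (presented_group V (W_relators N \<Delta>)) G" "h \<in> extensional (carrier (presented_group V (W_relators N \<Delta>)))"
      "\<And>a. a \<in> V \<Longrightarrow> h (presented_gen V (W_relators N \<Delta>) a) = f a" for h
    using that unfolding W_group_def W_gen_def by blast
qed (use f in auto)

text \<open>The enumeration of \<open>T\<close> is arbitrary. If \<open>T\<close> is a face its
  generators commute, so the product does not depend on the order.\<close>

definition PW :: "'a set \<Rightarrow> 'a word set" where
  "PW T = lword W sg (SOME vs. distinct vs \<and> set vs = T)"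

lemma PW_face:
  assumes S: "S \<in> complex"
  shows "T \<subseteq> S \<Longrightarrow> PW T \<in> carrier W" "T \<subseteq> S \<Longrightarrow> T' \<subseteq> S \<Longrightarrow> PW T \<otimes>\<^bsub>W\<^esub> PW T' = PW (sym_diff T T')"
    "v \<in> S \<Longrightarrow> PW {v} = sg v"
proof -
  have SV: "S \<subseteq> V" using S by (simp add: complex_iff)
  have com: "sg v \<otimes>\<^bsub>W\<^esub> sg w = sg w \<otimes>\<^bsub>W\<^esub> sg v" if "v \<in> S" "w \<in> S" for v w
    by (rule W_commute, rule complex_face[OF S]) (use that in auto)
  have cl: "sg v \<in> carrier W" and sq: "sg v \<otimes>\<^bsub>W\<^esub> sg v = \<one>\<^bsub>W\<^esub>" if "v \<in> S" for v
    using sg_closed W_square subsetD[OF SV that] by simp_all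
  note ex = commuting_involutions[where f = sg and S = S, OF W_is_group complex_finite[OF S]]
  obtain P where P: "\<forall>T\<subseteq>S. P T \<in> carrier W" "P {} = \<one>\<^bsub>W\<^esub>" "\<forall>v\<in>S. P {v} = sg v"
      "\<forall>T\<subseteq>S. \<forall>T'\<subseteq>S. P T \<otimes>\<^bsub>W\<^esub> P T' = P (sym_diff T T')"
    and "\<forall>T\<subseteq>S. \<forall>c\<in>carrier W. (\<forall>v\<in>S. c \<otimes>\<^bsub>W\<^esub> sg v = sg v \<otimes>\<^bsub>W\<^esub> c) \<longrightarrow> c \<otimes>\<^bsub>W\<^esub> P T = P T \<otimes>\<^bsub>W\<^esub> c"
    by (rule exE[OF ex[OF cl sq com]]; (elim conjE)?)
  have "lword W sg vs = P (set vs)" if "distinct vs" "set vs \<subseteq> S" for vs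
    using that
  proof (induction vs)
    case Nil
    then show ?case using P(2) by simp
  next
    case (Cons v vs)
    have "P {v} \<otimes>\<^bsub>W\<^esub> P (set vs) = P (sym_diff {v} (set vs))"
      by (rule P(4)[rule_format]) (use Cons.prems in auto)
    moreover have "sym_diff {v} (set vs) = set (v # vs)" using Cons.prems by auto
    ultimately show ?case using Cons P(3) by simp
  qed
  moreover have "distinct (SOME vs. distinct vs \<and> set vs = T) \<and> set (SOME vs. distinct vs \<and> set vs = T) = T" if "T \<subseteq> S" for T
    by (rule someI_ex) (use finite_distinct_list[OF finite_subset[OF that complex_finite[OF S]]] in blast)
  ultimately have eq: "PW T = P T" if "T \<subseteq> S" for T unfolding PW_def using that by simp
  show "T \<subseteq> S \<Longrightarrow> PW T \<in> carrier W" using P(1) eq by simp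
  show "v \<in> S \<Longrightarrow> PW {v} = sg v" using P(3) eq[of "{v}"] by simp
  show "PW T \<otimes>\<^bsub>W\<^esub> PW T' = PW (sym_diff T T')" if "T \<subseteq> S" "T' \<subseteq> S"
  proof -
    have "sym_diff T T' \<subseteq> S" using that by auto
    then show ?thesis using P(4) eq that by simp
  qed
qed

lemma PW_vertex: "v \<in> V \<Longrightarrow> PW {v} = sg v"
  by (rule PW_face(3)[of "{v}"]) (simp_all add: V_complex)

lemma hom_PW:
  assumes G: "group G" and h: "h \<in> hom W G" and S: "S \<in> complex"
    and Q: "\<And>T. T \<subseteq> S \<Longrightarrow> Q T \<in> carrier G" "\<And>T T'. T \<subseteq> S \<Longrightarrow> T' \<subseteq> S \<Longrightarrow> Q T \<otimes>\<^bsub>G\<^esub> Q T' = Q (sym_diff T T')"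
    and eq: "\<And>v. v \<in> S \<Longrightarrow> h (sg v) = Q {v}" and R: "R \<subseteq> S"
  shows "h (PW R) = Q R"
proof (rule symdiff_determined[OF G finite_subset[OF R complex_finite[OF S]] R _ _ Q])
  show "h (PW T) \<in> carrier G" if "T \<subseteq> S" for T by (rule hom_in_carrier[OF h PW_face(1)[OF S that]])
  show "h (PW T) \<otimes>\<^bsub>G\<^esub> h (PW T') = h (PW (sym_diff T T'))" if "T \<subseteq> S" "T' \<subseteq> S" for T T'
    unfolding PW_face(2)[OF S that, symmetric] by (rule hom_mult[OF h PW_face(1)[OF S that(1)] PW_face(1)[OF S that(2)], symmetric])
  show "h (PW {v}) = Q {v}" if "v \<in> S" for v unfolding PW_face(3)[OF S that] by (rule eq[OF that])
qed

lemma hom_local: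
  assumes G: "group G" and f: "f \<in> hom (local_group N \<Delta> (cn S)) G" and S: "S \<in> complex"
    and Q: "\<And>T. T \<subseteq> S \<Longrightarrow> Q T \<in> carrier G" "\<And>T T'. T \<subseteq> S \<Longrightarrow> T' \<subseteq> S \<Longrightarrow> Q T \<otimes>\<^bsub>G\<^esub> Q T' = Q (sym_diff T T')"
    and eq: "\<And>v. v \<in> S \<Longrightarrow> f (T2_class N v) = Q {v}" and R: "R \<subseteq> S"
  shows "f (PT R) = Q R"
proof (rule symdiff_determined[OF G finite_subset[OF R complex_finite[OF S]] R _ _ Q])
  have c: "PT T \<in> carrier (local_group N \<Delta> (cn S))" if "T \<subseteq> S" for T
    unfolding carrier_local_group[OF S] using that by blast
  show "f (PT T) \<in> carrier G" if "T \<subseteq> S" for T by (rule hom_in_carrier[OF f c[OF that]])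
  show "f (PT T) \<otimes>\<^bsub>G\<^esub> f (PT T') = f (PT (sym_diff T T'))" if "T \<subseteq> S" "T' \<subseteq> S" for T T'
    using hom_mult[OF f c[OF that(1)] c[OF that(2)]] by (simp only: local_group_mult local_group_symdiff[OF S that])
  show "f (PT {v}) = Q {v}" if "v \<in> S" for v using eq[OF that] by simp
qed

lemma PT_inj: "S \<in> complex \<Longrightarrow> inj_on (\<lambda>R. PT R) (Pow S)"
  using fan_development.P_inj[OF T2_development] .

text \<open>Resolves the definite description in \<open>iota\<close>: the elements of the local
  group are the classes of sums over subsets of \<open>S\<close>, and sending the one for
  \<open>T\<close> to \<open>PW T\<close> is the only homomorphism with the prescribed values on the
  vertices.\<close>

lemma iota_PT:
  assumes S: "S \<in> complex" and R: "R \<subseteq> S"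
  shows "iota N \<Delta> (cn S) (PT R) = PW R"
proof -
  let ?L = "local_group N \<Delta> (cn S)"
  let ?f = "\<lambda>g\<in>carrier ?L. PW (inv_into (Pow S) (\<lambda>R. PT R) g)"
  have VS: "V \<inter> cn S = S" using complex_cone[OF S] by simp
  have c: "PT T \<in> carrier ?L" if "T \<subseteq> S" for T unfolding carrier_local_group[OF S] using that by blast
  have f: "?f (PT T) = PW T" if "T \<subseteq> S" for T
    using c[OF that] inv_into_f_f[OF PT_inj[OF S], of T] that by simp
  have hom: "?f \<in> hom ?L W"
  proof (rule homI)
    fix g assume "g \<in> carrier ?L"
    then obtain T where T: "T \<subseteq> S" "g = PT T" unfolding carrier_local_group[OF S] by blast
    show "?f g \<in> carrier W" unfolding T(2) f[OF T(1)] by (rule PW_face(1)[OF S T(1)])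
  next
    fix g g' assume "g \<in> carrier ?L" "g' \<in> carrier ?L"
    then obtain T T' where T: "T \<subseteq> S" "g = PT T" "T' \<subseteq> S" "g' = PT T'" unfolding carrier_local_group[OF S] by blast
    have sd: "sym_diff T T' \<subseteq> S" using T by auto
    show "?f (g \<otimes>\<^bsub>?L\<^esub> g') = ?f g \<otimes>\<^bsub>W\<^esub> ?f g'"
      unfolding local_group_mult T(2,4) local_group_symdiff[OF S T(1,3)] f[OF sd] f[OF T(1)] f[OF T(3)]
      by (rule PW_face(2)[OF S T(1,3), symmetric])
  qed
  have val: "?f (T2_class N v) = sg v" if "v \<in> S" for v using f[of "{v}"] PW_face(3)[OF S that] that by simp
  have "?f = iota N \<Delta> (cn S)"
    unfolding iota_def VS
  proof (rule the_equality[symmetric])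
    show "?f \<in> hom ?L W \<and> ?f \<in> extensional (carrier ?L) \<and> (\<forall>v\<in>S. ?f (T2_class N v) = sg v)"
      using hom val by auto
    fix f' assume f': "f' \<in> hom ?L W \<and> f' \<in> extensional (carrier ?L) \<and> (\<forall>v\<in>S. f' (T2_class N v) = sg v)"
    show "f' = ?f"
    proof (rule extensionalityI[of _ "carrier ?L"])
      fix g assume "g \<in> carrier ?L"
      then obtain T where T: "T \<subseteq> S" "g = PT T" unfolding carrier_local_group[OF S] by blast
      show "f' g = ?f g" unfolding T(2) f[OF T(1)]
        by (rule hom_local[OF W_is_group _ S PW_face(1,2)[OF S] _ T(1)]) (use f' PW_face(3)[OF S] in auto)
    qed (use f' in auto)
  qed
  then show ?thesis using f[OF R] by simp
qed

lemma T2_is_comm_group: "comm_group (T2 N)"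
  by (rule lattice_basis.T2_comm_group[OF lattice_basis_bas[OF complex_empty]])

lemma T2_class_V: "v \<in> V \<Longrightarrow> T2_class N v \<in> carrier (T2 N)"
proof -
  assume "v \<in> V"
  then have v: "{v} \<in> complex" by (simp add: V_complex)
  show ?thesis using PT_closed[OF v bas(2)[OF v]] by simp
qed

lemma T2_projection:
  obtains h where "h \<in> hom W (T2 N)" "h \<in> extensional (carrier W)" "\<forall>v\<in>V. h (sg v) = T2_class N v"
proof -
  interpret T: comm_group "T2 N" by (rule T2_is_comm_group)
  have "\<exists>h. h \<in> hom W (T2 N) \<and> h \<in> extensional (carrier W) \<and> (\<forall>v\<in>V. h (sg v) = T2_class N v)"
  proof (rule W_universal[OF T2_is_group])
    show "T2_class N v \<otimes>\<^bsub>T2 N\<^esub> T2_class N w = T2_class N w \<otimes>\<^bsub>T2 N\<^esub> T2_class N v" if "{v, w} \<in> complex" for v w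
      by (rule T.m_comm) (use that T2_class_V in \<open>auto simp: complex_iff\<close>)
  qed (use T2_class_V T2_square' in auto)
  then show thesis using that by blast
qed

lemma hom_PW_T2:
  assumes h: "h \<in> hom W (T2 N)" "\<And>v. v \<in> V \<Longrightarrow> h (sg v) = T2_class N v" and S: "S \<in> complex" and R: "R \<subseteq> S"
  shows "h (PW R) = PT R"
proof (rule hom_PW[OF T2_is_group h(1) S _ _ _ R])
  show "PT T \<in> carrier (T2 N)" if "T \<subseteq> S" for T by (rule PT_closed[OF S]) (use that bas(2)[OF S] in auto)
  show "PT T \<otimes>\<^bsub>T2 N\<^esub> PT T' = PT (sym_diff T T')" if "T \<subseteq> S" "T' \<subseteq> S" for T T' by (rule local_group_symdiff[OF S that])
  show "h (sg v) = PT {v}" if "v \<in> S" for v using h(2)[of v] S that by (auto simp: complex_iff)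
qed

text \<open>That faces embed in \<open>W\<close> is not visible in the presentation. The projection
  to \<open>T2\<close> sends \<open>PW R\<close> to \<open>PT R\<close>, and different subsets of a
  lattice basis have different classes there; this works whether or not \<open>X\<close> is
  connected.\<close>

lemma PW_inj:
  assumes S: "S \<in> complex"
  shows "inj_on PW (Pow S)"
proof (rule inj_onI)
  fix R R' assume R: "R \<in> Pow S" "R' \<in> Pow S" "PW R = PW R'"
  obtain h where h: "h \<in> hom W (T2 N)" "h \<in> extensional (carrier W)" "\<forall>v\<in>V. h (sg v) = T2_class N v" by (rule T2_projection)
  have "PT R = PT R'" using hom_PW_T2[OF h(1) bspec[OF h(3)] S, of R] hom_PW_T2[OF h(1) bspec[OF h(3)] S, of R'] R by simp
  then show "R = R'" using inj_onD[OF PT_inj[OF S]] R(1,2) by blast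
qed

lemma W_development: "fan_development N \<Delta> W PW (iota N \<Delta>)"
  by (intro fan_development.intro fan_development_axioms.intro smooth_fan_locale_axioms W_is_group
      PW_face(1)[OF _ order_refl] PW_face(2) PW_inj iota_PT)

end

text \<open>Identifies the canonical map with any concrete homomorphism that has the right values on
  generators. For uniqueness, the value at the generator of \<open>v\<close> is reached through the
  local group of the ray of \<open>v\<close>.\<close>

lemma (in fan_development) induced_hom_eq:
  assumes h: "h \<in> hom W G" "h \<in> extensional (carrier W)" "\<And>v. v \<in> V \<Longrightarrow> h (sg v) = P {v}"
  shows "induced_hom N \<Delta> G \<phi> = h"
  unfolding induced_hom_def
proof (rule the_equality)
  have "h (iota N \<Delta> \<tau> g) = \<phi> \<tau> g" if t: "\<tau> \<in> \<Delta>" and g: "g \<in> carrier (local_group N \<Delta> \<tau>)" for \<tau> g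
  proof -
    obtain T where T: "T \<in> complex" "\<tau> = cn T" using t by (rule Delta_cases)
    obtain R where R: "R \<subseteq> T" "g = PT R" using g unfolding T(2) carrier_local_group[OF T(1)] by blast
    show ?thesis unfolding R(2) T(2) iota_PT[OF T(1) R(1)] phi[OF T(1) R(1)]
      by (rule hom_PW[OF group_axioms h(1) T(1) _ P_mult[OF T(1)] _ R(1)])
        (use P_closed complex_face[OF T(1)] h(3) T(1) in \<open>auto simp: complex_iff\<close>)
  qed
  then show "h \<in> hom W G \<and> h \<in> extensional (carrier W) \<and>
      (\<forall>\<tau>\<in>\<Delta>. \<forall>g\<in>carrier (local_group N \<Delta> \<tau>). h (iota N \<Delta> \<tau> g) = \<phi> \<tau> g)" using h by blast
  fix f assume f: "f \<in> hom W G \<and> f \<in> extensional (carrier W) \<and>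
      (\<forall>\<tau>\<in>\<Delta>. \<forall>g\<in>carrier (local_group N \<Delta> \<tau>). f (iota N \<Delta> \<tau> g) = \<phi> \<tau> g)"
  show "f = h"
  proof (rule W_hom_unique[OF group_axioms])
    fix v assume v: "v \<in> V"
    then have vc: "{v} \<in> complex" by (simp add: V_complex)
    have "PT {v} \<in> carrier (local_group N \<Delta> (cn {v}))" unfolding carrier_local_group[OF vc] by blast
    then have "f (iota N \<Delta> (cn {v}) (PT {v})) = \<phi> (cn {v}) (PT {v})" using f cone_in_Delta[OF vc] by blast
    then have "f (sg v) = P {v}" unfolding iota_PT[OF vc order_refl] phi[OF vc order_refl] PW_vertex[OF v] .
    then show "f (sg v) = h (sg v)" using h(3)[OF v] by simp
  qed (use f h in auto)
qed

section \<open>Coverings between developments\<close>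

lemma trivial_fundamental_group:
  assumes x: "x \<in> topspace X" and p: "\<And>p. p \<in> loops X x \<Longrightarrow> path_hom X p (\<lambda>_. x)"
  shows "trivial_group (fundamental_group X x)"
proof -
  have c: "(\<lambda>_. x) \<in> loops X x" using x by (simp add: loops_def pathin_def)
  have R: "loop_homotopy X x = loops X x \<times> loops X x"
  proof -
    have "path_hom X a b" if "a \<in> loops X x" "b \<in> loops X x" for a b
      by (rule path_hom_trans[OF p[OF that(1)] path_hom_sym[OF p[OF that(2)]]])
    then show ?thesis by (auto simp: loop_homotopy_iff)
  qed
  have car: "carrier (fundamental_group X x) = {loops X x}"
    unfolding fundamental_group_def R using c by (auto simp: quotient_def)
  have one: "\<one>\<^bsub>fundamental_group X x\<^esub> = loops X x"
    unfolding fundamental_group_def R using c by auto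
  have mult: "loops X x \<otimes>\<^bsub>fundamental_group X x\<^esub> loops X x = loops X x"
    unfolding fundamental_group_def R using loops_concat[OF c c] by (auto intro!: bexI[OF _ c])
  have "group (fundamental_group X x)"
    by (rule groupI) (simp_all add: car one mult)
  then show ?thesis by (simp add: trivial_group_def car one)
qed

text \<open>As \<open>k\<close> is injective, lying over the same point means the same before and
  after applying it. The two groups are equal, not only isomorphic.\<close>

lemma deck_group_compose:
  assumes "inj_on k (topspace X)" "p ` topspace E \<subseteq> topspace X"
  shows "deck_group E (k \<circ> p) = deck_group E p"
proof -
  have "k (p (f e)) = k (p e) \<longleftrightarrow> p (f e) = p e" if "homeomorphic_map E E f" "e \<in> topspace E" for f e
  proof (rule inj_on_eq_iff[OF assms(1)])
    have "f e \<in> topspace E" using homeomorphic_imp_surjective_map[OF that(1)] that(2) by blast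
    then show "p (f e) \<in> topspace X" "p e \<in> topspace X" using assms(2) that(2) by auto
  qed
  then show ?thesis by (auto simp: deck_group_def)
qed

text \<open>A preimage under \<open>h\<close> is chosen; two preimages differ by an element of the
  kernel of \<open>h\<close>, on which \<open>g\<close> is trivial.\<close>

lemma factor_hom:
  assumes W: "group W" and A: "group A" and B: "group B" and h: "h \<in> hom W A" "h ` carrier W = carrier A"
    and g: "g \<in> hom W B" and k: "kernel W A h \<subseteq> kernel W B g"
  obtains f where "f \<in> hom A B" "\<forall>w\<in>carrier W. f (h w) = g w"
proof -
  interpret h: group_hom W A h using W A h by (simp add: group_hom_def group_hom_axioms_def)
  interpret g: group_hom W B g using W B g by (simp add: group_hom_def group_hom_axioms_def)
  define f where "f x = g (inv_into (carrier W) h x)" for x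
  have f: "f (h w) = g w" if w: "w \<in> carrier W" for w
  proof -
    let ?w = "inv_into (carrier W) h (h w)"
    have w': "?w \<in> carrier W" "h ?w = h w" using w by (auto intro: inv_into_into f_inv_into_f)
    have "?w \<otimes>\<^bsub>W\<^esub> inv\<^bsub>W\<^esub> w \<in> kernel W A h" using w w' by (simp add: kernel_def)
    then have "g (?w \<otimes>\<^bsub>W\<^esub> inv\<^bsub>W\<^esub> w) = \<one>\<^bsub>B\<^esub>" using k by (auto simp: kernel_def)
    then have "g ?w \<otimes>\<^bsub>B\<^esub> inv\<^bsub>B\<^esub> g w = \<one>\<^bsub>B\<^esub>" using w w' by simp
    then have "g ?w = g w" using g.H.inv_solve_right[of "\<one>\<^bsub>B\<^esub>" "g ?w" "g w"] w w' by simp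
    then show ?thesis by (simp add: f_def)
  qed
  show thesis
  proof (rule that)
    show "f \<in> hom A B"
    proof (rule homI)
      fix x assume "x \<in> carrier A"
      then obtain w where "w \<in> carrier W" "x = h w" using h(2) by blast
      then show "f x \<in> carrier B" using f by simp
    next
      fix x y assume "x \<in> carrier A" "y \<in> carrier A"
      then obtain v w where v: "v \<in> carrier W" "x = h v" and w: "w \<in> carrier W" "y = h w" using h(2) by blast
      have "f (h (v \<otimes>\<^bsub>W\<^esub> w)) = g v \<otimes>\<^bsub>B\<^esub> g w" using v(1) w(1) by (simp add: f del: h.hom_mult)
      then show "f (x \<otimes>\<^bsub>A\<^esub> y) = f x \<otimes>\<^bsub>B\<^esub> f y" using f v w by simp
    qed
  qed (use f in blast)
qed

text \<open>A development whose group is a quotient of \<open>W\<close> with matching generators.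
  The development of \<open>W\<close> covers it, and the kernel of \<open>h\<close> is its
  fundamental group. The instances are \<open>T2\<close>, \<open>W\<close> itself and the
  abelianisation.\<close>

locale fan_quotient = fan_development N \<Delta> G P \<phi>
  for N :: "'a::real_vector set" and \<Delta> and G :: "('g, 'm) monoid_scheme" (structure) and P and \<phi> +
  fixes h :: "'a word set \<Rightarrow> 'g"
  assumes h_hom: "h \<in> hom (W_group N \<Delta>) G" and h_surj: "h ` carrier (W_group N \<Delta>) = carrier G"
    and h_gen: "v \<in> primitive_vectors N \<Delta> \<Longrightarrow> h (W_gen N \<Delta> v) = P {v}"
begin

sublocale Wd: fan_development N \<Delta> "W_group N \<Delta>" PW "iota N \<Delta>"
  by (rule W_development)

lemma h_PW:
  assumes S: "S \<in> complex"
  shows "h (PW S) = P S"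
proof (rule hom_PW[OF group_axioms h_hom S _ P_mult[OF S] _ order_refl])
  show "P T \<in> carrier G" if "T \<subseteq> S" for T by (rule P_closed[OF complex_face[OF S that]])
  show "h (sg v) = P {v}" if "v \<in> S" for v by (rule h_gen) (use S that in \<open>auto simp: complex_iff\<close>)
qed

sublocale q: development_morphism "nonneg_part N \<Delta>" complex tau bas corner_chart "W_group N \<Delta>" PW G P h
  by (intro development_morphism.intro development_morphism_axioms.intro Wd.dev.development_space_axioms
      dev.development_space_axioms h_hom h_surj h_PW)

lemma W_ev: "vs \<in> lists V \<Longrightarrow> Wd.dev.ev vs = lword W sg vs"
  unfolding Wd.dev.ev_def lword_def by (induction vs rule: list.induct) (auto simp: PW_vertex)

lemma gen:
  assumes "g \<in> carrier W"
  shows "\<exists>w\<in>lists {v. {v} \<in> complex}. g = Wd.dev.ev w"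
proof -
  obtain vs where vs: "vs \<in> lists V" "g = lword W sg vs" using W_generated[OF assms] by (elim bexE)
  show ?thesis unfolding vertices_eq by (rule bexI[OF _ vs(1)]) (simp only: W_ev[OF vs(1)] vs(2))
qed

lemma pres:
  "u \<in> lists {v. {v} \<in> complex} \<Longrightarrow> w \<in> lists {v. {v} \<in> complex} \<Longrightarrow> Wd.dev.ev u = Wd.dev.ev w \<Longrightarrow> cox_eq complex u w"
  unfolding vertices_eq by (rule W_cox) (simp_all add: W_ev)

lemma path_connected: "path_connected_space (development N \<Delta> G \<phi>)"
  unfolding development_eq by (rule dev.path_connected_D[OF q.cod_generated[OF gen]])

lemma covering_W: "covering_map (development N \<Delta> W (iota N \<Delta>)) (development N \<Delta> G \<phi>) q.pmap"
  unfolding development_eq Wd.development_eq by (rule q.covering)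

lemma has_pi1:
  "y \<in> topspace (development N \<Delta> G \<phi>) \<Longrightarrow> \<exists>L. has_pi1 (development N \<Delta> G \<phi>) y (W\<lparr>carrier := kernel W G h\<rparr>) L"
  unfolding development_eq by (rule q.pi1[OF gen pres])

lemma kernel_group: "group (W\<lparr>carrier := kernel W G h\<rparr>)"
  by (rule group.subgroup_imp_group[OF W_is_group q.f.subgroup_kernel])

end

section \<open>Connectedness, the universal cover and the fundamental group of the toric
  variety\<close>

context smooth_fan_locale
begin

lemma V_sub_N: "V \<subseteq> N"
proof
  fix v assume "v \<in> V"
  then have v: "{v} \<in> complex" by (simp add: V_complex)
  show "v \<in> N" by (rule lattice_basis.B_in_N[OF lattice_basis_bas[OF v]]) (use bas(2)[OF v] in auto)
qed

interpretation T2: fan_development N \<Delta> "T2 N" "\<lambda>R. PT R" incl_morphism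
  by (rule T2_development)

lemma T2_ev: "T2.dev.ev w = lword (T2 N) (T2_class N) w"
  by (simp add: T2.dev.ev_def)

lemma X_homeomorphic: "development N \<Delta> (T2 N) incl_morphism homeomorphic_space X"
  by (rule homeomorphic_map_imp_homeomorphic_space[OF act_map_homeo])

lemma connected_iff_generated:
  "connected_space X \<longleftrightarrow> (\<forall>t\<in>carrier (T2 N). \<exists>vs\<in>lists V. t = lword (T2 N) (T2_class N) vs)"
proof -
  have "connected_space T2.dev.D \<longleftrightarrow> (\<forall>t\<in>carrier (T2 N). \<exists>vs\<in>lists V. t = T2.dev.ev vs)"
  proof
    assume c: "connected_space T2.dev.D"
    show "\<forall>t\<in>carrier (T2 N). \<exists>vs\<in>lists V. t = T2.dev.ev vs"
      using T2.dev.connected_D_imp_generated[OF c] unfolding vertices_eq by blast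
  next
    assume *: "\<forall>t\<in>carrier (T2 N). \<exists>vs\<in>lists V. t = T2.dev.ev vs"
    have "path_connected_space T2.dev.D"
      by (rule T2.dev.path_connected_D) (use * in \<open>unfold vertices_eq, blast\<close>)
    then show "connected_space T2.dev.D" by (rule path_connected_imp_connected_space)
  qed
  then show ?thesis
    unfolding T2_ev homeomorphic_connected_space[OF X_homeomorphic, symmetric] T2.development_eq .
qed

lemma connected_iff_spans: "connected_space X \<longleftrightarrow> spans_mod2 N V"
  unfolding connected_iff_generated
  by (rule lattice_basis.spans_mod2_iff[OF lattice_basis_bas[OF complex_empty] V_sub_N, symmetric])

text \<open>Every element of \<open>T2\<close> is the class of a sum of basis vectors, and these
  vectors are letters.\<close>

lemma connected_if_basis:
  assumes B: "B \<subseteq> V" "Z_basis N B"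
  shows "connected_space X"
  unfolding connected_iff_generated
proof
  interpret L: lattice_basis N B by unfold_locales (rule B(2))
  fix t assume "t \<in> carrier (T2 N)"
  then obtain R where R: "R \<subseteq> B" "t = PT R" unfolding L.carrier_T2 by blast
  obtain vs where vs: "set vs = R" "distinct vs" using finite_distinct_list[OF finite_subset[OF R(1) L.finite_B]] by blast
  have l: "vs \<in> lists V" using vs(1) R(1) B(1) by auto
  have "sum_list vs = \<Sum>R" using vs by (simp add: distinct_sum_list_conv_Sum)
  then have "t = lword (T2 N) (T2_class N) vs" using L.lword_T2_class[OF l V_sub_N] R(2) by simp
  then show "\<exists>vs\<in>lists V. t = lword (T2 N) (T2_class N) vs" using l by blast
qed

text \<open>Connectedness of \<open>X\<close> enters as surjectivity of the projection from
  \<open>W\<close>: both say that the classes of the primitive vectors generate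
  \<open>T2\<close>.\<close>

lemma T2_quotient:
  assumes con: "connected_space X" and h: "h \<in> hom W (T2 N)" "\<forall>v\<in>V. h (sg v) = T2_class N v"
  shows "fan_quotient N \<Delta> (T2 N) (\<lambda>R. PT R) incl_morphism h"
proof (intro fan_quotient.intro T2_development fan_quotient_axioms.intro h(1))
  show "h ` carrier W = carrier (T2 N)"
  proof (intro equalityI subsetI)
    fix t assume "t \<in> carrier (T2 N)"
    then obtain vs where vs: "vs \<in> lists V" "t = lword (T2 N) (T2_class N) vs" using con unfolding connected_iff_generated by blast
    have "lword (T2 N) (h \<circ> sg) vs = t" unfolding vs(2) using vs(1) h(2) by (induction vs rule: list.induct) (auto simp: lword_def)
    moreover have "h (lword W sg vs) = lword (T2 N) (h \<circ> sg) vs"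
      by (rule lword_hom[OF W_is_group T2_is_group h(1)]) (use vs(1) sg_closed in auto)
    ultimately have "t = h (lword W sg vs)" by simp
    then show "t \<in> h ` carrier W" by (rule image_eqI[OF _ W_word_closed[OF vs(1)]])
  qed (use hom_in_carrier[OF h(1)] in blast)
  show "h (sg v) = PT {v}" if "v \<in> V" for v using h(2) that by simp
qed

lemma W_quotient: "fan_quotient N \<Delta> W PW (iota N \<Delta>) id"
proof (rule fan_quotient.intro[OF W_development fan_quotient_axioms.intro])
  interpret W: group W by (rule W_is_group)
  show "id \<in> hom W W" by (rule homI) simp_all
  show "id (sg v) = PW {v}" if "v \<in> V" for v using PW_vertex[OF that] by simp
qed simp

text \<open>The general computation of the fundamental group, applied to the identity of
  \<open>W\<close>, whose kernel is trivial.\<close>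

lemma simply_connected_W: "simply_connected_space (development N \<Delta> W (iota N \<Delta>))"
proof -
  interpret Q: fan_quotient N \<Delta> W PW "iota N \<Delta>" id by (rule W_quotient)
  let ?E = "development N \<Delta> W (iota N \<Delta>)"
  have ker: "kernel W W id = {\<one>\<^bsub>W\<^esub>}" using monoid.one_closed[OF group.is_monoid[OF W_is_group]] by (auto simp: kernel_def)
  have "trivial_group (fundamental_group ?E y)" if y: "y \<in> topspace ?E" for y
  proof (rule trivial_fundamental_group[OF y])
    obtain L where L: "has_pi1 ?E y (W\<lparr>carrier := {\<one>\<^bsub>W\<^esub>}\<rparr>) L" using Q.has_pi1[OF y] unfolding ker by (elim exE)
    have one: "path_hom ?E p (L \<one>\<^bsub>W\<^esub>)" if "p \<in> loops ?E y" for p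
      using L that unfolding has_pi1_def by simp
    have c: "(\<lambda>_. y) \<in> loops ?E y" using y by (simp add: loops_def pathin_def)
    show "path_hom ?E p (\<lambda>_. y)" if "p \<in> loops ?E y" for p
      by (rule path_hom_trans[OF one[OF that] path_hom_sym[OF one[OF c]]])
  qed
  then show ?thesis unfolding simply_connected_space_def using Q.path_connected by blast
qed

lemma universal_cover:
  assumes con: "connected_space X"
  shows "is_universal_cover (development N \<Delta> W (iota N \<Delta>)) X"
    "x \<in> topspace X \<Longrightarrow> fundamental_group X x \<cong> W\<lparr>carrier := kernel W (T2 N) (induced_hom N \<Delta> (T2 N) incl_morphism)\<rparr>"
proof -
  obtain h where h: "h \<in> hom W (T2 N)" "h \<in> extensional (carrier W)" "\<forall>v\<in>V. h (sg v) = T2_class N v" by (rule T2_projection)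
  interpret Q: fan_quotient N \<Delta> "T2 N" "\<lambda>R. PT R" incl_morphism h by (rule T2_quotient[OF con h(1,3)])
  have ind: "induced_hom N \<Delta> (T2 N) incl_morphism = h"
    by (rule T2.induced_hom_eq[OF h(1,2)]) (simp add: h(3))
  show "is_universal_cover (development N \<Delta> W (iota N \<Delta>)) X"
    unfolding is_universal_cover_def
    using simply_connected_W covering_map_homeomorphic_compose[OF Q.covering_W act_map_homeo] by blast
  assume "x \<in> topspace X"
  then obtain y where y: "y \<in> topspace (development N \<Delta> (T2 N) incl_morphism)" "x = act_map y"
    using homeomorphic_imp_surjective_map[OF act_map_homeo] by blast
  obtain L where L: "has_pi1 (development N \<Delta> (T2 N) incl_morphism) y (W\<lparr>carrier := kernel W (T2 N) h\<rparr>) L"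
    using Q.has_pi1[OF y(1)] by (elim exE)
  show "fundamental_group X x \<cong> W\<lparr>carrier := kernel W (T2 N) (induced_hom N \<Delta> (T2 N) incl_morphism)\<rparr>"
    unfolding ind y(2) by (rule fundamental_group_iso[OF Q.kernel_group has_pi1_homeomorphic[OF L act_map_homeo y(1)]])
qed

section \<open>The abelianisation of \<open>W\<close>\<close>

text \<open>Supplies the lower bound for the order of the abelianisation. Sending the generators to
  the unit vectors \<open>u {v}\<close> respects all relations, because in the target squares vanish
  and everything commutes.\<close>

lemma W_onto_Z2_power:
  "\<exists>h. h \<in> hom W (Z2_power (card V)) \<and> h ` carrier W = carrier (Z2_power (card V))"
proof -
  let ?d = "card V"
  let ?Z = "Z2_power ?d"
  interpret W: group W by (rule W_is_group)
  interpret Z: comm_group ?Z by (rule comm_group_square_one[OF group_Z2_power Z2_power_square])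
  obtain idx where "bij_betw idx V {0..<?d}" using ex_bij_betw_finite_nat[OF finite_V] by blast
  then have idx: "inj_on idx V" "idx ` V = {..<?d}" by (auto simp: bij_betw_def atLeast0LessThan)
  define u where "u T = (\<lambda>i\<in>{..<?d}. if i \<in> idx ` T then 1 else (0::int))" for T
  have uc: "u T \<in> carrier ?Z" for T by (auto simp: carrier_Z2_power u_def)
  have um: "u {v} \<otimes>\<^bsub>?Z\<^esub> u T = u (insert v T)" if "insert v T \<subseteq> V" "v \<notin> T" for v T
  proof -
    have "idx v \<notin> idx ` T" using inj_on_image_mem_iff[OF idx(1), of v T] that by auto
    then show ?thesis by (auto simp: mult_Z2_power u_def fun_eq_iff)
  qed
  have "\<exists>h. h \<in> hom W ?Z \<and> h \<in> extensional (carrier W) \<and> (\<forall>v\<in>V. h (sg v) = u {v})"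
    by (rule W_universal[OF group_Z2_power]) (use uc Z2_power_square Z.m_comm in auto)
  then obtain h where h: "h \<in> hom W ?Z" "\<forall>v\<in>V. h (sg v) = u {v}" by blast
  have img: "u T \<in> h ` carrier W" if "finite T" "T \<subseteq> V" for T
    using that
  proof (induction T rule: finite_induct)
    case empty
    have "u {} = \<one>\<^bsub>?Z\<^esub>" by (simp add: u_def one_Z2_power)
    then show ?case using hom_one[OF h(1) W_is_group group_Z2_power] W.one_closed by (intro image_eqI[of _ h "\<one>\<^bsub>W\<^esub>"]) simp_all
  next
    case (insert v T)
    then obtain w where w: "w \<in> carrier W" "u T = h w" by auto
    have v: "v \<in> V" using insert.prems by auto
    have "u (insert v T) = h (sg v \<otimes>\<^bsub>W\<^esub> w)"
      using um[OF insert.prems insert.hyps(2)] h w hom_mult[OF h(1) sg_closed[OF v] w(1)] v by simp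
    then show ?case using W.m_closed[OF sg_closed[OF v] w(1)] by blast
  qed
  have "x \<in> h ` carrier W" if x: "x \<in> carrier ?Z" for x
  proof -
    let ?T = "{v \<in> V. x (idx v) = 1}"
    have "x i = u ?T i" for i
    proof (cases "i < ?d")
      case True
      then have "i \<in> idx ` V" using idx(2) by simp
      then obtain v where v: "v \<in> V" "i = idx v" by blast
      have "idx v \<in> idx ` ?T \<longleftrightarrow> v \<in> ?T" by (rule inj_on_image_mem_iff[OF idx(1) v(1)]) auto
      moreover have "x i \<in> {0, 1}" using x True by (auto simp: carrier_Z2_power)
      ultimately show ?thesis using v True by (auto simp: u_def)
    next
      case False
      then show ?thesis using x by (simp add: carrier_Z2_power u_def PiE_def extensional_def)
    qed
    then have "x = u ?T" by (rule ext)
    then show ?thesis using img[of ?T] finite_V by simp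
  qed
  then have "h ` carrier W = carrier ?Z" using hom_in_carrier[OF h(1)] by blast
  then show ?thesis using h(1) by blast
qed

lemma abelianisation_W: "abelianisation W \<cong> Z2_power (card V)"
proof -
  obtain h where h: "h \<in> hom W (Z2_power (card V))" "h ` carrier W = carrier (Z2_power (card V))"
    using W_onto_Z2_power by blast
  show ?thesis
    by (rule abelianisation_involutions[OF W_is_group finite_V _ W_square W_generated
          comm_group_square_one[OF group_Z2_power Z2_power_square] h card_Z2_power])
      (use sg_closed in auto)
qed

lemma kernel_contains_derived:
  assumes B: "comm_group B" and g: "g \<in> hom W B"
  shows "derived W (carrier W) \<subseteq> kernel W B g"
proof -
  interpret B: comm_group B by fact
  interpret g: group_hom W B g using W_is_group B.is_group g by (simp add: group_hom_def group_hom_axioms_def)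
  have "g (a \<otimes>\<^bsub>W\<^esub> b \<otimes>\<^bsub>W\<^esub> inv\<^bsub>W\<^esub> a \<otimes>\<^bsub>W\<^esub> inv\<^bsub>W\<^esub> b) = \<one>\<^bsub>B\<^esub>" if ab: "a \<in> carrier W" "b \<in> carrier W" for a b
  proof -
    have c: "g a \<in> carrier B" "g b \<in> carrier B" using ab by simp_all
    have "g a \<otimes>\<^bsub>B\<^esub> g b \<otimes>\<^bsub>B\<^esub> inv\<^bsub>B\<^esub> g a = g b \<otimes>\<^bsub>B\<^esub> (g a \<otimes>\<^bsub>B\<^esub> inv\<^bsub>B\<^esub> g a)"
      unfolding B.m_comm[OF c] by (rule B.m_assoc) (use c in auto)
    then have "g a \<otimes>\<^bsub>B\<^esub> g b \<otimes>\<^bsub>B\<^esub> inv\<^bsub>B\<^esub> g a \<otimes>\<^bsub>B\<^esub> inv\<^bsub>B\<^esub> g b = \<one>\<^bsub>B\<^esub>" using c by simp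
    then show ?thesis using ab by simp
  qed
  then have "derived_set W (carrier W) \<subseteq> kernel W B g" by (auto simp: kernel_def)
  then show ?thesis
    unfolding derived_def by (rule g.G.generate_subgroup_incl[OF _ g.subgroup_kernel])
qed

text \<open>The identification \<open>e\<close> is arbitrary: being injective, it leaves the kernel
  of the canonical map to the abelianisation unchanged, and this kernel is the derived
  group.\<close>

lemma kernel_abelianisation:
  assumes e: "e \<in> iso (abelianisation W) (Z2_power k)" and h: "h = (\<lambda>w\<in>carrier W. e (abelianisation_map W w))"
  shows "h \<in> hom W (Z2_power k)" "h ` carrier W = carrier (Z2_power k)" "kernel W (Z2_power k) h = derived W (carrier W)"
proof -
  interpret W: group W by (rule W_is_group)
  interpret Dn: normal "derived W (carrier W)" W by (rule W.derived_is_normal[OF W.normal_self])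
  let ?A = "abelianisation W" and ?Z = "Z2_power k"
  have A: "group ?A" unfolding abelianisation_def by (rule Dn.factorgroup_is_group)
  have q: "abelianisation_map W \<in> hom W ?A"
    using Dn.r_coset_hom_Mod unfolding abelianisation_def abelianisation_map_def[abs_def] .
  have qc: "carrier ?A = abelianisation_map W ` carrier W"
    by (auto simp: abelianisation_def abelianisation_map_def FactGroup_def RCOSETS_def)
  have eh: "e \<in> hom ?A ?Z" and eb: "bij_betw e (carrier ?A) (carrier ?Z)" using e by (auto simp: iso_def)
  show hh: "h \<in> hom W ?Z"
  proof (rule homI)
    fix v w assume "v \<in> carrier W" "w \<in> carrier W"
    then show "h (v \<otimes>\<^bsub>W\<^esub> w) = h v \<otimes>\<^bsub>?Z\<^esub> h w"
      using hom_mult[OF q] hom_mult[OF eh] hom_in_carrier[OF q] by (simp add: h)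
  qed (use hom_in_carrier[OF q] hom_in_carrier[OF eh] in \<open>simp add: h\<close>)
  have "h ` carrier W = e ` carrier ?A" unfolding qc by (auto simp: h)
  then show "h ` carrier W = carrier ?Z" using eb by (simp add: bij_betw_def)
  have "h w = \<one>\<^bsub>?Z\<^esub> \<longleftrightarrow> w \<in> derived W (carrier W)" if w: "w \<in> carrier W" for w
  proof -
    have "h w = \<one>\<^bsub>?Z\<^esub> \<longleftrightarrow> e (abelianisation_map W w) = e \<one>\<^bsub>?A\<^esub>"
      using w hom_one[OF eh A group_Z2_power] by (simp add: h)
    also have "\<dots> \<longleftrightarrow> abelianisation_map W w = \<one>\<^bsub>?A\<^esub>"
      by (rule inj_on_eq_iff[OF bij_betw_imp_inj_on[OF eb] hom_in_carrier[OF q w] monoid.one_closed[OF group.is_monoid[OF A]]])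
    also have "\<dots> \<longleftrightarrow> w \<in> derived W (carrier W)"
      using W.coset_join1[OF _ w Dn.subgroup_axioms] W.coset_join2[OF w Dn.subgroup_axioms]
      by (auto simp: abelianisation_def abelianisation_map_def FactGroup_def)
    finally show ?thesis .
  qed
  then show "kernel W ?Z h = derived W (carrier W)" using Dn.subset by (auto simp: kernel_def)
qed

text \<open>As \<open>T2\<close> is abelian, the projection from \<open>W\<close> factors as
  \<open>f\<close> after \<open>h\<close>. So the local groups still embed in the abelianisation,
  and its development lies between those of \<open>W\<close> and \<open>T2\<close>: the covering by
  the former gives its fundamental group, and it covers the latter with the kernel of
  \<open>f\<close> as deck group.\<close>

lemma abelian_cover:
  fixes n :: nat
  assumes con: "connected_space X" and rank: "lattice_of_rank N n" and e: "e \<in> iso (abelianisation W) (Z2_power (card V))"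
    and h: "h = (\<lambda>w\<in>carrier W. e (abelianisation_map W w))"
  defines "\<alpha> \<equiv> \<lambda>\<tau> g. h (iota N \<Delta> \<tau> g)" and "Da \<equiv> development N \<Delta> (Z2_power (card V)) (\<lambda>\<tau> g. h (iota N \<Delta> \<tau> g))"
  shows "n \<le> card V" "simple_morphism N \<Delta> (Z2_power (card V)) \<alpha>" "injective_at_local_groups N \<Delta> \<alpha>"
    "induced_hom N \<Delta> (Z2_power (card V)) \<alpha> = h"
    "\<exists>p. covering_map Da X p \<and> deck_group Da p \<cong> Z2_power (card V - n)"
    "y \<in> topspace Da \<Longrightarrow> fundamental_group Da y \<cong> W\<lparr>carrier := derived W (carrier W)\<rparr>"
proof -
  let ?d = "card V"
  let ?Z = "Z2_power ?d"
  note hh = kernel_abelianisation[OF e h]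
  obtain g where g: "g \<in> hom W (T2 N)" "g \<in> extensional (carrier W)" "\<forall>v\<in>V. g (sg v) = T2_class N v" by (rule T2_projection)
  interpret QT: fan_quotient N \<Delta> "T2 N" "\<lambda>R. PT R" incl_morphism g by (rule T2_quotient[OF con g(1,3)])
  obtain f where f: "f \<in> hom ?Z (T2 N)" "\<forall>w\<in>carrier W. f (h w) = g w"
    using kernel_contains_derived[OF T2_is_comm_group g(1)] hh(3)
    by (elim factor_hom[OF W_is_group group_Z2_power T2_is_group hh(1,2) g(1), rotated]) simp
  have fPW: "f (h (PW R)) = PT R" if "S \<in> complex" "R \<subseteq> S" for S R
    using f(2) PW_face(1)[OF that] hom_PW_T2[OF g(1) bspec[OF g(3)] that] by simp
  have dev: "fan_development N \<Delta> ?Z (\<lambda>R. h (PW R)) \<alpha>"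
  proof (intro fan_development.intro fan_development_axioms.intro smooth_fan_locale_axioms group_Z2_power)
    show "h (PW S) \<in> carrier ?Z" if "S \<in> complex" for S by (rule hom_in_carrier[OF hh(1) PW_face(1)[OF that order_refl]])
    show "h (PW T) \<otimes>\<^bsub>?Z\<^esub> h (PW T') = h (PW (sym_diff T T'))" if "S \<in> complex" "T \<subseteq> S" "T' \<subseteq> S" for S T T'
      unfolding PW_face(2)[OF that, symmetric]
      by (rule hom_mult[OF hh(1) PW_face(1)[OF that(1,2)] PW_face(1)[OF that(1,3)], symmetric])
    show "inj_on (\<lambda>R. h (PW R)) (Pow S)" if S: "S \<in> complex" for S
    proof (rule inj_onI)
      fix R R' assume R: "R \<in> Pow S" "R' \<in> Pow S" "h (PW R) = h (PW R')"
      then have "PT R = PT R'" using fPW[OF S, of R] fPW[OF S, of R'] by simp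
      then show "R = R'" using inj_onD[OF PT_inj[OF S]] R(1,2) by blast
    qed
  qed (simp add: \<alpha>_def iota_PT)
  interpret QZ: fan_quotient N \<Delta> ?Z "\<lambda>R. h (PW R)" \<alpha> h
    by (intro fan_quotient.intro dev fan_quotient_axioms.intro hh(1,2)) (simp add: PW_vertex)
  have Da: "Da = development N \<Delta> ?Z \<alpha>" by (simp add: Da_def \<alpha>_def)
  show "simple_morphism N \<Delta> ?Z \<alpha>" by (rule QZ.simple_morphism)
  show "injective_at_local_groups N \<Delta> \<alpha>" by (rule QZ.injective)
  show "induced_hom N \<Delta> ?Z \<alpha> = h"
  proof (rule QZ.induced_hom_eq[OF hh(1)])
    show "h \<in> extensional (carrier W)" unfolding h by (rule restrict_extensional)
    show "h (sg v) = h (PW {v})" if "v \<in> V" for v by (simp only: PW_vertex[OF that])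
  qed
  have "f ` carrier ?Z = (\<lambda>w. f (h w)) ` carrier W" unfolding hh(2)[symmetric] image_image ..
  also have "\<dots> = g ` carrier W" by (rule image_cong) (use f(2) in auto)
  finally have fs: "f ` carrier ?Z = carrier (T2 N)" unfolding QT.h_surj .
  obtain B where B: "Z_basis N B" "card B = n" using rank unfolding lattice_of_rank_def by blast
  interpret L: lattice_basis N B by unfold_locales (rule B(1))
  have cT: "card (carrier (T2 N)) = 2 ^ n" unfolding L.card_T2 B(2) ..
  \<comment> \<open>\<open>f\<close> maps a group of order \<open>2 ^ card V\<close> onto
    \<open>T2\<close>, which has order \<open>2 ^ n\<close>.\<close>
  have "(2::nat) ^ n \<le> 2 ^ ?d"
    using card_image_le[OF finite_Z2_power, of f ?d] unfolding fs cT card_Z2_power .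
  then show nd: "n \<le> ?d" by (simp add: power_le_imp_le_exp)
  interpret M: development_morphism "nonneg_part N \<Delta>" complex tau bas corner_chart ?Z "\<lambda>R. h (PW R)" "T2 N" "\<lambda>R. PT R" f
    by (intro development_morphism.intro development_morphism_axioms.intro QZ.dev.development_space_axioms
        T2.dev.development_space_axioms f(1) fs fPW[OF _ order_refl])
  let ?K = "?Z\<lparr>carrier := kernel ?Z (T2 N) f\<rparr>"
  have cov: "covering_map Da (development N \<Delta> (T2 N) incl_morphism) M.pmap"
    unfolding Da QZ.development_eq T2.development_eq by (rule M.covering)
  have "connected_space QZ.dev.D"
    using path_connected_imp_connected_space[OF QZ.path_connected] unfolding QZ.development_eq .
  then have d1: "deck_group Da M.pmap \<cong> ?K" unfolding Da QZ.development_eq by (rule M.deck_group_iso)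
  have Kg: "group ?K" by (rule group.subgroup_imp_group[OF group_Z2_power M.f.subgroup_kernel])
  have Kf: "finite (carrier ?K)" by (rule finite_subset[OF _ finite_Z2_power[of ?d]]) (auto simp: kernel_def)
  have Ks: "x \<otimes>\<^bsub>?K\<^esub> x = \<one>\<^bsub>?K\<^esub>" if "x \<in> carrier ?K" for x
    using Z2_power_square[of x ?d] that by (simp add: kernel_def)
  \<comment> \<open>The kernel of \<open>f\<close> consists of involutions and the identity, so it
    is elementary abelian of some rank \<open>k\<close>; counting fibres of \<open>f\<close> then
    gives \<open>k\<close>.\<close>
  obtain k where k: "?K \<cong> Z2_power k" "card (carrier ?K) = 2 ^ k" by (rule elementary_abelian_iso_Z2_power[OF Kg Kf Ks])
  have "(2::nat) ^ ?d = 2 ^ n * 2 ^ k"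
    using card_surj_hom[OF group_Z2_power T2_is_group f(1) fs finite_Z2_power] k(2) by (simp add: cT card_Z2_power)
  then have "(2::nat) ^ ?d = 2 ^ (n + k)" by (simp only: power_add)
  then have "?d = n + k" by (rule power_inject_exp[THEN iffD1, rotated]) simp
  then have kd: "k = ?d - n" by simp
  have "M.pmap ` topspace Da \<subseteq> topspace (development N \<Delta> (T2 N) incl_morphism)"
    using cov unfolding covering_map_def by blast
  then have d2: "deck_group Da (act_map \<circ> M.pmap) = deck_group Da M.pmap"
    by (rule deck_group_compose[OF homeomorphic_imp_injective_map[OF act_map_homeo]])
  have "deck_group Da (act_map \<circ> M.pmap) \<cong> Z2_power (?d - n)"
    unfolding d2 kd[symmetric] by (rule iso_trans[OF d1 k(1)])
  then show "\<exists>p. covering_map Da X p \<and> deck_group Da p \<cong> Z2_power (?d - n)"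
    using covering_map_homeomorphic_compose[OF cov act_map_homeo] by blast
  assume y: "y \<in> topspace Da"
  obtain L where L: "has_pi1 Da y (W\<lparr>carrier := derived W (carrier W)\<rparr>) L"
    using QZ.has_pi1 y unfolding Da hh(3) by blast
  show "fundamental_group Da y \<cong> W\<lparr>carrier := derived W (carrier W)\<rparr>"
    by (rule fundamental_group_iso[OF QZ.kernel_group[unfolded hh(3)] L])
qed

end

theorem theorem2p5:
  fixes N :: "'a::real_vector set" and n :: nat and \<Delta> :: "'a set set"
  assumes "lattice_of_rank N n"
    and "smooth_fan N \<Delta>"
  shows
   "let V = primitive_vectors N \<Delta>;
        d = card V;
        X = real_toric_variety N \<Delta>;
        W = W_group N \<Delta>;
        \<phi> = incl_morphism;
        \<iota> = iota N \<Delta>;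
        D\<phi> = development N \<Delta> (T2 N) \<phi>;
        Xt = development N \<Delta> W \<iota>
    in
      \<comment> \<open>1\<close>
      (simple_morphism N \<Delta> (T2 N) \<phi> \<and> injective_at_local_groups N \<Delta> \<phi> \<and>
       simple_morphism N \<Delta> W \<iota> \<and> injective_at_local_groups N \<Delta> \<iota> \<and>
       D\<phi> homeomorphic_space X \<and>
       strata_preserving_action W Xt (dev_strata N \<Delta> W \<iota>) (dev_act N \<Delta> W \<iota>) \<and>
       strict_fundamental_domain W Xt (dev_strata N \<Delta> W \<iota>) (dev_act N \<Delta> W \<iota>)
         (dev_emb N \<Delta> W \<iota> ` topspace (nonneg_part N \<Delta>)) \<and>
       strata_preserving_action (T2 N) D\<phi> (dev_strata N \<Delta> (T2 N) \<phi>) (dev_act N \<Delta> (T2 N) \<phi>) \<and>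
       strict_fundamental_domain (T2 N) D\<phi> (dev_strata N \<Delta> (T2 N) \<phi>) (dev_act N \<Delta> (T2 N) \<phi>)
         (dev_emb N \<Delta> (T2 N) \<phi> ` topspace (nonneg_part N \<Delta>))) \<and>
      \<comment> \<open>2\<close>
      ((connected_space X \<longleftrightarrow> spans_mod2 N V) \<and>
       ((\<exists>B\<subseteq>V. Z_basis N B) \<longrightarrow> connected_space X)) \<and>
      \<comment> \<open>3\<close>
      (connected_space X \<longrightarrow>
         is_universal_cover Xt X \<and>
         (\<forall>x\<in>topspace X. fundamental_group X x \<cong>
            W\<lparr>carrier := kernel W (T2 N) (induced_hom N \<Delta> (T2 N) \<phi>)\<rparr>)) \<and>
      \<comment> \<open>4\<close>
      (connected_space X \<longrightarrow>
         n \<le> d \<and> abelianisation W \<cong> Z2_power d \<and>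
         (\<forall>e \<in> iso (abelianisation W) (Z2_power d).
            let h = (\<lambda>w\<in>carrier W. e (abelianisation_map W w));
                \<alpha> = (\<lambda>\<tau> g. h (\<iota> \<tau> g));
                D\<alpha> = development N \<Delta> (Z2_power d) \<alpha>
            in simple_morphism N \<Delta> (Z2_power d) \<alpha> \<and> injective_at_local_groups N \<Delta> \<alpha> \<and>
               induced_hom N \<Delta> (Z2_power d) \<alpha> = h \<and>
               (\<exists>p. covering_map D\<alpha> X p \<and> deck_group D\<alpha> p \<cong> Z2_power (d - n)) \<and>
               (\<forall>y\<in>topspace D\<alpha>. fundamental_group D\<alpha> y \<cong> W\<lparr>carrier := derived W (carrier W)\<rparr>)))"
proof -
  interpret smooth_fan_locale N \<Delta> by unfold_locales (rule assms(2))
  interpret T: fan_development N \<Delta> "T2 N" "\<lambda>R. PT R" incl_morphism by (rule T2_development)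
  interpret W: fan_development N \<Delta> W PW "iota N \<Delta>" by (rule W_development)
  note cover = abelian_cover[OF _ assms(1) _ HOL.refl]
  \<comment> \<open>The inequality does not mention an isomorphism \<open>e\<close>, but
    \<open>cover\<close> requires one; \<open>abelianisation_W\<close> supplies it.\<close>
  have le: "n \<le> card V" if "connected_space X"
    using cover(1)[OF that] abelianisation_W unfolding is_iso_def by blast
  show ?thesis
    unfolding Let_def
    by (intro conjI impI ballI T.simple_morphism T.injective W.simple_morphism W.injective X_homeomorphic
        W.strata_preserving W.strict_domain T.strata_preserving T.strict_domain connected_iff_spans
        universal_cover le abelianisation_W cover(2-6); (elim exE conjE)?;
        (assumption | erule (1) connected_if_basis))
qed

end
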